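(* Let $E$ be a finite directed graph without sinks or sources in which every cycle has an exit, and let $\mathcal J$ be an admissible set of pairs of paths, with unitary $u_{\mathcal J}\in L_{\mathbb Z}(E)$. 1. If the coding graph $E_{\mathcal J}$ contains a non-positive cycle, then the endomorphism $\Lambda_{\mathcal J}$ of $L_{\mathbb Z}(E)$ does not restrict to an automorphism of the diagonal $\mathcal D_{L_{\mathbb Z}(E)}$. 2. Suppose $E_{\mathcal J}$ has only non-negative edges and does not contain any non-positive cycles. Then the labeled graph $(E_{\mathcal J},\mathcal E)$ is left-synchronizing if and only if $\Lambda_{\mathcal J}\colon L_{\mathbb Z}(E)\to L_{\mathbb Z}(E)$ restricts to an automorphism of $\mathcal D_{L_{\mathbb Z}(E)}$. 3. If $E_{\mathcal J}$ contains a non-positive cycle, then the endomorphism $\lambda_{\mathcal J}$ of $C^*(E)$ does not restrict to an automorphism of the diagonal $\mathcal D_{C^*(E)}$. 4. Suppose $E_{\mathcal J}$ has only non-negative edges and does not contain any non-positive cycles. Then $(E_{\mathcal J},\mathcal E)$ is left-synchronizing if and only if $\lambda_{\mathcal J}\colon C^*(E)\to C^*(E)$ restricts to an automorphism of $\mathcal D_{C^*(E)}$.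
   Context: Graphs and algebras. $E=(E^0,E^1,r,s)$ is a finite directed graph (multiple edges allowed) with range and source maps $r,s$; no sinks (every vertex emits an edge), no sources (every vertex receives an edge). A path $\mu=\mu_1\cdots\mu_k$ is a sequence of edges with $r(\mu_j)=s(\mu_{j+1})$, of length $|\mu|=k$; vertices are paths of length $0$; $E^*$ is the set of finite paths. A cycle is a path of length $\ge1$ with equal source and range; it has an exit if the source of one of its edges emits at least two distinct edges. $L_{\mathbb Z}(E)$ is the universal $\mathbb Z$-algebra generated by pairwise orthogonal idempotents $P_v$ ($v\in E^0$) and elements $S_e,S_e^*$ ($e\in E^1$) subject to $S_e^*S_f=0$ for $e\ne f$, $S_e^*S_e=P_{r(e)}$, $P_{s(e)}S_e=S_e=S_eP_{r(e)}$, $S_e^*P_{s(e)}=S_e^*=P_{r(e)}S_e^*$, and $P_v=\sum_{s(e)=v}S_eS_e^*$; it is a unital $*$-algebra. $S_\mu=S_{\mu_1}\cdots S_{\mu_k}$, $S_v=P_v$ for $v\in E^0$, $P_\mu=S_\mu S_\mu^*$. The diagonal $\mathcal D_{L_{\mathbb Z}(E)}$ is the $\mathbb Z$-span of $\{P_\mu:\mu\in E^*\}$. $C^*(E)$ is the universal $C^*$-algebra generated by mutually orthogonal projections $p_v$ and partial isometries $s_e$ with $s_e^*s_e=p_{r(e)}$ and $p_v=\sum_{s(e)=v}s_es_e^*$; $s_\mu$, $p_\mu=s_\mu s_\mu^*$ are defined similarly and $\mathcal D_{C^*(E)}$ is the closed linear span of $\{p_\mu:\mu\in E^*\}$. $L_{\mathbb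 Z}(E)$ embeds in $C^*(E)$ via $S_e\mapsto s_e$, $P_v\mapsto p_v$. Admissible sets and endomorphisms. An admissible set is a finite $\mathcal J\subseteq E^*\times E^*$ such that $s(\mu)=s(\nu)$, $r(\mu)=r(\nu)$, $|\nu|\ge 1$ for all $(\mu,\nu)\in\mathcal J$ and $u_{\mathcal J}=\sum_{(\mu,\nu)\in\mathcal J}S_\mu S_\nu^*$ is unitary in $L_{\mathbb Z}(E)$ (equivalently: distinct pairs have distinct first components and distinct second components, and the $P_\mu$ over first components sum to $1$, as do the $P_\nu$ over second components). Elements of $\mathcal J$ are written $(\mu,e\nu)$ with $e\in E^1$, $\nu\in E^*$ ($\nu=r(e)$ if the second component is a single edge). $\Lambda_{\mathcal J}$ is the unital $*$-endomorphism of $L_{\mathbb Z}(E)$ with $\Lambda_{\mathcal J}(S_e)=u_{\mathcal J}S_e$, $\Lambda_{\mathcal J}(P_v)=P_v$, and $\lambda_{\mathcal J}$ is the unital $*$-endomorphism of $C^*(E)$ with $\lambda_{\mathcal J}(s_e)=u_{\mathcal J}s_e$, $\lambda_{\mathcal J}(p_v)=p_v$. Both are injective and map the respective diagonals into themselves; restricting to an automorphism of the diagonal means that the diagonal is mapped onto itself. Coding graph. $E_{\mathcal J}$ has vertex set $\mathcal J$, and exactly one edge $[(\mu_1,e_1\nu_1),(\mu_2,e_2\nu_2)]$ from $(\mu_1,e_1\nu_1)$ to $(\mu_2,e_2\nu_2)$ whenever $S_{\nu_1}^*S_{\mu_2}\neq0$; its label is $\mathcal L_{\mathcal J}=S_{\nu_1}^*S_{\mu_2}$,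 which is of the form $S_\alpha$ ($|\alpha|\geq 1$), $P_v$, or $S_\alpha^*$ ($|\alpha|\ge1$). The degree of the edge is $|\alpha|$, $0$, $-|\alpha|$ respectively. An edge is non-negative if its degree is $\ge0$; a path (in particular a cycle) in $E_{\mathcal J}$ is non-positive if all its edges have degree $\le0$. For a path $\omega$ in $E_{\mathcal J}$ visiting successively the vertices $(\mu_1,e_1\nu_1),\dots,(\mu_k,e_k\nu_k)$, $\mathcal E(\omega)=e_1e_2\cdots e_k\in E^*$. Left-synchronizing. $(E_{\mathcal J},\mathcal E)$ is left-synchronizing if there is $m\in\mathbb N$ (the delay) such that for any two paths $\omega_1,\omega_2$ of length $m$ in $E_{\mathcal J}$, $\mathcal E(\omega_1)=\mathcal E(\omega_2)$ implies $s(\omega_1)=s(\omega_2)$. *)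

theory Defs
  imports
    Complex_Main
    "HOL-Library.FuncSet"
    "HOL-Algebra.QuotRing"
    "HOL-Algebra.Generated_Groups"
    "Graph_Theory.Arc_Walk"
begin

section \<open>Directed graphs and their paths\<close>

text \<open>
  A finite directed graph is a \<open>fin_digraph\<close> (loops and multiple edges are allowed); the source
  map is \<^const>\<open>tail\<close>, the range map is \<^const>\<open>head\<close>.
\<close>

definition no_sinks :: "('v, 'e) pre_digraph \<Rightarrow> bool" where
  "no_sinks E \<longleftrightarrow> (\<forall>v\<in>verts E. out_arcs E v \<noteq> {})"

definition no_sources :: "('v, 'e) pre_digraph \<Rightarrow> bool" where
  "no_sources E \<longleftrightarrow> (\<forall>v\<in>verts E. in_arcs E v \<noteq> {})"

text \<open>
  A path is a pair \<open>(v, es)\<close> of its source and its list of edges, so that vertices are the paths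
  \<open>(v, [])\<close>.  For nonempty \<open>es\<close> the component \<open>v\<close> is forced to be the source of the first edge.
\<close>

type_synonym ('v, 'e) gpath = "'v \<times> 'e list"

definition paths :: "('v, 'e) pre_digraph \<Rightarrow> ('v, 'e) gpath set" where
  "paths E = {(v, es). \<exists>w. pre_digraph.awalk E v es w}"

definition psource :: "('v, 'e) gpath \<Rightarrow> 'v" where
  "psource \<mu> = fst \<mu>"

definition prange :: "('v, 'e) pre_digraph \<Rightarrow> ('v, 'e) gpath \<Rightarrow> 'v" where
  "prange E \<mu> = pre_digraph.awlast E (fst \<mu>) (snd \<mu>)"

definition plength :: "('v, 'e) gpath \<Rightarrow> nat" where
  "plength \<mu> = length (snd \<mu>)"

text \<open>
  Cycles are arbitrary closed paths of positive length: they may revisit vertices, unlike the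
  cycles of the library theory on arc walks.
\<close>

definition cycles :: "('v, 'e) pre_digraph \<Rightarrow> ('v, 'e) gpath set" where
  "cycles E = {\<mu> \<in> paths E. plength \<mu> \<ge> 1 \<and> psource \<mu> = prange E \<mu>}"

definition has_exit :: "('v, 'e) pre_digraph \<Rightarrow> ('v, 'e) gpath \<Rightarrow> bool" where
  "has_exit E \<mu> \<longleftrightarrow> (\<exists>e\<in>set (snd \<mu>). card (out_arcs E (tail E e)) \<ge> 2)"


section \<open>Algebras generated by the graph\<close>

text \<open>
  Rings with an involution and distinguished elements \<open>P\<^sub>v\<close> (\<open>vproj\<close>) and \<open>S\<^sub>e\<close> (\<open>eiso\<close>).
\<close>

record ('a, 'v, 'e) graph_alg = "'a ring" +
  star :: "'a \<Rightarrow> 'a"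
  vproj :: "'v \<Rightarrow> 'a"
  eiso :: "'e \<Rightarrow> 'a"

definition path_elt :: "('a, 'v, 'e) graph_alg \<Rightarrow> ('v, 'e) gpath \<Rightarrow> 'a" where
  "path_elt A \<mu> = (if snd \<mu> = [] then vproj A (fst \<mu>)
     else foldr (\<lambda>e x. eiso A e \<otimes>\<^bsub>A\<^esub> x) (snd \<mu>) \<one>\<^bsub>A\<^esub>)"

definition path_proj :: "('a, 'v, 'e) graph_alg \<Rightarrow> ('v, 'e) gpath \<Rightarrow> 'a" where
  "path_proj A \<mu> = path_elt A \<mu> \<otimes>\<^bsub>A\<^esub> star A (path_elt A \<mu>)"

definition pair_sum ::
  "('a, 'v, 'e) graph_alg \<Rightarrow> (('v, 'e) gpath \<times> ('v, 'e) gpath) set \<Rightarrow> 'a" where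
  "pair_sum A J = 
     finsum A (\<lambda>(\<mu>, \<nu>). path_elt A \<mu> \<otimes>\<^bsub>A\<^esub> star A (path_elt A \<nu>)) J"

definition is_unitary :: "('a, 'v, 'e) graph_alg \<Rightarrow> 'a \<Rightarrow> bool" where
  "is_unitary A u \<longleftrightarrow> u \<in> carrier A \<and> star A u \<otimes>\<^bsub>A\<^esub> u = \<one>\<^bsub>A\<^esub> \<and> u \<otimes>\<^bsub>A\<^esub> star A u = \<one>\<^bsub>A\<^esub>"

text \<open>Unital *-endomorphisms; preservation of the unit is part of \<^const>\<open>ring_hom\<close>.\<close>

definition star_endo :: "('a, 'v, 'e) graph_alg \<Rightarrow> ('a \<Rightarrow> 'a) set" where
  "star_endo A = {\<phi> \<in> ring_hom A A. \<forall>x\<in>carrier A. \<phi> (star A x) = star A (\<phi> x)}"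

definition quot_alg :: "('a, 'v, 'e) graph_alg \<Rightarrow> 'a set \<Rightarrow> ('a set, 'v, 'e) graph_alg" where
  "quot_alg A I = ring.extend (A Quot I)
     (graph_alg.fields (\<lambda>X. star A ` X) (\<lambda>v. I +>\<^bsub>A\<^esub> vproj A v) (\<lambda>e. I +>\<^bsub>A\<^esub> eiso A e))"


subsection \<open>The free *-algebra\<close>

text \<open>
  Noncommutative polynomials in the symbols \<open>P\<^sub>v\<close>, \<open>S\<^sub>e\<close>, \<open>S\<^sub>e\<^sup>*\<close>: finitely supported functions from
  words to coefficients, with the convolution product.  The involution fixes \<open>P\<^sub>v\<close>, exchanges
  \<open>S\<^sub>e\<close> and \<open>S\<^sub>e\<^sup>*\<close>, and acts on the coefficients by \<open>bar\<close>.
\<close>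

datatype ('v, 'e) gen = GP 'v | GS 'e | GSstar 'e

fun gen_star :: "('v, 'e) gen \<Rightarrow> ('v, 'e) gen" where
  "gen_star (GP v) = GP v"
| "gen_star (GS e) = GSstar e"
| "gen_star (GSstar e) = GS e"

definition gens :: "('v, 'e) pre_digraph \<Rightarrow> ('v, 'e) gen set" where
  "gens E = GP ` verts E \<union> GS ` arcs E \<union> GSstar ` arcs E"

definition free_alg ::
  "('k \<Rightarrow> 'k) \<Rightarrow> ('v, 'e) pre_digraph \<Rightarrow> (('v, 'e) gen list \<Rightarrow> 'k::comm_ring_1, 'v, 'e) graph_alg"
  where
  "free_alg bar E = \<lparr>
     carrier = {f. finite {w. f w \<noteq> 0} \<and> (\<forall>w. f w \<noteq> 0 \<longrightarrow> set w \<subseteq> gens E)},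
     mult = (\<lambda>f g w. \<Sum>i\<le>length w. f (take i w) * g (drop i w)),
     one = (\<lambda>w. if w = [] then 1 else 0),
     zero = (\<lambda>w. 0),
     add = (\<lambda>f g w. f w + g w),
     star = (\<lambda>f w. bar (f (rev (map gen_star w)))),
     vproj = (\<lambda>v w. if w = [GP v] then 1 else 0),
     eiso = (\<lambda>e w. if w = [GS e] then 1 else 0)\<rparr>"


subsection \<open>The Leavitt path algebra over the integers\<close>

text \<open>
  The elements of a graph algebra that have to vanish.  The first set identifies the unit of the
  free algebra with the sum of the \<open>P\<^sub>v\<close>, which is the unit of the universal algebra since the
  graph is finite.
\<close>

definition leavitt_rels :: "('a, 'v, 'e) graph_alg \<Rightarrow> ('v, 'e) pre_digraph \<Rightarrow> 'a set" where
  "leavitt_rels A E =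
     (let P = vproj A; S = eiso A; T = (\<lambda>e. star A (eiso A e)) in
      {\<one>\<^bsub>A\<^esub> \<ominus>\<^bsub>A\<^esub> (\<Oplus>\<^bsub>A\<^esub>v\<in>verts E. P v)}
    \<union> {P v \<otimes>\<^bsub>A\<^esub> P v \<ominus>\<^bsub>A\<^esub> P v |v. v \<in> verts E}
    \<union> {P v \<otimes>\<^bsub>A\<^esub> P w |v w. v \<in> verts E \<and> w \<in> verts E \<and> v \<noteq> w}
    \<union> {T e \<otimes>\<^bsub>A\<^esub> S f |e f. e \<in> arcs E \<and> f \<in> arcs E \<and> e \<noteq> f}
    \<union> {T e \<otimes>\<^bsub>A\<^esub> S e \<ominus>\<^bsub>A\<^esub> P (head E e) |e. e \<in> arcs E}
    \<union> {P (tail E e) \<otimes>\<^bsub>A\<^esub> S e \<ominus>\<^bsub>A\<^esub> S e |e. e \<in> arcs E}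
    \<union> {S e \<otimes>\<^bsub>A\<^esub> P (head E e) \<ominus>\<^bsub>A\<^esub> S e |e. e \<in> arcs E}
    \<union> {T e \<otimes>\<^bsub>A\<^esub> P (tail E e) \<ominus>\<^bsub>A\<^esub> T e |e. e \<in> arcs E}
    \<union> {P (head E e) \<otimes>\<^bsub>A\<^esub> T e \<ominus>\<^bsub>A\<^esub> T e |e. e \<in> arcs E}
    \<union> {P v \<ominus>\<^bsub>A\<^esub> (\<Oplus>\<^bsub>A\<^esub>e\<in>out_arcs E v. S e \<otimes>\<^bsub>A\<^esub> T e) |v. v \<in> verts E})"

definition leavitt ::
  "('v, 'e) pre_digraph \<Rightarrow> ((('v, 'e) gen list \<Rightarrow> int) set, 'v, 'e) graph_alg" where
  "leavitt E = (let F = free_alg id E in quot_alg F (genideal F (leavitt_rels F E)))"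

text \<open>The integer span of the \<open>P\<^sub>\<mu>\<close> is the additive subgroup they generate.\<close>

definition leavitt_diag :: "('v, 'e) pre_digraph \<Rightarrow> (('v, 'e) gen list \<Rightarrow> int) set set" where
  "leavitt_diag E = generate (add_monoid (leavitt E)) (path_proj (leavitt E) ` paths E)"


subsection \<open>The graph C*-algebra\<close>

text \<open>
  The universal C*-algebra on generators and relations is the separated completion of the free
  complex *-algebra with respect to the largest C*-seminorm under which the relations hold.  That
  the \<open>p\<^sub>v\<close> are self-adjoint is built into the involution of the free algebra; the first set of
  relations has the same role as in \<open>leavitt_rels\<close>.
\<close>

abbreviation cfree ::
  "('v, 'e) pre_digraph \<Rightarrow> (('v, 'e) gen list \<Rightarrow> complex, 'v, 'e) graph_alg" where
  "cfree E \<equiv> free_alg cnj E"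

definition ck_rels :: "('a, 'v, 'e) graph_alg \<Rightarrow> ('v, 'e) pre_digraph \<Rightarrow> 'a set" where
  "ck_rels A E =
     (let p = vproj A; s = eiso A; t = (\<lambda>e. star A (eiso A e)) in
      {\<one>\<^bsub>A\<^esub> \<ominus>\<^bsub>A\<^esub> (\<Oplus>\<^bsub>A\<^esub>v\<in>verts E. p v)}
    \<union> {p v \<otimes>\<^bsub>A\<^esub> p v \<ominus>\<^bsub>A\<^esub> p v |v. v \<in> verts E}
    \<union> {p v \<otimes>\<^bsub>A\<^esub> p w |v w. v \<in> verts E \<and> w \<in> verts E \<and> v \<noteq> w}
    \<union> {s e \<otimes>\<^bsub>A\<^esub> t e \<otimes>\<^bsub>A\<^esub> s e \<ominus>\<^bsub>A\<^esub> s e |e. e \<in> arcs E}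
    \<union> {t e \<otimes>\<^bsub>A\<^esub> s e \<ominus>\<^bsub>A\<^esub> p (head E e) |e. e \<in> arcs E}
    \<union> {p v \<ominus>\<^bsub>A\<^esub> (\<Oplus>\<^bsub>A\<^esub>e\<in>out_arcs E v. s e \<otimes>\<^bsub>A\<^esub> t e) |v. v \<in> verts E})"

definition cstar_seminorms ::
  "('v, 'e) pre_digraph \<Rightarrow> ((('v, 'e) gen list \<Rightarrow> complex) \<Rightarrow> real) set" where
  "cstar_seminorms E = (let A = cfree E in
     {\<rho>. (\<forall>x\<in>carrier A. \<rho> x \<ge> 0)
       \<and> (\<forall>x\<in>carrier A. \<forall>y\<in>carrier A. \<rho> (x \<oplus>\<^bsub>A\<^esub> y) \<le> \<rho> x + \<rho> y)
       \<and> (\<forall>c. \<forall>x\<in>carrier A. \<rho> (\<lambda>w. c * x w) = cmod c * \<rho> x)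
       \<and> (\<forall>x\<in>carrier A. \<forall>y\<in>carrier A. \<rho> (x \<otimes>\<^bsub>A\<^esub> y) \<le> \<rho> x * \<rho> y)
       \<and> (\<forall>x\<in>carrier A. \<rho> (star A x \<otimes>\<^bsub>A\<^esub> x) = (\<rho> x)\<^sup>2)
       \<and> (\<forall>x\<in>ck_rels A E. \<rho> x = 0)})"

text \<open>
  The supremum is finite: under every such seminorm each generator has norm at most 1.
\<close>

definition univ_seminorm ::
  "('v, 'e) pre_digraph \<Rightarrow> (('v, 'e) gen list \<Rightarrow> complex) \<Rightarrow> real" where
  "univ_seminorm E x = (SUP \<rho>\<in>cstar_seminorms E. \<rho> x)"

definition cauchy_alg ::
  "('v, 'e) pre_digraph \<Rightarrow> (nat \<Rightarrow> ('v, 'e) gen list \<Rightarrow> complex, 'v, 'e) graph_alg" where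
  "cauchy_alg E = (let A = cfree E in \<lparr>
     carrier = {x. (\<forall>n. x n \<in> carrier A) \<and>
       (\<forall>\<epsilon>>0. \<exists>N. \<forall>m\<ge>N. \<forall>n\<ge>N. univ_seminorm E (x m \<ominus>\<^bsub>A\<^esub> x n) < \<epsilon>)},
     mult = (\<lambda>x y n. x n \<otimes>\<^bsub>A\<^esub> y n),
     one = (\<lambda>n. \<one>\<^bsub>A\<^esub>),
     zero = (\<lambda>n. \<zero>\<^bsub>A\<^esub>),
     add = (\<lambda>x y n. x n \<oplus>\<^bsub>A\<^esub> y n),
     star = (\<lambda>x n. star A (x n)),
     vproj = (\<lambda>v n. vproj A v),
     eiso = (\<lambda>e n. eiso A e)\<rparr>)"

definition null_seqs ::
  "('v, 'e) pre_digraph \<Rightarrow> (nat \<Rightarrow> ('v, 'e) gen list \<Rightarrow> complex) set" where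
  "null_seqs E = {x \<in> carrier (cauchy_alg E). (\<lambda>n. univ_seminorm E (x n)) \<longlonglongrightarrow> 0}"

type_synonym ('v, 'e) cstar_elt = "(nat \<Rightarrow> ('v, 'e) gen list \<Rightarrow> complex) set"

definition graph_cstar :: "('v, 'e) pre_digraph \<Rightarrow> (('v, 'e) cstar_elt, 'v, 'e) graph_alg" where
  "graph_cstar E = quot_alg (cauchy_alg E) (null_seqs E)"

definition cnorm :: "('v, 'e) pre_digraph \<Rightarrow> ('v, 'e) cstar_elt \<Rightarrow> real" where
  "cnorm E X = (THE c. \<forall>x\<in>X. (\<lambda>n. univ_seminorm E (x n)) \<longlonglongrightarrow> c)"

text \<open>The scalar multiples of the unit; they carry the complex vector space structure.\<close>

definition cscalar :: "('v, 'e) pre_digraph \<Rightarrow> complex \<Rightarrow> ('v, 'e) cstar_elt" where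
  "cscalar E c = null_seqs E +>\<^bsub>cauchy_alg E\<^esub> (\<lambda>n w. if w = [] then c else 0)"

definition cspan :: "('v, 'e) pre_digraph \<Rightarrow> ('v, 'e) cstar_elt set \<Rightarrow> ('v, 'e) cstar_elt set" where
  "cspan E B = generate (add_monoid (graph_cstar E))
     {cscalar E c \<otimes>\<^bsub>graph_cstar E\<^esub> b |c b. b \<in> B}"

definition cclosure ::
  "('v, 'e) pre_digraph \<Rightarrow> ('v, 'e) cstar_elt set \<Rightarrow> ('v, 'e) cstar_elt set" where
  "cclosure E B = {x \<in> carrier (graph_cstar E).
     \<forall>\<epsilon>>0. \<exists>y\<in>B. cnorm E (x \<ominus>\<^bsub>graph_cstar E\<^esub> y) < \<epsilon>}"

definition cstar_diag :: "('v, 'e) pre_digraph \<Rightarrow> ('v, 'e) cstar_elt set" where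
  "cstar_diag E = cclosure E (cspan E (path_proj (graph_cstar E) ` paths E))"


section \<open>Admissible sets and their endomorphisms\<close>

type_synonym ('v, 'e) path_pair = "('v, 'e) gpath \<times> ('v, 'e) gpath"

definition admissible :: "('v, 'e) pre_digraph \<Rightarrow> ('v, 'e) path_pair set \<Rightarrow> bool" where
  "admissible E J \<longleftrightarrow> finite J \<and> J \<subseteq> paths E \<times> paths E
     \<and> (\<forall>(\<mu>, \<nu>)\<in>J. psource \<mu> = psource \<nu> \<and> prange E \<mu> = prange E \<nu> \<and> plength \<nu> \<ge> 1)
     \<and> is_unitary (leavitt E) (pair_sum (leavitt E) J)"

text \<open>
  The function is made extensional so that it is determined by its values on the carrier.
\<close>

definition Lambda_endo :: "('v, 'e) pre_digraph \<Rightarrow> ('v, 'e) path_pair set \<Rightarrow>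
    (('v, 'e) gen list \<Rightarrow> int) set \<Rightarrow> (('v, 'e) gen list \<Rightarrow> int) set" where
  "Lambda_endo E J = (let L = leavitt E in
     THE \<phi>. \<phi> \<in> extensional (carrier L) \<and> \<phi> \<in> star_endo L
       \<and> (\<forall>e\<in>arcs E. \<phi> (eiso L e) = pair_sum L J \<otimes>\<^bsub>L\<^esub> eiso L e)
       \<and> (\<forall>v\<in>verts E. \<phi> (vproj L v) = vproj L v))"

text \<open>
  Fixing the scalars makes the ring endomorphism complex linear.  Contractivity is automatic for
  *-homomorphisms of C*-algebras, so mentioning it does not restrict the description.
\<close>

definition lambda_endo :: "('v, 'e) pre_digraph \<Rightarrow> ('v, 'e) path_pair set \<Rightarrow>
    ('v, 'e) cstar_elt \<Rightarrow> ('v, 'e) cstar_elt" where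
  "lambda_endo E J = (let C = graph_cstar E in
     THE \<phi>. \<phi> \<in> extensional (carrier C) \<and> \<phi> \<in> star_endo C
       \<and> (\<forall>c. \<phi> (cscalar E c) = cscalar E c)
       \<and> (\<forall>x\<in>carrier C. cnorm E (\<phi> x) \<le> cnorm E x)
       \<and> (\<forall>e\<in>arcs E. \<phi> (eiso C e) = pair_sum C J \<otimes>\<^bsub>C\<^esub> eiso C e)
       \<and> (\<forall>v\<in>verts E. \<phi> (vproj C v) = vproj C v))"

text \<open>Both endomorphisms are injective and map the diagonal into itself.\<close>

definition restricts_to_automorphism :: "('a \<Rightarrow> 'a) \<Rightarrow> 'a set \<Rightarrow> bool" where
  "restricts_to_automorphism \<phi> D \<longleftrightarrow> \<phi> ` D = D"


section \<open>The coding graph\<close>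

text \<open>For a pair \<open>(\<mu>, e\<nu>)\<close> these are the edge \<open>e\<close> and the path \<open>\<nu>\<close>.\<close>

definition first_edge :: "('v, 'e) path_pair \<Rightarrow> 'e" where
  "first_edge a = hd (snd (snd a))"

definition rest_path :: "('v, 'e) pre_digraph \<Rightarrow> ('v, 'e) path_pair \<Rightarrow> ('v, 'e) gpath" where
  "rest_path E a = (head E (first_edge a), tl (snd (snd a)))"

definition edge_label :: "('v, 'e) pre_digraph \<Rightarrow> ('v, 'e) path_pair \<times> ('v, 'e) path_pair \<Rightarrow>
    (('v, 'e) gen list \<Rightarrow> int) set" where
  "edge_label E = (\<lambda>(a, b). let L = leavitt E in
     star L (path_elt L (rest_path E a)) \<otimes>\<^bsub>L\<^esub> path_elt L (fst b))"

definition coding_graph :: "('v, 'e) pre_digraph \<Rightarrow> ('v, 'e) path_pair set \<Rightarrow>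
    (('v, 'e) path_pair, ('v, 'e) path_pair \<times> ('v, 'e) path_pair) pre_digraph" where
  "coding_graph E J = \<lparr>
     verts = J,
     arcs = {(a, b). a \<in> J \<and> b \<in> J \<and> edge_label E (a, b) \<noteq> \<zero>\<^bsub>leavitt E\<^esub>},
     tail = fst,
     head = snd\<rparr>"

definition edge_degree ::
  "('v, 'e) pre_digraph \<Rightarrow> ('v, 'e) path_pair \<times> ('v, 'e) path_pair \<Rightarrow> int" where
  "edge_degree E x = (let L = leavitt E in
     THE d. \<exists>\<alpha>\<in>paths E.
       (edge_label E x = path_elt L \<alpha> \<and> d = int (plength \<alpha>)) \<or>
       (edge_label E x = star L (path_elt L \<alpha>) \<and> d = - int (plength \<alpha>)))"

definition only_nonneg_edges :: "('v, 'e) pre_digraph \<Rightarrow> ('v, 'e) path_pair set \<Rightarrow> bool" where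
  "only_nonneg_edges E J \<longleftrightarrow> (\<forall>x\<in>arcs (coding_graph E J). edge_degree E x \<ge> 0)"

definition has_nonpos_cycle :: "('v, 'e) pre_digraph \<Rightarrow> ('v, 'e) path_pair set \<Rightarrow> bool" where
  "has_nonpos_cycle E J \<longleftrightarrow>
     (\<exists>\<omega>\<in>cycles (coding_graph E J). \<forall>x\<in>set (snd \<omega>). edge_degree E x \<le> 0)"

text \<open>
  The word read along a path contains one edge for each visited vertex, the last one included.
\<close>

definition path_word :: "('v, 'e) pre_digraph \<Rightarrow> ('v, 'e) path_pair set \<Rightarrow>
    (('v, 'e) path_pair, ('v, 'e) path_pair \<times> ('v, 'e) path_pair) gpath \<Rightarrow> 'e list" where
  "path_word E J \<omega> =
     map first_edge (pre_digraph.awalk_verts (coding_graph E J) (fst \<omega>) (snd \<omega>))"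

definition left_synchronizing :: "('v, 'e) pre_digraph \<Rightarrow> ('v, 'e) path_pair set \<Rightarrow> bool" where
  "left_synchronizing E J \<longleftrightarrow> (\<exists>m. \<forall>\<omega>1\<in>paths (coding_graph E J). \<forall>\<omega>2\<in>paths (coding_graph E J).
     plength \<omega>1 = m \<and> plength \<omega>2 = m \<and> path_word E J \<omega>1 = path_word E J \<omega>2
     \<longrightarrow> psource \<omega>1 = psource \<omega>2)"

end

theory Submission
  imports
    Defs
    "HOL-Library.Stream"
    "HOL-Library.Sublist"
    "HOL-Analysis.L2_Norm"
begin

text \<open>
  The diagonal acts on functions on the space of infinite paths by multiplication with locally
  constant functions.  The unitary of an admissible set implements a homeomorphism of that space,
  and the endomorphism is dual to the map sending \<open>x\<close> to its itinerary: the sequence of the edges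
  \<open>e\<close> of the pairs \<open>(\<mu>, e\<nu>)\<close> met by the orbit of \<open>x\<close> under the inverse homeomorphism followed by the
  shift.  Hence the diagonal is mapped onto itself if and only if membership in every cylinder set
  is decided by a finite initial segment of the itinerary.  Along a non-positive cycle the keys
  of a whole cylinder set are constant, and this set contains two points since cycles have
  exits, so the itinerary cannot separate points.  If all degrees are non-negative and there is no
  non-positive cycle, long segments of the key sequence determine long segments of \<open>x\<close>, so the
  condition says that itineraries determine keys with bounded look-ahead, which is left
  synchronization.  For the C*-algebra the same argument applies to approximants, because the
  endomorphism is isometric on the dense subalgebra of step functions: their norm is the supremum
  norm, and the itinerary map has dense range.
\<close>

section \<open>Infinite paths and cylinder sets\<close>

text \<open>Two obstacles shape the proof. First, both algebras are given by generators and
  relations, so it must be proved that vertices and labels do not collapse, that degrees are well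
  defined, and that the endomorphisms denoted by definite descriptions exist. Everything is
  therefore lifted to the free star-algebra, which acts on functions of infinite paths. The Leavitt
  algebra, and a dense subalgebra of the C*-algebra, are quotients of it by an ideal lying between
  the defining relations and the kernel of this action: the lower bound supplies the calculus of
  paths, the upper one lets point masses test equations. A single argument, in
  \<open>free_coding\<close>, thus serves integer and complex coefficients. Second, the universal
  seminorm is known only as a supremum. Lower bounds come from the action on finitely supported
  functions. Upper bounds on the diagonal come from unitaries, and for these the range projections
  of the edges must be orthogonal. That is extracted from the C*-identity and the triangle
  inequality alone, by averaging over random signs.\<close>

definition src :: "('v, 'e) pre_digraph \<Rightarrow> 'e stream \<Rightarrow> 'v" where
  "src E x = tail E (shd x)"

definition infpaths :: "('v, 'e) pre_digraph \<Rightarrow> 'e stream set" where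
  "infpaths E = {x. \<forall>i. x !! i \<in> arcs E \<and> head E (x !! i) = tail E (x !! Suc i)}"

definition cyl :: "('v, 'e) pre_digraph \<Rightarrow> ('v, 'e) gpath \<Rightarrow> 'e stream set" where
  "cyl E \<beta> = {x \<in> infpaths E. src E x = fst \<beta> \<and> stake (length (snd \<beta>)) x = snd \<beta>}"

definition comparable :: "('v, 'e) gpath \<Rightarrow> ('v, 'e) gpath \<Rightarrow> bool" where
  "comparable \<beta> \<gamma> \<longleftrightarrow> fst \<beta> = fst \<gamma> \<and> (prefix (snd \<beta>) (snd \<gamma>) \<or> prefix (snd \<gamma>) (snd \<beta>))"

lemma src_SCons [simp]: "src E (e ## x) = tail E e"
  by (simp add: src_def)

lemma infpaths_SCons: "e ## x \<in> infpaths E \<longleftrightarrow> e \<in> arcs E \<and> x \<in> infpaths E \<and> src E x = head E e"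
proof -
  have "(\<forall>i. P i) \<longleftrightarrow> P 0 \<and> (\<forall>i. P (Suc i))" for P :: "nat \<Rightarrow> bool"
    using not0_implies_Suc by metis
  from this[of "\<lambda>i. (e ## x) !! i \<in> arcs E \<and> head E ((e ## x) !! i) = tail E ((e ## x) !! Suc i)"]
  show ?thesis
    unfolding infpaths_def src_def by (auto simp: snth.simps)
qed

lemma infpaths_stl: "x \<in> infpaths E \<Longrightarrow> stl x \<in> infpaths E"
  and infpaths_shd: "x \<in> infpaths E \<Longrightarrow> shd x \<in> arcs E"
  and src_stl: "x \<in> infpaths E \<Longrightarrow> src E (stl x) = head E (shd x)"
  by (metis infpaths_SCons stream.collapse)+

lemma infpaths_snth: "x \<in> infpaths E \<Longrightarrow> x !! i \<in> arcs E"
  by (simp add: infpaths_def)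

lemma infpaths_sdrop: "x \<in> infpaths E \<Longrightarrow> sdrop n x \<in> infpaths E"
  by (induction n arbitrary: x) (auto intro: infpaths_stl)

lemma cyl_infpaths: "x \<in> cyl E \<beta> \<Longrightarrow> x \<in> infpaths E"
  by (simp add: cyl_def)

lemma prange_Nil [simp]: "prange E (v, []) = v"
  by (simp add: prange_def pre_digraph.awalk_verts.simps)

lemma prange_Cons [simp]: "prange E (v, e # es) = prange E (head E e, es)"
  by (simp add: prange_def pre_digraph.awalk_verts.simps pre_digraph.awalk_verts_conv)

lemma prange_append: "prange E (v, es @ fs) = prange E (prange E (v, es), fs)"
  by (induction es arbitrary: v) auto

lemma stake_eq_prefix: "stake (length es) x = es \<longleftrightarrow> (\<exists>y. x = es @- y)"
proof
  assume "stake (length es) x = es"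
  then show "\<exists>y. x = es @- y" by (metis stake_sdrop)
qed (auto simp: stake_shift)

lemma stake_mono: "stake n x = stake n y \<Longrightarrow> m \<le> n \<Longrightarrow> stake m x = stake m y"
  by (metis min.absorb1 take_stake)

lemma stream_eqI_stake: "(\<And>n. stake n x = stake n y) \<Longrightarrow> x = y"
  by (metis stake_nth lessI smap_alt stream.map_ident)

lemma shift_prefix_comparable:
  "es @- x = fs @- y \<Longrightarrow> prefix es fs \<or> prefix fs es"
proof (induction es arbitrary: fs)
  case (Cons e es)
  then show ?case by (cases fs) auto
qed simp

lemma cyl_comparable: "x \<in> cyl E \<beta> \<Longrightarrow> x \<in> cyl E \<gamma> \<Longrightarrow> comparable \<beta> \<gamma>"
  unfolding cyl_def comparable_def
  by (auto simp: stake_eq_prefix dest: shift_prefix_comparable)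

lemma comparable_same_length:
  "comparable \<beta> \<gamma> \<Longrightarrow> length (snd \<beta>) = length (snd \<gamma>) \<Longrightarrow> \<beta> = \<gamma>"
  by (auto simp: comparable_def prefix_def prod_eq_iff)

section \<open>Concatenation and ranges of finite paths\<close>

context wf_digraph
begin

lemma paths_Nil [simp]: "(v, []) \<in> paths G \<longleftrightarrow> v \<in> verts G"
  by (auto simp: paths_def awalk_Nil_iff)

lemma paths_Cons [simp]:
  "(v, e # es) \<in> paths G \<longleftrightarrow> e \<in> arcs G \<and> tail G e = v \<and> (head G e, es) \<in> paths G"
  by (auto simp: paths_def awalk_Cons_iff)

lemma paths_source: "(v, es) \<in> paths G \<Longrightarrow> v \<in> verts G"
  by (cases es) auto

lemma paths_append:
  "(v, es @ fs) \<in> paths G \<longleftrightarrow> (v, es) \<in> paths G \<and> (prange G (v, es), fs) \<in> paths G"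
  by (induction es arbitrary: v) (auto dest: paths_source)

lemma paths_arcs: "(v, es) \<in> paths G \<Longrightarrow> set es \<subseteq> arcs G"
  by (induction es arbitrary: v) auto

lemma prange_in_verts: "(v, es) \<in> paths G \<Longrightarrow> prange G (v, es) \<in> verts G"
  by (induction es arbitrary: v) auto

end

section \<open>Infinite paths in a graph without sinks\<close>

locale path_graph = fin_digraph E for E :: "('v, 'e) pre_digraph" +
  assumes no_sinks: "no_sinks E"
begin

lemma src_in_verts: "x \<in> infpaths E \<Longrightarrow> src E x \<in> verts E"
  by (simp add: src_def infpaths_shd)

lemma shift_infpaths:
  "(v, es) \<in> paths E \<Longrightarrow>
   es @- x \<in> infpaths E \<and> src E (es @- x) = v \<longleftrightarrow> x \<in> infpaths E \<and> src E x = prange E (v, es)"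
proof (induction es arbitrary: v)
  case (Cons e es)
  then show ?case
    using Cons.IH[of "head E e"] by (auto simp: infpaths_SCons)
qed simp

lemma cyl_iff:
  "\<beta> \<in> paths E \<Longrightarrow> x \<in> cyl E \<beta> \<longleftrightarrow> (\<exists>y\<in>infpaths E. src E y = prange E \<beta> \<and> x = snd \<beta> @- y)"
  using shift_infpaths[of "fst \<beta>" "snd \<beta>"] unfolding cyl_def
  by (auto simp: stake_eq_prefix)

lemma cyl_sdrop:
  assumes "\<beta> \<in> paths E" "x \<in> cyl E \<beta>"
  shows "sdrop (length (snd \<beta>)) x \<in> infpaths E" "src E (sdrop (length (snd \<beta>)) x) = prange E \<beta>"
    "snd \<beta> @- sdrop (length (snd \<beta>)) x = x"
  using assms by (auto simp: cyl_iff sdrop_shift)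

lemma stake_path:
  assumes "x \<in> infpaths E"
  shows "(src E x, stake n x) \<in> paths E"
  using assms
proof (induction n arbitrary: x)
  case (Suc n)
  have "(src E (stl x), stake n (stl x)) \<in> paths E"
    using Suc by (simp add: infpaths_stl)
  then show ?case
    using Suc.prems by (simp add: src_stl infpaths_shd) (simp add: src_def)
qed (simp add: src_in_verts)

lemma in_cyl_stake: "x \<in> infpaths E \<Longrightarrow> x \<in> cyl E (src E x, stake n x)"
  by (simp add: cyl_def)

text \<open>Without sinks an outgoing edge can be chosen at the range of every edge, and iterating
  this choice never stops.\<close>

lemma ex_infpath:
  assumes "v \<in> verts E"
  obtains x where "x \<in> infpaths E" "src E x = v"
proof -
  define f where "f e = (SOME g. g \<in> out_arcs E (head E e))" for e
  have ex: "\<exists>g. g \<in> out_arcs E w" if "w \<in> verts E" for w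
    using no_sinks that unfolding no_sinks_def by blast
  have f: "f e \<in> arcs E \<and> tail E (f e) = head E e" if "e \<in> arcs E" for e
    using someI_ex[OF ex[OF head_in_verts[OF that]]] by (simp add: f_def)
  obtain e where e: "e \<in> arcs E" "tail E e = v" using ex[OF assms] by auto
  have it: "(f ^^ i) e \<in> arcs E" for i by (induction i) (auto simp: e f)
  have "siterate f e \<in> infpaths E"
    unfolding infpaths_def using it f by (simp add: funpow_swap1[symmetric])
  moreover have "src E (siterate f e) = v" by (simp add: src_def e)
  ultimately show ?thesis by (rule that)
qed

lemma cyl_nonempty:
  assumes "\<beta> \<in> paths E" obtains x where "x \<in> cyl E \<beta>"
proof -
  obtain y where "y \<in> infpaths E" "src E y = prange E \<beta>"
    using ex_infpath prange_in_verts[of "fst \<beta>" "snd \<beta>"] assms by auto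
  then show ?thesis using cyl_iff[OF assms] that by blast
qed

lemma cyl_append_subset: "cyl E (v, es @ fs) \<subseteq> cyl E (v, es)"
  unfolding cyl_def stake_eq_prefix by auto

lemma cyl_prefix_subset: "prefix es fs \<Longrightarrow> cyl E (v, fs) \<subseteq> cyl E (v, es)"
  using cyl_append_subset by (auto simp: prefix_def)

text \<open>If an infinite path were alone in its vertex cylinder, then a vertex it visits twice would lie
  on a cycle without exit.\<close>

lemma two_infpaths:
  assumes exits: "\<forall>\<mu>\<in>cycles E. has_exit E \<mu>" and v: "v \<in> verts E"
  obtains x y where "x \<in> infpaths E" "y \<in> infpaths E" "src E x = v" "src E y = v" "x \<noteq> y"
proof -
  obtain x where x: "x \<in> infpaths E" "src E x = v" using ex_infpath[OF v] .
  \<comment> \<open>Pigeonhole: only finitely many vertices are available as sources of the edges of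
    \<open>x\<close>.\<close>
  have "\<not> inj (\<lambda>i. tail E (x !! i))"
  proof
    assume "inj (\<lambda>i. tail E (x !! i))"
    moreover have "finite (range (\<lambda>i. tail E (x !! i)))"
      using infpaths_snth[OF x(1)] by (intro finite_subset[OF _ finite_verts]) auto
    ultimately show False using finite_imageD by fastforce
  qed
  then obtain i j where ij: "i < j" "tail E (x !! i) = tail E (x !! j)"
    unfolding inj_def by (metis linorder_neqE_nat)
  define z where "z = sdrop i x"
  have z: "z \<in> infpaths E" by (simp add: z_def infpaths_sdrop x)
  have srcdrop: "src E (sdrop k x) = tail E (x !! k)" for k
    by (metis src_def add_0_right sdrop_snth snth.simps(1))
  \<comment> \<open>A closed stretch of \<open>x\<close>. It need not be simple, which the broad
    notion of cycle allows.\<close>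
  define es where "es = stake (j - i) z"
  have p: "(src E z, es) \<in> paths E" unfolding es_def using stake_path[OF z] .
  have "z = es @- sdrop (j - i) z" by (simp add: es_def stake_sdrop)
  then have "src E (sdrop (j - i) z) = prange E (src E z, es)"
    using shift_infpaths[OF p] z by metis
  moreover have "src E (sdrop (j - i) z) = src E z"
    using ij srcdrop by (simp add: z_def)
  ultimately have "(src E z, es) \<in> cycles E"
    using p ij by (simp add: cycles_def plength_def psource_def es_def)
  then obtain e where e: "e \<in> set es" "card (out_arcs E (tail E e)) \<ge> 2"
    using exits by (auto simp: has_exit_def)
  from e(1) obtain k where k: "e = x !! k"
    by (auto simp: es_def z_def in_set_conv_nth sdrop_snth)
  have eo: "e \<in> out_arcs E (tail E e)" using infpaths_snth[OF x(1)] k by simp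
  obtain f where f: "f \<in> arcs E" "tail E f = tail E e" "f \<noteq> e"
  proof (rule ccontr)
    assume "\<not> thesis"
    then have "out_arcs E (tail E e) \<subseteq> {e}" using that by (metis in_out_arcs_conv singletonI subsetI)
    then have "card (out_arcs E (tail E e)) \<le> 1"
      by (metis card.empty card.insert card_mono empty_iff finite.emptyI finite.insertI One_nat_def)
    then show False using e(2) by simp
  qed
  obtain y where y: "y \<in> infpaths E" "src E y = head E f" using ex_infpath[of "head E f"] f by auto
  have p': "(v, stake k x) \<in> paths E" using stake_path[OF x(1)] x(2) by simp
  have "src E (sdrop k x) = prange E (v, stake k x)"
    using shift_infpaths[OF p', of "sdrop k x"] x by (simp add: stake_sdrop)
  then have "src E (f ## y) = prange E (v, stake k x)"
    using srcdrop k f by simp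
  \<comment> \<open>The second path follows \<open>x\<close> up to a vertex with two outgoing edges
    and leaves it there along \<open>f\<close>.\<close>
  then have w: "stake k x @- (f ## y) \<in> infpaths E \<and> src E (stake k x @- (f ## y)) = v"
    using shift_infpaths[OF p'] y f by (auto simp: infpaths_SCons)
  moreover have "x !! k \<noteq> (stake k x @- (f ## y)) !! k" using f k by (simp add: shift_snth)
  ultimately show ?thesis using that[OF x(1) _ x(2)] by metis
qed

lemma two_in_cyl:
  assumes exits: "\<forall>\<mu>\<in>cycles E. has_exit E \<mu>" and \<beta>: "\<beta> \<in> paths E"
  obtains x y where "x \<in> cyl E \<beta>" "y \<in> cyl E \<beta>" "x \<noteq> y"
proof -
  have "prange E \<beta> \<in> verts E" using prange_in_verts[of "fst \<beta>" "snd \<beta>"] \<beta> by simp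
  from two_infpaths[OF exits this] obtain x y where
    "x \<in> infpaths E" "y \<in> infpaths E" "src E x = prange E \<beta>" "src E y = prange E \<beta>" "x \<noteq> y" .
  then show ?thesis
    using that[of "snd \<beta> @- x" "snd \<beta> @- y"] cyl_iff[OF \<beta>] by auto
qed

end

section \<open>The dynamics of an admissible set\<close>

text \<open>Unitarity of \<open>u\<close> enters the dynamics only through the two partitions of the
  path space; \<open>admissible_coding\<close> derives them from the algebra.\<close>

locale coding = path_graph E for E :: "('v, 'e) pre_digraph" +
  fixes J :: "('v, 'e) path_pair set"
  assumes finite_J: "finite J"
    and J_paths: "j \<in> J \<Longrightarrow> fst j \<in> paths E \<and> snd j \<in> paths E"
    and J_source: "j \<in> J \<Longrightarrow> fst (fst j) = fst (snd j)"
    and J_range: "j \<in> J \<Longrightarrow> prange E (fst j) = prange E (snd j)"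
    and J_nonempty: "j \<in> J \<Longrightarrow> snd (snd j) \<noteq> []"
    and partition_fst: "x \<in> infpaths E \<Longrightarrow> \<exists>!j. j \<in> J \<and> x \<in> cyl E (fst j)"
    and partition_snd: "x \<in> infpaths E \<Longrightarrow> \<exists>!j. j \<in> J \<and> x \<in> cyl E (snd j)"
begin

definition key :: "'e stream \<Rightarrow> ('v, 'e) path_pair" where
  "key x = (THE j. j \<in> J \<and> x \<in> cyl E (fst j))"

definition key_snd :: "'e stream \<Rightarrow> ('v, 'e) path_pair" where
  "key_snd x = (THE j. j \<in> J \<and> x \<in> cyl E (snd j))"

text \<open>\<open>Umap\<close> is the homeomorphism of the infinite path space implemented by the unitary, \<open>Vmap\<close> its
  inverse; \<open>itinerary\<close> is dual to the endomorphism on the diagonal.\<close>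

definition Umap :: "'e stream \<Rightarrow> 'e stream" where
  "Umap x = (let j = key_snd x in snd (fst j) @- sdrop (length (snd (snd j))) x)"

definition Vmap :: "'e stream \<Rightarrow> 'e stream" where
  "Vmap x = (let j = key x in snd (snd j) @- sdrop (length (snd (fst j))) x)"

definition Tmap :: "'e stream \<Rightarrow> 'e stream" where
  "Tmap x = stl (Vmap x)"

definition keys :: "'e stream \<Rightarrow> ('v, 'e) path_pair stream" where
  "keys x = smap key (siterate Tmap x)"

definition itinerary :: "'e stream \<Rightarrow> 'e stream" where
  "itinerary x = smap first_edge (keys x)"

text \<open>The bound \<open>N\<close> is uniform over all points, so the indicator of the cylinder
  is a function of finitely many letters of the itinerary.\<close>

definition determined :: "('v, 'e) gpath \<Rightarrow> bool" where
  "determined \<beta> \<longleftrightarrow> (\<exists>N. \<forall>x\<in>infpaths E. \<forall>y\<in>infpaths E.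
     stake N (itinerary x) = stake N (itinerary y) \<longrightarrow> (x \<in> cyl E \<beta> \<longleftrightarrow> y \<in> cyl E \<beta>))"

section \<open>Orbits, keys and itineraries\<close>

lemma key: "x \<in> infpaths E \<Longrightarrow> key x \<in> J" "x \<in> infpaths E \<Longrightarrow> x \<in> cyl E (fst (key x))"
  using theI'[OF partition_fst] by (auto simp: key_def)

lemma key_snd: "x \<in> infpaths E \<Longrightarrow> key_snd x \<in> J" "x \<in> infpaths E \<Longrightarrow> x \<in> cyl E (snd (key_snd x))"
  using theI'[OF partition_snd] by (auto simp: key_snd_def)

lemma key_eq: "j \<in> J \<Longrightarrow> x \<in> cyl E (fst j) \<Longrightarrow> key x = j"
  using key partition_fst cyl_infpaths by metis

lemma key_snd_eq: "j \<in> J \<Longrightarrow> x \<in> cyl E (snd j) \<Longrightarrow> key_snd x = j"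
  using key_snd partition_snd cyl_infpaths by metis

lemma Vmap_shift:
  assumes "j \<in> J" "y \<in> infpaths E" "src E y = prange E (fst j)"
  shows "Vmap (snd (fst j) @- y) = snd (snd j) @- y"
    "snd (fst j) @- y \<in> cyl E (fst j)" "snd (snd j) @- y \<in> cyl E (snd j)"
proof -
  show c: "snd (fst j) @- y \<in> cyl E (fst j)"
    using assms J_paths cyl_iff by blast
  show "snd (snd j) @- y \<in> cyl E (snd j)"
    using assms J_paths[OF assms(1)] cyl_iff J_range by metis
  show "Vmap (snd (fst j) @- y) = snd (snd j) @- y"
    unfolding Vmap_def key_eq[OF assms(1) c] by (simp add: sdrop_shift)
qed

lemma Umap_shift:
  assumes "j \<in> J" "y \<in> infpaths E" "src E y = prange E (fst j)"
  shows "Umap (snd (snd j) @- y) = snd (fst j) @- y"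
  unfolding Umap_def key_snd_eq[OF assms(1) Vmap_shift(3)[OF assms]] by (simp add: sdrop_shift)

lemma key_decomp:
  assumes "x \<in> infpaths E"
  obtains y where "y \<in> infpaths E" "src E y = prange E (fst (key x))"
    "x = snd (fst (key x)) @- y" "Vmap x = snd (snd (key x)) @- y"
proof -
  have "fst (key x) \<in> paths E" using J_paths key(1)[OF assms] by blast
  then obtain y where y: "y \<in> infpaths E" "src E y = prange E (fst (key x))" "x = snd (fst (key x)) @- y"
    using key(2)[OF assms] cyl_iff by blast
  then have "Vmap x = snd (snd (key x)) @- y"
    using Vmap_shift(1)[OF key(1)[OF assms]] by metis
  then show ?thesis using y that by blast
qed

lemma key_snd_decomp:
  assumes "x \<in> infpaths E"
  obtains y where "y \<in> infpaths E" "src E y = prange E (fst (key_snd x))"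
    "x = snd (snd (key_snd x)) @- y" "Umap x = snd (fst (key_snd x)) @- y"
proof -
  have "snd (key_snd x) \<in> paths E" using J_paths key_snd(1)[OF assms] by blast
  then obtain y where y: "y \<in> infpaths E" "src E y = prange E (snd (key_snd x))"
      "x = snd (snd (key_snd x)) @- y"
    using key_snd(2)[OF assms] cyl_iff by blast
  then have y2: "src E y = prange E (fst (key_snd x))" using J_range key_snd(1)[OF assms] by metis
  then have "Umap x = snd (fst (key_snd x)) @- y"
    using Umap_shift[OF key_snd(1)[OF assms] y(1) y2] y by metis
  then show ?thesis using y y2 that by blast
qed

lemma
  assumes "x \<in> infpaths E"
  shows Vmap_cyl: "Vmap x \<in> cyl E (snd (key x))" and Umap_Vmap: "Umap (Vmap x) = x"
    and src_Vmap: "src E (Vmap x) = src E x"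
proof -
  from key_decomp[OF assms] obtain y where y: "y \<in> infpaths E" "src E y = prange E (fst (key x))"
    "x = snd (fst (key x)) @- y" "Vmap x = snd (snd (key x)) @- y" .
  show c: "Vmap x \<in> cyl E (snd (key x))" using Vmap_shift(3)[OF key(1)[OF assms] y(1,2)] y by simp
  show "Umap (Vmap x) = x" using Umap_shift[OF key(1)[OF assms] y(1,2)] y by simp
  show "src E (Vmap x) = src E x"
    using c key(2)[OF assms] J_source[OF key(1)[OF assms]] by (simp add: cyl_def)
qed

lemma Vmap_infpaths: "x \<in> infpaths E \<Longrightarrow> Vmap x \<in> infpaths E"
  using Vmap_cyl cyl_infpaths by blast

lemma
  assumes "x \<in> infpaths E"
  shows Umap_cyl: "Umap x \<in> cyl E (fst (key_snd x))" and Vmap_Umap: "Vmap (Umap x) = x"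
proof -
  from key_snd_decomp[OF assms] obtain y where y: "y \<in> infpaths E" "src E y = prange E (fst (key_snd x))"
    "x = snd (snd (key_snd x)) @- y" "Umap x = snd (fst (key_snd x)) @- y" .
  show "Umap x \<in> cyl E (fst (key_snd x))" using Vmap_shift(2)[OF key_snd(1)[OF assms] y(1,2)] y by simp
  show "Vmap (Umap x) = x" using Vmap_shift(1)[OF key_snd(1)[OF assms] y(1,2)] y by simp
qed

lemma Umap_infpaths: "x \<in> infpaths E \<Longrightarrow> Umap x \<in> infpaths E"
  using Umap_cyl cyl_infpaths by blast

lemma Tmap_infpaths: "x \<in> infpaths E \<Longrightarrow> Tmap x \<in> infpaths E"
  by (simp add: Tmap_def Vmap_infpaths infpaths_stl)

lemma shd_Vmap: "x \<in> infpaths E \<Longrightarrow> shd (Vmap x) = first_edge (key x)"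
  using J_nonempty[OF key(1)] by (auto simp: Vmap_def Let_def first_edge_def)

lemma keys_SCons: "keys x = key x ## keys (Tmap x)"
  unfolding keys_def by (subst siterate.ctr) simp

lemma itinerary_SCons: "itinerary x = first_edge (key x) ## itinerary (Tmap x)"
  unfolding itinerary_def by (subst keys_SCons) simp

text \<open>Consecutive letters fit together because the first edge of \<open>Vmap z\<close> ends
  where \<open>Tmap z\<close> starts, and \<open>Vmap\<close> preserves sources.\<close>

lemma itinerary_infpaths:
  assumes "x \<in> infpaths E"
  shows "itinerary x \<in> infpaths E" and src_itinerary: "src E (itinerary x) = src E x"
proof -
  have s: "src E (itinerary z) = src E z" if "z \<in> infpaths E" for z
  proof -
    have "src E (itinerary z) = src E (Vmap z)"
      by (subst itinerary_SCons) (simp add: src_def shd_Vmap that)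
    then show ?thesis using src_Vmap[OF that] by simp
  qed
  then show "src E (itinerary x) = src E x" using assms .
  have T: "(Tmap ^^ i) x \<in> infpaths E" for i
    by (induction i) (auto simp: assms Tmap_infpaths)
  have nth: "itinerary x !! i = shd (Vmap ((Tmap ^^ i) x))" for i
    by (simp add: itinerary_def keys_def shd_Vmap T)
  have "head E (shd (Vmap z)) = tail E (shd (Vmap (Tmap z)))" if "z \<in> infpaths E" for z
  proof -
    have "head E (shd (Vmap z)) = src E (Tmap z)"
      unfolding Tmap_def using src_stl[OF Vmap_infpaths[OF that]] by simp
    also have "\<dots> = src E (Vmap (Tmap z))" using src_Vmap Tmap_infpaths that by metis
    finally show ?thesis by (simp add: src_def)
  qed
  then have "itinerary x !! i \<in> arcs E \<and> head E (itinerary x !! i) = tail E (itinerary x !! Suc i)" for i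
    using T[of i] unfolding nth by (simp add: infpaths_shd Vmap_infpaths)
  then show "itinerary x \<in> infpaths E" unfolding infpaths_def by blast
qed

text \<open>For a key \<open>(\<mu>, e\<nu>)\<close>, \<open>Vmap\<close> trades the prefix
  \<open>\<mu>\<close> for \<open>e\<nu>\<close> and the shift removes \<open>e\<close>; the net
  effect is that \<open>\<nu>\<close> replaces \<open>\<mu>\<close>.\<close>

lemma Tmap_rest:
  assumes "j \<in> J" "y \<in> infpaths E" "src E y = prange E (fst j)"
  shows "Tmap (snd (fst j) @- y) = snd (rest_path E j) @- y"
  using Vmap_shift(1)[OF assms] J_nonempty[OF assms(1)]
  by (cases "snd (snd j)") (auto simp: Tmap_def rest_path_def)

lemma rest_path:
  assumes "j \<in> J"
  shows "rest_path E j \<in> paths E" "prange E (rest_path E j) = prange E (fst j)"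
proof -
  obtain v e es where j: "snd j = (v, e # es)"
    using J_nonempty[OF assms] by (metis list.exhaust prod.exhaust_sel)
  show "rest_path E j \<in> paths E" "prange E (rest_path E j) = prange E (fst j)"
    using J_paths[OF assms] J_range[OF assms] j by (auto simp: rest_path_def first_edge_def)
qed

lemma Tmap_rest_cyl:
  assumes "x \<in> infpaths E"
  shows "Tmap x \<in> cyl E (rest_path E (key x))"
proof -
  from key_decomp[OF assms] obtain y where y: "y \<in> infpaths E" "src E y = prange E (fst (key x))"
    "x = snd (fst (key x)) @- y" "Vmap x = snd (snd (key x)) @- y" .
  have "Tmap x = snd (rest_path E (key x)) @- y"
    using Tmap_rest[OF key(1)[OF assms] y(1,2)] y by simp
  then show ?thesis
    using cyl_iff rest_path[OF key(1)[OF assms]] y by metis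
qed

end

text \<open>This is all that the dynamics uses of the labels in the Leavitt algebra: nonvanishing
  and the sign of the degree become prefix comparisons. It is established in \<open>labels\<close>,
  where exits let the action on paths tell degrees apart.\<close>

locale coding_labels = coding E J
  for E :: "('v, 'e) pre_digraph" and J :: "('v, 'e) path_pair set" +
  assumes coding_arcs: "(a, b) \<in> arcs (coding_graph E J) \<longleftrightarrow>
      a \<in> J \<and> b \<in> J \<and> comparable (rest_path E a) (fst b)"
    and degree_nonneg: "(a, b) \<in> arcs (coding_graph E J) \<Longrightarrow>
      edge_degree E (a, b) \<ge> 0 \<longleftrightarrow> prefix (snd (rest_path E a)) (snd (fst b))"
    and degree_nonpos: "(a, b) \<in> arcs (coding_graph E J) \<Longrightarrow>
      edge_degree E (a, b) \<le> 0 \<longleftrightarrow> prefix (snd (fst b)) (snd (rest_path E a))"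
begin

lemma coding_simps [simp]: "verts (coding_graph E J) = J" "tail (coding_graph E J) = fst"
    "head (coding_graph E J) = snd"
  by (simp_all add: coding_graph_def)

sublocale cg: wf_digraph "coding_graph E J"
  by unfold_locales (auto simp: coding_graph_def)

lemma sdrop_itinerary: "sdrop n (itinerary x) = itinerary ((Tmap ^^ n) x)"
  by (simp add: itinerary_def keys_def)

text \<open>Along an edge of degree at most 0 the path left over from \<open>a\<close> already
  contains the prefix \<open>fst b\<close>, so the next key is forced for every point of the
  cylinder.\<close>

lemma Tmap_nonpos:
  assumes "(a, b) \<in> arcs (coding_graph E J)" "edge_degree E (a, b) \<le> 0" "x \<in> cyl E (fst a)"
  shows "Tmap x \<in> cyl E (fst b)" "key x = a"
proof -
  have e: "a \<in> J" "b \<in> J" "comparable (rest_path E a) (fst b)" using assms coding_arcs by auto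
  show k: "key x = a" using key_eq e assms by blast
  have "prefix (snd (fst b)) (snd (rest_path E a))" using degree_nonpos assms by blast
  then have "cyl E (rest_path E a) \<subseteq> cyl E (fst b)"
    using cyl_prefix_subset[of "snd (fst b)" "snd (rest_path E a)" "fst (fst b)"] e(3)
    by (metis comparable_def prod.collapse)
  then show "Tmap x \<in> cyl E (fst b)"
    using Tmap_rest_cyl[of x] k assms cyl_infpaths by blast
qed

lemma nonpos_walk:
  assumes "(a, es) \<in> paths (coding_graph E J)" "\<forall>x\<in>set es. edge_degree E x \<le> 0"
    "x \<in> cyl E (fst a)" "y \<in> cyl E (fst a)"
  shows "stake (length es) (itinerary x) = stake (length es) (itinerary y)"
  using assms
proof (induction es arbitrary: a x y)
  case (Cons e es)
  obtain b where e: "e = (a, b)" using Cons.prems by (metis cg.paths_Cons coding_simps(2) prod.collapse)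
  have ab: "(a, b) \<in> arcs (coding_graph E J)" "edge_degree E (a, b) \<le> 0" "(b, es) \<in> paths (coding_graph E J)"
    using Cons.prems e by auto
  have "stake (length es) (itinerary (Tmap x)) = stake (length es) (itinerary (Tmap y))"
    using Cons.IH[OF ab(3)] Tmap_nonpos(1)[OF ab(1,2)] Cons.prems by auto
  moreover have "key x = key y" using Tmap_nonpos(2)[OF ab(1,2)] Cons.prems by auto
  ultimately show ?case by (subst (1 2) itinerary_SCons) simp
qed simp

text \<open>Running round the cycle arbitrarily often makes the itineraries of all points of one
  cylinder agree to any length. A cylinder that separates two of these points then cannot be
  determined.\<close>

lemma nonpos_cycle_not_determined:
  assumes "\<forall>\<mu>\<in>cycles E. has_exit E \<mu>" "has_nonpos_cycle E J"
  shows "\<exists>\<beta>\<in>paths E. \<not> determined \<beta>"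
proof -
  obtain a es where c: "(a, es) \<in> cycles (coding_graph E J)" "\<forall>x\<in>set es. edge_degree E x \<le> 0"
    using assms(2) unfolding has_nonpos_cycle_def by fastforce
  have c': "(a, es) \<in> paths (coding_graph E J)" "length es \<ge> 1" "prange (coding_graph E J) (a, es) = a"
    using c by (auto simp: cycles_def plength_def psource_def)
  have rep: "(a, concat (replicate n es)) \<in> paths (coding_graph E J) \<and>
      prange (coding_graph E J) (a, concat (replicate n es)) = a" for n
    using c' by (induction n) (auto simp: cg.paths_append prange_append dest: cg.paths_source)
  \<comment> \<open>A cycle has length at least 1, so \<open>n\<close> rounds yield at least
    \<open>n\<close> letters.\<close>
  have len: "n \<le> length (concat (replicate n es))" for n
    using c'(2) by (simp add: length_concat sum_list_replicate)
  have agree: "stake n (itinerary x) = stake n (itinerary y)"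
    if "x \<in> cyl E (fst a)" "y \<in> cyl E (fst a)" for x y n
  proof -
    have "\<forall>x\<in>set (concat (replicate n es)). edge_degree E x \<le> 0" using c(2) by auto
    then have "stake (length (concat (replicate n es))) (itinerary x) =
      stake (length (concat (replicate n es))) (itinerary y)"
      using nonpos_walk rep that by blast
    then show ?thesis using len by (rule stake_mono)
  qed
  have "a \<in> J" using cg.paths_source[OF c'(1)] by simp
  then have "fst a \<in> paths E" using J_paths by blast
  from two_in_cyl[OF assms(1) this] obtain x y where
    xy: "x \<in> cyl E (fst a)" "y \<in> cyl E (fst a)" "x \<noteq> y" .
  have xy': "x \<in> infpaths E" "y \<in> infpaths E" using xy by (blast intro: cyl_infpaths)+
  obtain m where m: "stake m x \<noteq> stake m y" using xy stream_eqI_stake by blast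
  have "x \<in> cyl E (src E x, stake m x)" "y \<notin> cyl E (src E x, stake m x)"
    using xy' m by (auto simp: cyl_def)
  then have "\<not> determined (src E x, stake m x)"
    unfolding determined_def using agree xy xy' by blast
  then show ?thesis using stake_path[OF xy'(1)] by blast
qed

section \<open>Orbits as walks in the coding graph\<close>

lemma key_edge:
  assumes "x \<in> infpaths E"
  shows "(key x, key (Tmap x)) \<in> arcs (coding_graph E J)"
  using cyl_comparable[OF Tmap_rest_cyl[OF assms] key(2)[OF Tmap_infpaths[OF assms]]]
    key(1)[OF assms] key(1)[OF Tmap_infpaths[OF assms]] by (simp add: coding_arcs)

primrec walk :: "nat \<Rightarrow> 'e stream \<Rightarrow> (('v, 'e) path_pair \<times> ('v, 'e) path_pair) list" where
  "walk 0 x = []"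
| "walk (Suc n) x = (key x, key (Tmap x)) # walk n (Tmap x)"

lemma length_walk [simp]: "length (walk n x) = n"
  by (induction n arbitrary: x) auto

lemma set_walk: "e \<in> set (walk n x) \<Longrightarrow> \<exists>i<n. e = (key ((Tmap ^^ i) x), key ((Tmap ^^ Suc i) x))"
proof (induction n arbitrary: x)
  case (Suc n)
  show ?case
  proof (cases "e = (key x, key (Tmap x))")
    case False
    then obtain i where "i < n" "e = (key ((Tmap ^^ i) (Tmap x)), key ((Tmap ^^ Suc i) (Tmap x)))"
      using Suc by auto
    then show ?thesis by (intro exI[of _ "Suc i"]) (simp add: funpow_swap1)
  qed (auto intro!: exI[of _ 0])
qed simp

lemma walk_path:
  "x \<in> infpaths E \<Longrightarrow> (key x, walk n x) \<in> paths (coding_graph E J)"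
  "x \<in> infpaths E \<Longrightarrow> prange (coding_graph E J) (key x, walk n x) = key ((Tmap ^^ n) x)"
  by (induction n arbitrary: x) (auto simp: key(1) key_edge Tmap_infpaths funpow_swap1)

lemma walk_verts:
  "pre_digraph.awalk_verts (coding_graph E J) (key x) (walk n x) = stake (Suc n) (keys x)"
proof (induction n arbitrary: x)
  case 0
  then show ?case by (subst keys_SCons) (simp add: pre_digraph.awalk_verts.simps)
next
  case (Suc n)
  then show ?case by (subst keys_SCons) (simp add: pre_digraph.awalk_verts.simps)
qed

lemma Tmap_pow_infpaths: "x \<in> infpaths E \<Longrightarrow> (Tmap ^^ n) x \<in> infpaths E"
  by (induction n) (auto simp: Tmap_infpaths)

lemma snth_keys: "keys x !! n = key ((Tmap ^^ n) x)"
  by (simp add: keys_def)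

text \<open>As the two paths are comparable, this says that the edge from \<open>key x\<close> to
  \<open>key (Tmap x)\<close> has positive degree: the new key reveals letters beyond those already
  known.\<close>

definition grows :: "'e stream \<Rightarrow> bool" where
  "grows x \<longleftrightarrow> length (snd (rest_path E (key x))) < length (snd (fst (key (Tmap x))))"

text \<open>Among the \<open>card J + 1\<close> keys at times 0 to \<open>card J\<close> one
  repeats, and the walk between these two times is a cycle. Without growth all its edges would have
  degree at most 0.\<close>

lemma ex_grows:
  assumes "\<not> has_nonpos_cycle E J" "x \<in> infpaths E"
  shows "\<exists>i\<le>card J. grows ((Tmap ^^ i) x)"
proof (rule ccontr)
  assume neg: "\<not> ?thesis"
  have "\<not> inj_on (\<lambda>i. key ((Tmap ^^ i) x)) {..card J}"
  proof
    assume "inj_on (\<lambda>i. key ((Tmap ^^ i) x)) {..card J}"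
    moreover have "(\<lambda>i. key ((Tmap ^^ i) x)) ` {..card J} \<subseteq> J"
      using key(1) Tmap_pow_infpaths assms(2) by blast
    ultimately have "card {..card J} \<le> card J" using card_inj_on_le finite_J by blast
    then show False by simp
  qed
  then obtain p q where pq: "p < q" "q \<le> card J" "key ((Tmap ^^ p) x) = key ((Tmap ^^ q) x)"
    unfolding inj_on_def by (metis atMost_iff linorder_neqE_nat)
  define z where "z = (Tmap ^^ p) x"
  have z: "z \<in> infpaths E" by (simp add: z_def Tmap_pow_infpaths assms)
  have zi: "(Tmap ^^ i) z = (Tmap ^^ (i + p)) x" for i by (simp add: z_def funpow_add)
  have "(key z, walk (q - p) z) \<in> cycles (coding_graph E J)"
    using walk_path[OF z, of "q - p"] pq zi[of "q - p"] by (simp add: cycles_def plength_def psource_def z_def)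
  moreover have "edge_degree E e \<le> 0" if e: "e \<in> set (walk (q - p) z)" for e
  proof -
    obtain i where i: "i < q - p" "e = (key ((Tmap ^^ i) z), key ((Tmap ^^ Suc i) z))"
      using set_walk[OF e] by blast
    define y where "y = (Tmap ^^ i) z"
    have y: "y \<in> infpaths E" unfolding y_def using Tmap_pow_infpaths[OF z] .
    have e': "e = (key y, key (Tmap y))" using i by (simp add: y_def)
    have "\<not> grows y" using neg i pq unfolding y_def zi by auto
    then have "length (snd (fst (key (Tmap y)))) \<le> length (snd (rest_path E (key y)))"
      by (simp add: grows_def)
    then have "prefix (snd (fst (key (Tmap y)))) (snd (rest_path E (key y)))"
      using key_edge[OF y] by (auto simp: coding_arcs comparable_def prefix_def)
    then show ?thesis using degree_nonpos[OF key_edge[OF y]] e' by simp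
  qed
  ultimately show False using assms(1) unfolding has_nonpos_cycle_def by fastforce
qed

text \<open>\<open>Tmap\<close> exchanges the prefix \<open>fst (key x)\<close> for
  \<open>rest_path E (key x)\<close> and leaves the remainder alone, so \<open>L\<close> common
  letters past one prefix are \<open>L\<close> common letters past the other.\<close>

lemma step_back:
  assumes x: "x \<in> infpaths E" and y: "y \<in> infpaths E" and k: "key x = key y"
    and s: "stake (length (snd (rest_path E (key x))) + L) (Tmap x) =
      stake (length (snd (rest_path E (key x))) + L) (Tmap y)"
  shows "stake (length (snd (fst (key x))) + L) x = stake (length (snd (fst (key x))) + L) y"
proof -
  from key_decomp[OF x] obtain x' where x': "x' \<in> infpaths E" "src E x' = prange E (fst (key x))"
    "x = snd (fst (key x)) @- x'" by metis
  from key_decomp[OF y] obtain y' where y': "y' \<in> infpaths E" "src E y' = prange E (fst (key x))"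
    "y = snd (fst (key x)) @- y'" using k by metis
  have "Tmap x = snd (rest_path E (key x)) @- x'" "Tmap y = snd (rest_path E (key x)) @- y'"
    using Tmap_rest[OF key(1)[OF x]] x' y' by metis+
  then have "stake L x' = stake L y'" using s by (simp add: stake_shift)
  then show ?thesis using arg_cong[OF x'(3)] arg_cong[OF y'(3)] by (metis add_diff_cancel_left' le_add1 stake_shift take_all)
qed

text \<open>Agreement is measured beyond the prefix given by the first key. Pulled back along a
  non-negative edge it loses nothing, along a positive edge it gains at least one letter, and a
  positive edge occurs at some time up to \<open>card J\<close>.\<close>

lemma keys_separate:
  assumes nonneg: "only_nonneg_edges E J" and nocyc: "\<not> has_nonpos_cycle E J"
  shows "\<exists>K. \<forall>x\<in>infpaths E. \<forall>y\<in>infpaths E. stake K (keys x) = stake K (keys y) \<longrightarrow>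
    stake (length (snd (fst (key x))) + L) x = stake (length (snd (fst (key x))) + L) y"
proof (induction L)
  case 0
  have "stake (length (snd (fst (key x)))) x = stake (length (snd (fst (key x)))) y"
    if "x \<in> infpaths E" "y \<in> infpaths E" "key x = key y" for x y
    using key(2)[OF that(1)] key(2)[OF that(2)] that(3) by (simp add: cyl_def)
  moreover have "key x = key y" if "stake 1 (keys x) = stake 1 (keys y)" for x y
    using arg_cong[OF that, of hd] by (simp add: keys_def)
  ultimately show ?case unfolding add_0_right by blast
next
  case (Suc L)
  then obtain K where K: "\<And>x y. x \<in> infpaths E \<Longrightarrow> y \<in> infpaths E \<Longrightarrow> stake K (keys x) = stake K (keys y) \<Longrightarrow>
    stake (length (snd (fst (key x))) + L) x = stake (length (snd (fst (key x))) + L) y" by blast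
  have nn: "length (snd (rest_path E (key x))) \<le> length (snd (fst (key (Tmap x))))" if "x \<in> infpaths E" for x
    using nonneg key_edge[OF that] degree_nonneg prefix_length_le unfolding only_nonneg_edges_def by blast
  have step: "stake (length (snd (fst (key x))) + Suc L) x = stake (length (snd (fst (key x))) + Suc L) y"
    if "x \<in> infpaths E" "y \<in> infpaths E" "stake (Suc (i + K)) (keys x) = stake (Suc (i + K)) (keys y)"
      "grows ((Tmap ^^ i) x)" for i x y
    using that
  proof (induction i arbitrary: x y)
    case 0
    have k: "key x = key y" "stake K (keys (Tmap x)) = stake K (keys (Tmap y))"
      using 0(3) by (subst (asm) (1 2) keys_SCons; simp)+
    have "stake (length (snd (fst (key (Tmap x)))) + L) (Tmap x) =
      stake (length (snd (fst (key (Tmap x)))) + L) (Tmap y)"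
      using K k Tmap_infpaths 0 by blast
    \<comment> \<open>Growth makes \<open>fst (key (Tmap x))\<close> at least one letter longer than
      the rest path; this pays for \<open>Suc L\<close>.\<close>
    then have "stake (length (snd (rest_path E (key x))) + Suc L) (Tmap x) =
      stake (length (snd (rest_path E (key x))) + Suc L) (Tmap y)"
      by (rule stake_mono) (use 0(4) in \<open>simp add: grows_def\<close>)
    then show ?case by (rule step_back[OF 0(1,2) k(1)])
  next
    case (Suc i)
    have k: "key x = key y" "stake (Suc (i + K)) (keys (Tmap x)) = stake (Suc (i + K)) (keys (Tmap y))"
      using Suc.prems(3) by (subst (asm) (1 2) keys_SCons; simp)+
    have "grows ((Tmap ^^ i) (Tmap x))" using Suc.prems(4) by (simp add: funpow_swap1)
    then have "stake (length (snd (fst (key (Tmap x)))) + Suc L) (Tmap x) =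
      stake (length (snd (fst (key (Tmap x)))) + Suc L) (Tmap y)"
      using Suc.IH k(2) Tmap_infpaths Suc.prems by blast
    then have "stake (length (snd (rest_path E (key x))) + Suc L) (Tmap x) =
      stake (length (snd (rest_path E (key x))) + Suc L) (Tmap y)"
      by (rule stake_mono) (use nn[OF Suc.prems(1)] in simp)
    then show ?case by (rule step_back[OF Suc.prems(1,2) k(1)])
  qed
  \<comment> \<open>One more letter costs up to \<open>card J\<close> keys to reach a growing step,
    one key for that step, and then the \<open>K\<close> keys of the induction hypothesis.\<close>
  have "stake (length (snd (fst (key x))) + Suc L) x = stake (length (snd (fst (key x))) + Suc L) y"
    if xy: "x \<in> infpaths E" "y \<in> infpaths E" "stake (Suc (card J + K)) (keys x) = stake (Suc (card J + K)) (keys y)" for x y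
  proof -
    obtain i where i: "i \<le> card J" "grows ((Tmap ^^ i) x)" using ex_grows[OF nocyc xy(1)] by blast
    have "stake (Suc (i + K)) (keys x) = stake (Suc (i + K)) (keys y)"
      using xy(3) by (rule stake_mono) (use i in simp)
    then show ?thesis by (rule step[OF xy(1,2) _ i(2)])
  qed
  then show ?case by blast
qed

text \<open>A walk with \<open>m\<close> edges visits \<open>m + 1\<close> vertices and each
  contributes a letter, hence \<open>Suc m\<close>.\<close>

lemma word_walk: "path_word E J (key x, walk m x) = stake (Suc m) (itinerary x)"
  by (simp only: path_word_def fst_conv snd_conv walk_verts itinerary_def stake_smap)

text \<open>The delay turns letters of the itinerary into keys, and \<open>keys_separate\<close>
  turns keys into letters of the point itself.\<close>

lemma synchronizing_imp_determined:
  assumes nonneg: "only_nonneg_edges E J" and nocyc: "\<not> has_nonpos_cycle E J"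
    and "left_synchronizing E J"
  shows "determined \<beta>"
proof -
  obtain m where m: "\<And>\<omega>1 \<omega>2. \<omega>1 \<in> paths (coding_graph E J) \<Longrightarrow> \<omega>2 \<in> paths (coding_graph E J) \<Longrightarrow>
     plength \<omega>1 = m \<Longrightarrow> plength \<omega>2 = m \<Longrightarrow> path_word E J \<omega>1 = path_word E J \<omega>2 \<Longrightarrow> psource \<omega>1 = psource \<omega>2"
    using assms(3) unfolding left_synchronizing_def by blast
  obtain K where K: "\<And>x y. x \<in> infpaths E \<Longrightarrow> y \<in> infpaths E \<Longrightarrow> stake K (keys x) = stake K (keys y) \<Longrightarrow>
    stake (length (snd (fst (key x))) + length (snd \<beta>)) x = stake (length (snd (fst (key x))) + length (snd \<beta>)) y"
    using keys_separate[OF nonneg nocyc, of "length (snd \<beta>)"] by blast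
  \<comment> \<open>Each of the first \<open>K\<close> keys is read off from a window of
    \<open>Suc m\<close> letters starting at its own position; \<open>K + Suc m\<close> letters
    cover all these windows.\<close>
  have main: "x \<in> cyl E \<beta> \<longleftrightarrow> y \<in> cyl E \<beta>"
    if x: "x \<in> infpaths E" and y: "y \<in> infpaths E"
      and it: "stake (K + Suc m) (itinerary x) = stake (K + Suc m) (itinerary y)" for x y
  proof -
    have "key ((Tmap ^^ i) x) = key ((Tmap ^^ i) y)" if "i < K" for i
    proof -
      have "stake (i + Suc m) (itinerary x) = stake (i + Suc m) (itinerary y)"
        using it by (rule stake_mono) (use that in simp)
      then have "stake (Suc m) (itinerary ((Tmap ^^ i) x)) = stake (Suc m) (itinerary ((Tmap ^^ i) y))"
        by (metis add_diff_cancel_left' drop_stake sdrop_itinerary)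
      then show ?thesis
        using m[OF walk_path(1)[OF Tmap_pow_infpaths[OF x]] walk_path(1)[OF Tmap_pow_infpaths[OF y]], of i m i m]
        by (simp only: plength_def psource_def word_walk length_walk fst_conv snd_conv)
    qed
    then have "stake K (keys x) = stake K (keys y)"
      by (intro nth_equalityI) (auto simp: snth_keys)
    then have st: "stake (length (snd \<beta>)) x = stake (length (snd \<beta>)) y"
      using K[OF x y] stake_mono by (metis le_add2)
    \<comment> \<open>The cylinder of a path of length 0 is a condition on the source only, which
      \<open>st\<close> does not see; the first letter of the itinerary fixes it.\<close>
    have "stake 1 (itinerary x) = stake 1 (itinerary y)" using it by (rule stake_mono) simp
    then have "src E x = src E y"
      using src_itinerary[OF x] src_itinerary[OF y] by (simp add: src_def)
    then show ?thesis using st x y by (simp add: cyl_def)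
  qed
  then show ?thesis unfolding determined_def by blast
qed

text \<open>Built from the last vertex backwards: a non-negative edge puts
  \<open>cyl E (fst b)\<close> inside the cylinder of the rest path of \<open>a\<close>, so every
  point with key \<open>b\<close> is \<open>Tmap\<close> of a point with key
  \<open>a\<close>.\<close>

lemma realise:
  assumes nonneg: "only_nonneg_edges E J" and "(a, es) \<in> paths (coding_graph E J)"
  shows "\<exists>x\<in>infpaths E. key x = a \<and> walk (length es) x = es"
  using assms(2)
proof (induction es arbitrary: a)
  case Nil
  then have a: "a \<in> J" by (simp add: cg.paths_Nil)
  then obtain x where "x \<in> cyl E (fst a)" using cyl_nonempty J_paths by blast
  then show ?case using key_eq[OF a] cyl_infpaths[of x E "fst a"] by (intro bexI[of _ x]) auto
next
  case (Cons e es)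
  obtain b where e: "e = (a, b)" using Cons.prems by (metis cg.paths_Cons coding_simps(2) prod.collapse)
  have ab: "(a, b) \<in> arcs (coding_graph E J)" "(b, es) \<in> paths (coding_graph E J)"
    using Cons.prems e by auto
  have ab': "a \<in> J" "b \<in> J" "fst (rest_path E a) = fst (fst b)"
    using ab(1) by (auto simp: coding_arcs comparable_def)
  obtain x where x: "x \<in> infpaths E" "key x = b" "walk (length es) x = es" using Cons.IH[OF ab(2)] by blast
  have "prefix (snd (rest_path E a)) (snd (fst b))"
    using nonneg ab(1) degree_nonneg unfolding only_nonneg_edges_def by blast
  then have "cyl E (fst b) \<subseteq> cyl E (rest_path E a)"
    using cyl_prefix_subset[of "snd (rest_path E a)" "snd (fst b)" "fst (fst b)"] ab'
    by (metis prod.collapse)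
  then have "x \<in> cyl E (rest_path E a)" using key(2)[OF x(1)] x(2) by blast
  then obtain z where z: "z \<in> infpaths E" "src E z = prange E (fst a)" "x = snd (rest_path E a) @- z"
    using cyl_iff rest_path[OF ab'(1)] by metis
  have y: "snd (fst a) @- z \<in> cyl E (fst a)" by (rule Vmap_shift(2)[OF ab'(1) z(1,2)])
  have "Tmap (snd (fst a) @- z) = x" using Tmap_rest[OF ab'(1) z(1,2)] z(3) by simp
  then show ?case
    using y key_eq[OF ab'(1) y] x e cyl_infpaths[OF y] by (intro bexI[of _ "snd (fst a) @- z"]) auto
qed

text \<open>\<open>realise\<close> replaces the two paths by orbits. Equal words are then equal
  initial segments of itineraries, and these decide the cylinder of the first key.\<close>

lemma determined_imp_synchronizing:
  assumes nonneg: "only_nonneg_edges E J" and det: "\<forall>\<beta>\<in>paths E. determined \<beta>"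
  shows "left_synchronizing E J"
proof -
  have "\<exists>N. \<forall>x\<in>infpaths E. \<forall>y\<in>infpaths E.
     stake N (itinerary x) = stake N (itinerary y) \<longrightarrow> (x \<in> cyl E (fst j) \<longleftrightarrow> y \<in> cyl E (fst j))" if "j \<in> J" for j
    using det J_paths[OF that] unfolding determined_def by blast
  then obtain N where N: "\<And>j x y. j \<in> J \<Longrightarrow> x \<in> infpaths E \<Longrightarrow> y \<in> infpaths E \<Longrightarrow>
     stake (N j) (itinerary x) = stake (N j) (itinerary y) \<Longrightarrow> x \<in> cyl E (fst j) \<longleftrightarrow> y \<in> cyl E (fst j)"
    by metis
  \<comment> \<open>The sum serves as a common upper bound for the finitely many bounds
    \<open>N j\<close>.\<close>
  define m where "m = sum N J"
  have m: "N j \<le> Suc m" if "j \<in> J" for j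
    using member_le_sum[OF that _ finite_J, of N] by (simp add: m_def le_Suc_eq)
  have "psource \<omega>1 = psource \<omega>2" if w: "\<omega>1 \<in> paths (coding_graph E J)" "\<omega>2 \<in> paths (coding_graph E J)"
    "plength \<omega>1 = m" "plength \<omega>2 = m" "path_word E J \<omega>1 = path_word E J \<omega>2" for \<omega>1 \<omega>2
  proof -
    obtain x where x: "x \<in> infpaths E" "key x = fst \<omega>1" "walk m x = snd \<omega>1"
      using realise[OF nonneg, of "fst \<omega>1" "snd \<omega>1"] w by (auto simp: plength_def)
    obtain y where y: "y \<in> infpaths E" "key y = fst \<omega>2" "walk m y = snd \<omega>2"
      using realise[OF nonneg, of "fst \<omega>2" "snd \<omega>2"] w by (auto simp: plength_def)
    have "stake (Suc m) (itinerary x) = stake (Suc m) (itinerary y)"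
      using w(5) word_walk[of x m] word_walk[of y m] x y by simp
    then have "x \<in> cyl E (fst (key x)) \<longleftrightarrow> y \<in> cyl E (fst (key x))"
      using N[OF key(1)[OF x(1)] x(1) y(1)] stake_mono m[OF key(1)[OF x(1)]] by blast
    then have "key y = key x" using key(2)[OF x(1)] key_eq[OF key(1)[OF x(1)]] by blast
    then show ?thesis using x y by (simp add: psource_def)
  qed
  then show ?thesis unfolding left_synchronizing_def by blast
qed

end

section \<open>Star rings with distinguished generators\<close>

locale graph_star_ring = ring A
  for E :: "('v, 'e) pre_digraph" and A :: "('a, 'v, 'e) graph_alg" (structure) +
  assumes vproj_closed [simp, intro]: "v \<in> verts E \<Longrightarrow> vproj A v \<in> carrier A"
    and eiso_closed [simp, intro]: "e \<in> arcs E \<Longrightarrow> eiso A e \<in> carrier A"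
    and star_closed [simp, intro]: "x \<in> carrier A \<Longrightarrow> star A x \<in> carrier A"
    and star_add: "x \<in> carrier A \<Longrightarrow> y \<in> carrier A \<Longrightarrow> star A (x \<oplus> y) = star A x \<oplus> star A y"
    and star_mult: "x \<in> carrier A \<Longrightarrow> y \<in> carrier A \<Longrightarrow> star A (x \<otimes> y) = star A y \<otimes> star A x"
    and star_star [simp]: "x \<in> carrier A \<Longrightarrow> star A (star A x) = x"
    and star_vproj [simp]: "v \<in> verts E \<Longrightarrow> star A (vproj A v) = vproj A v"
begin

lemma star_zero [simp]: "star A \<zero> = \<zero>"
proof -
  have "star A \<zero> \<oplus> star A \<zero> = star A \<zero>" using star_add[of \<zero> \<zero>] by simp
  then show ?thesis using add.l_cancel_one[of "star A \<zero>" "star A \<zero>"] by simp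
qed

lemma star_one [simp]: "star A \<one> = \<one>"
proof -
  have "star A (star A \<one>) = star A (star A \<one> \<otimes> \<one>)" by simp
  also have "\<dots> = star A \<one> \<otimes> star A (star A \<one>)" by (rule star_mult) auto
  finally show ?thesis by simp
qed

lemma star_uminus: "x \<in> carrier A \<Longrightarrow> star A (\<ominus> x) = \<ominus> star A x"
  by (metis a_inv_closed l_neg minus_equality star_add star_closed star_zero)

lemma star_minus: "x \<in> carrier A \<Longrightarrow> y \<in> carrier A \<Longrightarrow> star A (x \<ominus> y) = star A x \<ominus> star A y"
  by (simp add: minus_eq star_add star_uminus)

lemma star_finsum:
  "f \<in> S \<rightarrow> carrier A \<Longrightarrow> star A (finsum A f S) = finsum A (\<lambda>x. star A (f x)) S"
proof (induction S rule: infinite_finite_induct)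
  case (insert x S)
  then have "f \<in> S \<rightarrow> carrier A" "f x \<in> carrier A" by auto
  then show ?case using insert by (subst finsum_insert; (subst finsum_insert)?) (auto simp: star_add)
qed (simp_all add: finsum_infinite)

end

text \<open>The generators of the target may be chosen freely. An endomorphism sending
  \<open>S_e\<close> to \<open>u S_e\<close> is thus a member for the target \<open>twisted\<close>,
  the same ring with other generators.\<close>

definition graph_hom ::
  "('v, 'e) pre_digraph \<Rightarrow> ('a, 'v, 'e) graph_alg \<Rightarrow> ('b, 'v, 'e) graph_alg \<Rightarrow> ('a \<Rightarrow> 'b) set" where
  "graph_hom E A B = {h \<in> ring_hom A B. (\<forall>x\<in>carrier A. h (star A x) = star B (h x))
     \<and> (\<forall>v\<in>verts E. h (vproj A v) = vproj B v) \<and> (\<forall>e\<in>arcs E. h (eiso A e) = eiso B e)}"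

lemma ring_hom_finsum:
  assumes "ring A" "ring B" "h \<in> ring_hom A B" "f \<in> S \<rightarrow> carrier A"
  shows "h (finsum A f S) = finsum B (\<lambda>x. h (f x)) S"
proof -
  interpret A: ring A by fact
  interpret B: ring B by fact
  interpret ring_hom_ring A B h using assms(3) by (unfold_locales) auto
  show ?thesis using assms(4)
  proof (induction S rule: infinite_finite_induct)
    case (insert x S)
    then have "f \<in> S \<rightarrow> carrier A" "f x \<in> carrier A" by auto
    then show ?case using insert
      by (subst A.finsum_insert; (subst B.finsum_insert)?) (auto intro!: hom_closed)
  qed (simp_all add: A.finsum_infinite B.finsum_infinite)
qed

text \<open>Stated for an arbitrary set \<open>X\<close>, so that it covers vanishing, membership in
  an ideal, and preimages under homomorphisms.\<close>

lemma leavitt_rels_subset: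
  "leavitt_rels A E \<subseteq> X \<longleftrightarrow>
    \<one>\<^bsub>A\<^esub> \<ominus>\<^bsub>A\<^esub> (\<Oplus>\<^bsub>A\<^esub>v\<in>verts E. vproj A v) \<in> X
  \<and> (\<forall>v\<in>verts E. vproj A v \<otimes>\<^bsub>A\<^esub> vproj A v \<ominus>\<^bsub>A\<^esub> vproj A v \<in> X)
  \<and> (\<forall>v\<in>verts E. \<forall>w\<in>verts E. v \<noteq> w \<longrightarrow> vproj A v \<otimes>\<^bsub>A\<^esub> vproj A w \<in> X)
  \<and> (\<forall>e\<in>arcs E. \<forall>f\<in>arcs E. e \<noteq> f \<longrightarrow> star A (eiso A e) \<otimes>\<^bsub>A\<^esub> eiso A f \<in> X)
  \<and> (\<forall>e\<in>arcs E. star A (eiso A e) \<otimes>\<^bsub>A\<^esub> eiso A e \<ominus>\<^bsub>A\<^esub> vproj A (head E e) \<in> X)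
  \<and> (\<forall>e\<in>arcs E. vproj A (tail E e) \<otimes>\<^bsub>A\<^esub> eiso A e \<ominus>\<^bsub>A\<^esub> eiso A e \<in> X)
  \<and> (\<forall>e\<in>arcs E. eiso A e \<otimes>\<^bsub>A\<^esub> vproj A (head E e) \<ominus>\<^bsub>A\<^esub> eiso A e \<in> X)
  \<and> (\<forall>e\<in>arcs E. star A (eiso A e) \<otimes>\<^bsub>A\<^esub> vproj A (tail E e) \<ominus>\<^bsub>A\<^esub> star A (eiso A e) \<in> X)
  \<and> (\<forall>e\<in>arcs E. vproj A (head E e) \<otimes>\<^bsub>A\<^esub> star A (eiso A e) \<ominus>\<^bsub>A\<^esub> star A (eiso A e) \<in> X)
  \<and> (\<forall>v\<in>verts E. vproj A v \<ominus>\<^bsub>A\<^esub> (\<Oplus>\<^bsub>A\<^esub>e\<in>out_arcs E v. eiso A e \<otimes>\<^bsub>A\<^esub> star A (eiso A e)) \<in> X)"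
  unfolding leavitt_rels_def Let_def Un_subset_iff conj_assoc by (intro conj_cong; blast)

lemma ck_rels_subset:
  "ck_rels A E \<subseteq> X \<longleftrightarrow>
    \<one>\<^bsub>A\<^esub> \<ominus>\<^bsub>A\<^esub> (\<Oplus>\<^bsub>A\<^esub>v\<in>verts E. vproj A v) \<in> X
  \<and> (\<forall>v\<in>verts E. vproj A v \<otimes>\<^bsub>A\<^esub> vproj A v \<ominus>\<^bsub>A\<^esub> vproj A v \<in> X)
  \<and> (\<forall>v\<in>verts E. \<forall>w\<in>verts E. v \<noteq> w \<longrightarrow> vproj A v \<otimes>\<^bsub>A\<^esub> vproj A w \<in> X)
  \<and> (\<forall>e\<in>arcs E. eiso A e \<otimes>\<^bsub>A\<^esub> star A (eiso A e) \<otimes>\<^bsub>A\<^esub> eiso A e \<ominus>\<^bsub>A\<^esub> eiso A e \<in> X)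
  \<and> (\<forall>e\<in>arcs E. star A (eiso A e) \<otimes>\<^bsub>A\<^esub> eiso A e \<ominus>\<^bsub>A\<^esub> vproj A (head E e) \<in> X)
  \<and> (\<forall>v\<in>verts E. vproj A v \<ominus>\<^bsub>A\<^esub> (\<Oplus>\<^bsub>A\<^esub>e\<in>out_arcs E v. eiso A e \<otimes>\<^bsub>A\<^esub> star A (eiso A e)) \<in> X)"
  unfolding ck_rels_def Let_def Un_subset_iff conj_assoc by (intro conj_cong; blast)

section \<open>Path elements and their images under homomorphisms\<close>

context wf_digraph
begin

lemma foldr_closed:
  assumes "graph_star_ring G A"
  shows "set es \<subseteq> arcs G \<Longrightarrow> foldr (\<lambda>e x. eiso A e \<otimes>\<^bsub>A\<^esub> x) es \<one>\<^bsub>A\<^esub> \<in> carrier A"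
proof (induction es)
  case Nil
  interpret graph_star_ring G A by fact
  show ?case by simp
next
  case (Cons e es)
  interpret graph_star_ring G A by fact
  show ?case using Cons by simp
qed

lemma path_elt_closed:
  assumes "graph_star_ring G A" "\<mu> \<in> paths G"
  shows "path_elt A \<mu> \<in> carrier A"
proof -
  interpret graph_star_ring G A by fact
  obtain v es where m: "\<mu> = (v, es)" by fastforce
  show ?thesis
    using foldr_closed[OF assms(1), of es] paths_arcs[of v es] assms(2) paths_source[of v es]
    unfolding m by (auto simp: path_elt_def)
qed

lemma path_proj_closed:
  assumes "graph_star_ring G A" "\<mu> \<in> paths G"
  shows "path_proj A \<mu> \<in> carrier A"
proof -
  interpret graph_star_ring G A by fact
  show ?thesis using path_elt_closed[OF assms] by (simp add: path_proj_def)
qed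

lemma pair_sum_term_closed:
  assumes "graph_star_ring G A" "J \<subseteq> paths G \<times> paths G"
  shows "(\<lambda>(\<mu>, \<nu>). path_elt A \<mu> \<otimes>\<^bsub>A\<^esub> star A (path_elt A \<nu>)) \<in> J \<rightarrow> carrier A"
proof -
  interpret graph_star_ring G A by fact
  show ?thesis using path_elt_closed[OF assms(1)] assms(2) by auto
qed

lemma pair_sum_closed:
  assumes "graph_star_ring G A" "J \<subseteq> paths G \<times> paths G"
  shows "pair_sum A J \<in> carrier A"
proof -
  interpret graph_star_ring G A by fact
  show ?thesis unfolding pair_sum_def using pair_sum_term_closed[OF assms] by (rule finsum_closed)
qed

end

locale graph_hom_ctx = wf_digraph E + A: graph_star_ring E A + B: graph_star_ring E B
  for E :: "('v, 'e) pre_digraph" and A :: "('a, 'v, 'e) graph_alg" and B :: "('b, 'v, 'e) graph_alg" +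
  fixes h assumes graph_hom: "h \<in> graph_hom E A B"
begin

sublocale ring_hom_ring A B h
  using graph_hom by unfold_locales (auto simp: graph_hom_def)

lemma hom_star: "x \<in> carrier A \<Longrightarrow> h (star A x) = star B (h x)"
  and hom_vproj: "v \<in> verts E \<Longrightarrow> h (vproj A v) = vproj B v"
  and hom_eiso: "e \<in> arcs E \<Longrightarrow> h (eiso A e) = eiso B e"
  using graph_hom by (auto simp: graph_hom_def)

lemma hom_minus: "x \<in> carrier A \<Longrightarrow> y \<in> carrier A \<Longrightarrow> h (x \<ominus>\<^bsub>A\<^esub> y) = h x \<ominus>\<^bsub>B\<^esub> h y"
  by (simp add: a_minus_def)

lemma hom_finsum: "f \<in> S \<rightarrow> carrier A \<Longrightarrow> h (finsum A f S) = finsum B (\<lambda>x. h (f x)) S"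
  by (rule ring_hom_finsum) (auto simp: A.ring_axioms B.ring_axioms homh)

lemma hom_foldr:
  "set es \<subseteq> arcs E \<Longrightarrow>
   h (foldr (\<lambda>e x. eiso A e \<otimes>\<^bsub>A\<^esub> x) es \<one>\<^bsub>A\<^esub>) = foldr (\<lambda>e x. eiso B e \<otimes>\<^bsub>B\<^esub> x) es \<one>\<^bsub>B\<^esub>"
proof (induction es)
  case (Cons e es)
  then show ?case using foldr_closed[OF A.graph_star_ring_axioms, of es] by (simp add: hom_eiso)
qed simp

lemma hom_path_elt: "\<mu> \<in> paths E \<Longrightarrow> h (path_elt A \<mu>) = path_elt B \<mu>"
  using hom_foldr[of "snd \<mu>"] paths_arcs[of "fst \<mu>" "snd \<mu>"] paths_source[of "fst \<mu>" "snd \<mu>"]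
  by (simp add: path_elt_def hom_vproj)

lemma hom_path_proj: "\<mu> \<in> paths E \<Longrightarrow> h (path_proj A \<mu>) = path_proj B \<mu>"
  using path_elt_closed[OF A.graph_star_ring_axioms] by (simp add: path_proj_def hom_path_elt hom_star)

lemma hom_pair_sum:
  assumes "J \<subseteq> paths E \<times> paths E"
  shows "h (pair_sum A J) = pair_sum B J"
proof -
  have "h (pair_sum A J) = finsum B (\<lambda>x. h ((\<lambda>(\<mu>, \<nu>). path_elt A \<mu> \<otimes>\<^bsub>A\<^esub> star A (path_elt A \<nu>)) x)) J"
    unfolding pair_sum_def using pair_sum_term_closed[OF A.graph_star_ring_axioms assms] by (rule hom_finsum)
  also have "\<dots> = pair_sum B J"
    unfolding pair_sum_def
  proof (rule B.finsum_cong')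
    fix j assume "j \<in> J"
    then obtain \<mu> \<nu> where j: "j = (\<mu>, \<nu>)" "\<mu> \<in> paths E" "\<nu> \<in> paths E" using assms by auto
    then show "h ((\<lambda>(\<mu>, \<nu>). path_elt A \<mu> \<otimes>\<^bsub>A\<^esub> star A (path_elt A \<nu>)) j) =
        (\<lambda>(\<mu>, \<nu>). path_elt B \<mu> \<otimes>\<^bsub>B\<^esub> star B (path_elt B \<nu>)) j"
      using path_elt_closed[OF A.graph_star_ring_axioms] by (simp add: hom_path_elt hom_star)
  qed (use pair_sum_term_closed[OF B.graph_star_ring_axioms assms] in auto)
  finally show ?thesis .
qed

lemma hom_sum_vproj: "h (\<Oplus>\<^bsub>A\<^esub>v\<in>verts E. vproj A v) = (\<Oplus>\<^bsub>B\<^esub>v\<in>verts E. vproj B v)"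
proof -
  have "h (\<Oplus>\<^bsub>A\<^esub>v\<in>verts E. vproj A v) = (\<Oplus>\<^bsub>B\<^esub>v\<in>verts E. h (vproj A v))"
    by (rule hom_finsum) auto
  also have "\<dots> = (\<Oplus>\<^bsub>B\<^esub>v\<in>verts E. vproj B v)"
    by (rule B.finsum_cong') (auto simp: hom_vproj)
  finally show ?thesis .
qed

lemma hom_sum_eiso:
  "h (\<Oplus>\<^bsub>A\<^esub>e\<in>out_arcs E v. eiso A e \<otimes>\<^bsub>A\<^esub> star A (eiso A e)) =
    (\<Oplus>\<^bsub>B\<^esub>e\<in>out_arcs E v. eiso B e \<otimes>\<^bsub>B\<^esub> star B (eiso B e))"
proof -
  have "h (\<Oplus>\<^bsub>A\<^esub>e\<in>out_arcs E v. eiso A e \<otimes>\<^bsub>A\<^esub> star A (eiso A e)) =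
      (\<Oplus>\<^bsub>B\<^esub>e\<in>out_arcs E v. h (eiso A e \<otimes>\<^bsub>A\<^esub> star A (eiso A e)))"
    by (rule hom_finsum) auto
  also have "\<dots> = (\<Oplus>\<^bsub>B\<^esub>e\<in>out_arcs E v. eiso B e \<otimes>\<^bsub>B\<^esub> star B (eiso B e))"
    by (rule B.finsum_cong') (auto simp: hom_eiso hom_star)
  finally show ?thesis .
qed

lemma hom_ck_rels: "x \<in> ck_rels A E \<Longrightarrow> h x \<in> ck_rels B E"
proof -
  have B: "ck_rels B E \<subseteq> ck_rels B E" ..
  have "ck_rels A E \<subseteq> {x. h x \<in> ck_rels B E}"
    unfolding ck_rels_subset mem_Collect_eq using B[unfolded ck_rels_subset[of B E "ck_rels B E"]]
    by (auto simp: hom_minus hom_star hom_vproj hom_eiso hom_sum_vproj hom_sum_eiso A.finsum_closed)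
  then show "x \<in> ck_rels A E \<Longrightarrow> h x \<in> ck_rels B E" by blast
qed

end

section \<open>The free star-algebra\<close>

definition conv :: "('g list \<Rightarrow> 'k::comm_ring_1) \<Rightarrow> ('g list \<Rightarrow> 'k) \<Rightarrow> 'g list \<Rightarrow> 'k" where
  "conv f g = (\<lambda>w. \<Sum>i\<le>length w. f (take i w) * g (drop i w))"

definition const :: "'k::comm_ring_1 \<Rightarrow> 'g list \<Rightarrow> 'k" where
  "const c = (\<lambda>w. if w = [] then c else 0)"

definition delta :: "'g list \<Rightarrow> 'g list \<Rightarrow> 'k::comm_ring_1" where
  "delta v = (\<lambda>w. if w = v then 1 else 0)"

text \<open>Linear extension of a family \<open>m\<close> indexed by words. It serves both for
  substitution of generators, where \<open>m w\<close> is again a polynomial, and for operators,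
  where \<open>m w\<close> is a function on paths.\<close>

definition lext :: "('g list \<Rightarrow> 'k::comm_ring_1) \<Rightarrow> ('g list \<Rightarrow> 'y \<Rightarrow> 'k) \<Rightarrow> 'y \<Rightarrow> 'k" where
  "lext f m y = (\<Sum>w | f w \<noteq> 0. f w * m w y)"

lemma lext_superset:
  assumes "finite S" "{w. f w \<noteq> 0} \<subseteq> S"
  shows "lext f m y = (\<Sum>w\<in>S. f w * m w y)"
  unfolding lext_def using assms by (intro sum.mono_neutral_left) auto

lemma lext_add:
  assumes "finite {w. f w \<noteq> 0}" "finite {w. g w \<noteq> 0}"
  shows "lext (\<lambda>w. f w + g w) m y = lext f m y + lext g m y"
proof -
  let ?S = "{w. f w \<noteq> 0} \<union> {w. g w \<noteq> 0}"
  have "finite ?S" using assms by simp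
  then show ?thesis
    by (subst (1 2 3) lext_superset[of ?S]) (auto simp: sum.distrib distrib_right)
qed

lemma lext_scale: "finite {w. f w \<noteq> 0} \<Longrightarrow> lext (\<lambda>w. c * f w) m y = c * lext f m y"
  by (subst (1 2) lext_superset[of "{w. f w \<noteq> 0}"]) (auto simp: sum_distrib_left mult.assoc)

lemma lext_delta: "lext (delta v) m y = m v y"
  by (subst lext_superset[of "{v}"]) (auto simp: delta_def)

lemma conv_splits: "conv f g w = (\<Sum>(u, v) | u @ v = w. f u * g v)"
  unfolding conv_def
  by (rule sum.reindex_bij_witness[where i = "\<lambda>(u, v). length u" and j = "\<lambda>i. (take i w, drop i w)"]) auto

lemma finite_splits: "finite {(u, v). u @ v = w}"
proof -
  have "p \<in> (\<lambda>i. (take i w, drop i w)) ` {..length w}" if "fst p @ snd p = w" for p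
    using that by (intro image_eqI[of _ _ "length (fst p)"]) auto
  then have "{(u, v). u @ v = w} \<subseteq> (\<lambda>i. (take i w, drop i w)) ` {..length w}" by force
  then show ?thesis using finite_subset by blast
qed

lemma conv_support:
  assumes "finite A" "finite B" "{w. f w \<noteq> 0} \<subseteq> A" "{w. g w \<noteq> 0} \<subseteq> B"
  shows "conv f g w = (\<Sum>(u, v)\<in>{p \<in> A \<times> B. fst p @ snd p = w}. f u * g v)"
  unfolding conv_splits
  by (rule sum.mono_neutral_right[OF finite_splits]) (use assms in fastforce)+

lemma conv_nonzero: "conv f g w \<noteq> 0 \<Longrightarrow> \<exists>u v. w = u @ v \<and> f u \<noteq> 0 \<and> g v \<noteq> 0"
proof (rule ccontr)
  assume n: "\<not> (\<exists>u v. w = u @ v \<and> f u \<noteq> 0 \<and> g v \<noteq> 0)" and "conv f g w \<noteq> 0"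
  have "conv f g w = 0" unfolding conv_splits by (rule sum.neutral) (use n in force)
  then show False using \<open>conv f g w \<noteq> 0\<close> by simp
qed

lemma conv_finite:
  assumes "finite {w. f w \<noteq> 0}" "finite {w. g w \<noteq> 0}"
  shows "finite {w. conv f g w \<noteq> 0}"
proof (rule finite_subset)
  show "{w. conv f g w \<noteq> 0} \<subseteq> (\<lambda>(u, v). u @ v) ` ({w. f w \<noteq> 0} \<times> {w. g w \<noteq> 0})"
    using conv_nonzero by fastforce
qed (use assms in simp)

text \<open>Reduces multiplicativity of a linear extension to a statement about concatenated words;
  both the substitution and the representation rely on it.\<close>

lemma lext_conv:
  assumes "finite {w. f w \<noteq> 0}" "finite {w. g w \<noteq> 0}"
  shows "lext (conv f g) m y = (\<Sum>u | f u \<noteq> 0. \<Sum>v | g v \<noteq> 0. f u * g v * m (u @ v) y)"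
proof -
  let ?P = "{w. f w \<noteq> 0} \<times> {w. g w \<noteq> 0}" and ?c = "\<lambda>p. fst p @ snd p"
  have fin: "finite ?P" using assms by simp
  have "{w. conv f g w \<noteq> 0} \<subseteq> ?c ` ?P" using conv_nonzero by (fastforce simp: image_iff)
  then have "lext (conv f g) m y = (\<Sum>w\<in>?c ` ?P. conv f g w * m w y)"
    using fin by (intro lext_superset) auto
  also have "\<dots> = (\<Sum>w\<in>?c ` ?P. \<Sum>p\<in>{p \<in> ?P. ?c p = w}. f (fst p) * g (snd p) * m (?c p) y)"
    by (intro sum.cong refl) (subst conv_support[OF assms subset_refl subset_refl],
      auto simp: sum_distrib_right case_prod_unfold intro!: sum.cong)
  also have "\<dots> = (\<Sum>p\<in>?P. f (fst p) * g (snd p) * m (?c p) y)"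
    by (rule sum.image_gen[OF fin, symmetric])
  also have "\<dots> = (\<Sum>u | f u \<noteq> 0. \<Sum>v | g v \<noteq> 0. f u * g v * m (u @ v) y)"
    by (simp add: sum.cartesian_product case_prod_unfold)
  finally show ?thesis .
qed

lemma conv_assoc: "conv (conv f g) h = conv f (conv g h)"
proof
  fix w
  have "conv (conv f g) h w = (\<Sum>(i, j)\<in>Sigma {..length w} (\<lambda>i. {..i}).
      f (take j w) * g (take (i - j) (drop j w)) * h (drop i w))"
    unfolding conv_def
    by (subst sum.Sigma[symmetric]) (auto simp: sum_distrib_right min_def drop_take intro!: sum.cong)
  \<comment> \<open>Both sums cut the word twice. The first cuts off \<open>i\<close> letters and
    splits these at \<open>j\<close>; the second cuts off \<open>j\<close> letters and then
    \<open>k = i - j\<close> more.\<close>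
  also have "\<dots> = (\<Sum>(j, k)\<in>Sigma {..length w} (\<lambda>j. {..length w - j}).
      f (take j w) * (g (take k (drop j w)) * h (drop (k + j) w)))"
    by (rule sum.reindex_bij_witness[where i = "\<lambda>(j, k). (k + j, j)" and j = "\<lambda>(i, j). (j, i - j)"])
      (auto simp: mult.assoc)
  also have "\<dots> = conv f (conv g h) w"
    unfolding conv_def
    by (subst sum.Sigma[symmetric]) (auto simp: sum_distrib_left intro!: sum.cong)
  finally show "conv (conv f g) h w = conv f (conv g h) w" .
qed

lemma conv_const_left: "conv (const c) f = (\<lambda>w. c * f w)"
proof
  fix w
  have "conv (const c) f w = (\<Sum>i\<in>{0}. const c (take i w) * f (drop i w))"
    unfolding conv_def by (rule sum.mono_neutral_right) (auto simp: const_def)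
  then show "conv (const c) f w = c * f w" by (simp add: const_def)
qed

lemma conv_const_right: "conv f (const c) = (\<lambda>w. c * f w)"
proof
  fix w
  have "conv f (const c) w = (\<Sum>i\<in>{length w}. f (take i w) * const c (drop i w))"
    unfolding conv_def by (rule sum.mono_neutral_right) (auto simp: const_def)
  then show "conv f (const c) w = c * f w" by (simp add: const_def mult.commute)
qed

lemma conv_delta: "conv (delta u) (delta v) = delta (u @ v)"
proof
  fix w
  have "conv (delta u :: 'a list \<Rightarrow> 'b) (delta v) w =
      (\<Sum>(u', v')\<in>{p \<in> {u} \<times> {v}. fst p @ snd p = w}. delta u u' * delta v v')"
    by (rule conv_support) (auto simp: delta_def)
  also have "{p \<in> {u} \<times> {v}. fst p @ snd p = w} = (if w = u @ v then {(u, v)} else {})"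
    by auto
  finally show "conv (delta u :: 'a list \<Rightarrow> 'b) (delta v) w = delta (u @ v) w"
    by (simp add: delta_def)
qed

lemma conv_add_left: "conv (\<lambda>w. f w + g w) h = (\<lambda>w. conv f h w + conv g h w)"
  and conv_add_right: "conv h (\<lambda>w. f w + g w) = (\<lambda>w. conv h f w + conv h g w)"
  by (auto simp: conv_def distrib_right distrib_left sum.distrib)

lemma free_simps [simp]:
  "mult (free_alg bar E) = conv"
  "one (free_alg bar E) = const 1"
  "zero (free_alg bar E) = (\<lambda>w. 0)"
  "add (free_alg bar E) = (\<lambda>f g w. f w + g w)"
  "star (free_alg bar E) f = (\<lambda>w. bar (f (rev (map gen_star w))))"
  "vproj (free_alg bar E) v = delta [GP v]"
  "eiso (free_alg bar E) e = delta [GS e]"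
  by (simp_all add: free_alg_def conv_def[abs_def] const_def delta_def)

lemma free_carrier: "f \<in> carrier (free_alg bar E) \<longleftrightarrow>
    finite {w. f w \<noteq> 0} \<and> (\<forall>w. f w \<noteq> 0 \<longrightarrow> set w \<subseteq> gens E)"
  by (simp add: free_alg_def)

lemma free_finite: "f \<in> carrier (free_alg bar E) \<Longrightarrow> finite {w. f w \<noteq> 0}"
  by (simp add: free_carrier)

lemma const_carrier [simp]: "const c \<in> carrier (free_alg bar E)"
  by (auto simp: free_carrier const_def)

lemma delta_carrier: "set w \<subseteq> gens E \<Longrightarrow> delta w \<in> carrier (free_alg bar E)"
  by (auto simp: free_carrier delta_def)

lemma gen_star_gen_star [simp]: "gen_star (gen_star g) = g"
  by (cases g) auto

lemma gen_star_gens [simp]: "gen_star g \<in> gens E \<longleftrightarrow> g \<in> gens E"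
  by (cases g) (auto simp: gens_def)

lemma free_ring: "ring (free_alg bar (E :: ('v, 'e) pre_digraph) ::
    (('v, 'e) gen list \<Rightarrow> 'k::comm_ring_1, 'v, 'e) graph_alg)"
proof (rule ringI)
  let ?F = "free_alg bar E :: (('v, 'e) gen list \<Rightarrow> 'k, 'v, 'e) graph_alg"
  have add: "(\<lambda>w. x w + y w) \<in> carrier ?F" if "x \<in> carrier ?F" "y \<in> carrier ?F" for x y
  proof -
    have "{w. x w + y w \<noteq> 0} \<subseteq> {w. x w \<noteq> 0} \<union> {w. y w \<noteq> 0}" by auto
    then have "finite {w. x w + y w \<noteq> 0}"
      by (rule finite_subset) (use that in \<open>simp add: free_carrier\<close>)
    moreover have "set w \<subseteq> gens E" if "x w + y w \<noteq> 0" for w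
      using that \<open>x \<in> _\<close> \<open>y \<in> _\<close> unfolding free_carrier by (cases "x w = 0") auto
    ultimately show ?thesis unfolding free_carrier by blast
  qed
  have neg: "\<exists>y\<in>carrier ?F. y \<oplus>\<^bsub>?F\<^esub> x = \<zero>\<^bsub>?F\<^esub>" if "x \<in> carrier ?F" for x
    using that by (intro bexI[of _ "\<lambda>w. - x w"]) (auto simp: free_carrier)
  show "abelian_group ?F"
  proof (rule abelian_groupI)
    show "x \<oplus>\<^bsub>?F\<^esub> y \<in> carrier ?F" if "x \<in> carrier ?F" "y \<in> carrier ?F" for x y
      using add[OF that] by simp
    show "\<zero>\<^bsub>?F\<^esub> \<in> carrier ?F" by (simp add: free_carrier)
    show "\<exists>y\<in>carrier ?F. y \<oplus>\<^bsub>?F\<^esub> x = \<zero>\<^bsub>?F\<^esub>" if "x \<in> carrier ?F" for x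
      by (rule neg[OF that])
  qed (simp_all add: ac_simps)
  have mult: "conv x y \<in> carrier ?F" if "x \<in> carrier ?F" "y \<in> carrier ?F" for x y
    using that conv_finite[of x y] conv_nonzero[of x y] unfolding free_carrier by fastforce
  show "monoid ?F"
    by (rule monoidI) (simp_all add: mult conv_assoc conv_const_left conv_const_right)
qed (auto simp: conv_add_left conv_add_right)

lemma free_uminus:
  assumes "f \<in> carrier (free_alg bar E)"
  shows "\<ominus>\<^bsub>free_alg bar E\<^esub> f = (\<lambda>w. - f w)"
proof -
  interpret ring "free_alg bar E" by (rule free_ring)
  have "(\<lambda>w. - f w) \<in> carrier (free_alg bar E)" using assms by (simp add: free_carrier)
  then show ?thesis using minus_equality[of "\<lambda>w. - f w" f] assms by simp
qed

lemma free_minus: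
  assumes "f \<in> carrier (free_alg bar E)" "g \<in> carrier (free_alg bar E)"
  shows "f \<ominus>\<^bsub>free_alg bar E\<^esub> g = (\<lambda>w. f w - g w)"
  using assms by (simp add: a_minus_def free_uminus)

lemma free_finsum:
  assumes "finite S" "f \<in> S \<rightarrow> carrier (free_alg bar E)"
  shows "finsum (free_alg bar E) f S = (\<lambda>w. \<Sum>s\<in>S. f s w)"
  using assms
proof (induction S rule: finite_induct)
  case empty
  interpret ring "free_alg bar E :: (('b, 'c) gen list \<Rightarrow> 'd, 'b, 'c) graph_alg" by (rule free_ring)
  show ?case by simp
next
  case (insert s S)
  interpret ring "free_alg bar E :: (('b, 'c) gen list \<Rightarrow> 'd, 'b, 'c) graph_alg" by (rule free_ring)
  show ?case using insert by (subst finsum_insert) (auto simp: Pi_iff)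
qed

text \<open>Arbitrary constants form a base case, so the rule holds over any coefficient ring;
  integer constants are treated by a further induction where this case arises.\<close>

lemma free_induct [consumes 1, case_names const delta add mult]:
  assumes f: "f \<in> carrier (free_alg bar E)"
    and const: "\<And>c. P (const c)"
    and delta: "\<And>g. g \<in> gens E \<Longrightarrow> P (delta [g])"
    and add: "\<And>f g. f \<in> carrier (free_alg bar E) \<Longrightarrow> g \<in> carrier (free_alg bar E) \<Longrightarrow> P f \<Longrightarrow> P g \<Longrightarrow>
      P (\<lambda>w. f w + g w)"
    and mult: "\<And>f g. f \<in> carrier (free_alg bar E) \<Longrightarrow> g \<in> carrier (free_alg bar E) \<Longrightarrow> P f \<Longrightarrow> P g \<Longrightarrow>
      P (conv f g)"
  shows "P f"
proof -
  have dw: "P (delta w)" if "set w \<subseteq> gens E" for w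
    using that
  proof (induction w)
    case Nil
    have "delta [] = const 1" by (auto simp: delta_def const_def)
    then show ?case using const by metis
  next
    case (Cons g w)
    then have "P (conv (delta [g]) (delta w))" by (intro mult delta delta_carrier) auto
    then show ?case by (simp add: conv_delta)
  qed
  have "finite {w. f w \<noteq> 0}" using f by (simp add: free_carrier)
  then show ?thesis using f
  proof (induction "{w. f w \<noteq> 0}" arbitrary: f rule: finite_induct)
    case empty
    then have "f = const 0" by (auto simp: const_def)
    then show ?case using const by simp
  next
    case (insert v S)
    \<comment> \<open>Induction on the support: \<open>f\<close> splits into its monomial at the
      word \<open>v\<close> and the remainder \<open>g\<close>.\<close>
    define g where "g = f(v := 0)"
    have v: "f v \<noteq> 0" using insert by auto
    have S: "S = {w. g w \<noteq> 0}" using insert by (auto simp: g_def)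
    have g: "g \<in> carrier (free_alg bar E)"
      unfolding free_carrier
    proof (intro conjI allI impI)
      show "finite {w. g w \<noteq> 0}" using S insert(1) by simp
      show "set w \<subseteq> gens E" if "g w \<noteq> 0" for w
      proof -
        have "f w \<noteq> 0" using that by (auto simp: g_def split: if_splits)
        then show ?thesis using insert.prems by (auto simp: free_carrier)
      qed
    qed
    have gv: "set v \<subseteq> gens E" using v insert.prems by (simp add: free_carrier)
    have "P (\<lambda>w. g w + conv (const (f v)) (delta v) w)"
    proof (rule add[OF g _ insert.hyps(3)[OF S g]])
      interpret ring "free_alg bar E :: (('a, 'b) gen list \<Rightarrow> 'c, 'a, 'b) graph_alg" by (rule free_ring)
      show "conv (const (f v)) (delta v) \<in> carrier (free_alg bar E)"
        using m_closed[OF const_carrier delta_carrier[OF gv]] by simp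
      show "P (conv (const (f v)) (delta v))" by (intro mult const dw gv const_carrier delta_carrier)
    qed
    moreover have "(\<lambda>w. g w + conv (const (f v)) (delta v) w) = f"
      by (auto simp: g_def conv_const_left delta_def)
    ultimately show ?case by simp
  qed
qed

text \<open>The instances are the integers with \<open>id\<close> and the complex numbers with
  \<open>cnj\<close>.\<close>

locale conjugation =
  fixes bar :: "'k::comm_ring_1 \<Rightarrow> 'k"
  assumes bar_add: "bar (a + b) = bar a + bar b"
    and bar_mult: "bar (a * b) = bar a * bar b"
    and bar_one [simp]: "bar 1 = 1"
    and bar_bar [simp]: "bar (bar a) = a"
begin

lemma bar_zero [simp]: "bar 0 = 0"
  using bar_add[of 0 0] by simp

lemma bar_sum: "bar (sum f S) = (\<Sum>x\<in>S. bar (f x))"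
  by (induction S rule: infinite_finite_induct) (auto simp: bar_add)

lemma bar_eq_0 [simp]: "bar a = 0 \<longleftrightarrow> a = 0"
  by (metis bar_bar bar_zero)

text \<open>Reversal turns a cut after \<open>i\<close> letters into a cut after
  \<open>length w - i\<close>, which exchanges the two factors.\<close>

lemma star_conv:
  "star (free_alg bar E) (conv f g) = conv (star (free_alg bar E) g) (star (free_alg bar E) f)"
proof
  fix w :: "('a, 'b) gen list"
  let ?s = "\<lambda>w :: ('a, 'b) gen list. rev (map gen_star w)"
  have "star (free_alg bar E) (conv f g) w = (\<Sum>i\<le>length w. bar (f (take i (?s w))) * bar (g (drop i (?s w))))"
    by (simp add: conv_def bar_sum bar_mult)
  also have "\<dots> = (\<Sum>i\<le>length w. bar (g (?s (take i w))) * bar (f (?s (drop i w))))"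
    by (rule sum.reindex_bij_witness[where i = "\<lambda>i. length w - i" and j = "\<lambda>i. length w - i"])
      (auto simp: take_rev drop_rev take_map drop_map mult.commute)
  finally show "star (free_alg bar E) (conv f g) w =
      conv (star (free_alg bar E) g) (star (free_alg bar E) f) w"
    by (simp add: conv_def)
qed

lemma map_gen_star [simp]: "map gen_star (map gen_star w) = w"
  by (simp add: comp_def)

lemma star_delta: "star (free_alg bar E) (delta w) = delta (rev (map gen_star w))"
proof -
  have "rev (map gen_star u) = w \<longleftrightarrow> u = rev (map gen_star w)" for u :: "('a, 'b) gen list"
    by (metis map_gen_star rev_map rev_rev_ident)
  then show ?thesis by (auto simp: delta_def)
qed

lemma star_const: "star (free_alg bar E) (const c) = const (bar c)"
  by (auto simp: const_def)

lemma free_graph_star_ring: "graph_star_ring E (free_alg bar E)"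
proof -
  interpret ring "free_alg bar E" by (rule free_ring)
  have inv: "rev (map gen_star (rev (map gen_star w))) = w" for w :: "('a, 'b) gen list"
    by (simp add: rev_map comp_def)
  show ?thesis
  proof unfold_locales
    fix f :: "('a, 'b) gen list \<Rightarrow> 'k" assume f: "f \<in> carrier (free_alg bar E)"
    have "{w. f (rev (map gen_star w)) \<noteq> 0} = (\<lambda>w. rev (map gen_star w)) ` {w. f w \<noteq> 0}"
      using inv by (auto simp: image_iff) metis
    moreover have "set w \<subseteq> gens E" if "f (rev (map gen_star w)) \<noteq> 0" for w
      using f that unfolding free_carrier by force
    ultimately show "star (free_alg bar E) f \<in> carrier (free_alg bar E)"
      using f by (simp add: free_carrier)
    show "star (free_alg bar E) (star (free_alg bar E) f) = f" by (simp add: rev_map comp_def)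
  next
    fix f g :: "('a, 'b) gen list \<Rightarrow> 'k"
    show "star (free_alg bar E) (f \<otimes>\<^bsub>free_alg bar E\<^esub> g) =
      star (free_alg bar E) g \<otimes>\<^bsub>free_alg bar E\<^esub> star (free_alg bar E) f"
      by (simp only: free_simps(1) star_conv)
    show "star (free_alg bar E) (f \<oplus>\<^bsub>free_alg bar E\<^esub> g) =
      star (free_alg bar E) f \<oplus>\<^bsub>free_alg bar E\<^esub> star (free_alg bar E) g"
      by (simp add: bar_add)
  next
    fix v show "star (free_alg bar E) (vproj (free_alg bar E) v) = vproj (free_alg bar E) v"
      by (simp only: free_simps(6) star_delta) simp
  qed (auto intro!: delta_carrier simp: gens_def)
qed

text \<open>Together with \<open>subst\<close> this is the homomorphism given by the universal
  property of the free algebra: the generator \<open>a\<close> is replaced by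
  \<open>g a\<close>.\<close>

definition subst_mono :: "(('v, 'e) gen \<Rightarrow> ('v, 'e) gen list \<Rightarrow> 'k) \<Rightarrow> ('v, 'e) gen list \<Rightarrow> ('v, 'e) gen list \<Rightarrow> 'k" where
  "subst_mono g w = foldr (\<lambda>a. conv (g a)) w (const 1)"

definition subst :: "(('v, 'e) gen \<Rightarrow> ('v, 'e) gen list \<Rightarrow> 'k) \<Rightarrow> (('v, 'e) gen list \<Rightarrow> 'k) \<Rightarrow> ('v, 'e) gen list \<Rightarrow> 'k" where
  "subst g f = lext f (subst_mono g)"

lemma subst_mono_append: "subst_mono g (u @ v) = conv (subst_mono g u) (subst_mono g v)"
  by (induction u) (auto simp: subst_mono_def conv_const_left conv_assoc)

lemma subst_mono_carrier:
  assumes "\<And>a. a \<in> gens E \<Longrightarrow> g a \<in> carrier (free_alg bar E)" "set w \<subseteq> gens E"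
  shows "subst_mono g w \<in> carrier (free_alg bar E)"
  using assms(2)
proof (induction w)
  case (Cons a w)
  interpret ring "free_alg bar E" by (rule free_ring)
  show ?case using m_closed[of "g a" "subst_mono g w"] Cons assms(1) by (simp add: subst_mono_def)
qed (simp add: subst_mono_def)

lemma subst_const: "subst g (const c) = const c"
proof
  fix y
  show "subst g (const c) y = const c y"
    unfolding subst_def by (subst lext_superset[of "{[]}"]) (auto simp: const_def subst_mono_def)
qed

lemma subst_delta: "subst g (delta [a]) = g a"
  by (auto simp: subst_def lext_delta subst_mono_def conv_const_right)

lemma subst_carrier:
  assumes g: "\<And>a. a \<in> gens E \<Longrightarrow> g a \<in> carrier (free_alg bar E)" and f: "f \<in> carrier (free_alg bar E)"
  shows "subst g f \<in> carrier (free_alg bar E)"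
proof -
  interpret ring "free_alg bar E" by (rule free_ring)
  have "(\<lambda>w. conv (const (f w)) (subst_mono g w)) \<in> {w. f w \<noteq> 0} \<rightarrow> carrier (free_alg bar E)"
    using m_closed[OF const_carrier subst_mono_carrier[OF g]] f by (auto simp: free_carrier)
  then have "finsum (free_alg bar E) (\<lambda>w. conv (const (f w)) (subst_mono g w)) {w. f w \<noteq> 0} \<in> carrier (free_alg bar E)"
    "finsum (free_alg bar E) (\<lambda>w. conv (const (f w)) (subst_mono g w)) {w. f w \<noteq> 0} = subst g f"
    using finsum_closed free_finsum[OF free_finite[OF f]]
    by (auto simp: subst_def lext_def[abs_def] conv_const_left)
  then show ?thesis by simp
qed

lemma subst_conv:
  assumes "finite {w. f w \<noteq> 0}" "finite {w. h w \<noteq> 0}"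
  shows "subst g (conv f h) = conv (subst g f) (subst g h)"
proof
  fix y
  let ?m = "subst_mono g"
  have "conv (subst g f) (subst g h) y =
    (\<Sum>i\<le>length y. \<Sum>u | f u \<noteq> 0. \<Sum>v | h v \<noteq> 0. f u * h v * (?m u (take i y) * ?m v (drop i y)))"
    unfolding conv_def subst_def lext_def sum_product by (intro sum.cong refl) (simp add: algebra_simps)
  also have "\<dots> = (\<Sum>u | f u \<noteq> 0. \<Sum>v | h v \<noteq> 0. \<Sum>i\<le>length y. f u * h v * (?m u (take i y) * ?m v (drop i y)))"
    by (subst sum.swap, intro sum.cong refl, subst sum.swap) (rule refl)
  also have "\<dots> = subst g (conv f h) y"
    unfolding subst_def lext_conv[OF assms] subst_mono_append by (simp add: conv_def sum_distrib_left)
  finally show "subst g (conv f h) y = conv (subst g f) (subst g h) y" by simp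
qed

lemma subst_hom:
  fixes E :: "('v, 'e) pre_digraph"
  assumes g: "\<And>a. a \<in> gens E \<Longrightarrow> g a \<in> carrier (free_alg bar E)"
  shows "subst g \<in> ring_hom (free_alg bar E) (free_alg bar E)"
proof (rule ring_hom_memI)
  fix f h :: "('v, 'e) gen list \<Rightarrow> 'k"
  assume fh: "f \<in> carrier (free_alg bar E)" "h \<in> carrier (free_alg bar E)"
  show "subst g f \<in> carrier (free_alg bar E)" by (rule subst_carrier[OF g fh(1)])
  show "subst g (f \<otimes>\<^bsub>free_alg bar E\<^esub> h) = subst g f \<otimes>\<^bsub>free_alg bar E\<^esub> subst g h"
    using subst_conv fh free_finite by (metis free_simps(1))
  show "subst g (f \<oplus>\<^bsub>free_alg bar E\<^esub> h) = subst g f \<oplus>\<^bsub>free_alg bar E\<^esub> subst g h"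
    using lext_add[OF free_finite[OF fh(1)] free_finite[OF fh(2)]] by (intro ext) (simp add: subst_def)
next
  show "subst g \<one>\<^bsub>free_alg bar E :: (('v, 'e) gen list \<Rightarrow> 'k, 'v, 'e) graph_alg\<^esub> =
      \<one>\<^bsub>free_alg bar E :: (('v, 'e) gen list \<Rightarrow> 'k, 'v, 'e) graph_alg\<^esub>"
    by (simp add: subst_const)
qed

lemma subst_star:
  fixes E :: "('v, 'e) pre_digraph"
  assumes g: "\<And>a. a \<in> gens E \<Longrightarrow> g a \<in> carrier (free_alg bar E)"
    and gs: "\<And>a. a \<in> gens E \<Longrightarrow> g (gen_star a) = star (free_alg bar E) (g a)"
    and f: "f \<in> carrier (free_alg bar E)"
  shows "subst g (star (free_alg bar E) f) = star (free_alg bar E) (subst g f)"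
  using f
proof (induction rule: free_induct)
  case (const c)
  show ?case by (simp only: star_const subst_const)
next
  case (delta a)
  then show ?case by (simp only: star_delta list.map rev.simps append_Nil subst_delta gs)
next
  case (add f h)
  let ?F = "free_alg bar E :: (('v, 'e) gen list \<Rightarrow> 'k, 'v, 'e) graph_alg"
  interpret F: graph_star_ring E ?F by (rule free_graph_star_ring)
  have 1: "star ?F (\<lambda>w. f w + h w) = star ?F f \<oplus>\<^bsub>?F\<^esub> star ?F h"
    using F.star_add[OF add(1,2)] by simp
  have 2: "subst g (\<lambda>w. f w + h w) = subst g f \<oplus>\<^bsub>?F\<^esub> subst g h"
    using ring_hom_add[OF subst_hom[OF g] add(1,2)] by simp
  have "subst g (star ?F f \<oplus>\<^bsub>?F\<^esub> star ?F h) = subst g (star ?F f) \<oplus>\<^bsub>?F\<^esub> subst g (star ?F h)"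
    by (rule ring_hom_add[OF subst_hom[OF g]]) (assumption | rule F.star_closed add)+
  also have "\<dots> = star ?F (subst g f) \<oplus>\<^bsub>?F\<^esub> star ?F (subst g h)"
    by (simp only: add(3,4))
  also have "\<dots> = star ?F (subst g f \<oplus>\<^bsub>?F\<^esub> subst g h)"
    by (rule F.star_add[symmetric]) (assumption | rule subst_carrier[OF g] add)+
  finally show ?case by (simp only: 1 2)
next
  case (mult f h)
  let ?F = "free_alg bar E :: (('v, 'e) gen list \<Rightarrow> 'k, 'v, 'e) graph_alg"
  interpret F: graph_star_ring E ?F by (rule free_graph_star_ring)
  have "subst g (conv (star ?F h) (star ?F f)) = conv (subst g (star ?F h)) (subst g (star ?F f))"
    by (rule subst_conv) (rule free_finite[where E = E and bar = bar], rule F.star_closed, fact mult)+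
  also have "\<dots> = conv (star ?F (subst g h)) (star ?F (subst g f))"
    by (simp only: mult(3,4))
  also have "\<dots> = star ?F (conv (subst g f) (subst g h))" by (rule star_conv[symmetric])
  also have "conv (subst g f) (subst g h) = subst g (conv f h)"
    by (rule subst_conv[symmetric]) (rule free_finite[where E = E and bar = bar], fact mult)+
  finally show ?case by (simp only: star_conv)
qed

end

declare free_simps [simp del]

section \<open>Path calculus in a Leavitt family\<close>

text \<open>Quotients and twisted families are records with known ring operations but other
  additional fields; this transfers the ring axioms to them.\<close>

lemma ring_cong:
  assumes "ring R" "carrier R' = carrier R" "mult R' = mult R" "one R' = one R"
    "zero R' = zero R" "add R' = add R"
  shows "ring R'"
proof -
  interpret ring R by fact
  show ?thesis
    by (rule ringI; (rule abelian_groupI | rule monoidI)?)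
      (use assms(2-6) l_neg in \<open>auto simp: a_ac m_assoc l_distr r_distr\<close>)
qed

lemma finsum_record_cong:
  "carrier R' = carrier R \<Longrightarrow> zero R' = zero R \<Longrightarrow> add R' = add R \<Longrightarrow> finsum R' f S = finsum R f S"
  unfolding finsum_def finprod_def by (simp add: monoid.simps)

lemma a_minus_record_cong:
  "carrier R' = carrier R \<Longrightarrow> zero R' = zero R \<Longrightarrow> add R' = add R \<Longrightarrow> a_minus R' x y = a_minus R x y"
  unfolding a_minus_def a_inv_def m_inv_def by simp

lemma (in ring) minus_eq_zero_iff:
  "x \<in> carrier R \<Longrightarrow> y \<in> carrier R \<Longrightarrow> x \<ominus> y = \<zero> \<longleftrightarrow> x = y"
  by (metis a_minus_def add.inv_closed minus_equality minus_minus r_neg)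

locale leavitt_alg = path_graph E + graph_star_ring E A
  for E :: "('v, 'e) pre_digraph" and A :: "('a, 'v, 'e) graph_alg" (structure) +
  assumes leavitt_rels: "leavitt_rels A E \<subseteq> {\<zero>\<^bsub>A\<^esub>}"
begin

abbreviation "P \<equiv> vproj A"
abbreviation "S \<equiv> eiso A"
abbreviation "T e \<equiv> star A (eiso A e)"
abbreviation "pe \<equiv> path_elt A"
abbreviation "pp \<equiv> path_proj A"

lemma sum_closed:
  "(\<Oplus>v\<in>verts E. P v) \<in> carrier A" "(\<Oplus>e\<in>out_arcs E v. S e \<otimes> T e) \<in> carrier A"
  by (auto intro!: finsum_closed)

lemma
  shows sum_vproj: "(\<Oplus>v\<in>verts E. P v) = \<one>"
    and vproj_idem [simp]: "v \<in> verts E \<Longrightarrow> P v \<otimes> P v = P v"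
    and vproj_orth: "v \<in> verts E \<Longrightarrow> w \<in> verts E \<Longrightarrow> v \<noteq> w \<Longrightarrow> P v \<otimes> P w = \<zero>"
    and eiso_orth: "e \<in> arcs E \<Longrightarrow> f \<in> arcs E \<Longrightarrow> e \<noteq> f \<Longrightarrow> T e \<otimes> S f = \<zero>"
    and eiso_iso [simp]: "e \<in> arcs E \<Longrightarrow> T e \<otimes> S e = P (head E e)"
    and vproj_eiso [simp]: "e \<in> arcs E \<Longrightarrow> P (tail E e) \<otimes> S e = S e"
    and eiso_vproj [simp]: "e \<in> arcs E \<Longrightarrow> S e \<otimes> P (head E e) = S e"
    and star_eiso_vproj [simp]: "e \<in> arcs E \<Longrightarrow> T e \<otimes> P (tail E e) = T e"
    and vproj_star_eiso [simp]: "e \<in> arcs E \<Longrightarrow> P (head E e) \<otimes> T e = T e"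
    and vproj_expand: "v \<in> verts E \<Longrightarrow> P v = (\<Oplus>e\<in>out_arcs E v. S e \<otimes> T e)"
  using leavitt_rels unfolding leavitt_rels_subset singleton_iff
  by (auto simp: sum_closed minus_eq_zero_iff)

lemma vproj_eiso_left [simp]: "e \<in> arcs E \<Longrightarrow> x \<in> carrier A \<Longrightarrow> P (tail E e) \<otimes> (S e \<otimes> x) = S e \<otimes> x"
  by (subst m_assoc[symmetric]) auto

lemma pe_Nil: "pe (v, []) = P v"
  by (simp add: path_elt_def)

lemma pe_closed [simp]: "\<beta> \<in> paths E \<Longrightarrow> pe \<beta> \<in> carrier A"
  by (rule path_elt_closed[OF graph_star_ring_axioms])

lemma pp_closed [simp]: "\<beta> \<in> paths E \<Longrightarrow> pp \<beta> \<in> carrier A"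
  by (rule path_proj_closed[OF graph_star_ring_axioms])

lemma pe_Cons: "(v, e # es) \<in> paths E \<Longrightarrow> pe (v, e # es) = S e \<otimes> pe (head E e, es)"
  by (cases es) (auto simp: path_elt_def)

lemma vproj_pe: "(v, es) \<in> paths E \<Longrightarrow> P v \<otimes> pe (v, es) = pe (v, es)"
proof (cases es)
  case (Cons e fs)
  assume p: "(v, es) \<in> paths E"
  then show ?thesis using Cons pe_Cons[of v e fs] by auto
qed (auto simp: pe_Nil)

lemma pe_append:
  "(v, es @ fs) \<in> paths E \<Longrightarrow> pe (v, es @ fs) = pe (v, es) \<otimes> pe (prange E (v, es), fs)"
proof (induction es arbitrary: v)
  case Nil
  then show ?case using vproj_pe by (simp add: pe_Nil)
next
  case (Cons e es)
  then have "(v, e # es) \<in> paths E" "(prange E (v, e # es), fs) \<in> paths E"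
    using paths_append[of v "e # es" fs] by auto
  then show ?case
    using Cons by (simp add: pe_Cons m_assoc)
qed

lemma pe_vproj: "(v, es) \<in> paths E \<Longrightarrow> pe (v, es) \<otimes> P (prange E (v, es)) = pe (v, es)"
  using pe_append[of v es "[]"] by (simp add: pe_Nil)

lemma pe_iso: "(v, es) \<in> paths E \<Longrightarrow> star A (pe (v, es)) \<otimes> pe (v, es) = P (prange E (v, es))"
proof (induction es arbitrary: v)
  case (Cons e es)
  then have p: "e \<in> arcs E" "(head E e, es) \<in> paths E" "tail E e = v" by auto
  have "star A (pe (v, e # es)) \<otimes> pe (v, e # es)
      = star A (pe (head E e, es)) \<otimes> (T e \<otimes> S e \<otimes> pe (head E e, es))"
    using p Cons.prems by (simp add: pe_Cons star_mult m_assoc del: eiso_iso)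
  also have "\<dots> = P (prange E (head E e, es))"
    using p Cons.IH[OF p(2)] by (simp add: vproj_pe)
  finally show ?case by simp
qed (simp add: pe_Nil)

lemma star_pe_append:
  assumes "(v, es @ fs) \<in> paths E"
  shows "star A (pe (v, es)) \<otimes> pe (v, es @ fs) = pe (prange E (v, es), fs)"
proof -
  have p: "(v, es) \<in> paths E" "(prange E (v, es), fs) \<in> paths E" using assms paths_append by auto
  then show ?thesis
    using pe_append[OF assms] pe_iso[OF p(1)] vproj_pe[OF p(2)] by (simp add: m_assoc[symmetric])
qed

text \<open>Common first edges cancel by the isometry relation; where the paths first differ, two
  distinct edges or two distinct vertices meet.\<close>

lemma pe_orth:
  "\<beta> \<in> paths E \<Longrightarrow> \<gamma> \<in> paths E \<Longrightarrow> \<not> comparable \<beta> \<gamma> \<Longrightarrow> star A (pe \<beta>) \<otimes> pe \<gamma> = \<zero>"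
proof (induction "snd \<beta>" arbitrary: \<beta> \<gamma>)
  case Nil
  then obtain v w fs where b: "\<beta> = (v, [])" "\<gamma> = (w, fs)" by (metis prod.collapse)
  with Nil have vw: "v \<in> verts E" "w \<in> verts E" "v \<noteq> w" "(w, fs) \<in> paths E"
    using paths_source[of w fs] by (auto simp: comparable_def)
  then have "P v \<otimes> (P w \<otimes> pe (w, fs)) = \<zero>"
    by (subst m_assoc[symmetric]) (auto simp: vproj_orth)
  then show ?case using vw by (simp add: b pe_Nil vproj_pe)
next
  case (Cons e es)
  obtain v where b: "\<beta> = (v, e # es)" using Cons.hyps(2) by (metis prod.collapse)
  then have p: "e \<in> arcs E" "(head E e, es) \<in> paths E" "tail E e = v"
    using Cons.prems(1) unfolding b by auto
  have x: "star A (pe \<beta>) \<otimes> y = star A (pe (head E e, es)) \<otimes> (T e \<otimes> y)" if "y \<in> carrier A" for y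
    using that p Cons.prems(1) by (simp add: b pe_Cons star_mult m_assoc)
  obtain w fs where g: "\<gamma> = (w, fs)" by fastforce
  have w: "w \<in> verts E" using Cons.prems g paths_source by blast
  show ?case
  proof (cases fs)
    case Nil
    then have "v \<noteq> w" using Cons.prems b g by (auto simp: comparable_def)
    then have "T e \<otimes> P (tail E e) \<otimes> P w = \<zero>"
      using p w by (subst m_assoc) (auto simp: vproj_orth)
    then have "T e \<otimes> P w = \<zero>" using p(1) by (simp only: star_eiso_vproj)
    then show ?thesis using p w x[of "P w"] by (simp add: g Nil pe_Nil)
  next
    case (Cons f fs')
    then have q: "f \<in> arcs E" "(head E f, fs') \<in> paths E" "tail E f = w" "(w, f # fs') \<in> paths E"
      using Cons.prems g by auto
    have y: "T e \<otimes> pe \<gamma> = T e \<otimes> S f \<otimes> pe (head E f, fs')"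
      using p q by (simp add: g Cons pe_Cons m_assoc)
    show ?thesis
    proof (cases "e = f")
      case True
      have "\<not> comparable (head E e, es) (head E f, fs')"
        using Cons.prems(3) p q True by (auto simp: comparable_def b g Cons)
      then have "star A (pe (head E e, es)) \<otimes> pe (head E f, fs') = \<zero>"
        using Cons.hyps(1)[of "(head E e, es)" "(head E f, fs')"] p q by simp
      then show ?thesis using x[of "pe \<gamma>"] y True p q Cons.prems by (simp add: vproj_pe)
    next
      case False
      then show ?thesis using x[of "pe \<gamma>"] y p q Cons.prems by (simp add: eiso_orth)
    qed
  qed
qed

lemma pp_Nil: "v \<in> verts E \<Longrightarrow> pp (v, []) = P v"
  by (simp add: path_proj_def pe_Nil)

lemma pp_Cons:
  "(v, e # es) \<in> paths E \<Longrightarrow> pp (v, e # es) = S e \<otimes> pp (head E e, es) \<otimes> T e"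
  by (auto simp: path_proj_def pe_Cons star_mult m_assoc)

lemma eiso_pp_orth:
  assumes "e \<in> arcs E" "\<beta> \<in> paths E" "fst \<beta> \<noteq> head E e"
  shows "S e \<otimes> pp \<beta> \<otimes> T e = \<zero>"
proof -
  obtain v es where b: "\<beta> = (v, es)" by fastforce
  have v: "v \<in> verts E" "v \<noteq> head E e" "(v, es) \<in> paths E" using assms b paths_source by auto
  have "P (head E e) \<otimes> pe \<beta> = P (head E e) \<otimes> (P v \<otimes> pe \<beta>)" using v by (simp add: b vproj_pe)
  also have "\<dots> = P (head E e) \<otimes> P v \<otimes> pe \<beta>" using v assms by (subst m_assoc) auto
  also have "\<dots> = \<zero>" using v assms vproj_orth[of "head E e" v] by simp
  finally have "S e \<otimes> (P (head E e) \<otimes> pe \<beta>) = \<zero>" using assms by simp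
  then have "S e \<otimes> P (head E e) \<otimes> pe \<beta> = \<zero>" using assms by (subst m_assoc) auto
  then have "S e \<otimes> pe \<beta> = \<zero>" using assms by simp
  then have "S e \<otimes> pp \<beta> = \<zero>"
    using assms by (simp add: path_proj_def m_assoc[symmetric])
  then show ?thesis using assms by simp
qed

lemma star_pp: "\<beta> \<in> paths E \<Longrightarrow> star A (pp \<beta>) = pp \<beta>"
  by (simp add: path_proj_def star_mult)

lemma pp_idem:
  assumes "\<beta> \<in> paths E" shows "pp \<beta> \<otimes> pp \<beta> = pp \<beta>"
proof -
  obtain v es where b: "\<beta> = (v, es)" by fastforce
  have "pp \<beta> \<otimes> pp \<beta> = pe \<beta> \<otimes> (star A (pe \<beta>) \<otimes> pe \<beta>) \<otimes> star A (pe \<beta>)"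
    using assms by (simp add: path_proj_def m_assoc)
  also have "\<dots> = pp \<beta>" using assms by (simp add: b pe_iso pe_vproj path_proj_def)
  finally show ?thesis .
qed

lemma pp_orth:
  assumes "\<beta> \<in> paths E" "\<gamma> \<in> paths E" "\<not> comparable \<beta> \<gamma>" shows "pp \<beta> \<otimes> pp \<gamma> = \<zero>"
proof -
  have "pp \<beta> \<otimes> pp \<gamma> = pe \<beta> \<otimes> (star A (pe \<beta>) \<otimes> pe \<gamma>) \<otimes> star A (pe \<gamma>)"
    using assms by (simp add: path_proj_def m_assoc)
  also have "\<dots> = \<zero>" using assms by (simp add: pe_orth)
  finally show ?thesis .
qed

text \<open>The expansion of the vertex projection at the range of the path, conjugated by
  \<open>pe (v, es)\<close>.\<close>

lemma pp_expand:
  assumes "(v, es) \<in> paths E"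
  shows "pp (v, es) = (\<Oplus>e\<in>out_arcs E (prange E (v, es)). pp (v, es @ [e]))"
proof -
  let ?w = "prange E (v, es)"
  have w: "?w \<in> verts E" using prange_in_verts[OF assms] .
  have c: "(\<lambda>e. S e \<otimes> T e) \<in> out_arcs E ?w \<rightarrow> carrier A" by auto
  have c': "(\<lambda>e. pe (v, es) \<otimes> (S e \<otimes> T e)) \<in> out_arcs E ?w \<rightarrow> carrier A" using assms by auto
  have "pp (v, es) = pe (v, es) \<otimes> P ?w \<otimes> star A (pe (v, es))"
    using assms by (simp add: path_proj_def pe_vproj)
  also have "\<dots> = (\<Oplus>e\<in>out_arcs E ?w. pe (v, es) \<otimes> (S e \<otimes> T e) \<otimes> star A (pe (v, es)))"
    unfolding vproj_expand[OF w] finsum_rdistr[OF finite_out_arcs pe_closed[OF assms] c]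
    using c' assms by (intro finsum_ldistr) auto
  also have "\<dots> = (\<Oplus>e\<in>out_arcs E ?w. pp (v, es @ [e]))"
  proof (rule finsum_cong')
    fix e assume e: "e \<in> out_arcs E ?w"
    then have p: "(v, es @ [e]) \<in> paths E" "(?w, [e]) \<in> paths E"
      using assms by (auto simp: paths_append)
    have "pe (?w, [e]) = S e" using e p(2) by (auto simp: pe_Cons pe_Nil)
    then show "pe (v, es) \<otimes> (S e \<otimes> T e) \<otimes> star A (pe (v, es)) = pp (v, es @ [e])"
      using e assms by (auto simp: path_proj_def pe_append[OF p(1)] star_mult m_assoc)
  qed (use assms in \<open>auto simp: paths_append\<close>)
  finally show ?thesis .
qed

subsection \<open>Projections of clopen sets\<close>

definition lev :: "nat \<Rightarrow> ('v, 'e) gpath set" where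
  "lev n = {\<beta> \<in> paths E. length (snd \<beta>) = n}"

text \<open>Within the path space, \<open>Y\<close> is a union of cylinders of length
  \<open>n\<close>.\<close>

definition saturated :: "nat \<Rightarrow> 'e stream set \<Rightarrow> bool" where
  "saturated n Y \<longleftrightarrow> (\<forall>\<beta>\<in>lev n. cyl E \<beta> \<subseteq> Y \<or> cyl E \<beta> \<inter> Y = {})"

text \<open>The projection of \<open>Y\<close> read at level \<open>n\<close>. For clopen sets it no
  longer changes once \<open>n\<close> is large, so a projection is attached to the set and not to a
  decomposition of it.\<close>

definition Q :: "nat \<Rightarrow> 'e stream set \<Rightarrow> 'a" where
  "Q n Y = (\<Oplus>\<beta>\<in>{\<beta> \<in> lev n. cyl E \<beta> \<subseteq> Y}. pp \<beta>)"

lemma finite_lev [simp]: "finite (lev n)"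
proof (rule finite_subset)
  show "lev n \<subseteq> verts E \<times> {es. set es \<subseteq> arcs E \<and> length es = n}"
    using paths_source paths_arcs by (fastforce simp: lev_def)
qed (simp add: finite_lists_length_eq)

lemma lev_paths: "\<beta> \<in> lev n \<Longrightarrow> \<beta> \<in> paths E"
  by (simp add: lev_def)

lemma cyl_not_empty: "\<beta> \<in> paths E \<Longrightarrow> cyl E \<beta> \<noteq> {}"
  by (metis cyl_nonempty empty_iff)

lemma Q_closed: "Q n Y \<in> carrier A"
  unfolding Q_def by (rule finsum_closed) (auto dest: lev_paths)

lemma cyl_disjoint:
  assumes "\<beta> \<in> paths E" "\<gamma> \<in> paths E"
  shows "cyl E \<beta> \<inter> cyl E \<gamma> = {} \<longleftrightarrow> \<not> comparable \<beta> \<gamma>"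
proof
  assume d: "cyl E \<beta> \<inter> cyl E \<gamma> = {}"
  show "\<not> comparable \<beta> \<gamma>"
  proof
    assume c: "comparable \<beta> \<gamma>"
    then have "cyl E \<beta> \<subseteq> cyl E \<gamma> \<or> cyl E \<gamma> \<subseteq> cyl E \<beta>"
      using cyl_prefix_subset[of "snd \<beta>" "snd \<gamma>" "fst \<beta>"] cyl_prefix_subset[of "snd \<gamma>" "snd \<beta>" "fst \<beta>"]
      by (metis comparable_def prod.collapse)
    then show False using d cyl_nonempty assms by (metis Int_absorb1 Int_absorb2 empty_iff)
  qed
qed (auto dest: cyl_comparable)

lemma saturated_cyl:
  assumes "length (snd \<beta>) \<le> n" "\<beta> \<in> paths E"
  shows "saturated n (cyl E \<beta>)"
  unfolding saturated_def
proof
  fix \<gamma> assume g: "\<gamma> \<in> lev n"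
  show "cyl E \<gamma> \<subseteq> cyl E \<beta> \<or> cyl E \<gamma> \<inter> cyl E \<beta> = {}"
  proof (cases "comparable \<gamma> \<beta>")
    case True
    then have "prefix (snd \<beta>) (snd \<gamma>)"
      using g assms by (auto simp: comparable_def lev_def prefix_def)
    then have "cyl E (fst \<beta>, snd \<gamma>) \<subseteq> cyl E (fst \<beta>, snd \<beta>)" by (rule cyl_prefix_subset)
    then show ?thesis using True by (metis comparable_def prod.collapse)
  qed (use cyl_disjoint g assms lev_paths in blast)
qed

lemma saturated_Un: "saturated n Y \<Longrightarrow> saturated n Z \<Longrightarrow> saturated n (Y \<union> Z)"
  unfolding saturated_def by blast

lemma saturated_UN: "(\<And>i. i \<in> I \<Longrightarrow> saturated n (Y i)) \<Longrightarrow> saturated n (\<Union>i\<in>I. Y i)"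
  unfolding saturated_def by blast

lemma Q_empty: "Q n {} = \<zero>"
proof -
  have "{\<beta> \<in> lev n. cyl E \<beta> \<subseteq> {}} = {}" using cyl_not_empty lev_paths by blast
  then show ?thesis unfolding Q_def by (simp only: finsum_empty)
qed

lemma Q_Un:
  assumes "saturated n Y" "saturated n Z" "Y \<inter> Z = {}"
  shows "Q n (Y \<union> Z) = Q n Y \<oplus> Q n Z"
proof -
  have eq: "{\<beta> \<in> lev n. cyl E \<beta> \<subseteq> Y \<union> Z} = {\<beta> \<in> lev n. cyl E \<beta> \<subseteq> Y} \<union> {\<beta> \<in> lev n. cyl E \<beta> \<subseteq> Z}"
    using assms unfolding saturated_def by blast
  have "{\<beta> \<in> lev n. cyl E \<beta> \<subseteq> Y} \<inter> {\<beta> \<in> lev n. cyl E \<beta> \<subseteq> Z} = {}"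
    using assms(3) cyl_not_empty[OF lev_paths] by blast
  then show ?thesis
    unfolding Q_def eq by (intro finsum_Un_disjoint) (auto intro!: pp_closed lev_paths)
qed

lemma Q_UN:
  assumes "finite I" "\<And>i. i \<in> I \<Longrightarrow> saturated n (Y i)"
    "\<And>i j. i \<in> I \<Longrightarrow> j \<in> I \<Longrightarrow> i \<noteq> j \<Longrightarrow> Y i \<inter> Y j = {}"
  shows "Q n (\<Union>i\<in>I. Y i) = (\<Oplus>i\<in>I. Q n (Y i))"
  using assms
proof (induction I rule: finite_induct)
  case (insert i I)
  have "Q n (Y i \<union> (\<Union>i\<in>I. Y i)) = Q n (Y i) \<oplus> Q n (\<Union>i\<in>I. Y i)"
  proof (rule Q_Un)
    show "saturated n (\<Union>i\<in>I. Y i)" by (rule saturated_UN) (use insert in auto)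
    show "Y i \<inter> (\<Union>i\<in>I. Y i) = {}" using insert.hyps(2) insert.prems(2)[of i] by blast
  qed (use insert in auto)
  then show ?case using insert by (simp add: Q_closed Pi_iff)
qed (simp add: Q_empty)

lemma cyl_children:
  assumes "(v, es) \<in> paths E"
  shows "cyl E (v, es) = (\<Union>e\<in>out_arcs E (prange E (v, es)). cyl E (v, es @ [e]))"
proof
  show "cyl E (v, es) \<subseteq> (\<Union>e\<in>out_arcs E (prange E (v, es)). cyl E (v, es @ [e]))"
  proof
    fix x assume x: "x \<in> cyl E (v, es)"
    then obtain y where y: "y \<in> infpaths E" "src E y = prange E (v, es)" "x = es @- y"
      using cyl_iff[OF assms] by auto
    then have "shd y \<in> out_arcs E (prange E (v, es))" by (simp add: infpaths_shd src_def)
    moreover have "x = (es @ [shd y]) @- stl y" using y by simp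
    then have "x \<in> cyl E (v, es @ [shd y])"
      using x[unfolded cyl_def] unfolding cyl_def snd_conv fst_conv stake_eq_prefix mem_Collect_eq by blast
    ultimately show "x \<in> (\<Union>e\<in>out_arcs E (prange E (v, es)). cyl E (v, es @ [e]))" by blast
  qed
qed (use cyl_append_subset in blast)

text \<open>Induction on the excess of \<open>n\<close> over the length of \<open>\<beta>\<close>: a
  cylinder is the disjoint union of those one edge longer, and \<open>pp_expand\<close> is the
  matching identity of projections.\<close>

lemma Q_cyl:
  assumes "\<beta> \<in> paths E" "length (snd \<beta>) \<le> n"
  shows "Q n (cyl E \<beta>) = pp \<beta>"
proof -
  have "Q (length (snd \<beta>) + k) (cyl E \<beta>) = pp \<beta>" for k
    using assms(1)
  proof (induction k arbitrary: \<beta>)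
    case 0
    have "{\<gamma> \<in> lev (length (snd \<beta>)). cyl E \<gamma> \<subseteq> cyl E \<beta>} = {\<beta>}"
    proof (intro equalityI subsetI)
      fix \<gamma> assume g: "\<gamma> \<in> {\<gamma> \<in> lev (length (snd \<beta>)). cyl E \<gamma> \<subseteq> cyl E \<beta>}"
      then obtain x where "x \<in> cyl E \<gamma>" "x \<in> cyl E \<beta>" using cyl_not_empty[OF lev_paths, of \<gamma>] by blast
      then show "\<gamma> \<in> {\<beta>}"
        using g comparable_same_length[OF cyl_comparable[of x E \<gamma> \<beta>]] by (auto simp: lev_def)
    qed (use 0 in \<open>auto simp: lev_def\<close>)
    then show ?case unfolding Q_def using 0 by simp
  next
    case (Suc k)
    obtain v es where b: "\<beta> = (v, es)" by fastforce
    let ?O = "out_arcs E (prange E (v, es))"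
    have p: "(v, es @ [e]) \<in> paths E" if "e \<in> ?O" for e
      using that Suc.prems b by (auto simp: paths_append)
    have "Q (length es + Suc k) (\<Union>e\<in>?O. cyl E (v, es @ [e])) =
        (\<Oplus>e\<in>?O. Q (length es + Suc k) (cyl E (v, es @ [e])))"
    proof (rule Q_UN)
      show "cyl E (v, es @ [e]) \<inter> cyl E (v, es @ [f]) = {}" if "e \<in> ?O" "f \<in> ?O" "e \<noteq> f" for e f
        using cyl_disjoint[OF p p] that by (auto simp: comparable_def)
    qed (use p saturated_cyl in \<open>auto\<close>)
    also have "\<dots> = (\<Oplus>e\<in>?O. pp (v, es @ [e]))"
      using Suc.IH[OF p] by (intro finsum_cong') (auto simp: p)
    also have "\<dots> = pp (v, es)" using pp_expand Suc.prems b by simp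
    finally show ?case using cyl_children Suc.prems b by simp
  qed
  then show ?thesis using assms(2) by (metis le_add_diff_inverse)
qed

text \<open>\<open>d\<close> is the projection of the clopen set \<open>Y\<close>, partitioned into cylinders of length at least \<open>K\<close>.\<close>

inductive clopen_proj :: "nat \<Rightarrow> 'e stream set \<Rightarrow> 'a \<Rightarrow> bool" for K where
  empty: "clopen_proj K {} \<zero>"
| insert: "clopen_proj K Y d \<Longrightarrow> \<beta> \<in> paths E \<Longrightarrow> length (snd \<beta>) \<ge> K \<Longrightarrow> cyl E \<beta> \<inter> Y = {} \<Longrightarrow>
    clopen_proj K (cyl E \<beta> \<union> Y) (pp \<beta> \<oplus> d)"

lemma clopen_proj_closed: "clopen_proj K Y d \<Longrightarrow> d \<in> carrier A"
  by (induction rule: clopen_proj.induct) auto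

lemma clopen_proj_infpaths: "clopen_proj K Y d \<Longrightarrow> Y \<subseteq> infpaths E"
  by (induction rule: clopen_proj.induct) (auto dest: cyl_infpaths)

lemma clopen_proj_cyl: "\<beta> \<in> paths E \<Longrightarrow> K \<le> length (snd \<beta>) \<Longrightarrow> clopen_proj K (cyl E \<beta>) (pp \<beta>)"
  using clopen_proj.insert[OF clopen_proj.empty, of \<beta> K] by simp

lemma clopen_proj_eventually: "clopen_proj K Y d \<Longrightarrow> \<exists>N. \<forall>n\<ge>N. saturated n Y \<and> Q n Y = d"
proof (induction rule: clopen_proj.induct)
  case empty
  then show ?case by (auto simp: saturated_def Q_empty)
next
  case (insert Y d \<beta>)
  then obtain N where N: "\<forall>n\<ge>N. saturated n Y \<and> Q n Y = d" by blast
  then have "saturated n (cyl E \<beta> \<union> Y) \<and> Q n (cyl E \<beta> \<union> Y) = pp \<beta> \<oplus> d"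
    if "n \<ge> max N (length (snd \<beta>))" for n
    using that insert saturated_cyl Q_Un[of n "cyl E \<beta>" Y] saturated_Un Q_cyl by simp
  then show ?case by blast
qed

text \<open>Two decompositions of one set are compared at a common level, where \<open>Q n Y\<close>
  depends on the set alone.\<close>

lemma clopen_proj_unique: "clopen_proj K Y d \<Longrightarrow> clopen_proj K' Y d' \<Longrightarrow> d = d'"
  using clopen_proj_eventually by (metis max.cobounded1 max.cobounded2)

lemma clopen_proj_UN_cyl:
  assumes "finite B" "B \<subseteq> paths E" "\<And>\<beta>. \<beta> \<in> B \<Longrightarrow> K \<le> length (snd \<beta>)"
    "\<And>\<beta> \<gamma>. \<beta> \<in> B \<Longrightarrow> \<gamma> \<in> B \<Longrightarrow> \<beta> \<noteq> \<gamma> \<Longrightarrow> cyl E \<beta> \<inter> cyl E \<gamma> = {}"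
  shows "clopen_proj K (\<Union>\<beta>\<in>B. cyl E \<beta>) (\<Oplus>\<beta>\<in>B. pp \<beta>)"
  using assms
proof (induction B rule: finite_induct)
  case (insert \<beta> B)
  have "clopen_proj K (cyl E \<beta> \<union> (\<Union>\<beta>\<in>B. cyl E \<beta>)) (pp \<beta> \<oplus> (\<Oplus>\<beta>\<in>B. pp \<beta>))"
  proof (rule clopen_proj.insert)
    show "cyl E \<beta> \<inter> (\<Union>\<beta>\<in>B. cyl E \<beta>) = {}" using insert.hyps(2) insert.prems(3)[of \<beta>] by blast
  qed (use insert in auto)
  moreover have "pp \<in> B \<rightarrow> carrier A" "pp \<beta> \<in> carrier A" using insert by auto
  ultimately show ?case using insert.hyps by simp
qed (simp add: clopen_proj.empty)

text \<open>Prepares for conjugation by \<open>u\<close>, whose effect on a cylinder is a change of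
  prefix once the cylinder is long enough.\<close>

lemma clopen_proj_refine:
  assumes "clopen_proj K Y d" shows "clopen_proj K' Y d"
proof -
  obtain N where N: "\<forall>n\<ge>N. saturated n Y \<and> Q n Y = d" using clopen_proj_eventually[OF assms] by blast
  define n where "n = max N K'"
  have s: "saturated n Y" "Q n Y = d" using N by (auto simp: n_def)
  let ?B = "{\<beta> \<in> lev n. cyl E \<beta> \<subseteq> Y}"
  have "Y = (\<Union>\<beta>\<in>?B. cyl E \<beta>)"
  proof (intro equalityI subsetI)
    fix x assume x: "x \<in> Y"
    then have xi: "x \<in> infpaths E" using clopen_proj_infpaths assms by blast
    have "(src E x, stake n x) \<in> lev n" using stake_path[OF xi] by (simp add: lev_def)
    moreover have "x \<in> cyl E (src E x, stake n x)" using in_cyl_stake[OF xi] .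
    ultimately show "x \<in> (\<Union>\<beta>\<in>?B. cyl E \<beta>)" using s x unfolding saturated_def by blast
  qed auto
  moreover have "clopen_proj K' (\<Union>\<beta>\<in>?B. cyl E \<beta>) (\<Oplus>\<beta>\<in>?B. pp \<beta>)"
  proof (rule clopen_proj_UN_cyl)
    show "finite ?B" by (rule finite_subset[OF _ finite_lev[of n]]) auto
    show "cyl E \<beta> \<inter> cyl E \<gamma> = {}" if "\<beta> \<in> ?B" "\<gamma> \<in> ?B" "\<beta> \<noteq> \<gamma>" for \<beta> \<gamma>
      using that comparable_same_length[of \<beta> \<gamma>] cyl_disjoint[of \<beta> \<gamma>] by (auto simp: lev_def)
  qed (auto simp: lev_def n_def)
  ultimately show ?thesis using s(2) by (simp add: Q_def)
qed

lemma clopen_proj_Un: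
  "clopen_proj K Y d \<Longrightarrow> clopen_proj K Z c \<Longrightarrow> Y \<inter> Z = {} \<Longrightarrow> clopen_proj K (Y \<union> Z) (d \<oplus> c)"
proof (induction rule: clopen_proj.induct)
  case empty
  then show ?case by (simp add: clopen_proj_closed)
next
  case (insert Y d \<beta>)
  then have "clopen_proj K (cyl E \<beta> \<union> (Y \<union> Z)) (pp \<beta> \<oplus> (d \<oplus> c))"
    by (intro clopen_proj.insert) auto
  then show ?case using insert by (simp add: a_assoc clopen_proj_closed Un_assoc)
qed

lemma clopen_proj_UN:
  assumes "finite I" "\<And>i. i \<in> I \<Longrightarrow> clopen_proj K (Y i) (d i)"
    "\<And>i j. i \<in> I \<Longrightarrow> j \<in> I \<Longrightarrow> i \<noteq> j \<Longrightarrow> Y i \<inter> Y j = {}"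
  shows "clopen_proj K (\<Union>i\<in>I. Y i) (\<Oplus>i\<in>I. d i)"
  using assms
proof (induction I rule: finite_induct)
  case (insert i I)
  have "clopen_proj K (Y i \<union> (\<Union>i\<in>I. Y i)) (d i \<oplus> (\<Oplus>i\<in>I. d i))"
  proof (rule clopen_proj_Un)
    show "Y i \<inter> (\<Union>i\<in>I. Y i) = {}" using insert.hyps(2) insert.prems(2)[of i] by blast
  qed (use insert in auto)
  moreover have "d k \<in> carrier A" if "k \<in> insert i I" for k
    using clopen_proj_closed insert.prems(1) that by blast
  then have "d \<in> I \<rightarrow> carrier A" "d i \<in> carrier A" by auto
  ultimately show ?case using insert.hyps by simp
qed (simp add: clopen_proj.empty)

lemma clopen_proj_repr:
  "clopen_proj K Y d \<Longrightarrow> \<exists>B. finite B \<and> B \<subseteq> paths E \<and> d = (\<Oplus>\<beta>\<in>B. pp \<beta>)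
     \<and> Y = (\<Union>\<beta>\<in>B. cyl E \<beta>) \<and> (\<forall>\<beta>\<in>B. \<forall>\<gamma>\<in>B. \<beta> \<noteq> \<gamma> \<longrightarrow> cyl E \<beta> \<inter> cyl E \<gamma> = {})"
proof (induction rule: clopen_proj.induct)
  case empty
  show ?case by (intro exI[of _ "{}"]) simp
next
  case (insert Y d \<beta>)
  then obtain B where B: "finite B" "B \<subseteq> paths E" "d = (\<Oplus>\<beta>\<in>B. pp \<beta>)" "Y = (\<Union>\<beta>\<in>B. cyl E \<beta>)"
    "\<forall>\<beta>\<in>B. \<forall>\<gamma>\<in>B. \<beta> \<noteq> \<gamma> \<longrightarrow> cyl E \<beta> \<inter> cyl E \<gamma> = {}" by blast
  have "\<beta> \<notin> B" using insert.hyps(2,4) B(4) cyl_not_empty by blast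
  moreover have "pp \<in> B \<rightarrow> carrier A" using B by auto
  ultimately show ?case
    using insert.hyps B by (intro exI[of _ "insert \<beta> B"]) auto
qed

text \<open>Conjugation by \<open>S e\<close> corresponds to prepending \<open>e\<close>; cylinders
  that do not start at the range of \<open>e\<close> vanish on both sides.\<close>

lemma clopen_proj_eiso:
  assumes e: "e \<in> arcs E"
  shows "clopen_proj K Y d \<Longrightarrow>
    clopen_proj K ((\<lambda>x. e ## x) ` {x \<in> Y. src E x = head E e}) (S e \<otimes> d \<otimes> T e)"
proof (induction rule: clopen_proj.induct)
  case empty
  then show ?case using e by (simp add: clopen_proj.empty)
next
  case (insert Y d \<beta>)
  let ?s = "\<lambda>Y. (\<lambda>x. e ## x) ` {x \<in> Y. src E x = head E e}"
  have eq: "S e \<otimes> (pp \<beta> \<oplus> d) \<otimes> T e = S e \<otimes> pp \<beta> \<otimes> T e \<oplus> S e \<otimes> d \<otimes> T e"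
    using e insert.hyps clopen_proj_closed by (simp add: r_distr l_distr)
  have un: "?s (cyl E \<beta> \<union> Y) = ?s (cyl E \<beta>) \<union> ?s Y" by auto
  show ?case
  proof (cases "fst \<beta> = head E e")
    case True
    have "(head E e, snd \<beta>) \<in> paths E" using True insert.hyps by (metis prod.collapse)
    then have p: "(tail E e, e # snd \<beta>) \<in> paths E" using e by simp
    have pp: "pp (tail E e, e # snd \<beta>) = S e \<otimes> pp \<beta> \<otimes> T e"
      using pp_Cons[OF p] True by (metis prod.collapse)
    have c: "?s (cyl E \<beta>) = cyl E (tail E e, e # snd \<beta>)"
    proof (intro equalityI subsetI)
      fix x assume "x \<in> cyl E (tail E e, e # snd \<beta>)"
      then have x: "x \<in> infpaths E" "shd x = e" "stake (length (snd \<beta>)) (stl x) = snd \<beta>"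
        by (auto simp: cyl_def)
      then have "stl x \<in> cyl E \<beta>" "src E (stl x) = head E e"
        using True by (auto simp: cyl_def infpaths_stl src_stl)
      then show "x \<in> ?s (cyl E \<beta>)" using x by (intro image_eqI[of _ _ "stl x"]) auto
    qed (use e True in \<open>auto simp: cyl_def infpaths_SCons\<close>)
    have "clopen_proj K (cyl E (tail E e, e # snd \<beta>) \<union> ?s Y) (pp (tail E e, e # snd \<beta>) \<oplus> S e \<otimes> d \<otimes> T e)"
    proof (rule clopen_proj.insert[OF insert.IH p])
      show "cyl E (tail E e, e # snd \<beta>) \<inter> ?s Y = {}" unfolding c[symmetric] using insert.hyps by auto
    qed (use insert.hyps in simp)
    then show ?thesis unfolding un eq c pp .
  next
    case False
    then have 1: "?s (cyl E \<beta>) = {}" by (auto simp: cyl_def)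
    have 2: "S e \<otimes> pp \<beta> \<otimes> T e = \<zero>" using eiso_pp_orth e insert.hyps False by blast
    have "S e \<otimes> d \<otimes> T e \<in> carrier A" using insert.IH clopen_proj_closed by blast
    then show ?thesis unfolding un eq 1 2 using insert.IH by simp
  qed
qed

lemma clopen_proj_one: "clopen_proj 0 (infpaths E) \<one>"
proof -
  have "clopen_proj 0 (\<Union>v\<in>verts E. cyl E (v, [])) (\<Oplus>v\<in>verts E. P v)"
    by (rule clopen_proj_UN) (use clopen_proj_cyl[of "(_, [])" 0] in \<open>auto simp: pp_Nil cyl_def\<close>)
  moreover have "(\<Union>v\<in>verts E. cyl E (v, [])) = infpaths E"
    by (auto simp: cyl_def src_in_verts)
  ultimately show ?thesis by (simp add: sum_vproj)
qed

end

section \<open>The twisted family\<close>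

locale leavitt_coding = coding E J + leavitt_alg E A
  for E :: "('v, 'e) pre_digraph" and J and A :: "('a, 'v, 'e) graph_alg" (structure)
begin

declare finite_J [simp]

definition u :: 'a where "u = pair_sum A J"

text \<open>The generators are the images of the original ones under the endomorphism. Once they are
  known to satisfy the Leavitt relations, the path calculus applies to them, and
  \<open>path_proj twisted\<close> gives the images of the diagonal projections.\<close>

definition twisted :: "('a, 'v, 'e) graph_alg" where
  "twisted = A\<lparr>eiso := \<lambda>e. u \<otimes> eiso A e\<rparr>"

lemma J_sub: "J \<subseteq> paths E \<times> paths E"
  using J_paths by (auto simp: mem_Times_iff)

lemma u_closed [simp]: "u \<in> carrier A"
  unfolding u_def by (rule pair_sum_closed[OF graph_star_ring_axioms J_sub])

lemma u_eq: "u = (\<Oplus>j\<in>J. pe (fst j) \<otimes> star A (pe (snd j)))"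
  unfolding u_def pair_sum_def by (simp add: case_prod_unfold)

lemma term_closed [simp]:
  "j \<in> J \<Longrightarrow> pe (fst j) \<in> carrier A" "j \<in> J \<Longrightarrow> pe (snd j) \<in> carrier A"
  using J_paths by auto

lemma star_u_eq: "star A u = (\<Oplus>j\<in>J. pe (snd j) \<otimes> star A (pe (fst j)))"
proof -
  have "star A u = (\<Oplus>j\<in>J. star A (pe (fst j) \<otimes> star A (pe (snd j))))"
    unfolding u_eq by (rule star_finsum) auto
  also have "\<dots> = (\<Oplus>j\<in>J. pe (snd j) \<otimes> star A (pe (fst j)))"
    by (rule finsum_cong') (auto simp: star_mult)
  finally show ?thesis .
qed

lemma finsum_single:
  assumes "j \<in> J" "f \<in> J \<rightarrow> carrier A" "\<And>k. k \<in> J \<Longrightarrow> k \<noteq> j \<Longrightarrow> f k = \<zero>"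
  shows "finsum A f J = f j"
proof -
  have "finsum A f J = (\<Oplus>k\<in>J. if j = k then f k else \<zero>)"
    using assms by (intro finsum_cong') auto
  also have "\<dots> = f j" by (rule finsum_singleton[OF assms(1) finite_J assms(2)])
  finally show ?thesis .
qed

lemma range_append:
  assumes "j \<in> J" "(prange E (fst j), fs) \<in> paths E"
  shows "(fst (fst j), snd (fst j) @ fs) \<in> paths E" "(fst (snd j), snd (snd j) @ fs) \<in> paths E"
  using assms J_paths[OF assms(1)] J_range[OF assms(1)] by (auto simp: paths_append)

text \<open>Only the term of \<open>u\<close> belonging to \<open>j\<close> survives: for another
  one, \<open>snd k\<close> would have to be comparable with an extension of \<open>snd j\<close>,
  against the partition by second components.\<close>

lemma u_pe:
  assumes j: "j \<in> J" and fs: "(prange E (fst j), fs) \<in> paths E"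
  shows "u \<otimes> pe (fst (snd j), snd (snd j) @ fs) = pe (fst (fst j), snd (fst j) @ fs)" (is "u \<otimes> pe ?b = _")
proof -
  have b: "?b \<in> paths E" "(fst (fst j), snd (fst j) @ fs) \<in> paths E" using range_append[OF j fs] by auto
  have "u \<otimes> pe ?b = (\<Oplus>k\<in>J. pe (fst k) \<otimes> star A (pe (snd k)) \<otimes> pe ?b)"
    unfolding u_eq using b by (intro finsum_ldistr) auto
  also have "\<dots> = pe (fst j) \<otimes> star A (pe (snd j)) \<otimes> pe ?b"
  proof (rule finsum_single[OF j])
    fix k assume k: "k \<in> J" "k \<noteq> j"
    have "\<not> comparable (snd k) ?b"
    proof
      assume "comparable (snd k) ?b"
      then obtain x where "x \<in> cyl E (snd k)" "x \<in> cyl E ?b"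
        using cyl_disjoint[of "snd k" ?b] J_paths[OF k(1)] b by blast
      then have "x \<in> cyl E (snd k)" "x \<in> cyl E (snd j)"
        using cyl_append_subset[of "fst (snd j)" "snd (snd j)" fs] by auto
      then show False using key_snd_eq k j by metis
    qed
    then show "pe (fst k) \<otimes> star A (pe (snd k)) \<otimes> pe ?b = \<zero>"
      using k b J_paths[OF k(1)] by (simp add: m_assoc pe_orth)
  qed (use b in auto)
  also have "\<dots> = pe (fst j) \<otimes> (star A (pe (fst (snd j), snd (snd j))) \<otimes> pe ?b)"
    using j b by (simp add: m_assoc)
  also have "\<dots> = pe (fst j) \<otimes> pe (prange E (fst j), fs)"
    using star_pe_append[OF b(1)] J_range[OF j] by simp
  also have "\<dots> = pe (fst (fst j), snd (fst j) @ fs)"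
    using pe_append[OF b(2)] by simp
  finally show ?thesis .
qed

lemma star_u_pe:
  assumes j: "j \<in> J" shows "star A u \<otimes> pe (fst j) = pe (snd j)"
proof -
  have "star A u \<otimes> pe (fst j) = (\<Oplus>k\<in>J. pe (snd k) \<otimes> star A (pe (fst k)) \<otimes> pe (fst j))"
    unfolding star_u_eq using j by (intro finsum_ldistr) auto
  also have "\<dots> = pe (snd j) \<otimes> star A (pe (fst j)) \<otimes> pe (fst j)"
  proof (rule finsum_single[OF j])
    fix k assume k: "k \<in> J" "k \<noteq> j"
    have "\<not> comparable (fst k) (fst j)"
    proof
      assume "comparable (fst k) (fst j)"
      then obtain x where "x \<in> cyl E (fst k)" "x \<in> cyl E (fst j)"
        using cyl_disjoint[of "fst k" "fst j"] J_paths[OF k(1)] J_paths[OF j] by blast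
      then show False using key_eq k j by metis
    qed
    then show "pe (snd k) \<otimes> star A (pe (fst k)) \<otimes> pe (fst j) = \<zero>"
      using k j J_paths[OF k(1)] J_paths[OF j] by (simp add: m_assoc pe_orth)
  qed (use j in auto)
  also have "\<dots> = pe (snd j) \<otimes> P (prange E (snd j))"
    using j J_paths[OF j] pe_iso[of "fst (fst j)" "snd (fst j)"] J_range[OF j] by (simp add: m_assoc)
  also have "\<dots> = pe (snd j)"
    using pe_vproj[of "fst (snd j)" "snd (snd j)"] J_paths[OF j] by simp
  finally show ?thesis .
qed

text \<open>The cylinders of first components partition the path space, so their projections sum to
  1. The argument works in every algebra satisfying the relations and hence also in the completed
  one.\<close>

lemma u_star_u: "u \<otimes> star A u = \<one>"
proof -
  have "u \<otimes> star A u = (\<Oplus>j\<in>J. u \<otimes> (pe (snd j) \<otimes> star A (pe (fst j))))"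
    unfolding star_u_eq by (intro finsum_rdistr) auto
  also have "\<dots> = (\<Oplus>j\<in>J. pp (fst j))"
  proof (rule finsum_cong')
    fix j assume j: "j \<in> J"
    have "(prange E (fst j), []) \<in> paths E"
      using J_paths[OF j] prange_in_verts[of "fst (fst j)" "snd (fst j)"] by simp
    from u_pe[OF j this] have "u \<otimes> pe (snd j) = pe (fst j)" by simp
    then show "u \<otimes> (pe (snd j) \<otimes> star A (pe (fst j))) = pp (fst j)"
      using j by (simp add: m_assoc[symmetric] path_proj_def)
  qed (use J_paths in auto)
  also have "\<dots> = \<one>"
  proof (rule clopen_proj_unique[OF _ clopen_proj_one])
    have "clopen_proj 0 (\<Union>j\<in>J. cyl E (fst j)) (\<Oplus>j\<in>J. pp (fst j))"
      using key_eq J_paths by (intro clopen_proj_UN[OF finite_J] clopen_proj_cyl) (blast, simp, blast)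
    moreover have "(\<Union>j\<in>J. cyl E (fst j)) = infpaths E"
      using key cyl_infpaths by blast
    ultimately show "clopen_proj 0 (infpaths E) (\<Oplus>j\<in>J. pp (fst j))" by simp
  qed
  finally show ?thesis .
qed

lemma star_u_u: "star A u \<otimes> u = \<one>"
proof -
  have "star A u \<otimes> u = (\<Oplus>j\<in>J. star A u \<otimes> (pe (fst j) \<otimes> star A (pe (snd j))))"
    using finsum_rdistr[of J "star A u" "\<lambda>j. pe (fst j) \<otimes> star A (pe (snd j))"] by (simp add: u_eq[symmetric] Pi_iff)
  also have "\<dots> = (\<Oplus>j\<in>J. pp (snd j))"
  proof (rule finsum_cong')
    fix j assume j: "j \<in> J"
    then show "star A u \<otimes> (pe (fst j) \<otimes> star A (pe (snd j))) = pp (snd j)"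
      using star_u_pe[OF j] by (simp add: m_assoc[symmetric] path_proj_def)
  qed (use J_paths in auto)
  also have "\<dots> = \<one>"
  proof (rule clopen_proj_unique[OF _ clopen_proj_one])
    have "clopen_proj 0 (\<Union>j\<in>J. cyl E (snd j)) (\<Oplus>j\<in>J. pp (snd j))"
      using key_snd_eq J_paths by (intro clopen_proj_UN[OF finite_J] clopen_proj_cyl) (blast, simp, blast)
    moreover have "(\<Union>j\<in>J. cyl E (snd j)) = infpaths E"
      using key_snd cyl_infpaths by blast
    ultimately show "clopen_proj 0 (infpaths E) (\<Oplus>j\<in>J. pp (snd j))" by simp
  qed
  finally show ?thesis .
qed

text \<open>Each term of \<open>u\<close> has the common source of its pair as left and right
  support.\<close>

lemma u_vproj:
  assumes v: "v \<in> verts E" shows "u \<otimes> P v = P v \<otimes> u"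
proof -
  have o: "P v \<otimes> pe \<beta> = (if fst \<beta> = v then pe \<beta> else \<zero>)" if "\<beta> \<in> paths E" for \<beta>
    using that v vproj_pe[of "fst \<beta>" "snd \<beta>"] pe_orth[of "(v, [])" \<beta>] by (auto simp: pe_Nil comparable_def)
  have o': "star A (pe \<beta>) \<otimes> P v = (if fst \<beta> = v then star A (pe \<beta>) else \<zero>)" if "\<beta> \<in> paths E" for \<beta>
    using arg_cong[OF o[OF that], of "star A"] that v by (simp add: star_mult split: if_splits)
  have "u \<otimes> P v = (\<Oplus>j\<in>J. pe (fst j) \<otimes> star A (pe (snd j)) \<otimes> P v)"
    unfolding u_eq using v by (intro finsum_ldistr) auto
  also have "\<dots> = (\<Oplus>j\<in>J. P v \<otimes> (pe (fst j) \<otimes> star A (pe (snd j))))"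
  proof (rule finsum_cong')
    fix j assume j: "j \<in> J"
    have "pe (fst j) \<otimes> star A (pe (snd j)) \<otimes> P v = pe (fst j) \<otimes> (star A (pe (snd j)) \<otimes> P v)"
      using j v by (simp add: m_assoc)
    also have "\<dots> = P v \<otimes> pe (fst j) \<otimes> star A (pe (snd j))"
      using o[of "fst j"] o'[of "snd j"] J_paths[OF j] J_source[OF j] j by simp
    finally show "pe (fst j) \<otimes> star A (pe (snd j)) \<otimes> P v = P v \<otimes> (pe (fst j) \<otimes> star A (pe (snd j)))"
      using j v by (simp add: m_assoc)
  qed (use v in auto)
  also have "\<dots> = P v \<otimes> u"
    using finsum_rdistr[of J "P v" "\<lambda>j. pe (fst j) \<otimes> star A (pe (snd j))"] v by (simp add: u_eq[symmetric] Pi_iff)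
  finally show ?thesis .
qed

lemma twisted_simps [simp]:
  "carrier twisted = carrier A" "mult twisted = mult A" "one twisted = \<one>" "zero twisted = \<zero>"
  "add twisted = add A" "star twisted = star A" "vproj twisted = P" "eiso twisted e = u \<otimes> S e"
  by (simp_all add: twisted_def)

lemma twisted_finsum [simp]: "finsum twisted f I = finsum A f I"
  by (rule finsum_record_cong) auto

lemma twisted_minus [simp]: "a_minus twisted x y = a_minus A x y"
  by (rule a_minus_record_cong) auto

lemma twisted_sum:
  assumes "v \<in> verts E"
  shows "(\<Oplus>e\<in>out_arcs E v. u \<otimes> S e \<otimes> star A (u \<otimes> S e)) = P v"
proof -
  have "(\<Oplus>e\<in>out_arcs E v. u \<otimes> S e \<otimes> star A (u \<otimes> S e)) = (\<Oplus>e\<in>out_arcs E v. u \<otimes> (S e \<otimes> T e) \<otimes> star A u)"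
    by (rule finsum_cong') (auto simp: star_mult m_assoc)
  also have "\<dots> = (\<Oplus>e\<in>out_arcs E v. u \<otimes> (S e \<otimes> T e)) \<otimes> star A u"
    by (rule finsum_ldistr[symmetric]) auto
  also have "\<dots> = u \<otimes> (\<Oplus>e\<in>out_arcs E v. S e \<otimes> T e) \<otimes> star A u"
    by (rule arg_cong[of _ _ "\<lambda>x. x \<otimes> star A u"], rule finsum_rdistr[symmetric]) auto
  also have "\<dots> = u \<otimes> P v \<otimes> star A u" using vproj_expand[OF assms] by simp
  also have "\<dots> = P v"
    using assms by (simp add: u_vproj m_assoc u_star_u)
  finally show ?thesis .
qed

sublocale tw: leavitt_alg E twisted
proof -
  interpret tw: ring twisted by (rule ring_cong[OF ring_axioms]) auto
  \<comment> \<open>The unitary cancels in the middle of every product of an adjoint with a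
    generator, so these relations reduce to the untwisted ones.\<close>
  have mid: "T e \<otimes> star A u \<otimes> (u \<otimes> x) = T e \<otimes> x" if "e \<in> arcs E" "x \<in> carrier A" for e x
  proof -
    have "T e \<otimes> star A u \<otimes> (u \<otimes> x) = T e \<otimes> (star A u \<otimes> u) \<otimes> x" using that by (simp add: m_assoc)
    then show ?thesis using that by (simp add: star_u_u)
  qed
  have star_u_P: "star A u \<otimes> P v = P v \<otimes> star A u" if "v \<in> verts E" for v
    using arg_cong[OF u_vproj[OF that], of "star A"] that by (simp add: star_mult)
  have a1: "P (tail E e) \<otimes> (u \<otimes> S e) = u \<otimes> S e" if "e \<in> arcs E" for e
    using that by (simp add: m_assoc[symmetric] u_vproj[symmetric]) (simp add: m_assoc)
  have a2: "T e \<otimes> star A u \<otimes> P (tail E e) = T e \<otimes> star A u" if "e \<in> arcs E" for e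
    using that by (simp add: m_assoc star_u_P) (simp add: m_assoc[symmetric])
  show "leavitt_alg E twisted"
  proof unfold_locales
    show "leavitt_rels twisted E \<subseteq> {\<zero>\<^bsub>twisted\<^esub>}"
      unfolding leavitt_rels_subset singleton_iff
      using twisted_sum sum_closed
      by (auto simp: minus_eq_zero_iff sum_vproj star_mult vproj_orth mid eiso_orth a1 a2 m_assoc[symmetric, of "P (head E _)"]
          m_assoc[of u "S _" "P (head E _)"] vproj_expand[symmetric])
  qed (auto simp: star_add star_mult)
qed

text \<open>A cylinder at least this long lies in the cylinder of a single second component. The
  inserted 0 keeps the maximum meaningful for an empty \<open>J\<close>.\<close>

definition long :: nat where "long = Max (insert 0 ((\<lambda>j. length (snd (snd j))) ` J))"

text \<open>On a long cylinder conjugation by \<open>u\<close> replaces the prefix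
  \<open>snd j\<close> by \<open>fst j\<close>, which is what \<open>Umap\<close> does to its
  points.\<close>

lemma clopen_proj_u: "clopen_proj long Y d \<Longrightarrow> clopen_proj 0 (Umap ` Y) (u \<otimes> d \<otimes> star A u)"
proof (induction rule: clopen_proj.induct)
  case empty
  then show ?case by (simp add: clopen_proj.empty)
next
  case (insert Y d \<beta>)
  obtain x where x: "x \<in> cyl E \<beta>" using cyl_not_empty insert.hyps by blast
  then have xi: "x \<in> infpaths E" by (rule cyl_infpaths)
  define j where "j = key_snd x"
  have j: "j \<in> J" "x \<in> cyl E (snd j)" using key_snd[OF xi] by (auto simp: j_def)
  have c: "comparable (snd j) \<beta>" using cyl_comparable[OF j(2) x] .
  have "length (snd (snd j)) \<le> long" unfolding long_def using j finite_J by (intro Max_ge) auto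
  then have "length (snd (snd j)) \<le> length (snd \<beta>)" using insert.hyps(3) by simp
  then have "prefix (snd (snd j)) (snd \<beta>)"
    using c by (auto simp: comparable_def prefix_def)
  then obtain fs where fs: "\<beta> = (fst (snd j), snd (snd j) @ fs)"
    using c by (auto simp: comparable_def prefix_def prod_eq_iff)
  have p: "(prange E (fst j), fs) \<in> paths E"
    using insert.hyps(2) J_range[OF j(1)] fs paths_append[of "fst (snd j)" "snd (snd j)" fs] by simp
  let ?c = "(fst (fst j), snd (fst j) @ fs)"
  have pc: "?c \<in> paths E" using range_append[OF j(1) p] by simp
  have "u \<otimes> pp \<beta> \<otimes> star A u = (u \<otimes> pe \<beta>) \<otimes> star A (u \<otimes> pe \<beta>)"
    using insert.hyps by (simp add: path_proj_def star_mult m_assoc)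
  then have upp: "u \<otimes> pp \<beta> \<otimes> star A u = pp ?c"
    using u_pe[OF j(1) p] fs by (simp add: path_proj_def)
  have img: "Umap ` cyl E \<beta> = cyl E ?c"
  proof -
    have pr: "prange E \<beta> = prange E (prange E (fst j), fs)" "prange E ?c = prange E (prange E (fst j), fs)"
      using fs J_range[OF j(1)] prange_append[of E "fst (snd j)" "snd (snd j)" fs]
        prange_append[of E "fst (fst j)" "snd (fst j)" fs] by simp_all
    let ?D = "{y \<in> infpaths E. src E y = prange E (prange E (fst j), fs)}"
    have U: "Umap (snd \<beta> @- y) = snd ?c @- y" if "y \<in> ?D" for y
      using Umap_shift[OF j(1), of "fs @- y"] shift_infpaths[OF p, of y] that fs by simp
    have cb: "cyl E \<gamma> = (\<lambda>y. snd \<gamma> @- y) ` {y \<in> infpaths E. src E y = prange E \<gamma>}"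
      if "\<gamma> \<in> paths E" for \<gamma>
      using cyl_iff[OF that] by (simp add: set_eq_iff image_iff) blast
    show ?thesis
      unfolding cb[OF insert.hyps(2)] cb[OF pc] pr image_image by (rule image_cong[OF refl U])
  qed
  have "Umap ` cyl E \<beta> \<inter> Umap ` Y = {}"
  proof (rule ccontr)
    assume "Umap ` cyl E \<beta> \<inter> Umap ` Y \<noteq> {}"
    then obtain a b where ab: "a \<in> cyl E \<beta>" "b \<in> Y" "Umap a = Umap b" by blast
    then have "a = b" using Vmap_Umap cyl_infpaths clopen_proj_infpaths[OF insert.hyps(1)] by (metis subsetD)
    then show False using ab insert.hyps by blast
  qed
  then have "clopen_proj 0 (cyl E ?c \<union> Umap ` Y) (pp ?c \<oplus> u \<otimes> d \<otimes> star A u)"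
    using clopen_proj.insert[OF insert.IH pc] img by simp
  moreover have "u \<otimes> (pp \<beta> \<oplus> d) \<otimes> star A u = pp ?c \<oplus> u \<otimes> d \<otimes> star A u"
    using upp insert.hyps clopen_proj_closed by (simp add: r_distr l_distr)
  ultimately show ?case by (simp add: image_Un img)
qed

text \<open>\<open>Vmap x\<close> is the first letter of the itinerary followed by
  \<open>Tmap x\<close>, and \<open>Umap\<close> solves this for \<open>x\<close>. The two outer
  maps are those that conjugation by \<open>S e\<close> and then by \<open>u\<close> induces on
  sets.\<close>

lemma itinerary_vimage_Cons:
  assumes "(v, e # es) \<in> paths E"
  shows "{x \<in> infpaths E. itinerary x \<in> cyl E (v, e # es)} =
    Umap ` (\<lambda>x. e ## x) ` {x \<in> {x \<in> infpaths E. itinerary x \<in> cyl E (head E e, es)}. src E x = head E e}"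
    (is "?L = Umap ` ?R")
proof (intro equalityI subsetI)
  fix x assume "x \<in> ?L"
  then have x: "x \<in> infpaths E" "itinerary x \<in> cyl E (v, e # es)" by auto
  have e: "first_edge (key x) = e" "stake (length es) (itinerary (Tmap x)) = es"
    using x(2) itinerary_SCons[of x] by (auto simp: cyl_def)
  have V: "Vmap x = e ## Tmap x" using shd_Vmap[OF x(1)] e by (metis Tmap_def stream.collapse)
  have T: "Tmap x \<in> infpaths E" "src E (Tmap x) = head E e"
    using Tmap_infpaths[OF x(1)] Vmap_infpaths[OF x(1)] V by (auto simp: infpaths_SCons)
  have "itinerary (Tmap x) \<in> cyl E (head E e, es)"
    using itinerary_infpaths(1)[OF T(1)] src_itinerary[OF T(1)] T(2) e(2) by (simp add: cyl_def)
  then have R: "e ## Tmap x \<in> ?R" using T by blast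
  have "x = Umap (e ## Tmap x)" using Umap_Vmap[OF x(1)] unfolding V by (rule sym)
  then show "x \<in> Umap ` ?R" using R by (rule image_eqI)
next
  fix x assume "x \<in> Umap ` ?R"
  then obtain y where y: "y \<in> infpaths E" "itinerary y \<in> cyl E (head E e, es)" "src E y = head E e"
    "x = Umap (e ## y)" by auto
  have ey: "e ## y \<in> infpaths E" using y assms by (simp add: infpaths_SCons)
  have x: "x \<in> infpaths E" using Umap_infpaths[OF ey] y(4) by simp
  have V: "Vmap x = e ## y" using Vmap_Umap[OF ey] y(4) by simp
  then have "itinerary x = e ## itinerary y"
    using itinerary_SCons[of x] shd_Vmap[OF x] by (simp add: Tmap_def)
  then have "itinerary x \<in> cyl E (v, e # es)"
    using y(2) itinerary_infpaths(1)[OF x] assms by (auto simp: cyl_def)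
  then show "x \<in> ?L" using x by blast
qed

text \<open>The duality between the endomorphism and the itinerary: the image of a diagonal
  projection is the projection of the preimage of its cylinder.\<close>

lemma clopen_proj_twisted:
  "(v, es) \<in> paths E \<Longrightarrow>
   clopen_proj 0 {x \<in> infpaths E. itinerary x \<in> cyl E (v, es)} (path_proj twisted (v, es))"
proof (induction es arbitrary: v)
  case Nil
  have "{x \<in> infpaths E. itinerary x \<in> cyl E (v, [])} = cyl E (v, [])"
    using itinerary_infpaths src_itinerary by (auto simp: cyl_def)
  then show ?case using clopen_proj_cyl[of "(v, [])" 0] Nil by (simp add: pp_Nil tw.pp_Nil)
next
  case (Cons e es)
  then have p: "e \<in> arcs E" "(head E e, es) \<in> paths E" by auto
  let ?d = "path_proj twisted (head E e, es)"
  have d: "?d \<in> carrier A" using tw.pp_closed[OF p(2)] by simp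
  have "path_proj twisted (v, e # es) = u \<otimes> (S e \<otimes> ?d \<otimes> T e) \<otimes> star A u"
    using tw.pp_Cons[OF Cons.prems] p d by (simp add: star_mult m_assoc)
  then show ?case
    unfolding itinerary_vimage_Cons[OF Cons.prems]
    using clopen_proj_u[OF clopen_proj_refine[OF clopen_proj_eiso[OF p(1) Cons.IH[OF p(2)]]]] by simp
qed

lemma twisted_proj:
  assumes "w \<in> paths E"
  obtains B where "finite B" "B \<subseteq> paths E" "path_proj twisted w = (\<Oplus>\<beta>\<in>B. pp \<beta>)"
    "{x \<in> infpaths E. itinerary x \<in> cyl E w} = (\<Union>\<beta>\<in>B. cyl E \<beta>)"
    "\<forall>\<beta>\<in>B. \<forall>\<gamma>\<in>B. \<beta> \<noteq> \<gamma> \<longrightarrow> cyl E \<beta> \<inter> cyl E \<gamma> = {}"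
  using clopen_proj_repr[OF clopen_proj_twisted[of "fst w" "snd w"]] assms by auto

lemma determined_proj:
  assumes \<beta>: "\<beta> \<in> paths E" and "determined \<beta>"
  obtains W where "finite W" "W \<subseteq> paths E" "pp \<beta> = (\<Oplus>w\<in>W. path_proj twisted w)"
proof -
  obtain N where N: "\<And>x y. x \<in> infpaths E \<Longrightarrow> y \<in> infpaths E \<Longrightarrow>
     stake N (itinerary x) = stake N (itinerary y) \<Longrightarrow> x \<in> cyl E \<beta> \<longleftrightarrow> y \<in> cyl E \<beta>"
    using assms(2) unfolding determined_def by blast
  \<comment> \<open>The words of length \<open>N\<close> with which itineraries of points of the
    cylinder begin; by the choice of \<open>N\<close> no point outside produces one of them.\<close>
  define W where "W = {w \<in> lev N. \<exists>x\<in>cyl E \<beta>. itinerary x \<in> cyl E w}"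
  let ?Y = "\<lambda>w. {x \<in> infpaths E. itinerary x \<in> cyl E w}"
  have W: "finite W" "W \<subseteq> paths E"
    by (rule finite_subset[OF _ finite_lev[of N]]) (auto simp: W_def lev_def)
  have "clopen_proj 0 (\<Union>w\<in>W. ?Y w) (\<Oplus>w\<in>W. path_proj twisted w)"
  proof (rule clopen_proj_UN[OF W(1)])
    show "clopen_proj 0 (?Y w) (path_proj twisted w)" if "w \<in> W" for w
      using clopen_proj_twisted[of "fst w" "snd w"] W that by auto
    show "?Y w \<inter> ?Y w' = {}" if "w \<in> W" "w' \<in> W" "w \<noteq> w'" for w w'
      using that comparable_same_length[of w w'] cyl_comparable[of "itinerary _" E w w'] by (fastforce simp: W_def lev_def)
  qed
  moreover have "(\<Union>w\<in>W. ?Y w) = cyl E \<beta>"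
  proof (intro equalityI subsetI)
    fix x assume "x \<in> (\<Union>w\<in>W. ?Y w)"
    then obtain w y where w: "w \<in> lev N" "y \<in> cyl E \<beta>" "itinerary y \<in> cyl E w" "x \<in> infpaths E" "itinerary x \<in> cyl E w"
      by (auto simp: W_def)
    then have "stake N (itinerary x) = stake N (itinerary y)" by (auto simp: cyl_def lev_def)
    then show "x \<in> cyl E \<beta>" using N w cyl_infpaths by blast
  next
    fix x assume x: "x \<in> cyl E \<beta>"
    then have xi: "x \<in> infpaths E" by (rule cyl_infpaths)
    let ?w = "(src E (itinerary x), stake N (itinerary x))"
    have "?w \<in> lev N" using stake_path[OF itinerary_infpaths(1)[OF xi]] by (simp add: lev_def)
    moreover have "itinerary x \<in> cyl E ?w" using in_cyl_stake[OF itinerary_infpaths(1)[OF xi]] .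
    ultimately show "x \<in> (\<Union>w\<in>W. ?Y w)" using x xi unfolding W_def by blast
  qed
  ultimately have "pp \<beta> = (\<Oplus>w\<in>W. path_proj twisted w)"
    using clopen_proj_unique[OF clopen_proj_cyl[OF \<beta>, of 0]] by simp
  then show ?thesis using W that by blast
qed

end

section \<open>Quotients\<close>

lemma (in ring) ideal_intro:
  assumes sub: "I \<subseteq> carrier R" and zero: "\<zero> \<in> I"
    and add: "\<And>a b. a \<in> I \<Longrightarrow> b \<in> I \<Longrightarrow> a \<oplus> b \<in> I"
    and left: "\<And>a x. a \<in> I \<Longrightarrow> x \<in> carrier R \<Longrightarrow> x \<otimes> a \<in> I"
    and right: "\<And>a x. a \<in> I \<Longrightarrow> x \<in> carrier R \<Longrightarrow> a \<otimes> x \<in> I"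
  shows "ideal I R"
proof (rule idealI[OF ring_axioms])
  have neg: "\<ominus> a \<in> I" if a: "a \<in> I" for a
  proof -
    have "\<ominus> a = \<ominus> \<one> \<otimes> a" using a sub by (auto simp: l_minus)
    then show ?thesis using left[OF a, of "\<ominus> \<one>"] by simp
  qed
  show "subgroup I (add_monoid R)"
    by (rule subgroup.intro) (use sub zero add neg in \<open>auto simp: a_inv_def[symmetric]\<close>)
qed (use left right in auto)

text \<open>With \<open>X\<close> the zero set it carries relations into quotients; with the twisted
  family as target it shows that relations lie in a kernel.\<close>

lemma (in graph_hom_ctx) leavitt_rels_vimage:
  "leavitt_rels A E \<subseteq> {x. h x \<in> X} \<longleftrightarrow> leavitt_rels B E \<subseteq> X"
proof -
  have [simp]: "(\<Oplus>\<^bsub>A\<^esub>v\<in>verts E. vproj A v) \<in> carrier A"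
    "(\<Oplus>\<^bsub>A\<^esub>e\<in>out_arcs E v. eiso A e \<otimes>\<^bsub>A\<^esub> star A (eiso A e)) \<in> carrier A" for v
    by (auto intro!: A.finsum_closed)
  show ?thesis
    unfolding leavitt_rels_subset mem_Collect_eq
    by (intro conj_cong ball_cong refl imp_cong)
      (simp_all add: hom_minus hom_star hom_vproj hom_eiso hom_sum_vproj hom_sum_eiso)
qed

lemma (in graph_hom_ctx) ck_rels_vimage:
  "ck_rels A E \<subseteq> {x. h x \<in> X} \<longleftrightarrow> ck_rels B E \<subseteq> X"
proof -
  have [simp]: "(\<Oplus>\<^bsub>A\<^esub>v\<in>verts E. vproj A v) \<in> carrier A"
    "(\<Oplus>\<^bsub>A\<^esub>e\<in>out_arcs E v. eiso A e \<otimes>\<^bsub>A\<^esub> star A (eiso A e)) \<in> carrier A" for v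
    by (auto intro!: A.finsum_closed)
  show ?thesis
    unfolding ck_rels_subset mem_Collect_eq
    by (intro conj_cong ball_cong refl imp_cong)
      (simp_all add: hom_minus hom_star hom_vproj hom_eiso hom_sum_vproj hom_sum_eiso)
qed

locale star_quotient = wf_digraph E + A: graph_star_ring E A + ideal I A
  for E :: "('v, 'e) pre_digraph" and A :: "('a, 'v, 'e) graph_alg" (structure) and I +
  assumes star_ideal: "x \<in> I \<Longrightarrow> star A x \<in> I"
begin

abbreviation "Qt \<equiv> quot_alg A I"
abbreviation "q \<equiv> a_r_coset A I"

lemma quot_simps:
  "carrier Qt = a_rcosets I" "mult Qt = rcoset_mult A I" "one Qt = I +> \<one>" "zero Qt = I"
  "add Qt = set_add A" "star Qt X = star A ` X" "vproj Qt v = I +> vproj A v" "eiso Qt e = I +> eiso A e"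
  by (simp_all add: quot_alg_def ring.extend_def graph_alg.fields_def FactRing_def)

lemma quot_carrier: "X \<in> carrier Qt \<longleftrightarrow> (\<exists>x\<in>carrier A. X = q x)"
  unfolding quot_simps(1) A_RCOSETS_def' by auto

lemma quot_carrierE:
  assumes "X \<in> carrier Qt" obtains x where "x \<in> carrier A" "X = q x"
  using assms quot_carrier by blast

lemma q_closed [simp]: "x \<in> carrier A \<Longrightarrow> q x \<in> carrier Qt"
  using quot_carrier by blast

lemma quot_ring: "ring Qt"
  by (rule ring_cong[OF quotient_is_ring]) (simp_all add: quot_simps FactRing_def)

lemma q_hom: "q \<in> ring_hom A Qt"
  using rcos_ring_hom by (simp add: ring_hom_def quot_simps FactRing_def)

lemma q_memb: "y \<in> q x \<longleftrightarrow> (\<exists>h\<in>I. y = h \<oplus> x)"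
  by (auto simp: a_r_coset_def')

lemma star_q: "x \<in> carrier A \<Longrightarrow> star A ` (q x) = q (star A x)"
proof (intro equalityI subsetI)
  fix y assume x: "x \<in> carrier A" and "y \<in> star A ` (q x)"
  then obtain h where h: "h \<in> I" "y = star A (h \<oplus> x)" by (auto simp: q_memb)
  then show "y \<in> q (star A x)" using x star_ideal Icarr by (auto simp: q_memb A.star_add)
next
  fix y assume x: "x \<in> carrier A" and "y \<in> q (star A x)"
  then obtain h where h: "h \<in> I" "y = h \<oplus> star A x" by (auto simp: q_memb)
  then have "y = star A (star A h \<oplus> x)" using x Icarr by (simp add: A.star_add)
  moreover have "star A h \<oplus> x \<in> q x" using h star_ideal by (auto simp: q_memb)
  ultimately show "y \<in> star A ` (q x)" by blast
qed

sublocale Qt: graph_star_ring E Qt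
proof -
  interpret Q: ring Qt by (rule quot_ring)
  have hom: "q (x \<oplus> y) = q x \<oplus>\<^bsub>Qt\<^esub> q y" "q (x \<otimes> y) = q x \<otimes>\<^bsub>Qt\<^esub> q y" if "x \<in> carrier A" "y \<in> carrier A" for x y
    using q_hom that by (auto simp: ring_hom_def)
  show "graph_star_ring E Qt"
  proof unfold_locales
    fix X assume X: "X \<in> carrier Qt"
    then obtain x where x: "x \<in> carrier A" "X = q x" by (rule quot_carrierE)
    show "star Qt X \<in> carrier Qt" using x by (simp only: quot_simps(6) star_q) simp
    show "star Qt (star Qt X) = X" using x by (simp add: quot_simps(6) star_q)
  next
    fix X Y assume "X \<in> carrier Qt" "Y \<in> carrier Qt"
    then obtain x y where x: "x \<in> carrier A" "X = q x" and y: "y \<in> carrier A" "Y = q y"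
      by (elim quot_carrierE)
    show "star Qt (X \<oplus>\<^bsub>Qt\<^esub> Y) = star Qt X \<oplus>\<^bsub>Qt\<^esub> star Qt Y"
      using x y by (simp only: quot_simps(6) hom[symmetric] star_q A.a_closed A.star_closed A.star_add)
    show "star Qt (X \<otimes>\<^bsub>Qt\<^esub> Y) = star Qt Y \<otimes>\<^bsub>Qt\<^esub> star Qt X"
      using x y by (simp only: quot_simps(6) hom[symmetric] star_q A.m_closed A.star_closed A.star_mult)
  next
    fix v assume "v \<in> verts E"
    then show "vproj Qt v \<in> carrier Qt" "star Qt (vproj Qt v) = vproj Qt v"
      by (simp_all only: quot_simps(6,7) star_q A.vproj_closed A.star_vproj q_closed)
  next
    fix e assume "e \<in> arcs E"
    then show "eiso Qt e \<in> carrier Qt" by (simp only: quot_simps(8) A.eiso_closed q_closed)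
  qed
qed

sublocale qh: graph_hom_ctx E A Qt q
  by unfold_locales (auto simp: graph_hom_def q_hom quot_simps(6-8) star_q)

lemma q_eq_zero: "x \<in> carrier A \<Longrightarrow> q x = \<zero>\<^bsub>Qt\<^esub> \<longleftrightarrow> x \<in> I"
proof
  assume x: "x \<in> carrier A" and "q x = \<zero>\<^bsub>Qt\<^esub>"
  then have "q x = I" by (simp add: quot_simps)
  moreover have "x \<in> q x" unfolding q_memb using x additive_subgroup.zero_closed[OF is_additive_subgroup]
    by (intro bexI[of _ \<zero>]) auto
  ultimately show "x \<in> I" by simp
qed (simp add: quot_simps a_rcos_const)

lemma q_eq_iff: "x \<in> carrier A \<Longrightarrow> y \<in> carrier A \<Longrightarrow> q x = q y \<longleftrightarrow> x \<ominus> y \<in> I"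
  using q_eq_zero[of "x \<ominus> y"] qh.hom_minus[of x y] Qt.minus_eq_zero_iff[of "q x" "q y"] by simp

text \<open>The representative is arbitrary, and the value is independent of it when
  \<open>h\<close> kills \<open>I\<close>. Restriction to the carrier makes the map extensional, as
  the endomorphisms to be identified are.\<close>

definition induced :: "('a \<Rightarrow> 'b) \<Rightarrow> 'a set \<Rightarrow> 'b" where
  "induced h = restrict (\<lambda>X. h (SOME x. x \<in> carrier A \<and> X = q x)) (carrier Qt)"

lemma induced_q:
  assumes "graph_hom_ctx E A B h" and "\<And>x. x \<in> I \<Longrightarrow> h x = \<zero>\<^bsub>B\<^esub>" and x: "x \<in> carrier A"
  shows "induced h (q x) = h x"
proof -
  interpret h: graph_hom_ctx E A B h by fact
  define y where "y = (SOME y. y \<in> carrier A \<and> q x = q y)"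
  have y: "y \<in> carrier A" "q x = q y"
    using someI[of "\<lambda>y. y \<in> carrier A \<and> q x = q y" x] x by (auto simp: y_def)
  then have "h (x \<ominus> y) = \<zero>\<^bsub>B\<^esub>" using x q_eq_iff assms(2) by blast
  then have "h x = h y" using x y by (simp add: h.hom_minus h.B.minus_eq_zero_iff)
  then show ?thesis using x by (simp add: induced_def y_def)
qed

lemma induced_hom:
  assumes h: "graph_hom_ctx E A B h" and I: "\<And>x. x \<in> I \<Longrightarrow> h x = \<zero>\<^bsub>B\<^esub>"
  shows "induced h \<in> graph_hom E Qt B"
proof -
  interpret h: graph_hom_ctx E A B h by fact
  have iq: "induced h (q x) = h x" if "x \<in> carrier A" for x
    by (rule induced_q[OF h _ that]) (rule I)
  have "induced h \<in> ring_hom Qt B"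
  proof (rule ring_hom_memI)
    fix X Y assume "X \<in> carrier Qt" "Y \<in> carrier Qt"
    then obtain x y where x: "x \<in> carrier A" "X = q x" and y: "y \<in> carrier A" "Y = q y"
      by (elim quot_carrierE)
    show "induced h (X \<otimes>\<^bsub>Qt\<^esub> Y) = induced h X \<otimes>\<^bsub>B\<^esub> induced h Y"
      using x y by (simp add: iq qh.hom_mult[symmetric] del: qh.hom_mult)
    show "induced h (X \<oplus>\<^bsub>Qt\<^esub> Y) = induced h X \<oplus>\<^bsub>B\<^esub> induced h Y"
      using x y by (simp add: iq qh.hom_add[symmetric] del: qh.hom_add)
    show "induced h X \<in> carrier B" using x by (simp add: iq)
  next
    show "induced h \<one>\<^bsub>Qt\<^esub> = \<one>\<^bsub>B\<^esub>" using iq[OF A.one_closed] by simp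
  qed
  moreover have "induced h (star Qt X) = star B (induced h X)" if X: "X \<in> carrier Qt" for X
  proof -
    obtain x where x: "x \<in> carrier A" "X = q x" using X by (rule quot_carrierE)
    then show ?thesis using iq h.hom_star by (simp add: quot_simps(6) star_q)
  qed
  ultimately show ?thesis
    using iq h.hom_vproj h.hom_eiso by (auto simp: graph_hom_def quot_simps(7,8))
qed

end

section \<open>The representation on functions of infinite paths\<close>

text \<open>On point masses \<open>S_e\<close> prepends \<open>e\<close> and its adjoint removes it.
  The tests for \<open>infpaths E\<close> are there because a stream of edges need not be a
  path.\<close>

fun gen_op :: "('v, 'e) pre_digraph \<Rightarrow> ('v, 'e) gen \<Rightarrow> ('e stream \<Rightarrow> 'k) \<Rightarrow> 'e stream \<Rightarrow> 'k::comm_ring_1" where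
  "gen_op E (GP v) \<xi> x = (if x \<in> infpaths E \<and> src E x = v then \<xi> x else 0)"
| "gen_op E (GS e) \<xi> x = (if x \<in> infpaths E \<and> shd x = e then \<xi> (stl x) else 0)"
| "gen_op E (GSstar e) \<xi> x = (if x \<in> infpaths E \<and> src E x = head E e then \<xi> (e ## x) else 0)"

definition word_op :: "('v, 'e) pre_digraph \<Rightarrow> ('v, 'e) gen list \<Rightarrow> ('e stream \<Rightarrow> 'k) \<Rightarrow> 'e stream \<Rightarrow> 'k::comm_ring_1" where
  "word_op E w \<xi> = foldr (gen_op E) w \<xi>"

definition op :: "('v, 'e) pre_digraph \<Rightarrow> (('v, 'e) gen list \<Rightarrow> 'k) \<Rightarrow> ('e stream \<Rightarrow> 'k) \<Rightarrow> 'e stream \<Rightarrow> 'k::comm_ring_1" where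
  "op E f \<xi> = lext f (\<lambda>w. word_op E w \<xi>)"

definition pathfun :: "('v, 'e) pre_digraph \<Rightarrow> ('e stream \<Rightarrow> 'k::zero) set" where
  "pathfun E = {\<xi>. \<forall>x. x \<notin> infpaths E \<longrightarrow> \<xi> x = 0}"

lemma gen_op_sum: "finite S \<Longrightarrow> gen_op E a (\<lambda>y. \<Sum>s\<in>S. c s * \<eta> s y) = (\<lambda>x. \<Sum>s\<in>S. c s * gen_op E a (\<eta> s) x)"
  by (rule ext) (cases a; auto)

lemma word_op_sum: "finite S \<Longrightarrow> word_op E w (\<lambda>y. \<Sum>s\<in>S. c s * \<eta> s y) = (\<lambda>x. \<Sum>s\<in>S. c s * word_op E w (\<eta> s) x)"
proof (induction w)
  case (Cons a w)
  then show ?case using gen_op_sum[of S E a c "\<lambda>s. word_op E w (\<eta> s)"] by (simp add: word_op_def)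
qed (simp add: word_op_def)

lemma word_op_append: "word_op E (u @ v) \<xi> = word_op E u (word_op E v \<xi>)"
  by (simp add: word_op_def)

lemma op_conv:
  assumes "finite {w. f w \<noteq> 0}" "finite {w. g w \<noteq> 0}"
  shows "op E (conv f g) \<xi> = op E f (op E g \<xi>)"
proof
  fix x
  have "op E (conv f g) \<xi> x = (\<Sum>u | f u \<noteq> 0. \<Sum>v | g v \<noteq> 0. f u * g v * word_op E u (word_op E v \<xi>) x)"
    unfolding op_def lext_conv[OF assms] word_op_append ..
  also have "\<dots> = (\<Sum>u | f u \<noteq> 0. f u * word_op E u (\<lambda>y. \<Sum>v | g v \<noteq> 0. g v * word_op E v \<xi> y) x)"
    using assms(2) by (simp add: word_op_sum sum_distrib_left mult.assoc)
  also have "\<dots> = op E f (op E g \<xi>) x"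
    unfolding op_def lext_def ..
  finally show "op E (conv f g) \<xi> x = op E f (op E g \<xi>) x" .
qed

lemma op_add:
  "finite {w. f w \<noteq> 0} \<Longrightarrow> finite {w. g w \<noteq> 0} \<Longrightarrow> op E (\<lambda>w. f w + g w) \<xi> = (\<lambda>x. op E f \<xi> x + op E g \<xi> x)"
  by (auto simp: op_def lext_add)

lemma op_scale: "finite {w. f w \<noteq> 0} \<Longrightarrow> op E (\<lambda>w. c * f w) \<xi> = (\<lambda>x. c * op E f \<xi> x)"
  by (auto simp: op_def lext_scale)

lemma op_const: "op E (const c) \<xi> = (\<lambda>x. c * \<xi> x)"
proof
  fix x show "op E (const c) \<xi> x = c * \<xi> x"
    unfolding op_def by (subst lext_superset[of "{[]}"]) (auto simp: const_def word_op_def)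
qed

lemma op_delta: "op E (delta [a]) \<xi> = gen_op E a \<xi>"
  by (auto simp: op_def lext_delta word_op_def)

lemma op_zero [simp]: "op E (\<lambda>w. 0) \<xi> = (\<lambda>x. 0)"
  by (auto simp: op_def lext_def)

lemma op_zero_right [simp]:
  fixes f :: "('v, 'e) gen list \<Rightarrow> 'k::comm_ring_1"
  shows "op E f (\<lambda>x. 0) = (\<lambda>x. 0)"
proof -
  have g: "gen_op E a (\<lambda>x. 0) = (\<lambda>x. 0 :: 'k)" for a by (rule ext) (cases a; simp)
  have "word_op E w (\<lambda>x. 0) = (\<lambda>x. 0 :: 'k)" for w by (induction w) (simp_all add: word_op_def g)
  then show ?thesis by (auto simp: op_def lext_def)
qed

lemma gen_op_pathfun: "\<xi> \<in> pathfun E \<Longrightarrow> gen_op E a \<xi> \<in> pathfun E"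
  by (cases a) (auto simp: pathfun_def)

lemma op_pathfun: "\<xi> \<in> pathfun E \<Longrightarrow> op E f \<xi> \<in> pathfun E"
proof -
  assume "\<xi> \<in> pathfun E"
  then have "word_op E w \<xi> \<in> pathfun E" for w
    by (induction w) (auto simp: word_op_def gen_op_pathfun)
  then show ?thesis by (simp add: pathfun_def op_def lext_def)
qed

context conjugation
begin

text \<open>Only functions supported on infinite paths are tested, because on these the sum of the
  vertex projections acts as the identity.\<close>

definition op_ker :: "('v, 'e) pre_digraph \<Rightarrow> (('v, 'e) gen list \<Rightarrow> 'k) set" where
  "op_ker E = {f \<in> carrier (free_alg bar E). \<forall>\<xi>\<in>pathfun E. op E f \<xi> = (\<lambda>x. 0)}"

lemma op_minus:
  assumes "f \<in> carrier (free_alg bar E)" "g \<in> carrier (free_alg bar E)"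
  shows "op E (f \<ominus>\<^bsub>free_alg bar E\<^esub> g) \<xi> = (\<lambda>x. op E f \<xi> x - op E g \<xi> x)"
proof -
  have g: "finite {w. (-1) * g w \<noteq> 0}" using free_finite[OF assms(2)] by simp
  have "f \<ominus>\<^bsub>free_alg bar E\<^esub> g = (\<lambda>w. f w + (-1) * g w)" using free_minus[OF assms] by simp
  then show ?thesis
    using op_add[OF free_finite[OF assms(1)] g] op_scale[OF free_finite[OF assms(2)], of E "-1" \<xi>] by simp
qed

lemma op_finsum:
  fixes E :: "('a, 'b) pre_digraph"
  assumes "finite S" "f \<in> S \<rightarrow> carrier (free_alg bar E)"
  shows "op E (finsum (free_alg bar E) f S) \<xi> = (\<lambda>x. \<Sum>s\<in>S. op E (f s) \<xi> x)"
  using assms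
proof (induction S rule: finite_induct)
  case empty
  interpret ring "free_alg bar E :: (('a, 'b) gen list \<Rightarrow> 'k, 'a, 'b) graph_alg" by (rule free_ring)
  show ?case by (simp add: free_simps(3))
next
  case (insert s S)
  interpret ring "free_alg bar E :: (('a, 'b) gen list \<Rightarrow> 'k, 'a, 'b) graph_alg" by (rule free_ring)
  have c: "f s \<in> carrier (free_alg bar E)" "finsum (free_alg bar E) f S \<in> carrier (free_alg bar E)"
    using insert.prems by (auto intro!: finsum_closed)
  have "finsum (free_alg bar E) f (insert s S) = (\<lambda>w. f s w + finsum (free_alg bar E) f S w)"
    using insert by (subst finsum_insert) (auto simp: free_simps(4))
  then show ?case
    using op_add[OF c[THEN free_finite]] insert by simp
qed

lemma op_ker_ideal: "ideal (op_ker E) (free_alg bar E)"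
proof -
  interpret ring "free_alg bar E" by (rule free_ring)
  show ?thesis
  proof (rule ideal_intro)
    fix a x assume a: "a \<in> op_ker E" and x: "x \<in> carrier (free_alg bar E)"
    have c: "a \<in> carrier (free_alg bar E)" using a by (simp add: op_ker_def)
    have a0: "op E a \<xi> = (\<lambda>x. 0)" if "\<xi> \<in> pathfun E" for \<xi> using a that by (simp add: op_ker_def)
    show "x \<otimes>\<^bsub>free_alg bar E\<^esub> a \<in> op_ker E" "a \<otimes>\<^bsub>free_alg bar E\<^esub> x \<in> op_ker E"
      using m_closed[OF x c] m_closed[OF c x] op_conv[OF free_finite[OF x] free_finite[OF c]]
        op_conv[OF free_finite[OF c] free_finite[OF x]]
      by (simp_all add: op_ker_def free_simps(1) a0 op_pathfun)
  next
    fix a b assume a: "a \<in> op_ker E" and b: "b \<in> op_ker E"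
    have c: "a \<in> carrier (free_alg bar E)" "b \<in> carrier (free_alg bar E)" using a b by (auto simp: op_ker_def)
    show "a \<oplus>\<^bsub>free_alg bar E\<^esub> b \<in> op_ker E"
      using a b a_closed[OF c] op_add[OF c[THEN free_finite]] by (auto simp: op_ker_def free_simps(4))
  qed (use zero_closed in \<open>auto simp: op_ker_def free_simps(3)\<close>)
qed

lemma op_ker_minus:
  assumes "f \<in> carrier (free_alg bar E)" "g \<in> carrier (free_alg bar E)"
    "\<And>\<xi>. \<xi> \<in> pathfun E \<Longrightarrow> op E f \<xi> = op E g \<xi>"
  shows "f \<ominus>\<^bsub>free_alg bar E\<^esub> g \<in> op_ker E"
proof -
  interpret ring "free_alg bar E" by (rule free_ring)
  show ?thesis using assms by (auto simp: op_ker_def op_minus minus_closed)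
qed

lemma star_eiso_delta: "star (free_alg bar E) (eiso (free_alg bar E) e) = delta [GSstar e]"
  unfolding free_simps(7) star_delta by simp

lemma op_ker_rels:
  assumes "path_graph E"
  shows "leavitt_rels (free_alg bar E) E \<subseteq> op_ker E"
proof -
  interpret path_graph E by fact
  let ?F = "free_alg bar E :: (('a, 'b) gen list \<Rightarrow> 'k, 'a, 'b) graph_alg"
  interpret F: graph_star_ring E ?F by (rule free_graph_star_ring)
  have opm: "op E (f \<otimes>\<^bsub>?F\<^esub> g) \<xi> = op E f (op E g \<xi>)" if "f \<in> carrier ?F" "g \<in> carrier ?F" for f g \<xi>
    unfolding free_simps(1) using op_conv that free_finite by blast
  have opP: "op E (vproj ?F v) \<xi> = gen_op E (GP v) \<xi>" for v \<xi>
    by (simp only: free_simps op_delta)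
  have opS: "op E (eiso ?F e) \<xi> = gen_op E (GS e) \<xi>" for e \<xi>
    by (simp only: free_simps op_delta)
  have opT: "op E (star ?F (eiso ?F e)) \<xi> = gen_op E (GSstar e) \<xi>" for e \<xi>
    by (simp only: star_eiso_delta op_delta)
  have op1: "op E \<one>\<^bsub>?F\<^esub> \<xi> = \<xi>" for \<xi> by (simp add: free_simps op_const)
  have ker: "f \<in> op_ker E" if "f \<in> carrier ?F" "\<And>\<xi>. \<xi> \<in> pathfun E \<Longrightarrow> op E f \<xi> = (\<lambda>x. 0)" for f
    using that by (simp add: op_ker_def)
  have sumP: "op E (\<Oplus>\<^bsub>?F\<^esub>v\<in>verts E. vproj ?F v) \<xi> = \<xi>" if "\<xi> \<in> pathfun E" for \<xi>
  proof -
    have "op E (\<Oplus>\<^bsub>?F\<^esub>v\<in>verts E. vproj ?F v) \<xi> = (\<lambda>x. \<Sum>v\<in>verts E. gen_op E (GP v) \<xi> x)"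
      by (subst op_finsum) (auto simp: opP)
    also have "\<dots> = \<xi>"
    proof
      fix x
      show "(\<Sum>v\<in>verts E. gen_op E (GP v) \<xi> x) = \<xi> x"
      proof (cases "x \<in> infpaths E")
        case True
        then have "(\<Sum>v\<in>verts E. gen_op E (GP v) \<xi> x) = (\<Sum>v\<in>verts E. if v = src E x then \<xi> x else 0)"
          by (intro sum.cong) auto
        then show ?thesis using src_in_verts[OF True] by simp
      qed (use that in \<open>simp add: pathfun_def\<close>)
    qed
    finally show ?thesis .
  qed
  have sumS: "op E (\<Oplus>\<^bsub>?F\<^esub>e\<in>out_arcs E v. eiso ?F e \<otimes>\<^bsub>?F\<^esub> star ?F (eiso ?F e)) \<xi> = gen_op E (GP v) \<xi>" for v \<xi>
  proof -
    have "op E (\<Oplus>\<^bsub>?F\<^esub>e\<in>out_arcs E v. eiso ?F e \<otimes>\<^bsub>?F\<^esub> star ?F (eiso ?F e)) \<xi> =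
        (\<lambda>x. \<Sum>e\<in>out_arcs E v. gen_op E (GS e) (gen_op E (GSstar e) \<xi>) x)"
      by (subst op_finsum) (auto simp: opm opS opT)
    also have "\<dots> = gen_op E (GP v) \<xi>"
    proof
      fix x
      show "(\<Sum>e\<in>out_arcs E v. gen_op E (GS e) (gen_op E (GSstar e) \<xi>) x) = gen_op E (GP v) \<xi> x"
      proof (cases "x \<in> infpaths E")
        case True
        then have "(\<Sum>e\<in>out_arcs E v. gen_op E (GS e) (gen_op E (GSstar e) \<xi>) x) =
            (\<Sum>e\<in>out_arcs E v. if e = shd x then \<xi> x else 0)"
          by (intro sum.cong) (auto simp: infpaths_stl src_stl)
        also have "\<dots> = gen_op E (GP v) \<xi> x"
          using True infpaths_shd[OF True] by (auto simp: src_def sum.delta[OF finite_out_arcs])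
        finally show ?thesis .
      qed simp
    qed
    finally show ?thesis .
  qed
  have cl: "(\<Oplus>\<^bsub>?F\<^esub>v\<in>verts E. vproj ?F v) \<in> carrier ?F"
    "(\<Oplus>\<^bsub>?F\<^esub>e\<in>out_arcs E v. eiso ?F e \<otimes>\<^bsub>?F\<^esub> star ?F (eiso ?F e)) \<in> carrier ?F" for v
    by (auto intro!: F.finsum_closed)
  show ?thesis
    unfolding leavitt_rels_subset
  proof (intro conjI ballI impI)
    show "\<one>\<^bsub>?F\<^esub> \<ominus>\<^bsub>?F\<^esub> (\<Oplus>\<^bsub>?F\<^esub>v\<in>verts E. vproj ?F v) \<in> op_ker E"
      by (rule op_ker_minus[OF F.one_closed cl(1)]) (simp only: op1 sumP)
  next
    fix v assume v: "v \<in> verts E"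
    show "vproj ?F v \<otimes>\<^bsub>?F\<^esub> vproj ?F v \<ominus>\<^bsub>?F\<^esub> vproj ?F v \<in> op_ker E"
      by (rule op_ker_minus) (use v in \<open>auto simp: opm opP\<close>)
    show "vproj ?F v \<ominus>\<^bsub>?F\<^esub> (\<Oplus>\<^bsub>?F\<^esub>e\<in>out_arcs E v. eiso ?F e \<otimes>\<^bsub>?F\<^esub> star ?F (eiso ?F e)) \<in> op_ker E"
      by (rule op_ker_minus[OF F.vproj_closed[OF v] cl(2)]) (simp only: sumS opP)
    show "vproj ?F v \<otimes>\<^bsub>?F\<^esub> vproj ?F w \<in> op_ker E" if "w \<in> verts E" "v \<noteq> w" for w
      by (rule ker) (use v that in \<open>auto simp: opm opP\<close>)
  next
    fix e assume e: "e \<in> arcs E"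
    show "star ?F (eiso ?F e) \<otimes>\<^bsub>?F\<^esub> eiso ?F e \<ominus>\<^bsub>?F\<^esub> vproj ?F (head E e) \<in> op_ker E"
      by (rule op_ker_minus) (use e in \<open>auto simp: opm opP opS opT infpaths_SCons\<close>)
    show "vproj ?F (tail E e) \<otimes>\<^bsub>?F\<^esub> eiso ?F e \<ominus>\<^bsub>?F\<^esub> eiso ?F e \<in> op_ker E"
      by (rule op_ker_minus) (use e in \<open>auto simp: opm opP opS src_def\<close>)
    show "eiso ?F e \<otimes>\<^bsub>?F\<^esub> vproj ?F (head E e) \<ominus>\<^bsub>?F\<^esub> eiso ?F e \<in> op_ker E"
      by (rule op_ker_minus) (use e in \<open>auto simp: opm opP opS infpaths_stl src_stl\<close>)
    show "star ?F (eiso ?F e) \<otimes>\<^bsub>?F\<^esub> vproj ?F (tail E e) \<ominus>\<^bsub>?F\<^esub> star ?F (eiso ?F e) \<in> op_ker E"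
      by (rule op_ker_minus) (use e in \<open>auto simp: opm opP opT infpaths_SCons\<close>)
    show "vproj ?F (head E e) \<otimes>\<^bsub>?F\<^esub> star ?F (eiso ?F e) \<ominus>\<^bsub>?F\<^esub> star ?F (eiso ?F e) \<in> op_ker E"
      by (rule op_ker_minus) (use e in \<open>auto simp: opm opP opT\<close>)
    show "star ?F (eiso ?F e) \<otimes>\<^bsub>?F\<^esub> eiso ?F f \<in> op_ker E" if "f \<in> arcs E" "e \<noteq> f" for f
      by (rule ker) (use e that in \<open>auto simp: opm opS opT\<close>)
  qed
qed

lemma op_mult:
  assumes "f \<in> carrier (free_alg bar E)" "g \<in> carrier (free_alg bar E)"
  shows "op E (f \<otimes>\<^bsub>free_alg bar E\<^esub> g) \<xi> = op E f (op E g \<xi>)"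
  unfolding free_simps(1) by (rule op_conv) (rule free_finite, rule assms)+

text \<open>For an empty list the product is the unit and not a vertex projection, hence the guard
  \<open>es \<noteq> []\<close> in the second equation.\<close>

lemma op_foldr:
  assumes "path_graph E" "\<xi> \<in> pathfun E" "(v, es) \<in> paths E"
  shows "op E (foldr (\<lambda>e x. eiso (free_alg bar E) e \<otimes>\<^bsub>free_alg bar E\<^esub> x) es \<one>\<^bsub>free_alg bar E\<^esub>) \<xi> x =
      (if x \<in> infpaths E \<and> stake (length es) x = es then \<xi> (sdrop (length es) x) else 0)"
    "op E (star (free_alg bar E)
        (foldr (\<lambda>e x. eiso (free_alg bar E) e \<otimes>\<^bsub>free_alg bar E\<^esub> x) es \<one>\<^bsub>free_alg bar E\<^esub>)) \<xi> x =
      (if x \<in> infpaths E \<and> (es \<noteq> [] \<longrightarrow> src E x = prange E (v, es)) then \<xi> (es @- x) else 0)"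
  using assms(2,3)
proof (induction es arbitrary: v x \<xi>)
  case Nil
  case 1
  then show ?case by (simp add: free_simps(2) op_const pathfun_def)
next
  case Nil
  interpret F: graph_star_ring E "free_alg bar E" by (rule free_graph_star_ring)
  case 2
  then show ?case by (simp add: free_simps(2) star_const op_const pathfun_def)
next
  case (Cons e es)
  interpret path_graph E by fact
  interpret F: graph_star_ring E "free_alg bar E" by (rule free_graph_star_ring)
  let ?f = "foldr (\<lambda>e x. eiso (free_alg bar E) e \<otimes>\<^bsub>free_alg bar E\<^esub> x) es \<one>\<^bsub>free_alg bar E\<^esub>"
  {
    case 1
    then have p: "e \<in> arcs E" "(head E e, es) \<in> paths E" by auto
    have f: "?f \<in> carrier (free_alg bar E)"
      by (rule foldr_closed[OF free_graph_star_ring paths_arcs[OF p(2)]])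
    have "op E (eiso (free_alg bar E) e \<otimes>\<^bsub>free_alg bar E\<^esub> ?f) \<xi> x = gen_op E (GS e) (op E ?f \<xi>) x"
      unfolding op_mult[OF F.eiso_closed[OF p(1)] f] by (simp add: free_simps(7) op_delta)
    then show ?case
      using Cons.IH(1)[OF 1(1) p(2), of "stl x"] by (auto simp: infpaths_stl)
  next
    case 2
    then have p: "e \<in> arcs E" "(head E e, es) \<in> paths E" by auto
    have f: "?f \<in> carrier (free_alg bar E)"
      by (rule foldr_closed[OF free_graph_star_ring paths_arcs[OF p(2)]])
    have "op E (star (free_alg bar E) (eiso (free_alg bar E) e \<otimes>\<^bsub>free_alg bar E\<^esub> ?f)) \<xi> x =
        op E (star (free_alg bar E) ?f) (gen_op E (GSstar e) \<xi>) x"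
      unfolding F.star_mult[OF F.eiso_closed[OF p(1)] f] star_eiso_delta
      by (subst op_mult[OF F.star_closed[OF f]]) (use p in \<open>auto simp: op_delta gens_def intro!: delta_carrier\<close>)
    also have "\<dots> = (if x \<in> infpaths E \<and> src E x = prange E (head E e, es) then \<xi> (e ## es @- x) else 0)"
      unfolding Cons.IH(2)[OF gen_op_pathfun[OF 2(1)] p(2), of "GSstar e" x]
      using shift_infpaths[OF p(2), of x] by (cases es) auto
    finally show ?case by simp
  }
qed

lemma op_path_elt:
  assumes "path_graph E" "\<xi> \<in> pathfun E" "\<beta> \<in> paths E"
  shows "op E (path_elt (free_alg bar E) \<beta>) \<xi> x =
      (if x \<in> cyl E \<beta> then \<xi> (sdrop (length (snd \<beta>)) x) else 0)"
    "op E (star (free_alg bar E) (path_elt (free_alg bar E) \<beta>)) \<xi> x =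
      (if x \<in> infpaths E \<and> src E x = prange E \<beta> then \<xi> (snd \<beta> @- x) else 0)"
proof -
  interpret path_graph E by fact
  interpret F: graph_star_ring E "free_alg bar E" by (rule free_graph_star_ring)
  obtain v es where b: "\<beta> = (v, es)" by fastforce
  note p = assms(3)[unfolded b]
  show "op E (path_elt (free_alg bar E) \<beta>) \<xi> x =
      (if x \<in> cyl E \<beta> then \<xi> (sdrop (length (snd \<beta>)) x) else 0)"
  proof (cases es)
    case Nil
    then show ?thesis by (simp add: b path_elt_def cyl_def free_simps(6) op_delta)
  next
    case (Cons e fs)
    have "x \<in> cyl E \<beta> \<longleftrightarrow> x \<in> infpaths E \<and> stake (length es) x = es"
      using p Cons by (auto simp: b cyl_def src_def)
    then show ?thesis using op_foldr(1)[OF assms(1,2) p, of x] by (simp add: b Cons path_elt_def)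
  qed
  show "op E (star (free_alg bar E) (path_elt (free_alg bar E) \<beta>)) \<xi> x =
      (if x \<in> infpaths E \<and> src E x = prange E \<beta> then \<xi> (snd \<beta> @- x) else 0)"
  proof (cases es)
    case Nil
    then have "v \<in> verts E" using p by simp
    then have "star (free_alg bar E) (path_elt (free_alg bar E) \<beta>) = delta [GP v]"
      using F.star_vproj Nil by (simp add: b path_elt_def free_simps(6))
    then show ?thesis by (simp add: b Nil op_delta)
  next
    case (Cons e fs)
    then show ?thesis using op_foldr(2)[OF assms(1,2) p, of x] by (simp add: b path_elt_def)
  qed
qed

lemma op_path_proj:
  assumes "path_graph E" "\<xi> \<in> pathfun E" "\<beta> \<in> paths E"
  shows "op E (path_proj (free_alg bar E) \<beta>) \<xi> = (\<lambda>x. if x \<in> cyl E \<beta> then \<xi> x else 0)"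
proof
  fix x
  interpret path_graph E by fact
  interpret F: graph_star_ring E "free_alg bar E" by (rule free_graph_star_ring)
  have c: "path_elt (free_alg bar E) \<beta> \<in> carrier (free_alg bar E)"
    by (rule path_elt_closed[OF free_graph_star_ring assms(3)])
  have "op E (path_proj (free_alg bar E) \<beta>) \<xi> x =
      op E (path_elt (free_alg bar E) \<beta>) (op E (star (free_alg bar E) (path_elt (free_alg bar E) \<beta>)) \<xi>) x"
    unfolding path_proj_def op_mult[OF c F.star_closed[OF c]] ..
  then show "op E (path_proj (free_alg bar E) \<beta>) \<xi> x = (if x \<in> cyl E \<beta> then \<xi> x else 0)"
    using op_path_elt(1)[OF assms(1) op_pathfun[OF assms(2)] assms(3), of _ x]
      op_path_elt(2)[OF assms, of "sdrop (length (snd \<beta>)) x"] cyl_sdrop[OF assms(3), of x]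
    by auto
qed

end

section \<open>The diagonal under the endomorphism\<close>

text \<open>\<open>rels_I\<close> makes the quotient a Leavitt family, and \<open>I_ker\<close> lets
  the action on functions descend to it. The instances of \<open>I\<close> are the ideal of
  relations over the integers and the null ideal of the universal seminorm.\<close>

locale free_coding = coding E J + conjugation bar
  for E :: "('v, 'e) pre_digraph" and J and bar :: "'k::comm_ring_1 \<Rightarrow> 'k" +
  fixes I
  assumes ideal_I: "ideal I (free_alg bar E)"
    and star_I: "x \<in> I \<Longrightarrow> star (free_alg bar E) x \<in> I"
    and rels_I: "leavitt_rels (free_alg bar E) E \<subseteq> I"
    and I_ker: "I \<subseteq> op_ker E"
begin

abbreviation "F \<equiv> free_alg bar E"

lemma path_graph_E: "path_graph E" ..

sublocale star_quotient E F I
proof -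
  interpret A: graph_star_ring E F by (rule free_graph_star_ring)
  interpret ideal I F by (rule ideal_I)
  show "star_quotient E F I" by unfold_locales (rule star_I)
qed

sublocale leavitt_coding E J Qt
proof unfold_locales
  have "q x = \<zero>\<^bsub>Qt\<^esub>" if "x \<in> leavitt_rels F E" for x
  proof -
    have x: "x \<in> I" using rels_I that by (rule subsetD)
    show ?thesis by (rule iffD2[OF q_eq_zero[OF Icarr[OF x]] x])
  qed
  then show "leavitt_rels Qt E \<subseteq> {\<zero>\<^bsub>Qt\<^esub>}"
    unfolding qh.leavitt_rels_vimage[symmetric] singleton_iff by blast
qed

lemma finite_supp: "f \<in> carrier F \<Longrightarrow> finite {w. f w \<noteq> 0}"
  by (rule free_finite)

text \<open>\<open>phi\<close> lifts the endomorphism attached to \<open>J\<close> to the free algebra.\<close>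

definition gsub :: "('v, 'e) gen \<Rightarrow> ('v, 'e) gen list \<Rightarrow> 'k" where
  "gsub a = (case a of GP v \<Rightarrow> vproj F v | GS e \<Rightarrow> pair_sum F J \<otimes>\<^bsub>F\<^esub> eiso F e
     | GSstar e \<Rightarrow> star F (pair_sum F J \<otimes>\<^bsub>F\<^esub> eiso F e))"

definition phi :: "(('v, 'e) gen list \<Rightarrow> 'k) \<Rightarrow> ('v, 'e) gen list \<Rightarrow> 'k" where
  "phi = subst gsub"

lemma uF_closed: "pair_sum F J \<in> carrier F"
  by (rule pair_sum_closed[OF A.graph_star_ring_axioms J_sub])

lemma gsub_closed: "a \<in> gens E \<Longrightarrow> gsub a \<in> carrier F"
  using uF_closed by (auto simp: gens_def gsub_def)

lemma gsub_star: "a \<in> gens E \<Longrightarrow> gsub (gen_star a) = star F (gsub a)"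
  using uF_closed by (auto simp: gens_def gsub_def)

lemma phi_hom: "phi \<in> ring_hom F F"
  unfolding phi_def by (rule subst_hom[OF gsub_closed])

lemma phi_closed [simp]: "x \<in> carrier F \<Longrightarrow> phi x \<in> carrier F"
  by (rule ring_hom_closed[OF phi_hom])

lemma phi_star: "x \<in> carrier F \<Longrightarrow> phi (star F x) = star F (phi x)"
  unfolding phi_def by (rule subst_star) (simp_all add: gsub_closed gsub_star)

lemma phi_const: "phi (const c) = const c"
  by (simp add: phi_def subst_const)

lemma phi_vproj: "phi (vproj F v) = vproj F v"
  by (simp add: phi_def free_simps(6) subst_delta gsub_def)

lemma phi_eiso: "phi (eiso F e) = pair_sum F J \<otimes>\<^bsub>F\<^esub> eiso F e"
  by (simp add: phi_def free_simps(7) subst_delta gsub_def)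

lemma phi_add: "x \<in> carrier F \<Longrightarrow> y \<in> carrier F \<Longrightarrow> phi (x \<oplus>\<^bsub>F\<^esub> y) = phi x \<oplus>\<^bsub>F\<^esub> phi y"
  and phi_mult: "x \<in> carrier F \<Longrightarrow> y \<in> carrier F \<Longrightarrow> phi (x \<otimes>\<^bsub>F\<^esub> y) = phi x \<otimes>\<^bsub>F\<^esub> phi y"
  using phi_hom by (auto simp: ring_hom_def)

lemma phi_minus:
  assumes "x \<in> carrier F" "y \<in> carrier F" shows "phi (x \<ominus>\<^bsub>F\<^esub> y) = phi x \<ominus>\<^bsub>F\<^esub> phi y"
proof -
  interpret p: ring_hom_ring F F phi using phi_hom by unfold_locales auto
  show ?thesis using assms by (simp add: a_minus_def)
qed

lemma q_pair_sum: "q (pair_sum F J) = u"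
  unfolding u_def by (rule qh.hom_pair_sum[OF J_sub])

lemma q_phi_hom: "(\<lambda>x. q (phi x)) \<in> graph_hom E F twisted"
  unfolding graph_hom_def
proof (intro CollectI conjI ballI)
  show "(\<lambda>x. q (phi x)) \<in> ring_hom F twisted"
  proof (rule ring_hom_memI)
    show "q (phi \<one>\<^bsub>F\<^esub>) = \<one>\<^bsub>twisted\<^esub>"
      using ring_hom_one[OF phi_hom] by simp
  qed (auto simp: phi_add phi_mult)
  fix x assume "x \<in> carrier F"
  then show "q (phi (star F x)) = star twisted (q (phi x))" by (simp add: phi_star qh.hom_star)
next
  fix v assume "v \<in> verts E"
  then show "q (phi (vproj F v)) = vproj twisted v" by (simp add: phi_vproj qh.hom_vproj)
next
  fix e assume "e \<in> arcs E"
  then show "q (phi (eiso F e)) = eiso twisted e"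
    using uF_closed by (simp add: phi_eiso q_pair_sum qh.hom_eiso)
qed

sublocale ph: graph_hom_ctx E F twisted "\<lambda>x. q (phi x)"
  by unfold_locales (rule q_phi_hom)

lemma q_phi_proj: "w \<in> paths E \<Longrightarrow> q (phi (path_proj F w)) = path_proj twisted w"
  by (rule ph.hom_path_proj)

lemma projF_closed [simp]: "\<beta> \<in> paths E \<Longrightarrow> path_proj F \<beta> \<in> carrier F"
  by (rule path_proj_closed[OF A.graph_star_ring_axioms])

subsection \<open>Linear combinations of path projections\<close>

text \<open>The span is formed in the free algebra, where \<open>phi\<close> acts; equalities
  between its elements are sought only modulo \<open>I\<close>.\<close>

definition cdiag :: "(('v, 'e) gen list \<Rightarrow> 'k) set" where
  "cdiag = generate (add_monoid F) {const c \<otimes>\<^bsub>F\<^esub> path_proj F \<beta> |c \<beta>. \<beta> \<in> paths E}"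

lemma cdiag_gens: "{const c \<otimes>\<^bsub>F\<^esub> path_proj F \<beta> |c \<beta>. \<beta> \<in> paths E} \<subseteq> carrier F"
  by auto

lemma add_monoid_simps: "mult (add_monoid R) = add R" "one (add_monoid R) = zero R"
  "carrier (add_monoid R) = carrier R" "m_inv (add_monoid R) = a_inv R"
  by (simp_all add: a_inv_def fun_eq_iff)

lemma cdiag_carrier: "z \<in> cdiag \<Longrightarrow> z \<in> carrier F"
  using A.add.generate_in_carrier[of _ z] cdiag_gens unfolding cdiag_def by (simp add: add_monoid_simps)

lemma cdiag_subgroup: "subgroup cdiag (add_monoid F)"
  unfolding cdiag_def by (rule A.add.generate_is_subgroup) (use cdiag_gens in \<open>simp add: add_monoid_simps\<close>)

lemma cdiag_add: "x \<in> cdiag \<Longrightarrow> y \<in> cdiag \<Longrightarrow> x \<oplus>\<^bsub>F\<^esub> y \<in> cdiag"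
  using subgroup.m_closed[OF cdiag_subgroup] by (simp add: add_monoid_simps)

lemma cdiag_zero: "\<zero>\<^bsub>F\<^esub> \<in> cdiag"
  using subgroup.one_closed[OF cdiag_subgroup] by (simp add: add_monoid_simps)

lemma cdiag_gen: "\<beta> \<in> paths E \<Longrightarrow> const c \<otimes>\<^bsub>F\<^esub> path_proj F \<beta> \<in> cdiag"
  unfolding cdiag_def by (rule generate.incl) blast

text \<open>The negative of a generator is again a generator, with coefficient \<open>- c\<close>,
  so no separate case for inverses remains.\<close>

lemma cdiag_induct [consumes 1, case_names zero gen add]:
  assumes "z \<in> cdiag" and zero: "\<Phi> \<zero>\<^bsub>F\<^esub>"
    and gen: "\<And>c \<beta>. \<beta> \<in> paths E \<Longrightarrow> \<Phi> (const c \<otimes>\<^bsub>F\<^esub> path_proj F \<beta>)"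
    and add: "\<And>x y. x \<in> cdiag \<Longrightarrow> y \<in> cdiag \<Longrightarrow> \<Phi> x \<Longrightarrow> \<Phi> y \<Longrightarrow> \<Phi> (x \<oplus>\<^bsub>F\<^esub> y)"
  shows "\<Phi> z"
  using assms(1) unfolding cdiag_def
proof (induction rule: generate.induct)
  case one
  then show ?case using zero by simp
next
  case (incl h)
  then show ?case using gen by auto
next
  case (inv h)
  then obtain c \<beta> where h: "h = const c \<otimes>\<^bsub>F\<^esub> path_proj F \<beta>" "\<beta> \<in> paths E" by auto
  have "inv\<^bsub>add_monoid F\<^esub> h = \<ominus>\<^bsub>F\<^esub> h" by (simp add: a_inv_def)
  also have "\<dots> = (\<lambda>w. - h w)" by (rule free_uminus) (use h in simp)
  also have "\<dots> = const (- c) \<otimes>\<^bsub>F\<^esub> path_proj F \<beta>"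
    unfolding h(1) by (simp add: free_simps(1) conv_const_left)
  finally show ?case using gen h(2) by simp
next
  case (eng h1 h2)
  then show ?case using add by (simp add: cdiag_def)
qed

lemma cdiag_scale: "z \<in> cdiag \<Longrightarrow> const c \<otimes>\<^bsub>F\<^esub> z \<in> cdiag"
proof (induction rule: cdiag_induct)
  case zero
  then show ?case using cdiag_zero by simp
next
  case (gen d \<beta>)
  have "const c \<otimes>\<^bsub>F\<^esub> const d = const (c * d)"
    unfolding free_simps(1) conv_const_left by (auto simp: const_def)
  then have "const c \<otimes>\<^bsub>F\<^esub> (const d \<otimes>\<^bsub>F\<^esub> path_proj F \<beta>) = const (c * d) \<otimes>\<^bsub>F\<^esub> path_proj F \<beta>"
    using gen A.m_assoc[of "const c" "const d" "path_proj F \<beta>"] by simp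
  then show ?case using cdiag_gen gen by simp
next
  case (add x y)
  then show ?case using cdiag_carrier cdiag_add by (simp add: A.r_distr)
qed

lemma cdiag_proj: "\<beta> \<in> paths E \<Longrightarrow> path_proj F \<beta> \<in> cdiag"
  using cdiag_gen[of \<beta> 1] by (simp add: free_simps(1) conv_const_left)

lemma cdiag_finsum: "finite B \<Longrightarrow> B \<subseteq> paths E \<Longrightarrow> finsum F (path_proj F) B \<in> cdiag"
proof (induction B rule: finite_induct)
  case (insert \<beta> B)
  then have B: "\<beta> \<in> paths E" "path_proj F \<in> B \<rightarrow> carrier F" "finsum F (path_proj F) B \<in> cdiag" by auto
  then show ?case
    using insert.hyps cdiag_add[OF cdiag_proj[OF B(1)] B(3)] by simp
qed (simp add: cdiag_zero)

text \<open>The sources are compared separately because for \<open>N = 0\<close> no edge is.\<close>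

definition local_fun :: "nat \<Rightarrow> ('e stream \<Rightarrow> 'k) \<Rightarrow> bool" where
  "local_fun N f \<longleftrightarrow> (\<forall>x\<in>infpaths E. \<forall>y\<in>infpaths E. src E x = src E y \<longrightarrow> stake N x = stake N y \<longrightarrow> f x = f y)"

definition acts :: "(('v, 'e) gen list \<Rightarrow> 'k) \<Rightarrow> ('e stream \<Rightarrow> 'k) \<Rightarrow> bool" where
  "acts z f \<longleftrightarrow> (\<forall>\<xi>\<in>pathfun E. op E z \<xi> = (\<lambda>x. f x * \<xi> x))"

lemma acts_add:
  "x \<in> carrier F \<Longrightarrow> y \<in> carrier F \<Longrightarrow> acts x f \<Longrightarrow> acts y g \<Longrightarrow> acts (x \<oplus>\<^bsub>F\<^esub> y) (\<lambda>x. f x + g x)"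
  unfolding acts_def free_simps(4) using op_add[OF finite_supp finite_supp, of x y]
  by (simp add: distrib_right)

lemma acts_zero: "acts \<zero>\<^bsub>F\<^esub> (\<lambda>x. 0)"
  by (simp add: acts_def free_simps(3))

lemma acts_scale: "z \<in> carrier F \<Longrightarrow> acts z f \<Longrightarrow> acts (const c \<otimes>\<^bsub>F\<^esub> z) (\<lambda>x. c * f x)"
  by (simp add: acts_def op_mult op_const mult.assoc)

lemma acts_proj: "\<beta> \<in> paths E \<Longrightarrow> acts (path_proj F \<beta>) (\<lambda>x. of_bool (x \<in> cyl E \<beta>))"
  by (auto simp: acts_def op_path_proj[OF path_graph_E])

lemma acts_cong: "acts z f \<Longrightarrow> (\<And>x. x \<in> infpaths E \<Longrightarrow> f x = g x) \<Longrightarrow> acts z g"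
  unfolding acts_def pathfun_def by (auto simp: fun_eq_iff) (metis mult_zero_right)

lemma acts_finsum:
  assumes "finite B" "B \<subseteq> paths E" "\<forall>\<beta>\<in>B. \<forall>\<gamma>\<in>B. \<beta> \<noteq> \<gamma> \<longrightarrow> cyl E \<beta> \<inter> cyl E \<gamma> = {}"
  shows "acts (finsum F (path_proj F) B) (\<lambda>x. of_bool (x \<in> (\<Union>\<beta>\<in>B. cyl E \<beta>)))"
  using assms
proof (induction B rule: finite_induct)
  case empty
  then show ?case using acts_zero by simp
next
  case (insert \<beta> B)
  have "cyl E \<beta> \<inter> cyl E \<gamma> = {}" if "\<gamma> \<in> B" for \<gamma>
    using insert.hyps(2) insert.prems(2) that by (metis insertI1 insertI2)
  then have d: "cyl E \<beta> \<inter> (\<Union>\<beta>\<in>B. cyl E \<beta>) = {}" by blast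
  have B: "\<beta> \<in> paths E" "path_proj F \<in> B \<rightarrow> carrier F" "path_proj F \<beta> \<in> carrier F"
    "finsum F (path_proj F) B \<in> carrier F"
    using insert.prems(1) by (auto intro!: A.finsum_closed)
  have "acts (finsum F (path_proj F) B) (\<lambda>x. of_bool (x \<in> (\<Union>\<beta>\<in>B. cyl E \<beta>)))"
    using insert.IH insert.prems by blast
  then have "acts (path_proj F \<beta> \<oplus>\<^bsub>F\<^esub> finsum F (path_proj F) B)
      (\<lambda>x. of_bool (x \<in> cyl E \<beta>) + of_bool (x \<in> (\<Union>\<beta>\<in>B. cyl E \<beta>)))"
    by (rule acts_add[OF B(3,4) acts_proj[OF B(1)]])
  moreover have "(\<lambda>x. of_bool (x \<in> cyl E \<beta>) + of_bool (x \<in> (\<Union>\<beta>\<in>B. cyl E \<beta>))) =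
      (\<lambda>x. of_bool (x \<in> (\<Union>\<beta>\<in>insert \<beta> B. cyl E \<beta>)) :: 'k)"
    using d by (auto simp: fun_eq_iff)
  moreover have "finsum F (path_proj F) (insert \<beta> B) = path_proj F \<beta> \<oplus>\<^bsub>F\<^esub> finsum F (path_proj F) B"
    using insert.hyps B by (intro A.finsum_insert) auto
  ultimately show ?case by (simp only:)
qed

text \<open>The point mass at \<open>x\<close> is an eigenvector and reveals the value of the
  multiplier there.\<close>

lemma acts_unique:
  assumes "acts z f" "acts z g" "x \<in> infpaths E" shows "f x = g x"
proof -
  let ?\<xi> = "\<lambda>y. of_bool (y = x) :: 'k"
  have "?\<xi> \<in> pathfun E" using assms(3) by (auto simp: pathfun_def)
  then have "(\<lambda>y. f y * ?\<xi> y) = (\<lambda>y. g y * ?\<xi> y)" using assms by (auto simp: acts_def)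
  from fun_cong[OF this, of x] show ?thesis by simp
qed

text \<open>By \<open>I_ker\<close>, elements equal modulo \<open>I\<close> act alike on functions;
  so a multiplier belongs to a class of the quotient.\<close>

lemma acts_mod:
  assumes "x \<in> carrier F" "y \<in> carrier F" "q x = q y" "acts x f" shows "acts y f"
proof -
  have "x \<ominus>\<^bsub>F\<^esub> y \<in> op_ker E" using assms I_ker q_eq_iff by blast
  then have *: "(\<lambda>z. op E x \<xi> z - op E y \<xi> z) = (\<lambda>z. 0)" if "\<xi> \<in> pathfun E" for \<xi>
    using that assms op_minus[of x E y \<xi>] by (simp add: op_ker_def)
  have "op E x \<xi> z = op E y \<xi> z" if "\<xi> \<in> pathfun E" for \<xi> z
    using fun_cong[OF *[OF that], of z] by simp
  then have "op E x \<xi> = op E y \<xi>" if "\<xi> \<in> pathfun E" for \<xi> using that by blast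
  then show ?thesis using assms(4) by (simp add: acts_def)
qed

lemma q_finsum: "B \<subseteq> paths E \<Longrightarrow> q (finsum F (path_proj F) B) = finsum Qt pp B"
proof -
  assume B: "B \<subseteq> paths E"
  then have "q (finsum F (path_proj F) B) = (\<Oplus>\<^bsub>Qt\<^esub>\<beta>\<in>B. q (path_proj F \<beta>))"
    by (intro qh.hom_finsum) auto
  also have "\<dots> = finsum Qt pp B"
    using B by (intro Qt.finsum_cong') (auto simp: qh.hom_path_proj subset_iff)
  finally show ?thesis .
qed

text \<open>The Gelfand picture of the diagonal: \<open>z\<close> becomes multiplication by a
  locally constant \<open>f\<close>, and applying the endomorphism composes \<open>f\<close> with
  the itinerary.\<close>

lemma cdiag_function:
  "z \<in> cdiag \<Longrightarrow> \<exists>f N. local_fun N f \<and> acts z f \<and> acts (phi z) (\<lambda>x. f (itinerary x))"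
proof (induction rule: cdiag_induct)
  case zero
  have "phi \<zero>\<^bsub>F\<^esub> = \<zero>\<^bsub>F\<^esub>" using ring_hom_zero[OF phi_hom] A.ring_axioms by blast
  then show ?case using acts_zero by (intro exI[of _ "\<lambda>x. 0"]) (auto simp: local_fun_def)
next
  case (gen c \<beta>)
  obtain B where B: "finite B" "B \<subseteq> paths E" "path_proj twisted \<beta> = finsum Qt pp B"
    "{x \<in> infpaths E. itinerary x \<in> cyl E \<beta>} = (\<Union>\<gamma>\<in>B. cyl E \<gamma>)"
    "\<forall>\<beta>\<in>B. \<forall>\<gamma>\<in>B. \<beta> \<noteq> \<gamma> \<longrightarrow> cyl E \<beta> \<inter> cyl E \<gamma> = {}"
    using twisted_proj[OF gen] .
  have c: "finsum F (path_proj F) B \<in> carrier F" using B(2) by (intro A.finsum_closed) auto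
  have "acts (phi (path_proj F \<beta>)) (\<lambda>x. of_bool (x \<in> (\<Union>\<gamma>\<in>B. cyl E \<gamma>)))"
    by (rule acts_mod[OF c _ _ acts_finsum[OF B(1,2,5)]])
      (use gen B in \<open>auto simp: q_finsum q_phi_proj\<close>)
  then have "acts (phi (path_proj F \<beta>)) (\<lambda>x. of_bool (itinerary x \<in> cyl E \<beta>))"
    by (rule acts_cong) (use B(4) in auto)
  then have "acts (phi (const c \<otimes>\<^bsub>F\<^esub> path_proj F \<beta>)) (\<lambda>x. c * of_bool (itinerary x \<in> cyl E \<beta>))"
    using gen by (simp add: phi_mult phi_const acts_scale)
  moreover have "acts (const c \<otimes>\<^bsub>F\<^esub> path_proj F \<beta>) (\<lambda>x. c * of_bool (x \<in> cyl E \<beta>))"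
    using gen by (intro acts_scale acts_proj) auto
  moreover have "local_fun (length (snd \<beta>)) (\<lambda>x. c * of_bool (x \<in> cyl E \<beta>))"
    by (auto simp: local_fun_def cyl_def)
  ultimately show ?case by (intro exI[of _ "\<lambda>x. c * of_bool (x \<in> cyl E \<beta>)"]) blast
next
  case (add x y)
  then obtain f N g M where fg: "local_fun N f" "acts x f" "acts (phi x) (\<lambda>x. f (itinerary x))"
    "local_fun M g" "acts y g" "acts (phi y) (\<lambda>x. g (itinerary x))" by blast
  have c: "x \<in> carrier F" "y \<in> carrier F" using add cdiag_carrier by auto
  have "local_fun (max N M) (\<lambda>x. f x + g x)"
    unfolding local_fun_def
  proof (intro ballI impI)
    fix a b assume ab: "a \<in> infpaths E" "b \<in> infpaths E" "src E a = src E b" "stake (max N M) a = stake (max N M) b"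
    have "stake N a = stake N b" "stake M a = stake M b" by (rule stake_mono[OF ab(4)], simp)+
    then show "f a + g a = f b + g b" using fg(1,4) ab unfolding local_fun_def by metis
  qed
  moreover have "acts (x \<oplus>\<^bsub>F\<^esub> y) (\<lambda>x. f x + g x)" using fg c by (intro acts_add)
  moreover have "acts (phi (x \<oplus>\<^bsub>F\<^esub> y)) (\<lambda>x. f (itinerary x) + g (itinerary x))"
    unfolding phi_add[OF c] using fg c by (intro acts_add) auto
  ultimately show ?case by (intro exI[of _ "\<lambda>x. f x + g x"]) blast
qed

lemma phi_cdiag: "z \<in> cdiag \<Longrightarrow> \<exists>z'\<in>cdiag. q (phi z) = q z'"
proof (induction rule: cdiag_induct)
  case zero
  have "phi \<zero>\<^bsub>F\<^esub> = \<zero>\<^bsub>F\<^esub>" using ring_hom_zero[OF phi_hom] A.ring_axioms by blast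
  then show ?case using cdiag_zero by (intro bexI[of _ "\<zero>\<^bsub>F\<^esub>"]) auto
next
  case (gen c \<beta>)
  obtain B where B: "finite B" "B \<subseteq> paths E" "path_proj twisted \<beta> = finsum Qt pp B"
    by (rule twisted_proj[OF gen])
  have z: "finsum F (path_proj F) B \<in> cdiag" using B cdiag_finsum by blast
  have "q (phi (const c \<otimes>\<^bsub>F\<^esub> path_proj F \<beta>)) = q (const c \<otimes>\<^bsub>F\<^esub> finsum F (path_proj F) B)"
    using gen B cdiag_carrier[OF z] by (simp add: phi_mult phi_const q_phi_proj q_finsum)
  then show ?case using cdiag_scale[OF z] by blast
next
  case (add x y)
  then obtain x' y' where x': "x' \<in> cdiag" "q (phi x) = q x'" and y': "y' \<in> cdiag" "q (phi y) = q y'" by blast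
  have "q (phi (x \<oplus>\<^bsub>F\<^esub> y)) = q (x' \<oplus>\<^bsub>F\<^esub> y')"
    using x' y' add cdiag_carrier by (simp add: phi_add)
  then show ?case using cdiag_add[OF x'(1) y'(1)] by blast
qed

text \<open>Surjectivity onto the diagonal modulo \<open>I\<close>: on generators it is the
  expansion from \<open>determined_proj\<close>, and linearity does the rest.\<close>

lemma cdiag_phi:
  assumes det: "\<forall>\<beta>\<in>paths E. determined \<beta>"
  shows "z \<in> cdiag \<Longrightarrow> \<exists>z'\<in>cdiag. q z = q (phi z')"
proof (induction rule: cdiag_induct)
  case zero
  have "phi \<zero>\<^bsub>F\<^esub> = \<zero>\<^bsub>F\<^esub>" using ring_hom_zero[OF phi_hom] A.ring_axioms by blast
  then show ?case using cdiag_zero by (intro bexI[of _ "\<zero>\<^bsub>F\<^esub>"]) auto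
next
  case (gen c \<beta>)
  obtain W where W: "finite W" "W \<subseteq> paths E" "pp \<beta> = finsum Qt (path_proj twisted) W"
    using determined_proj[OF gen] det gen by blast
  have z: "finsum F (path_proj F) W \<in> cdiag" using W cdiag_finsum by blast
  have "q (phi (finsum F (path_proj F) W)) = finsum twisted (\<lambda>w. q (phi (path_proj F w))) W"
    using W by (intro ph.hom_finsum) auto
  also have "\<dots> = finsum Qt (path_proj twisted) W"
    unfolding twisted_finsum using W tw.pp_closed
    by (intro Qt.finsum_cong') (auto simp: q_phi_proj subset_iff)
  finally have *: "q (phi (finsum F (path_proj F) W)) = q (path_proj F \<beta>)"
    using W gen by (simp add: qh.hom_path_proj)
  have "q (phi (const c \<otimes>\<^bsub>F\<^esub> finsum F (path_proj F) W)) = q (const c \<otimes>\<^bsub>F\<^esub> path_proj F \<beta>)"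
    using gen cdiag_carrier[OF z] * by (simp add: phi_mult phi_const)
  then show ?case using cdiag_scale[OF z] by metis
next
  case (add x y)
  then obtain x' y' where x': "x' \<in> cdiag" "q x = q (phi x')" and y': "y' \<in> cdiag" "q y = q (phi y')" by blast
  have "q (x \<oplus>\<^bsub>F\<^esub> y) = q (phi (x' \<oplus>\<^bsub>F\<^esub> y'))"
    using x' y' add cdiag_carrier by (simp add: phi_add)
  then show ?case using cdiag_add[OF x'(1) y'(1)] by blast
qed

text \<open>The predicate \<open>p\<close> decides membership from the value of \<open>f\<close>:
  equality with 1 for exact preimages, distance to 1 for approximate ones.\<close>

lemma determinedI:
  assumes loc: "local_fun N f" and f: "\<And>x. x \<in> infpaths E \<Longrightarrow> x \<in> cyl E \<beta> \<longleftrightarrow> p (f (itinerary x))"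
  shows "determined \<beta>"
proof -
  \<comment> \<open>\<open>Suc N\<close> instead of \<open>N\<close>, so that at least one letter is
    compared and the sources of the itineraries agree.\<close>
  have "x \<in> cyl E \<beta> \<longleftrightarrow> y \<in> cyl E \<beta>"
    if xy: "x \<in> infpaths E" "y \<in> infpaths E" "stake (Suc N) (itinerary x) = stake (Suc N) (itinerary y)" for x y
  proof -
    have "src E (itinerary x) = src E (itinerary y)" using xy(3) by (simp add: src_def)
    moreover have "stake N (itinerary x) = stake N (itinerary y)" by (rule stake_mono[OF xy(3)]) simp
    ultimately have "f (itinerary x) = f (itinerary y)"
      using loc itinerary_infpaths(1) xy unfolding local_fun_def by blast
    then show ?thesis using f xy by simp
  qed
  then show ?thesis unfolding determined_def by blast
qed

end

section \<open>The Leavitt path algebra\<close>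

lemma leavitt_rels_carrier:
  assumes "fin_digraph E" "graph_star_ring E A"
  shows "leavitt_rels A E \<subseteq> carrier A"
proof -
  interpret fin_digraph E by fact
  interpret graph_star_ring E A by fact
  have [simp]: "(\<Oplus>\<^bsub>A\<^esub>v\<in>verts E. vproj A v) \<in> carrier A"
    "(\<Oplus>\<^bsub>A\<^esub>e\<in>out_arcs E v. eiso A e \<otimes>\<^bsub>A\<^esub> star A (eiso A e)) \<in> carrier A" for v
    by (auto intro!: finsum_closed)
  show ?thesis unfolding leavitt_rels_subset by auto
qed

text \<open>The involution permutes the relations, so the preimage of the ideal under it is again an
  ideal containing them.\<close>

lemma star_leavitt_ideal:
  assumes "fin_digraph E" "graph_star_ring E A" and x: "x \<in> genideal A (leavitt_rels A E)"
  shows "star A x \<in> genideal A (leavitt_rels A E)"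
proof -
  interpret fin_digraph E by fact
  interpret graph_star_ring E A by fact
  let ?I = "genideal A (leavitt_rels A E)"
  note rc = leavitt_rels_carrier[OF assms(1,2)]
  interpret I: ideal ?I A by (rule genideal_ideal[OF rc])
  have rels: "leavitt_rels A E \<subseteq> ?I" by (rule genideal_self[OF rc])
  have [simp]: "(\<Oplus>\<^bsub>A\<^esub>v\<in>verts E. vproj A v) \<in> carrier A"
    "(\<Oplus>\<^bsub>A\<^esub>e\<in>out_arcs E v. eiso A e \<otimes>\<^bsub>A\<^esub> star A (eiso A e)) \<in> carrier A" for v
    by (auto intro!: finsum_closed)
  have s1: "star A (\<Oplus>\<^bsub>A\<^esub>v\<in>verts E. vproj A v) = (\<Oplus>\<^bsub>A\<^esub>v\<in>verts E. vproj A v)"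
    by (subst star_finsum) (auto intro!: finsum_cong')
  have s2: "star A (\<Oplus>\<^bsub>A\<^esub>e\<in>out_arcs E v. eiso A e \<otimes>\<^bsub>A\<^esub> star A (eiso A e)) =
      (\<Oplus>\<^bsub>A\<^esub>e\<in>out_arcs E v. eiso A e \<otimes>\<^bsub>A\<^esub> star A (eiso A e))" for v
    by (subst star_finsum) (auto intro!: finsum_cong' simp: star_mult)
  have "ideal {x \<in> carrier A. star A x \<in> ?I} A"
    by (rule ideal_intro)
      (auto simp: star_add star_mult I.I_l_closed I.I_r_closed additive_subgroup.a_closed[OF I.is_additive_subgroup]
        additive_subgroup.zero_closed[OF I.is_additive_subgroup])
  moreover have "leavitt_rels A E \<subseteq> {x \<in> carrier A. star A x \<in> ?I}"
  proof -
    have "leavitt_rels A E \<subseteq> {x. star A x \<in> ?I}"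
      unfolding leavitt_rels_subset mem_Collect_eq using rels[unfolded leavitt_rels_subset[of A E ?I]]
      by (simp add: star_minus star_mult s1 s2)
    then show ?thesis using rc by blast
  qed
  ultimately have "?I \<subseteq> {x \<in> carrier A. star A x \<in> ?I}" by (rule genideal_minimal)
  then show ?thesis using x by blast
qed

interpretation int_conj: conjugation "id :: int \<Rightarrow> int"
  by unfold_locales auto

locale leavitt_int = path_graph E for E :: "('v, 'e) pre_digraph"
begin

abbreviation "FZ \<equiv> free_alg (id :: int \<Rightarrow> int) E"

definition relI :: "(('v, 'e) gen list \<Rightarrow> int) set" where
  "relI = genideal FZ (leavitt_rels FZ E)"

lemma leavitt_quot: "leavitt E = quot_alg FZ relI"
  by (simp add: leavitt_def relI_def Let_def)

lemma path_graph_E': "path_graph E" ..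

sublocale FZ: graph_star_ring E FZ by (rule int_conj.free_graph_star_ring)

lemma rels_FZ: "leavitt_rels FZ E \<subseteq> carrier FZ"
  by (rule leavitt_rels_carrier[OF fin_digraph FZ.graph_star_ring_axioms])

lemma relI_ideal: "ideal relI FZ"
  unfolding relI_def by (rule FZ.genideal_ideal[OF rels_FZ])

lemma relI_star: "x \<in> relI \<Longrightarrow> star FZ x \<in> relI"
  unfolding relI_def by (rule star_leavitt_ideal[OF fin_digraph FZ.graph_star_ring_axioms])

lemma relI_rels: "leavitt_rels FZ E \<subseteq> relI"
  unfolding relI_def by (rule FZ.genideal_self[OF rels_FZ])

lemma relI_ker: "relI \<subseteq> int_conj.op_ker E"
  unfolding relI_def
  by (rule FZ.genideal_minimal[OF int_conj.op_ker_ideal int_conj.op_ker_rels[OF path_graph_E']])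

sublocale sq: star_quotient E FZ relI
proof -
  interpret ideal relI FZ by (rule relI_ideal)
  show "star_quotient E FZ relI" by unfold_locales (rule relI_star)
qed

sublocale L: leavitt_alg E "leavitt E"
proof -
  have "sq.q x = \<zero>\<^bsub>sq.Qt\<^esub>" if "x \<in> leavitt_rels FZ E" for x
  proof -
    have x: "x \<in> relI" using relI_rels that by (rule subsetD)
    show ?thesis by (rule iffD2[OF sq.q_eq_zero[OF sq.Icarr[OF x]] x])
  qed
  then have "leavitt_rels sq.Qt E \<subseteq> {\<zero>\<^bsub>sq.Qt\<^esub>}"
    unfolding sq.qh.leavitt_rels_vimage[symmetric] singleton_iff by blast
  then show "leavitt_alg E (leavitt E)"
    unfolding leavitt_quot by unfold_locales
qed

lemma op_q:
  assumes "f \<in> carrier FZ" "g \<in> carrier FZ" "sq.q f = sq.q g" "\<xi> \<in> pathfun E"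
  shows "op E f \<xi> = op E g \<xi>"
proof -
  have "f \<ominus>\<^bsub>FZ\<^esub> g \<in> int_conj.op_ker E" using assms relI_ker sq.q_eq_iff by blast
  then have "(\<lambda>z. op E f \<xi> z - op E g \<xi> z) = (\<lambda>z. 0)"
    using assms int_conj.op_minus[of f E g \<xi>] by (simp add: int_conj.op_ker_def)
  then have "op E f \<xi> z = op E g \<xi> z" for z by (metis eq_iff_diff_eq_0)
  then show ?thesis by blast
qed

lemma pe_q: "\<beta> \<in> paths E \<Longrightarrow> L.pe \<beta> = sq.q (path_elt FZ \<beta>)"
  unfolding leavitt_quot by (rule sq.qh.hom_path_elt[symmetric])

lemma star_pe_q: "\<beta> \<in> paths E \<Longrightarrow> star (leavitt E) (L.pe \<beta>) = sq.q (star FZ (path_elt FZ \<beta>))"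
  unfolding pe_q using path_elt_closed[OF FZ.graph_star_ring_axioms] sq.qh.hom_star[of "path_elt FZ \<beta>"]
  by (simp add: leavitt_quot)

subsection \<open>Admissible sets partition the path space\<close>

lemma op_pairs:
  assumes J: "finite J" "\<And>j. j \<in> J \<Longrightarrow> a j \<in> paths E \<and> b j \<in> paths E \<and> prange E (a j) = prange E (b j)"
    and \<xi>: "\<xi> \<in> pathfun E"
  shows "op E (\<Oplus>\<^bsub>FZ\<^esub>j\<in>J. path_elt FZ (a j) \<otimes>\<^bsub>FZ\<^esub> star FZ (path_elt FZ (b j))) \<xi> x =
    (\<Sum>j\<in>J. if x \<in> cyl E (a j) then \<xi> (snd (b j) @- sdrop (length (snd (a j))) x) else 0)"
proof -
  have c: "path_elt FZ (a j) \<in> carrier FZ" "path_elt FZ (b j) \<in> carrier FZ" if "j \<in> J" for j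
    using J that path_elt_closed[OF FZ.graph_star_ring_axioms] by auto
  have "op E (\<Oplus>\<^bsub>FZ\<^esub>j\<in>J. path_elt FZ (a j) \<otimes>\<^bsub>FZ\<^esub> star FZ (path_elt FZ (b j))) \<xi> x =
      (\<Sum>j\<in>J. op E (path_elt FZ (a j) \<otimes>\<^bsub>FZ\<^esub> star FZ (path_elt FZ (b j))) \<xi> x)"
    using c by (subst int_conj.op_finsum[OF J(1)]) auto
  also have "\<dots> = (\<Sum>j\<in>J. if x \<in> cyl E (a j) then \<xi> (snd (b j) @- sdrop (length (snd (a j))) x) else 0)"
  proof (rule sum.cong[OF refl])
    fix j assume j: "j \<in> J"
    have p: "a j \<in> paths E" "b j \<in> paths E" "prange E (a j) = prange E (b j)" using J j by auto
    have "op E (path_elt FZ (a j) \<otimes>\<^bsub>FZ\<^esub> star FZ (path_elt FZ (b j))) \<xi> x =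
        op E (path_elt FZ (a j)) (op E (star FZ (path_elt FZ (b j))) \<xi>) x"
      by (subst int_conj.op_mult[OF c(1)[OF j] FZ.star_closed[OF c(2)[OF j]]]) simp
    then show "op E (path_elt FZ (a j) \<otimes>\<^bsub>FZ\<^esub> star FZ (path_elt FZ (b j))) \<xi> x =
        (if x \<in> cyl E (a j) then \<xi> (snd (b j) @- sdrop (length (snd (a j))) x) else 0)"
      using int_conj.op_path_elt(1)[OF path_graph_E' op_pathfun[OF \<xi>] p(1), of _ x]
        int_conj.op_path_elt(2)[OF path_graph_E' \<xi> p(2), of "sdrop (length (snd (a j))) x"]
        cyl_sdrop[OF p(1), of x] p(3) by simp
  qed
  finally show ?thesis .
qed

text \<open>Applying the product to the point mass at \<open>x\<close> and evaluating at
  \<open>x\<close> expresses 1 as a sum of integers, one for each \<open>j\<close> with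
  \<open>x \<in> cyl E (a j)\<close>. Each of them is at least 1, so there is exactly one such
  \<open>j\<close>.\<close>

lemma unique_pair:
  fixes a b :: "'j \<Rightarrow> ('v, 'e) gpath"
  assumes J: "finite J" "\<And>j. j \<in> J \<Longrightarrow> a j \<in> paths E \<and> b j \<in> paths E \<and> prange E (a j) = prange E (b j)"
    and inv: "\<And>\<xi>. \<xi> \<in> pathfun E \<Longrightarrow>
      op E (\<Oplus>\<^bsub>FZ\<^esub>j\<in>J. path_elt FZ (a j) \<otimes>\<^bsub>FZ\<^esub> star FZ (path_elt FZ (b j)))
        (op E (\<Oplus>\<^bsub>FZ\<^esub>j\<in>J. path_elt FZ (b j) \<otimes>\<^bsub>FZ\<^esub> star FZ (path_elt FZ (a j))) \<xi>) = \<xi>"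
    and x: "x \<in> infpaths E"
  shows "\<exists>!j. j \<in> J \<and> x \<in> cyl E (a j)"
proof -
  let ?d = "\<lambda>y. of_bool (y = x) :: int"
  define \<eta> where "\<eta> = op E (\<Oplus>\<^bsub>FZ\<^esub>j\<in>J. path_elt FZ (b j) \<otimes>\<^bsub>FZ\<^esub> star FZ (path_elt FZ (a j))) ?d"
  let ?y = "\<lambda>j. snd (b j) @- sdrop (length (snd (a j))) x"
  have d: "?d \<in> pathfun E" using x by (auto simp: pathfun_def)
  have \<eta>: "\<eta> y = (\<Sum>k\<in>J. if y \<in> cyl E (b k) then ?d (snd (a k) @- sdrop (length (snd (b k))) y) else 0)" for y
    unfolding \<eta>_def by (rule op_pairs) (use J d in auto)
  have "\<eta> \<in> pathfun E" unfolding \<eta>_def by (rule op_pathfun[OF d])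
  then have "(\<Sum>j\<in>J. if x \<in> cyl E (a j) then \<eta> (?y j) else 0) =
      op E (\<Oplus>\<^bsub>FZ\<^esub>j\<in>J. path_elt FZ (a j) \<otimes>\<^bsub>FZ\<^esub> star FZ (path_elt FZ (b j))) \<eta> x"
    by (intro op_pairs[symmetric]) (use J in auto)
  also have "\<dots> = 1" unfolding \<eta>_def using inv[OF d] by simp
  finally have one: "(\<Sum>j\<in>J. if x \<in> cyl E (a j) then \<eta> (?y j) else 0) = 1" .
  let ?S = "{j \<in> J. x \<in> cyl E (a j)}"
  have sumS: "(\<Sum>j\<in>?S. \<eta> (?y j)) = 1"
    using one J(1) by (simp add: sum.If_cases Int_def)
  \<comment> \<open>\<open>\<eta>\<close> is a sum of non-negative terms, and the term
    \<open>k = j\<close> leads back to \<open>x\<close> and contributes 1.\<close>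
  have ge: "\<eta> (?y j) \<ge> 1" if j: "j \<in> ?S" for j
  proof -
    have p: "a j \<in> paths E" "b j \<in> paths E" "prange E (a j) = prange E (b j)" using J j by auto
    have y: "?y j \<in> cyl E (b j)"
      using cyl_sdrop[OF p(1)] j p(3) cyl_iff[OF p(2)] by auto
    have "snd (a j) @- sdrop (length (snd (b j))) (?y j) = x"
      using cyl_sdrop(3)[OF p(1)] j by (simp add: sdrop_shift)
    then have "(1 :: int) = (if ?y j \<in> cyl E (b j) then ?d (snd (a j) @- sdrop (length (snd (b j))) (?y j)) else 0)"
      using y by simp
    also have "\<dots> \<le> \<eta> (?y j)"
      unfolding \<eta> by (rule member_le_sum) (use j J in auto)
    finally show ?thesis .
  qed
  have "int (card ?S) = (\<Sum>j\<in>?S. 1)" by simp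
  also have "\<dots> \<le> (\<Sum>j\<in>?S. \<eta> (?y j))" by (rule sum_mono[OF ge])
  finally have "card ?S \<le> 1" using sumS by simp
  moreover have "card ?S \<noteq> 0"
  proof
    assume "card ?S = 0"
    then have "?S = {}" using J(1) by simp
    then show False using sumS by (simp only: sum.empty)
  qed
  ultimately have "card ?S = 1" by simp
  then obtain j where j: "?S = {j}" by (auto simp: card_1_singleton_iff)
  have "j \<in> J \<and> x \<in> cyl E (a j)" and "\<And>k. k \<in> J \<and> x \<in> cyl E (a k) \<Longrightarrow> k = j"
    using j by (auto simp: set_eq_iff)
  then show ?thesis by (rule ex1I)
qed

lemma admissible_coding:
  assumes adm: "admissible E J"
  shows "coding E J"
proof -
  have J: "finite J" "J \<subseteq> paths E \<times> paths E" using adm by (auto simp: admissible_def)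
  have Jp: "fst j \<in> paths E \<and> snd j \<in> paths E \<and> prange E (fst j) = prange E (snd j)" if "j \<in> J" for j
    using adm that unfolding admissible_def by (cases j) fastforce
  have Jq: "fst (fst j) = fst (snd j)" "snd (snd j) \<noteq> []" if "j \<in> J" for j
    using adm that unfolding admissible_def psource_def plength_def by (cases j; fastforce)+
  let ?u = "pair_sum FZ J"
  have u: "?u \<in> carrier FZ" by (rule pair_sum_closed[OF FZ.graph_star_ring_axioms J(2)])
  have un: "is_unitary sq.Qt (pair_sum sq.Qt J)"
    using adm by (simp add: admissible_def leavitt_quot)
  have qu: "pair_sum sq.Qt J = sq.q ?u" by (rule sq.qh.hom_pair_sum[OF J(2), symmetric])
  have c: "path_elt FZ (fst j) \<in> carrier FZ" "path_elt FZ (snd j) \<in> carrier FZ" if "j \<in> J" for j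
    using Jp[OF that] path_elt_closed[OF FZ.graph_star_ring_axioms] by auto
  have u1: "?u = (\<Oplus>\<^bsub>FZ\<^esub>j\<in>J. path_elt FZ (fst j) \<otimes>\<^bsub>FZ\<^esub> star FZ (path_elt FZ (snd j)))"
    by (simp add: pair_sum_def case_prod_unfold)
  have u2: "star FZ ?u = (\<Oplus>\<^bsub>FZ\<^esub>j\<in>J. path_elt FZ (snd j) \<otimes>\<^bsub>FZ\<^esub> star FZ (path_elt FZ (fst j)))"
    unfolding u1 using c by (subst FZ.star_finsum) (auto intro!: FZ.finsum_cong' simp: FZ.star_mult)
  have "sq.q (?u \<otimes>\<^bsub>FZ\<^esub> star FZ ?u) = sq.q \<one>\<^bsub>FZ\<^esub>" "sq.q (star FZ ?u \<otimes>\<^bsub>FZ\<^esub> ?u) = sq.q \<one>\<^bsub>FZ\<^esub>"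
    using un u unfolding qu is_unitary_def by (simp_all add: sq.qh.hom_star)
  then have "op E (?u \<otimes>\<^bsub>FZ\<^esub> star FZ ?u) \<xi> = op E \<one>\<^bsub>FZ\<^esub> \<xi>" "op E (star FZ ?u \<otimes>\<^bsub>FZ\<^esub> ?u) \<xi> = op E \<one>\<^bsub>FZ\<^esub> \<xi>"
    if "\<xi> \<in> pathfun E" for \<xi>
    using u that by (auto intro!: op_q)
  then have inv: "op E ?u (op E (star FZ ?u) \<xi>) = \<xi>" "op E (star FZ ?u) (op E ?u \<xi>) = \<xi>"
    if "\<xi> \<in> pathfun E" for \<xi>
    using u that by (simp_all add: int_conj.op_mult free_simps(2) op_const)
  \<comment> \<open>The two orders of the product give the two partitions, with the roles of the
    components exchanged.\<close>
  have pf: "\<exists>!j. j \<in> J \<and> x \<in> cyl E (fst j)" if "x \<in> infpaths E" for x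
    by (rule unique_pair[where b = snd]) (use J Jp inv that in \<open>auto simp: u1[symmetric] u2[symmetric]\<close>)
  have ps: "\<exists>!j. j \<in> J \<and> x \<in> cyl E (snd j)" if "x \<in> infpaths E" for x
    by (rule unique_pair[where b = fst]) (use J Jp inv that in \<open>auto simp: u1[symmetric] u2[symmetric]\<close>)
  show ?thesis
    by unfold_locales (use J Jp Jq pf ps in blast)+
qed

subsection \<open>Labels of the coding graph\<close>

text \<open>Detected by the action on the point mass of a path starting at \<open>v\<close>.\<close>

lemma vproj_nonzero:
  assumes v: "v \<in> verts E" shows "L.P v \<noteq> \<zero>\<^bsub>leavitt E\<^esub>"
proof
  assume "L.P v = \<zero>\<^bsub>leavitt E\<^esub>"
  then have "sq.q (vproj FZ v) = sq.q \<zero>\<^bsub>FZ\<^esub>" using v by (simp add: leavitt_quot sq.qh.hom_vproj)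
  moreover obtain x where x: "x \<in> infpaths E" "src E x = v" using ex_infpath[OF v] .
  moreover have "(\<lambda>y. of_bool (y = x) :: int) \<in> pathfun E" using x by (auto simp: pathfun_def)
  ultimately have "op E (vproj FZ v) (\<lambda>y. of_bool (y = x) :: int) = op E \<zero>\<^bsub>FZ\<^esub> (\<lambda>y. of_bool (y = x))"
    using v by (intro op_q) auto
  then have "gen_op E (GP v) (\<lambda>y. of_bool (y = x) :: int) x = 0"
    by (simp only: free_simps(3,6) op_delta op_zero)
  then show False using x by simp
qed

lemma pe_nonzero:
  assumes "\<beta> \<in> paths E" shows "L.pe \<beta> \<noteq> \<zero>\<^bsub>leavitt E\<^esub>" "star (leavitt E) (L.pe \<beta>) \<noteq> \<zero>\<^bsub>leavitt E\<^esub>"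
proof -
  show n: "L.pe \<beta> \<noteq> \<zero>\<^bsub>leavitt E\<^esub>"
  proof
    assume "L.pe \<beta> = \<zero>\<^bsub>leavitt E\<^esub>"
    then have "L.P (prange E \<beta>) = \<zero>\<^bsub>leavitt E\<^esub>" using L.pe_iso[of "fst \<beta>" "snd \<beta>"] assms by simp
    then show False using vproj_nonzero prange_in_verts[of "fst \<beta>" "snd \<beta>"] assms by simp
  qed
  show "star (leavitt E) (L.pe \<beta>) \<noteq> \<zero>\<^bsub>leavitt E\<^esub>"
    using n L.star_star[OF L.pe_closed[OF assms]] L.star_zero by metis
qed

text \<open>Both streams are \<open>g\<close> repeated forever.\<close>

lemma periodic_unique:
  assumes "y = g @- y" "z = g @- z" "g \<noteq> []" shows "y = z"
proof (rule stream_eqI_stake)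
  fix n show "stake n y = stake n z"
  proof (induction n rule: less_induct)
    case (less n)
    have "stake (n - length g) y = stake (n - length g) z"
      using less[of "n - length g"] assms(3) by (cases "n = 0") auto
    then show ?case using assms(1,2) by (metis stake_shift)
  qed
qed

context
  assumes exits: "\<forall>\<mu>\<in>cycles E. has_exit E \<mu>"
begin

text \<open>Were \<open>\<beta>\<close> longer by a word \<open>g\<close>, comparing the actions on
  point masses would make every path leaving the range of \<open>\<beta>\<close> equal to
  \<open>g\<close> repeated forever. Exits provide two such paths.\<close>

lemma pe_eq_length_le:
  assumes p: "\<alpha> \<in> paths E" "\<beta> \<in> paths E" and eq: "L.pe \<alpha> = L.pe \<beta>"
  shows "length (snd \<beta>) \<le> length (snd \<alpha>)"
proof (rule ccontr)
  assume "\<not> length (snd \<beta>) \<le> length (snd \<alpha>)"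
  then have lt: "length (snd \<alpha>) < length (snd \<beta>)" by simp
  define g where "g = drop (length (snd \<alpha>)) (snd \<beta>)"
  have per: "y = g @- y" if y: "y \<in> infpaths E" "src E y = prange E \<beta>" for y
  proof -
    let ?d = "\<lambda>z. of_bool (z = y) :: int"
    have d: "?d \<in> pathfun E" using y by (auto simp: pathfun_def)
    let ?x = "snd \<beta> @- y"
    have x: "?x \<in> cyl E \<beta>" using cyl_iff[OF p(2)] y by blast
    have "op E (path_elt FZ \<alpha>) ?d = op E (path_elt FZ \<beta>) ?d"
      using eq p d path_elt_closed[OF FZ.graph_star_ring_axioms] by (intro op_q) (auto simp: pe_q)
    then have "op E (path_elt FZ \<alpha>) ?d ?x = op E (path_elt FZ \<beta>) ?d ?x" by simp
    then have "sdrop (length (snd \<alpha>)) ?x = y"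
      using int_conj.op_path_elt(1)[OF path_graph_E' d p(1), of ?x]
        int_conj.op_path_elt(1)[OF path_graph_E' d p(2), of ?x] x
      by (simp add: sdrop_shift split: if_splits)
    then show ?thesis using lt by (simp add: sdrop_shift g_def)
  qed
  have "prange E \<beta> \<in> verts E" using prange_in_verts[of "fst \<beta>" "snd \<beta>"] p by simp
  from two_infpaths[OF exits this] obtain y z where
    "y \<in> infpaths E" "z \<in> infpaths E" "src E y = prange E \<beta>" "src E z = prange E \<beta>" "y \<noteq> z" .
  moreover have "g \<noteq> []" using lt by (simp add: g_def)
  ultimately show False using per periodic_unique by blast
qed

text \<open>The same comparison forces periodicity with period
  \<open>snd \<beta> @ snd \<alpha>\<close>, unless this word is empty.\<close>

lemma pe_eq_star:
  assumes p: "\<alpha> \<in> paths E" "\<beta> \<in> paths E" and eq: "L.pe \<alpha> = star (leavitt E) (L.pe \<beta>)"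
  shows "snd \<alpha> = [] \<and> snd \<beta> = []"
proof (rule ccontr)
  assume "\<not> ?thesis"
  then have ne: "snd \<beta> @ snd \<alpha> \<noteq> []" by auto
  have per: "y = (snd \<beta> @ snd \<alpha>) @- y" if y: "y \<in> infpaths E" "src E y = prange E \<alpha>" for y
  proof -
    let ?d = "\<lambda>z. of_bool (z = y) :: int"
    have d: "?d \<in> pathfun E" using y by (auto simp: pathfun_def)
    let ?x = "snd \<alpha> @- y"
    have x: "?x \<in> cyl E \<alpha>" using cyl_iff[OF p(1)] y by blast
    have "op E (path_elt FZ \<alpha>) ?d = op E (star FZ (path_elt FZ \<beta>)) ?d"
      using eq p d path_elt_closed[OF FZ.graph_star_ring_axioms] unfolding pe_q[OF p(1)] star_pe_q[OF p(2)]
      by (intro op_q) auto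
    then have "op E (path_elt FZ \<alpha>) ?d ?x = op E (star FZ (path_elt FZ \<beta>)) ?d ?x" by simp
    then have "snd \<beta> @- ?x = y"
      using int_conj.op_path_elt(1)[OF path_graph_E' d p(1), of ?x]
        int_conj.op_path_elt(2)[OF path_graph_E' d p(2), of ?x] x
      by (simp add: sdrop_shift split: if_splits)
    then show ?thesis by simp
  qed
  have "prange E \<alpha> \<in> verts E" using prange_in_verts[of "fst \<alpha>" "snd \<alpha>"] p by simp
  from two_infpaths[OF exits this] obtain y z where
    "y \<in> infpaths E" "z \<in> infpaths E" "src E y = prange E \<alpha>" "src E z = prange E \<alpha>" "y \<noteq> z" .
  then show False using per periodic_unique[OF _ _ ne] by blast
qed

text \<open>The degree is a definite description; the two preceding lemmas exclude a competing path
  of another length and a competing adjoint.\<close>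

lemma degree_pe:
  assumes p: "\<alpha> \<in> paths E" and l: "edge_label E x = L.pe \<alpha>"
  shows "edge_degree E x = int (length (snd \<alpha>))"
  unfolding edge_degree_def Let_def plength_def
proof (rule the_equality)
  fix d assume "\<exists>\<beta>\<in>paths E. edge_label E x = L.pe \<beta> \<and> d = int (length (snd \<beta>)) \<or>
      edge_label E x = star (leavitt E) (L.pe \<beta>) \<and> d = - int (length (snd \<beta>))"
  then obtain \<beta> where b: "\<beta> \<in> paths E" "edge_label E x = L.pe \<beta> \<and> d = int (length (snd \<beta>)) \<or>
      edge_label E x = star (leavitt E) (L.pe \<beta>) \<and> d = - int (length (snd \<beta>))" by blast
  from b(2) show "d = int (length (snd \<alpha>))"
  proof
    assume "edge_label E x = L.pe \<beta> \<and> d = int (length (snd \<beta>))"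
    then show ?thesis using pe_eq_length_le[OF p b(1)] pe_eq_length_le[OF b(1) p] l by simp
  next
    assume "edge_label E x = star (leavitt E) (L.pe \<beta>) \<and> d = - int (length (snd \<beta>))"
    then show ?thesis using pe_eq_star[OF p b(1)] l by simp
  qed
qed (use assms in auto)

lemma degree_star_pe:
  assumes p: "\<alpha> \<in> paths E" and l: "edge_label E x = star (leavitt E) (L.pe \<alpha>)"
  shows "edge_degree E x = - int (length (snd \<alpha>))"
  unfolding edge_degree_def Let_def plength_def
proof (rule the_equality)
  fix d assume "\<exists>\<beta>\<in>paths E. edge_label E x = L.pe \<beta> \<and> d = int (length (snd \<beta>)) \<or>
      edge_label E x = star (leavitt E) (L.pe \<beta>) \<and> d = - int (length (snd \<beta>))"
  then obtain \<beta> where b: "\<beta> \<in> paths E" "edge_label E x = L.pe \<beta> \<and> d = int (length (snd \<beta>)) \<or>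
      edge_label E x = star (leavitt E) (L.pe \<beta>) \<and> d = - int (length (snd \<beta>))" by blast
  from b(2) show "d = - int (length (snd \<alpha>))"
  proof
    assume "edge_label E x = L.pe \<beta> \<and> d = int (length (snd \<beta>))"
    then show ?thesis using pe_eq_star[OF b(1) p] l by simp
  next
    assume a: "edge_label E x = star (leavitt E) (L.pe \<beta>) \<and> d = - int (length (snd \<beta>))"
    then have "L.pe \<alpha> = L.pe \<beta>"
      using l L.star_star[OF L.pe_closed[OF p]] L.star_star[OF L.pe_closed[OF b(1)]] by metis
    then show ?thesis using pe_eq_length_le[OF p b(1)] pe_eq_length_le[OF b(1) p] a by simp
  qed
qed (use assms in auto)

text \<open>Cancelling the common prefix leaves the path element of the surplus, or its adjoint if
  the surplus belongs to the rest path. An empty surplus gives degree 0, and then both prefix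
  relations hold.\<close>

lemma labels:
  assumes "coding E J" shows "coding_labels E J"
proof -
  interpret coding E J by fact
  have lab: "edge_label E (a, b) = star (leavitt E) (L.pe (rest_path E a)) \<otimes>\<^bsub>leavitt E\<^esub> L.pe (fst b)" for a b
    by (simp add: edge_label_def Let_def)
  have pos: "\<exists>\<alpha>\<in>paths E. edge_label E (a, b) = L.pe \<alpha> \<and> snd (fst b) = snd (rest_path E a) @ snd \<alpha>"
    if ab: "a \<in> J" "b \<in> J" "fst (rest_path E a) = fst (fst b)" "prefix (snd (rest_path E a)) (snd (fst b))" for a b
  proof -
    obtain fs where fs: "snd (fst b) = snd (rest_path E a) @ fs" using ab(4) by (auto simp: prefix_def)
    have fb: "fst b = (fst (rest_path E a), snd (rest_path E a) @ fs)" using fs ab(3) by (simp add: prod_eq_iff)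
    have "fst b \<in> paths E" using J_paths[OF ab(2)] by simp
    then have p: "(fst (rest_path E a), snd (rest_path E a) @ fs) \<in> paths E" using fb by simp
    have "edge_label E (a, b) = L.pe (prange E (rest_path E a), fs)"
      unfolding lab fb using L.star_pe_append[OF p] by simp
    then show ?thesis
      using p fs paths_append[of "fst (rest_path E a)" "snd (rest_path E a)" fs]
      by (intro bexI[of _ "(prange E (rest_path E a), fs)"]) auto
  qed
  have neg: "\<exists>\<alpha>\<in>paths E. edge_label E (a, b) = star (leavitt E) (L.pe \<alpha>) \<and> snd (rest_path E a) = snd (fst b) @ snd \<alpha>"
    if ab: "a \<in> J" "b \<in> J" "fst (rest_path E a) = fst (fst b)" "prefix (snd (fst b)) (snd (rest_path E a))" for a b
  proof -
    obtain fs where fs: "snd (rest_path E a) = snd (fst b) @ fs" using ab(4) by (auto simp: prefix_def)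
    have fb: "rest_path E a = (fst (fst b), snd (fst b) @ fs)" using fs ab(3) by (simp add: prod_eq_iff)
    have bp: "fst b \<in> paths E" using J_paths[OF ab(2)] by simp
    have p: "(fst (fst b), snd (fst b) @ fs) \<in> paths E" using rest_path(1)[OF ab(1)] fb by simp
    have "star (leavitt E) (edge_label E (a, b)) = L.pe (prange E (fst b), fs)"
      unfolding lab fb using L.star_pe_append[OF p] L.pe_closed[OF p] L.pe_closed[OF bp]
      by (simp add: L.star_mult)
    moreover have "edge_label E (a, b) \<in> carrier (leavitt E)"
      unfolding lab using L.pe_closed rest_path(1)[OF ab(1)] bp by simp
    ultimately have "edge_label E (a, b) = star (leavitt E) (L.pe (prange E (fst b), fs))"
      using L.star_star by metis
    then show ?thesis
      using p fs paths_append[of "fst (fst b)" "snd (fst b)" fs]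
      by (intro bexI[of _ "(prange E (fst b), fs)"]) auto
  qed
  have arcs: "(a, b) \<in> arcs (coding_graph E J) \<longleftrightarrow> a \<in> J \<and> b \<in> J \<and> comparable (rest_path E a) (fst b)" for a b
  proof -
    have "edge_label E (a, b) \<noteq> \<zero>\<^bsub>leavitt E\<^esub> \<longleftrightarrow> comparable (rest_path E a) (fst b)" if ab: "a \<in> J" "b \<in> J"
    proof
      assume "edge_label E (a, b) \<noteq> \<zero>\<^bsub>leavitt E\<^esub>"
      then show "comparable (rest_path E a) (fst b)"
        unfolding lab using L.pe_orth rest_path(1)[OF ab(1)] J_paths[OF ab(2)] by blast
    next
      assume "comparable (rest_path E a) (fst b)"
      then show "edge_label E (a, b) \<noteq> \<zero>\<^bsub>leavitt E\<^esub>"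
        using pos[OF ab] neg[OF ab] pe_nonzero unfolding comparable_def by metis
    qed
    then show ?thesis by (auto simp: coding_graph_def)
  qed
  show ?thesis
  proof unfold_locales
    show "(a, b) \<in> arcs (coding_graph E J) \<longleftrightarrow> a \<in> J \<and> b \<in> J \<and> comparable (rest_path E a) (fst b)" for a b
      by (rule arcs)
    fix a b assume "(a, b) \<in> arcs (coding_graph E J)"
    then have ab: "a \<in> J" "b \<in> J" "fst (rest_path E a) = fst (fst b)"
      "prefix (snd (rest_path E a)) (snd (fst b)) \<or> prefix (snd (fst b)) (snd (rest_path E a))"
      using arcs by (auto simp: comparable_def)
    show "edge_degree E (a, b) \<ge> 0 \<longleftrightarrow> prefix (snd (rest_path E a)) (snd (fst b))"
    proof
      assume "prefix (snd (rest_path E a)) (snd (fst b))"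
      then show "edge_degree E (a, b) \<ge> 0" using pos[OF ab(1-3)] degree_pe by fastforce
    next
      assume d: "edge_degree E (a, b) \<ge> 0"
      show "prefix (snd (rest_path E a)) (snd (fst b))"
      proof (rule ccontr)
        assume n: "\<not> prefix (snd (rest_path E a)) (snd (fst b))"
        then have "prefix (snd (fst b)) (snd (rest_path E a))" using ab(4) by blast
        from neg[OF ab(1-3) this] obtain \<alpha> where \<alpha>: "\<alpha> \<in> paths E"
          "edge_label E (a, b) = star (leavitt E) (L.pe \<alpha>)" "snd (rest_path E a) = snd (fst b) @ snd \<alpha>" by blast
        then have "snd \<alpha> = []" using d degree_star_pe[OF \<alpha>(1,2)] by simp
        then show False using \<alpha>(3) n by simp
      qed
    qed
    show "edge_degree E (a, b) \<le> 0 \<longleftrightarrow> prefix (snd (fst b)) (snd (rest_path E a))"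
    proof
      assume "prefix (snd (fst b)) (snd (rest_path E a))"
      then show "edge_degree E (a, b) \<le> 0" using neg[OF ab(1-3)] degree_star_pe by fastforce
    next
      assume d: "edge_degree E (a, b) \<le> 0"
      show "prefix (snd (fst b)) (snd (rest_path E a))"
      proof (rule ccontr)
        assume n: "\<not> prefix (snd (fst b)) (snd (rest_path E a))"
        then have "prefix (snd (rest_path E a)) (snd (fst b))" using ab(4) by blast
        from pos[OF ab(1-3) this] obtain \<alpha> where \<alpha>: "\<alpha> \<in> paths E"
          "edge_label E (a, b) = L.pe \<alpha>" "snd (fst b) = snd (rest_path E a) @ snd \<alpha>" by blast
        then have "snd \<alpha> = []" using d degree_pe[OF \<alpha>(1,2)] by simp
        then show False using \<alpha>(3) n by simp
      qed
    qed
  qed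
qed

end

end

subsection \<open>The endomorphism of the Leavitt path algebra\<close>

lemma generate_hom_image:
  assumes "ring A" "ring B" "h \<in> ring_hom A B" "K \<subseteq> carrier A"
  shows "h ` generate (add_monoid A) K = generate (add_monoid B) (h ` K)"
proof -
  interpret A: ring A by fact
  interpret B: ring B by fact
  interpret ring_hom_ring A B h using assms(3) by unfold_locales auto
  show ?thesis using group_hom.generate_img[OF a_group_hom, of K] assms(4) by simp
qed

locale leavitt_endo = leavitt_int E + coding E J for E :: "('v, 'e) pre_digraph" and J
begin

sublocale fc: free_coding E J "id :: int \<Rightarrow> int" relI
  by unfold_locales (use relI_ideal relI_star relI_rels relI_ker in auto)

lemma graph_hom_twisted:
  "\<phi> \<in> graph_hom E (leavitt E) fc.twisted \<longleftrightarrow> \<phi> \<in> star_endo (leavitt E)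
     \<and> (\<forall>e\<in>arcs E. \<phi> (eiso (leavitt E) e) = pair_sum (leavitt E) J \<otimes>\<^bsub>leavitt E\<^esub> eiso (leavitt E) e)
     \<and> (\<forall>v\<in>verts E. \<phi> (vproj (leavitt E) v) = vproj (leavitt E) v)"
  unfolding graph_hom_def star_endo_def ring_hom_def leavitt_quot by (auto simp: fc.u_def)

text \<open>Both maps are fixed on the generators. On integer constants they agree because they
  agree on the unit, which is added or subtracted step by step.\<close>

lemma hom_unique:
  assumes \<phi>: "\<phi> \<in> graph_hom E (leavitt E) fc.twisted" and \<psi>: "\<psi> \<in> graph_hom E (leavitt E) fc.twisted"
    and f: "f \<in> carrier FZ"
  shows "\<phi> (sq.q f) = \<psi> (sq.q f)"
proof -
  interpret p: graph_hom_ctx E sq.Qt fc.twisted \<phi> by unfold_locales (use \<phi> leavitt_quot in auto)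
  interpret r: graph_hom_ctx E sq.Qt fc.twisted \<psi> by unfold_locales (use \<psi> leavitt_quot in auto)
  have cadd: "const (a + b) = const a \<oplus>\<^bsub>FZ\<^esub> const b" for a b :: int by (auto simp: free_simps(4) const_def)
  have cone: "const 1 = \<one>\<^bsub>FZ\<^esub>" by (simp add: free_simps(2))
  have csub: "const (a - b) = const a \<ominus>\<^bsub>FZ\<^esub> const b" for a b :: int
    unfolding free_minus[OF const_carrier const_carrier] by (auto simp: const_def)
  define agree where "agree f \<longleftrightarrow> \<phi> (sq.q f) = \<psi> (sq.q f)" for f
  have "agree f" using f
  proof (induction rule: free_induct)
    case (const c)
    show ?case
    proof (induction c rule: int_induct[of _ 0])
      case base
      have "const 0 = \<zero>\<^bsub>FZ\<^esub>" by (auto simp: free_simps(3) const_def)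
      then show ?case unfolding agree_def by (simp only: sq.qh.hom_zero p.hom_zero r.hom_zero)
    next
      case (step1 i)
      then show ?case unfolding agree_def by (simp add: cadd cone)
    next
      case (step2 i)
      then show ?case unfolding agree_def by (simp add: csub cone sq.qh.hom_minus p.hom_minus r.hom_minus)
    qed
  next
    case (delta g)
    show ?case
    proof (cases g)
      case (GP v)
      then have v: "v \<in> verts E" using delta by (auto simp: gens_def)
      have "delta [g] = vproj FZ v" by (simp add: GP free_simps(6))
      then show ?thesis unfolding agree_def using v by (simp add: sq.qh.hom_vproj p.hom_vproj r.hom_vproj)
    next
      case (GS e)
      then have e: "e \<in> arcs E" using delta by (auto simp: gens_def)
      have "delta [g] = eiso FZ e" by (simp add: GS free_simps(7))
      then show ?thesis unfolding agree_def using e by (simp add: sq.qh.hom_eiso p.hom_eiso r.hom_eiso)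
    next
      case (GSstar e)
      then have e: "e \<in> arcs E" using delta by (auto simp: gens_def)
      have "delta [g] = star FZ (eiso FZ e)" by (simp add: GSstar int_conj.star_eiso_delta)
      then show ?thesis unfolding agree_def using e
        by (simp add: sq.qh.hom_eiso p.hom_eiso r.hom_eiso sq.qh.hom_star p.hom_star r.hom_star)
    qed
  next
    case (add f g)
    then have "agree (f \<oplus>\<^bsub>FZ\<^esub> g)" unfolding agree_def by simp
    then show ?case by (simp only: free_simps(4))
  next
    case (mult f g)
    then have "agree (f \<otimes>\<^bsub>FZ\<^esub> g)" unfolding agree_def by simp
    then show ?case by (simp only: free_simps(1))
  qed
  then show ?thesis unfolding agree_def .
qed

text \<open>Well-definedness on the quotient: the kernel of the quotient map after
  \<open>phi\<close> is an ideal, and it contains the relations because the twisted family satisfies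
  them.\<close>

lemma phi_relI:
  assumes "x \<in> relI" shows "sq.q (fc.phi x) = \<zero>\<^bsub>sq.Qt\<^esub>"
proof -
  have "ideal (a_kernel FZ fc.twisted (\<lambda>x. sq.q (fc.phi x))) FZ" by (rule fc.ph.kernel_is_ideal)
  moreover have "leavitt_rels FZ E \<subseteq> a_kernel FZ fc.twisted (\<lambda>x. sq.q (fc.phi x))"
  proof -
    have k: "leavitt_rels FZ E \<subseteq> {x. sq.q (fc.phi x) \<in> {\<zero>\<^bsub>fc.twisted\<^esub>}}"
      unfolding fc.ph.leavitt_rels_vimage by (rule fc.tw.leavitt_rels)
    show ?thesis
    proof
      fix x assume x: "x \<in> leavitt_rels FZ E"
      have "x \<in> carrier FZ" using rels_FZ x by (rule subsetD)
      moreover have "sq.q (fc.phi x) = \<zero>\<^bsub>fc.twisted\<^esub>" using subsetD[OF k x] by (simp only: mem_Collect_eq singleton_iff)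
      ultimately show "x \<in> a_kernel FZ fc.twisted (\<lambda>x. sq.q (fc.phi x))"
        by (simp only: a_kernel_def' mem_Collect_eq simp_thms)
    qed
  qed
  ultimately have "relI \<subseteq> a_kernel FZ fc.twisted (\<lambda>x. sq.q (fc.phi x))"
    unfolding relI_def by (rule FZ.genideal_minimal)
  from subsetD[OF this assms] show ?thesis
    by (simp only: a_kernel_def' mem_Collect_eq fc.twisted_simps)
qed

text \<open>Resolves the definite description: existence by the map induced from \<open>phi\<close>,
  uniqueness by \<open>hom_unique\<close>.\<close>

lemma Lambda_endo:
  shows "Lambda_endo E J \<in> graph_hom E (leavitt E) fc.twisted"
    and Lambda_q: "f \<in> carrier FZ \<Longrightarrow> Lambda_endo E J (sq.q f) = sq.q (fc.phi f)"
proof -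
  let ?h = "\<lambda>x. sq.q (fc.phi x)"
  have ctx: "graph_hom_ctx E FZ fc.twisted ?h" by (rule fc.ph.graph_hom_ctx_axioms)
  have hI: "?h x = \<zero>\<^bsub>fc.twisted\<^esub>" if "x \<in> relI" for x using phi_relI[OF that] by simp
  let ?\<phi> = "sq.induced ?h"
  have ph: "?\<phi> \<in> graph_hom E (leavitt E) fc.twisted"
    unfolding leavitt_quot by (rule sq.induced_hom[OF ctx hI])
  have ext: "?\<phi> \<in> extensional (carrier (leavitt E))"
    unfolding leavitt_quot sq.induced_def by simp
  have "Lambda_endo E J = ?\<phi>"
    unfolding Lambda_endo_def Let_def
  proof (rule the_equality)
    show "?\<phi> \<in> extensional (carrier (leavitt E)) \<and> ?\<phi> \<in> star_endo (leavitt E)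
       \<and> (\<forall>e\<in>arcs E. ?\<phi> (eiso (leavitt E) e) = pair_sum (leavitt E) J \<otimes>\<^bsub>leavitt E\<^esub> eiso (leavitt E) e)
       \<and> (\<forall>v\<in>verts E. ?\<phi> (vproj (leavitt E) v) = vproj (leavitt E) v)"
      using ext ph unfolding graph_hom_twisted by blast
    fix \<psi> assume a: "\<psi> \<in> extensional (carrier (leavitt E)) \<and> \<psi> \<in> star_endo (leavitt E)
       \<and> (\<forall>e\<in>arcs E. \<psi> (eiso (leavitt E) e) = pair_sum (leavitt E) J \<otimes>\<^bsub>leavitt E\<^esub> eiso (leavitt E) e)
       \<and> (\<forall>v\<in>verts E. \<psi> (vproj (leavitt E) v) = vproj (leavitt E) v)"
    then have ps: "\<psi> \<in> graph_hom E (leavitt E) fc.twisted" unfolding graph_hom_twisted by blast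
    show "\<psi> = ?\<phi>"
    proof (rule extensionalityI)
      show "\<psi> \<in> extensional (carrier (leavitt E))" using a by blast
      show "?\<phi> \<in> extensional (carrier (leavitt E))" by (rule ext)
      fix X assume "X \<in> carrier (leavitt E)"
      then obtain f where "f \<in> carrier FZ" "X = sq.q f" unfolding leavitt_quot by (rule sq.quot_carrierE)
      then show "\<psi> X = ?\<phi> X" using hom_unique[OF ps ph] by simp
    qed
  qed
  then show "Lambda_endo E J \<in> graph_hom E (leavitt E) fc.twisted"
    "f \<in> carrier FZ \<Longrightarrow> Lambda_endo E J (sq.q f) = sq.q (fc.phi f)"
    using ph sq.induced_q[OF ctx hI] by auto
qed

text \<open>\<open>cdiag\<close> has integer coefficients already in its generators; induction on
  the coefficient puts these multiples into the group generated by the projections alone.\<close>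

lemma leavitt_diag_cdiag: "leavitt_diag E = sq.q ` fc.cdiag"
proof -
  let ?G = "{const c \<otimes>\<^bsub>FZ\<^esub> path_proj FZ \<beta> |c \<beta>. \<beta> \<in> paths E}"
  let ?D = "generate (add_monoid sq.Qt) (path_proj sq.Qt ` paths E)"
  have pc: "path_proj sq.Qt ` paths E \<subseteq> carrier sq.Qt"
    using fc.pp_closed by blast
  have sub: "subgroup ?D (add_monoid sq.Qt)" by (rule sq.Qt.add.generate_is_subgroup[OF pc])
  have img: "sq.q ` fc.cdiag = generate (add_monoid sq.Qt) (sq.q ` ?G)"
    unfolding fc.cdiag_def
    by (rule generate_hom_image[OF FZ.ring_axioms sq.Qt.ring_axioms sq.q_hom fc.cdiag_gens])
  have gens: "sq.q (const c \<otimes>\<^bsub>FZ\<^esub> path_proj FZ \<beta>) \<in> ?D" if b: "\<beta> \<in> paths E" for c \<beta>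
  proof -
    have cadd: "const (a + b) \<otimes>\<^bsub>FZ\<^esub> path_proj FZ \<beta> = const a \<otimes>\<^bsub>FZ\<^esub> path_proj FZ \<beta> \<oplus>\<^bsub>FZ\<^esub> const b \<otimes>\<^bsub>FZ\<^esub> path_proj FZ \<beta>"
      for a b :: int by (auto simp: free_simps(1,4) conv_const_left distrib_right)
    have p: "path_proj FZ \<beta> \<in> carrier FZ" using b by simp
    have P: "sq.q (path_proj FZ \<beta>) \<in> ?D"
      using b sq.qh.hom_path_proj by (auto intro!: generate.incl)
    have c1: "const 1 \<otimes>\<^bsub>FZ\<^esub> path_proj FZ \<beta> = path_proj FZ \<beta>"
      "const (-1) \<otimes>\<^bsub>FZ\<^esub> path_proj FZ \<beta> = \<ominus>\<^bsub>FZ\<^esub> path_proj FZ \<beta>"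
      "const 0 \<otimes>\<^bsub>FZ\<^esub> path_proj FZ \<beta> = \<zero>\<^bsub>FZ\<^esub>"
      using p by (auto simp: free_simps(1,3) conv_const_left free_uminus)
    have N: "\<ominus>\<^bsub>sq.Qt\<^esub> sq.q (path_proj FZ \<beta>) \<in> ?D"
      using subgroup.m_inv_closed[OF sub P] by (simp add: a_inv_def)
    define inD where "inD c \<longleftrightarrow> sq.q (const c \<otimes>\<^bsub>FZ\<^esub> path_proj FZ \<beta>) \<in> ?D" for c
    have "inD c"
    proof (induction c rule: int_induct[of _ 0])
      case base
      show ?case unfolding inD_def c1 sq.qh.hom_zero using subgroup.one_closed[OF sub] by (simp only: monoid.simps)
    next
      case (step1 i)
      then show ?case unfolding inD_def using subgroup.m_closed[OF sub step1(2)[unfolded inD_def] P] p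
        by (simp add: cadd c1)
    next
      case (step2 i)
      have "const (i - 1) \<otimes>\<^bsub>FZ\<^esub> path_proj FZ \<beta> = const i \<otimes>\<^bsub>FZ\<^esub> path_proj FZ \<beta> \<oplus>\<^bsub>FZ\<^esub> \<ominus>\<^bsub>FZ\<^esub> path_proj FZ \<beta>"
        using cadd[of i "-1"] c1 by simp
      then show ?case unfolding inD_def using subgroup.m_closed[OF sub step2(2)[unfolded inD_def] N] p by simp
    qed
    then show ?thesis unfolding inD_def .
  qed
  have "sq.q ` ?G \<subseteq> ?D" using gens by auto
  then have "generate (add_monoid sq.Qt) (sq.q ` ?G) \<subseteq> ?D"
    by (rule sq.Qt.add.generate_subgroup_incl[OF _ sub])
  moreover have "path_proj sq.Qt ` paths E \<subseteq> sq.q ` ?G"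
  proof
    fix X assume "X \<in> path_proj sq.Qt ` paths E"
    then obtain \<beta> where b: "\<beta> \<in> paths E" "X = path_proj sq.Qt \<beta>" by blast
    then have "X = sq.q (const 1 \<otimes>\<^bsub>FZ\<^esub> path_proj FZ \<beta>)"
      by (simp add: free_simps(1) conv_const_left sq.qh.hom_path_proj)
    then show "X \<in> sq.q ` ?G" using b by blast
  qed
  then have "?D \<subseteq> generate (add_monoid sq.Qt) (sq.q ` ?G)"
    by (rule sq.Qt.add.mono_generate)
  ultimately show ?thesis unfolding leavitt_diag_def leavitt_quot img by blast
qed

theorem leavitt_automorphism:
  "restricts_to_automorphism (Lambda_endo E J) (leavitt_diag E) \<longleftrightarrow> (\<forall>\<beta>\<in>paths E. determined \<beta>)"
proof -
  have img: "Lambda_endo E J ` leavitt_diag E = (\<lambda>z. sq.q (fc.phi z)) ` fc.cdiag"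
    unfolding leavitt_diag_cdiag image_image using Lambda_q fc.cdiag_carrier by (intro image_cong) auto
  show ?thesis
  proof
    assume "restricts_to_automorphism (Lambda_endo E J) (leavitt_diag E)"
    then have eq: "(\<lambda>z. sq.q (fc.phi z)) ` fc.cdiag = sq.q ` fc.cdiag"
      unfolding restricts_to_automorphism_def img unfolding leavitt_diag_cdiag .
    show "\<forall>\<beta>\<in>paths E. determined \<beta>"
    proof
      fix \<beta> assume b: "\<beta> \<in> paths E"
      have "sq.q (path_proj FZ \<beta>) \<in> (\<lambda>z. sq.q (fc.phi z)) ` fc.cdiag"
        unfolding eq using fc.cdiag_proj[OF b] by blast
      then obtain z where z: "z \<in> fc.cdiag" "sq.q (path_proj FZ \<beta>) = sq.q (fc.phi z)" by blast
      \<comment> \<open>The preimage \<open>z\<close> exhibits the indicator of the cylinder as a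
        locally constant function of the itinerary.\<close>
      from fc.cdiag_function[OF z(1)] obtain f N where f: "fc.local_fun N f" "fc.acts z f"
        "fc.acts (fc.phi z) (\<lambda>x. f (itinerary x))" by blast
      have "fc.acts (path_proj FZ \<beta>) (\<lambda>x. f (itinerary x))"
        using fc.acts_mod[OF _ _ z(2)[symmetric] f(3)] z(1) fc.cdiag_carrier b by auto
      then have *: "of_bool (x \<in> cyl E \<beta>) = f (itinerary x)" if "x \<in> infpaths E" for x
        using fc.acts_unique[OF fc.acts_proj[OF b] _ that] by blast
      show "determined \<beta>"
      proof (rule fc.determinedI[OF f(1), where p = "\<lambda>c. c = 1"])
        fix x assume "x \<in> infpaths E"
        from *[OF this] show "x \<in> cyl E \<beta> \<longleftrightarrow> f (itinerary x) = 1"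
          by (cases "x \<in> cyl E \<beta>") auto
      qed
    qed
  next
    assume det: "\<forall>\<beta>\<in>paths E. determined \<beta>"
    have "(\<lambda>z. sq.q (fc.phi z)) ` fc.cdiag = sq.q ` fc.cdiag"
      using fc.phi_cdiag fc.cdiag_phi[OF det] by (auto simp: image_iff)
    then show "restricts_to_automorphism (Lambda_endo E J) (leavitt_diag E)"
      unfolding restricts_to_automorphism_def img unfolding leavitt_diag_cdiag .
  qed
qed

end

section \<open>The representation on square summable functions\<close>

interpretation cnj_conj: conjugation cnj
  by unfold_locales auto

text \<open>A dense pre-Hilbert space inside the square summable functions. The free algebra maps it
  to itself, so norms, inner products and adjoints are finite sums throughout.\<close>

definition finfun :: "('v, 'e) pre_digraph \<Rightarrow> ('e stream \<Rightarrow> complex) set" where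
  "finfun E = {\<xi> \<in> pathfun E. finite {x. \<xi> x \<noteq> 0}}"

definition nrm :: "('x \<Rightarrow> complex) \<Rightarrow> real" where
  "nrm \<xi> = L2_set (\<lambda>x. cmod (\<xi> x)) {x. \<xi> x \<noteq> 0}"

definition ip :: "('x \<Rightarrow> complex) \<Rightarrow> ('x \<Rightarrow> complex) \<Rightarrow> complex" where
  "ip \<xi> \<eta> = (\<Sum>x | \<xi> x \<noteq> 0. \<xi> x * cnj (\<eta> x))"

lemma nrm_superset: "finite S \<Longrightarrow> {x. \<xi> x \<noteq> 0} \<subseteq> S \<Longrightarrow> nrm \<xi> = L2_set (\<lambda>x. cmod (\<xi> x)) S"
  unfolding nrm_def L2_set_def by (rule arg_cong[of _ _ sqrt], rule sum.mono_neutral_left) auto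

lemma ip_superset: "finite S \<Longrightarrow> {x. \<xi> x \<noteq> 0} \<subseteq> S \<Longrightarrow> ip \<xi> \<eta> = (\<Sum>x\<in>S. \<xi> x * cnj (\<eta> x))"
  unfolding ip_def by (rule sum.mono_neutral_left) auto

lemma nrm_nonneg [simp]: "nrm \<xi> \<ge> 0"
  by (simp add: nrm_def)

lemma nrm_zero [simp]: "nrm (\<lambda>x. 0) = 0"
  by (simp add: nrm_def)

lemma nrm_triangle:
  assumes "finite {x. \<xi> x \<noteq> 0}" "finite {x. \<eta> x \<noteq> 0}"
  shows "nrm (\<lambda>x. \<xi> x + \<eta> x) \<le> nrm \<xi> + nrm \<eta>"
proof -
  let ?S = "{x. \<xi> x \<noteq> 0} \<union> {x. \<eta> x \<noteq> 0}"
  have S: "finite ?S" using assms by simp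
  have "nrm (\<lambda>x. \<xi> x + \<eta> x) = L2_set (\<lambda>x. cmod (\<xi> x + \<eta> x)) ?S"
    by (rule nrm_superset[OF S]) auto
  also have "\<dots> \<le> L2_set (\<lambda>x. cmod (\<xi> x) + cmod (\<eta> x)) ?S"
    by (rule L2_set_mono) (auto simp: norm_triangle_ineq)
  also have "\<dots> \<le> L2_set (\<lambda>x. cmod (\<xi> x)) ?S + L2_set (\<lambda>x. cmod (\<eta> x)) ?S"
    by (rule L2_set_triangle_ineq)
  also have "\<dots> = nrm \<xi> + nrm \<eta>"
    using nrm_superset[OF S, of \<xi>] nrm_superset[OF S, of \<eta>] by simp
  finally show ?thesis .
qed

lemma nrm_scale: "finite {x. \<xi> x \<noteq> 0} \<Longrightarrow> nrm (\<lambda>x. c * \<xi> x) = cmod c * nrm \<xi>"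
  by (subst (1 2) nrm_superset[of "{x. \<xi> x \<noteq> 0}"]) (auto simp: norm_mult L2_set_right_distrib)

lemma ip_cauchy_schwarz:
  assumes "finite {x. \<xi> x \<noteq> 0}" "finite {x. \<eta> x \<noteq> 0}"
  shows "cmod (ip \<xi> \<eta>) \<le> nrm \<xi> * nrm \<eta>"
proof -
  let ?S = "{x. \<xi> x \<noteq> 0} \<union> {x. \<eta> x \<noteq> 0}"
  have S: "finite ?S" using assms by simp
  have "cmod (ip \<xi> \<eta>) \<le> (\<Sum>x\<in>?S. cmod (\<xi> x * cnj (\<eta> x)))"
    using S by (subst ip_superset[OF S]) (auto intro!: norm_sum)
  also have "\<dots> = (\<Sum>x\<in>?S. \<bar>cmod (\<xi> x)\<bar> * \<bar>cmod (\<eta> x)\<bar>)"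
    by (simp add: norm_mult)
  also have "\<dots> \<le> L2_set (\<lambda>x. cmod (\<xi> x)) ?S * L2_set (\<lambda>x. cmod (\<eta> x)) ?S"
    by (rule L2_set_mult_ineq)
  also have "\<dots> = nrm \<xi> * nrm \<eta>"
    using nrm_superset[OF S, of \<xi>] nrm_superset[OF S, of \<eta>] by simp
  finally show ?thesis .
qed

lemma ip_self: "finite {x. \<xi> x \<noteq> 0} \<Longrightarrow> ip \<xi> \<xi> = of_real ((nrm \<xi>)\<^sup>2)"
  by (simp add: ip_def nrm_def L2_set_def sum_nonneg complex_norm_square del: of_real_power)

lemma ip_commute:
  assumes "finite {x. \<xi> x \<noteq> 0}" "finite {x. \<eta> x \<noteq> 0}" shows "ip \<eta> \<xi> = cnj (ip \<xi> \<eta>)"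
proof -
  let ?S = "{x. \<xi> x \<noteq> 0} \<union> {x. \<eta> x \<noteq> 0}"
  have S: "finite ?S" using assms by simp
  show ?thesis
    using ip_superset[OF S, of \<xi> \<eta>] ip_superset[OF S, of \<eta> \<xi>] by (simp add: mult.commute)
qed

lemma ip_add_left:
  assumes "finite {x. \<xi> x \<noteq> 0}" "finite {x. \<eta> x \<noteq> 0}"
  shows "ip (\<lambda>x. \<xi> x + \<eta> x) \<zeta> = ip \<xi> \<zeta> + ip \<eta> \<zeta>"
proof -
  let ?S = "{x. \<xi> x \<noteq> 0} \<union> {x. \<eta> x \<noteq> 0}"
  have S: "finite ?S" using assms by simp
  have "ip (\<lambda>x. \<xi> x + \<eta> x) \<zeta> = (\<Sum>x\<in>?S. (\<xi> x + \<eta> x) * cnj (\<zeta> x))"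
    by (rule ip_superset[OF S]) auto
  then show ?thesis
    using ip_superset[OF S, of \<xi> \<zeta>] ip_superset[OF S, of \<eta> \<zeta>] by (simp add: distrib_right sum.distrib)
qed

lemma ip_add_right: "ip \<xi> (\<lambda>x. \<eta> x + \<zeta> x) = ip \<xi> \<eta> + ip \<xi> \<zeta>"
  by (simp add: ip_def distrib_left sum.distrib)

lemma finfun_finite: "\<xi> \<in> finfun E \<Longrightarrow> finite {x. \<xi> x \<noteq> 0}"
  and finfun_pathfun: "\<xi> \<in> finfun E \<Longrightarrow> \<xi> \<in> pathfun E"
  by (auto simp: finfun_def)

lemma gen_op_finfun:
  assumes "\<xi> \<in> finfun E" shows "gen_op E a \<xi> \<in> finfun E"
proof -
  have f: "finite {x. \<xi> x \<noteq> 0}" using assms by (rule finfun_finite)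
  have "finite {x. gen_op E a \<xi> x \<noteq> 0}"
  proof (cases a)
    case (GP v)
    then show ?thesis by (intro finite_subset[OF _ f]) (auto split: if_splits)
  next
    case (GS e)
    have "x \<in> (\<lambda>x. e ## x) ` {x. \<xi> x \<noteq> 0}" if "gen_op E a \<xi> x \<noteq> 0" for x
      using that by (intro image_eqI[of _ _ "stl x"]) (auto simp: GS split: if_splits)
    then show ?thesis using f by (intro finite_subset[OF _ finite_imageI[OF f]]) blast
  next
    case (GSstar e)
    have "x \<in> stl ` {x. \<xi> x \<noteq> 0}" if "gen_op E a \<xi> x \<noteq> 0" for x
      using that by (intro image_eqI[of _ _ "e ## x"]) (auto simp: GSstar split: if_splits)
    then show ?thesis using f by (intro finite_subset[OF _ finite_imageI[OF f]]) blast
  qed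
  then show ?thesis using gen_op_pathfun[OF finfun_pathfun[OF assms]] by (simp add: finfun_def)
qed

lemma scale_finfun: "\<xi> \<in> finfun E \<Longrightarrow> (\<lambda>x. c * \<xi> x) \<in> finfun E"
  by (auto simp: finfun_def pathfun_def elim!: finite_subset[rotated])

lemma add_finfun:
  assumes "\<xi> \<in> finfun E" "\<eta> \<in> finfun E" shows "(\<lambda>x. \<xi> x + \<eta> x) \<in> finfun E"
proof -
  have "finite {x. \<xi> x + \<eta> x \<noteq> 0}"
    by (rule finite_subset[of _ "{x. \<xi> x \<noteq> 0} \<union> {x. \<eta> x \<noteq> 0}"]) (use assms in \<open>auto simp: finfun_def\<close>)
  then show ?thesis using assms by (auto simp: finfun_def pathfun_def)
qed

lemma gen_op_adjoint_aux:
  assumes "e \<in> arcs E" "\<xi> \<in> finfun E" "\<eta> \<in> finfun E"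
  shows "ip (gen_op E (GS e) \<xi>) \<eta> = ip \<xi> (gen_op E (GSstar e) \<eta>)"
proof -
  have f: "finite {x. \<xi> x \<noteq> 0}" using assms finfun_finite by blast
  have "x \<in> (\<lambda>x. e ## x) ` {x. \<xi> x \<noteq> 0}" if "gen_op E (GS e) \<xi> x \<noteq> 0" for x
    using that by (intro image_eqI[of _ _ "stl x"]) (auto split: if_splits)
  then have "ip (gen_op E (GS e) \<xi>) \<eta> =
      (\<Sum>y\<in>(\<lambda>x. e ## x) ` {x. \<xi> x \<noteq> 0}. gen_op E (GS e) \<xi> y * cnj (\<eta> y))"
    using f by (intro ip_superset) auto
  also have "\<dots> = (\<Sum>x | \<xi> x \<noteq> 0. gen_op E (GS e) \<xi> (e ## x) * cnj (\<eta> (e ## x)))"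
    by (subst sum.reindex) (auto simp: inj_on_def)
  also have "\<dots> = ip \<xi> (gen_op E (GSstar e) \<eta>)"
    unfolding ip_def by (rule sum.cong) (use assms in \<open>auto simp: infpaths_SCons\<close>)
  finally show ?thesis .
qed

lemma gen_op_adjoint:
  assumes "a \<in> gens E" "\<xi> \<in> finfun E" "\<eta> \<in> finfun E"
  shows "ip (gen_op E a \<xi>) \<eta> = ip \<xi> (gen_op E (gen_star a) \<eta>)"
proof (cases a)
  case (GP v)
  have "ip (gen_op E (GP v) \<xi>) \<eta> = (\<Sum>x | \<xi> x \<noteq> 0. gen_op E (GP v) \<xi> x * cnj (\<eta> x))"
    by (rule ip_superset) (use assms finfun_finite in \<open>auto split: if_splits\<close>)
  also have "\<dots> = ip \<xi> (gen_op E (GP v) \<eta>)"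
    unfolding ip_def by (rule sum.cong) auto
  finally show ?thesis by (simp add: GP)
next
  case (GS e)
  then show ?thesis using gen_op_adjoint_aux assms by (auto simp: gens_def)
next
  case (GSstar e)
  then have e: "e \<in> arcs E" using assms by (auto simp: gens_def)
  have "ip (gen_op E (GSstar e) \<xi>) \<eta> = cnj (ip \<eta> (gen_op E (GSstar e) \<xi>))"
    by (rule ip_commute) (use assms gen_op_finfun finfun_finite in blast)+
  also have "\<dots> = cnj (ip (gen_op E (GS e) \<eta>) \<xi>)"
    using gen_op_adjoint_aux[OF e assms(3,2)] by simp
  also have "\<dots> = ip \<xi> (gen_op E (GS e) \<eta>)"
    by (rule ip_commute[symmetric]) (use assms gen_op_finfun finfun_finite in blast)+
  finally show ?thesis by (simp add: GSstar)
qed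

text \<open>A generator followed by its adjoint is a cut-off to a set of paths, so the squared norm
  of the image is a part of the sum defining that of \<open>\<xi>\<close>.\<close>

lemma gen_op_contraction:
  assumes "a \<in> gens E" "\<xi> \<in> finfun E"
  shows "nrm (gen_op E a \<xi>) \<le> nrm \<xi>"
proof -
  have f: "finite {x. \<xi> x \<noteq> 0}" using assms finfun_finite by blast
  have fa: "finite {x. gen_op E a \<xi> x \<noteq> 0}" using assms gen_op_finfun finfun_finite by blast
  obtain A where A: "gen_op E (gen_star a) (gen_op E a \<xi>) = (\<lambda>x. if x \<in> A then \<xi> x else 0)"
  proof (cases a)
    case (GP v)
    then show ?thesis by (intro that[of "{x \<in> infpaths E. src E x = v}"]) (auto simp: fun_eq_iff)
  next
    case (GS e)
    then have "e \<in> arcs E" using assms by (auto simp: gens_def)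
    then show ?thesis using GS
      by (intro that[of "{x \<in> infpaths E. src E x = head E e}"]) (auto simp: fun_eq_iff infpaths_SCons)
  next
    case (GSstar e)
    then show ?thesis
      by (intro that[of "{x \<in> infpaths E. shd x = e}"]) (auto simp: fun_eq_iff infpaths_stl src_stl)
  qed
  have "of_real ((nrm (gen_op E a \<xi>))\<^sup>2) = ip (gen_op E a \<xi>) (gen_op E a \<xi>)"
    using ip_self[OF fa] by simp
  also have "\<dots> = ip \<xi> (\<lambda>x. if x \<in> A then \<xi> x else 0)"
    using gen_op_adjoint[OF assms gen_op_finfun[OF assms(2)]] A by simp
  also have "\<dots> = of_real (\<Sum>x | \<xi> x \<noteq> 0. if x \<in> A then (cmod (\<xi> x))\<^sup>2 else 0)"
    unfolding ip_def of_real_sum by (rule sum.cong) (auto simp: complex_norm_square simp del: of_real_power)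
  finally have "(nrm (gen_op E a \<xi>))\<^sup>2 = (\<Sum>x | \<xi> x \<noteq> 0. if x \<in> A then (cmod (\<xi> x))\<^sup>2 else 0)"
    using of_real_eq_iff by blast
  also have "\<dots> \<le> (\<Sum>x | \<xi> x \<noteq> 0. (cmod (\<xi> x))\<^sup>2)" by (rule sum_mono) auto
  also have "\<dots> = (nrm \<xi>)\<^sup>2" by (simp add: nrm_def L2_set_def sum_nonneg)
  finally show ?thesis by (rule power2_le_imp_le) simp
qed

locale cstar_graph = path_graph E for E :: "('v, 'e) pre_digraph"
begin

abbreviation "FC \<equiv> cfree E"

sublocale FC: graph_star_ring E FC by (rule cnj_conj.free_graph_star_ring)

lemma path_graph_E: "path_graph E" ..

lemma op_finfun: "f \<in> carrier FC \<Longrightarrow> \<xi> \<in> finfun E \<Longrightarrow> op E f \<xi> \<in> finfun E"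
proof (induction arbitrary: \<xi> rule: free_induct)
  case (const c)
  then show ?case by (simp add: op_const scale_finfun)
next
  case (delta g)
  then show ?case by (simp add: op_delta gen_op_finfun)
next
  case (add f g)
  then show ?case by (simp add: op_add[OF free_finite free_finite] add_finfun)
next
  case (mult f g)
  then show ?case by (simp add: op_conv[OF free_finite free_finite])
qed

lemma op_adjoint:
  "f \<in> carrier FC \<Longrightarrow> \<xi> \<in> finfun E \<Longrightarrow> \<eta> \<in> finfun E \<Longrightarrow> ip (op E f \<xi>) \<eta> = ip \<xi> (op E (star FC f) \<eta>)"
proof (induction arbitrary: \<xi> \<eta> rule: free_induct)
  case (const c)
  have "ip (\<lambda>x. c * \<xi> x) \<eta> = (\<Sum>x | \<xi> x \<noteq> 0. c * \<xi> x * cnj (\<eta> x))"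
    by (rule ip_superset) (use const finfun_finite in auto)
  then show ?case
    by (simp add: cnj_conj.star_const op_const ip_def mult.commute mult.left_commute)
next
  case (delta g)
  then show ?case by (simp add: cnj_conj.star_delta op_delta gen_op_adjoint)
next
  case (add f g)
  have s: "star FC (\<lambda>w. f w + g w) = (\<lambda>w. star FC f w + star FC g w)"
    using FC.star_add[OF add(1,2)] by (simp add: free_simps(4))
  have "op E (star FC (\<lambda>w. f w + g w)) \<eta> = (\<lambda>x. op E (star FC f) \<eta> x + op E (star FC g) \<eta> x)"
    unfolding s by (rule op_add) (rule free_finite, rule FC.star_closed, rule add)+
  moreover have "op E (\<lambda>w. f w + g w) \<xi> = (\<lambda>x. op E f \<xi> x + op E g \<xi> x)"
    by (rule op_add) (rule free_finite, rule add)+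
  moreover have "ip (\<lambda>x. op E f \<xi> x + op E g \<xi> x) \<eta> = ip (op E f \<xi>) \<eta> + ip (op E g \<xi>) \<eta>"
    by (rule ip_add_left) (rule finfun_finite, rule op_finfun, rule add, rule add)+
  ultimately show ?case using add by (simp add: ip_add_right)
next
  case (mult f g)
  have "op E (star FC (conv f g)) \<eta> = op E (star FC g) (op E (star FC f) \<eta>)"
    unfolding cnj_conj.star_conv by (rule op_conv) (rule free_finite, rule FC.star_closed, rule mult)+
  moreover have "op E (conv f g) \<xi> = op E f (op E g \<xi>)"
    by (rule op_conv) (rule free_finite, rule mult)+
  ultimately show ?case using mult op_finfun FC.star_closed by simp
qed

lemma op_bounded: "f \<in> carrier FC \<Longrightarrow> \<exists>C\<ge>0. \<forall>\<xi>\<in>finfun E. nrm (op E f \<xi>) \<le> C * nrm \<xi>"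
proof (induction rule: free_induct)
  case (const c)
  then show ?case by (intro exI[of _ "cmod c"]) (auto simp: op_const nrm_scale finfun_finite)
next
  case (delta g)
  then show ?case by (intro exI[of _ 1]) (auto simp: op_delta gen_op_contraction)
next
  case (add f g)
  then obtain C D where C: "C \<ge> 0" "\<forall>\<xi>\<in>finfun E. nrm (op E f \<xi>) \<le> C * nrm \<xi>"
    and D: "D \<ge> 0" "\<forall>\<xi>\<in>finfun E. nrm (op E g \<xi>) \<le> D * nrm \<xi>" by blast
  have "nrm (op E (\<lambda>w. f w + g w) \<xi>) \<le> (C + D) * nrm \<xi>" if x: "\<xi> \<in> finfun E" for \<xi>
  proof -
    have "nrm (op E (\<lambda>w. f w + g w) \<xi>) \<le> nrm (op E f \<xi>) + nrm (op E g \<xi>)"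
      unfolding op_add[OF free_finite[OF add(1)] free_finite[OF add(2)]]
      by (rule nrm_triangle) (rule finfun_finite, rule op_finfun, rule add, rule x)+
    then show ?thesis using C D x by (fastforce simp: distrib_right)
  qed
  then show ?case using C D by (intro exI[of _ "C + D"]) auto
next
  case (mult f g)
  then obtain C D where C: "C \<ge> 0" "\<forall>\<xi>\<in>finfun E. nrm (op E f \<xi>) \<le> C * nrm \<xi>"
    and D: "D \<ge> 0" "\<forall>\<xi>\<in>finfun E. nrm (op E g \<xi>) \<le> D * nrm \<xi>" by blast
  have "nrm (op E (conv f g) \<xi>) \<le> C * D * nrm \<xi>" if x: "\<xi> \<in> finfun E" for \<xi>
  proof -
    have "nrm (op E (conv f g) \<xi>) \<le> C * nrm (op E g \<xi>)"
      unfolding op_conv[OF free_finite[OF mult(1)] free_finite[OF mult(2)]]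
      using C(2) op_finfun[OF mult(2) x] by blast
    also have "\<dots> \<le> C * (D * nrm \<xi>)" using C D x by (intro mult_left_mono) auto
    finally show ?thesis by (simp add: mult.assoc)
  qed
  then show ?case using C D by (intro exI[of _ "C * D"]) auto
qed

section \<open>The operator norm of the path representation\<close>

definition opnorm :: "(('v, 'e) gen list \<Rightarrow> complex) \<Rightarrow> real" where
  "opnorm f = (SUP \<xi>\<in>{\<xi> \<in> finfun E. nrm \<xi> \<le> 1}. nrm (op E f \<xi>))"

lemma zero_finfun: "(\<lambda>x. 0) \<in> {\<xi> \<in> finfun E. nrm \<xi> \<le> 1}"
  by (simp add: finfun_def pathfun_def)

lemma opnorm_bdd:
  assumes "f \<in> carrier FC" shows "bdd_above ((\<lambda>\<xi>. nrm (op E f \<xi>)) ` {\<xi> \<in> finfun E. nrm \<xi> \<le> 1})"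
proof -
  obtain C where C: "C \<ge> 0" "\<forall>\<xi>\<in>finfun E. nrm (op E f \<xi>) \<le> C * nrm \<xi>" using op_bounded[OF assms] by blast
  have "nrm (op E f \<xi>) \<le> C" if "\<xi> \<in> finfun E" "nrm \<xi> \<le> 1" for \<xi>
    using C that mult_left_mono[of "nrm \<xi>" 1 C] by fastforce
  then show ?thesis by (auto intro!: bdd_aboveI2)
qed

lemma opnorm_upper:
  assumes "f \<in> carrier FC" "\<xi> \<in> finfun E" "nrm \<xi> \<le> 1" shows "nrm (op E f \<xi>) \<le> opnorm f"
  unfolding opnorm_def by (rule cSUP_upper[OF _ opnorm_bdd]) (use assms in auto)

lemma opnorm_least:
  "(\<And>\<xi>. \<xi> \<in> finfun E \<Longrightarrow> nrm \<xi> \<le> 1 \<Longrightarrow> nrm (op E f \<xi>) \<le> C) \<Longrightarrow> opnorm f \<le> C"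
  unfolding opnorm_def by (rule cSUP_least) (use zero_finfun in auto)

lemma opnorm_nonneg: "f \<in> carrier FC \<Longrightarrow> opnorm f \<ge> 0"
  using opnorm_upper[of f "\<lambda>x. 0"] zero_finfun by simp

lemma op_scale_right:
  "f \<in> carrier FC \<Longrightarrow> op E f (\<lambda>x. c * \<xi> x) = (\<lambda>x. c * op E f \<xi> x)"
proof -
  assume f: "f \<in> carrier FC"
  have "op E f (\<lambda>x. c * \<xi> x) = op E (conv f (const c)) \<xi>"
    unfolding op_conv[OF free_finite[OF f] free_finite[OF const_carrier[where bar = cnj and E = E]]] op_const ..
  also have "conv f (const c) = (\<lambda>w. c * f w)" by (rule conv_const_right)
  finally show ?thesis using op_scale[OF free_finite[OF f]] by simp
qed

lemma opnorm_bound: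
  assumes f: "f \<in> carrier FC" and x: "\<xi> \<in> finfun E" shows "nrm (op E f \<xi>) \<le> opnorm f * nrm \<xi>"
proof (cases "nrm \<xi> = 0")
  case True
  obtain C where "\<forall>\<xi>\<in>finfun E. nrm (op E f \<xi>) \<le> C * nrm \<xi>" using op_bounded[OF f] by blast
  then show ?thesis using True x by fastforce
next
  case False
  let ?c = "of_real (1 / nrm \<xi>) :: complex"
  have n: "cmod ?c = 1 / nrm \<xi>" by (simp add: norm_divide)
  have "nrm (\<lambda>y. ?c * \<xi> y) = 1"
    unfolding nrm_scale[OF finfun_finite[OF x]] n using False by simp
  then have "nrm (op E f (\<lambda>y. ?c * \<xi> y)) \<le> opnorm f"
    by (intro opnorm_upper[OF f scale_finfun[OF x]] eq_refl)
  then have "1 / nrm \<xi> * nrm (op E f \<xi>) \<le> opnorm f"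
    unfolding op_scale_right[OF f] nrm_scale[OF finfun_finite[OF op_finfun[OF f x]]] n .
  then show ?thesis using False nrm_nonneg[of \<xi>] by (simp add: field_simps)
qed

lemma opnorm_scale_le:
  assumes f: "f \<in> carrier FC" shows "opnorm (\<lambda>w. c * f w) \<le> cmod c * opnorm f"
proof (rule opnorm_least)
  fix \<xi> assume x: "\<xi> \<in> finfun E" "nrm \<xi> \<le> 1"
  show "nrm (op E (\<lambda>w. c * f w) \<xi>) \<le> cmod c * opnorm f"
    unfolding op_scale[OF free_finite[OF f]] nrm_scale[OF finfun_finite[OF op_finfun[OF f x(1)]]]
    using opnorm_upper[OF f x] by (simp add: mult_left_mono)
qed

lemma scale_carrier: "f \<in> carrier FC \<Longrightarrow> (\<lambda>w. c * f w) \<in> carrier FC"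
  using FC.m_closed[OF const_carrier[of c]] by (simp add: free_simps(1) conv_const_left)

text \<open>The squared norm of \<open>op E f \<xi>\<close> is the pairing of \<open>\<xi>\<close>
  with the image of \<open>\<xi>\<close> under the product; Cauchy-Schwarz bounds it.\<close>

lemma opnorm_star_le:
  assumes f: "f \<in> carrier FC" shows "(opnorm f)\<^sup>2 \<le> opnorm (star FC f \<otimes>\<^bsub>FC\<^esub> f)"
proof -
  have c: "star FC f \<otimes>\<^bsub>FC\<^esub> f \<in> carrier FC" using f by simp
  have "opnorm f \<le> sqrt (opnorm (star FC f \<otimes>\<^bsub>FC\<^esub> f))"
  proof (rule opnorm_least, rule real_le_rsqrt)
    fix \<xi> assume x: "\<xi> \<in> finfun E" "nrm \<xi> \<le> 1"
    have fx: "op E f \<xi> \<in> finfun E" by (rule op_finfun[OF f x(1)])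
    have "(nrm (op E f \<xi>))\<^sup>2 = cmod (ip (op E f \<xi>) (op E f \<xi>))"
      using ip_self[OF finfun_finite[OF fx]] by (simp add: norm_power)
    also have "\<dots> = cmod (ip \<xi> (op E (star FC f \<otimes>\<^bsub>FC\<^esub> f) \<xi>))"
      unfolding op_adjoint[OF f x(1) fx] using f by (simp add: cnj_conj.op_mult)
    also have "\<dots> \<le> nrm \<xi> * nrm (op E (star FC f \<otimes>\<^bsub>FC\<^esub> f) \<xi>)"
      by (rule ip_cauchy_schwarz) (rule finfun_finite, (rule x op_finfun c)+)+
    also have "\<dots> \<le> 1 * opnorm (star FC f \<otimes>\<^bsub>FC\<^esub> f)"
      by (rule mult_mono) (use x opnorm_upper[OF c x] in auto)
    finally show "(nrm (op E f \<xi>))\<^sup>2 \<le> opnorm (star FC f \<otimes>\<^bsub>FC\<^esub> f)" by simp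
  qed
  then show ?thesis using opnorm_nonneg[OF f] opnorm_nonneg[OF c]
    by (metis real_sqrt_le_iff real_sqrt_abs abs_of_nonneg)
qed

lemma opnorm_mult_le:
  assumes f: "f \<in> carrier FC" and g: "g \<in> carrier FC"
  shows "opnorm (f \<otimes>\<^bsub>FC\<^esub> g) \<le> opnorm f * opnorm g"
proof (rule opnorm_least)
  fix \<xi> assume x: "\<xi> \<in> finfun E" "nrm \<xi> \<le> 1"
  have "nrm (op E (f \<otimes>\<^bsub>FC\<^esub> g) \<xi>) \<le> opnorm f * nrm (op E g \<xi>)"
    using opnorm_bound[OF f op_finfun[OF g x(1)]] f g by (simp add: cnj_conj.op_mult)
  also have "\<dots> \<le> opnorm f * opnorm g"
    using opnorm_upper[OF g x] opnorm_nonneg[OF f] by (rule mult_left_mono)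
  finally show "nrm (op E (f \<otimes>\<^bsub>FC\<^esub> g) \<xi>) \<le> opnorm f * opnorm g" .
qed

text \<open>Reduces the C*-identity to an inequality in one direction. Combined with
  submultiplicativity it bounds \<open>\<rho> y\<close> by its value at the adjoint, and using this
  twice makes the involution isometric.\<close>

lemma cstar_of_le:
  fixes \<rho> :: "(('v, 'e) gen list \<Rightarrow> complex) \<Rightarrow> real"
  assumes "\<And>x. x \<in> carrier FC \<Longrightarrow> \<rho> x \<ge> 0"
    and "\<And>x y. x \<in> carrier FC \<Longrightarrow> y \<in> carrier FC \<Longrightarrow> \<rho> (x \<otimes>\<^bsub>FC\<^esub> y) \<le> \<rho> x * \<rho> y"
    and "\<And>x. x \<in> carrier FC \<Longrightarrow> (\<rho> x)\<^sup>2 \<le> \<rho> (star FC x \<otimes>\<^bsub>FC\<^esub> x)"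
    and x: "x \<in> carrier FC"
  shows "\<rho> (star FC x) = \<rho> x" and "\<rho> (star FC x \<otimes>\<^bsub>FC\<^esub> x) = (\<rho> x)\<^sup>2"
proof -
  have le: "\<rho> y \<le> \<rho> (star FC y)" if y: "y \<in> carrier FC" for y
  proof (cases "\<rho> y = 0")
    case False
    have "\<rho> y * \<rho> y \<le> \<rho> (star FC y) * \<rho> y"
      using order_trans[OF assms(3)[OF y] assms(2)[OF FC.star_closed[OF y] y]] unfolding power2_eq_square .
    then show ?thesis using False assms(1)[OF y] by simp
  qed (use assms(1) y in auto)
  show s: "\<rho> (star FC x) = \<rho> x" using le[OF x] le[OF FC.star_closed[OF x]] x by simp
  show "\<rho> (star FC x \<otimes>\<^bsub>FC\<^esub> x) = (\<rho> x)\<^sup>2"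
    using assms(3)[OF x] assms(2)[OF FC.star_closed[OF x] x] s by (simp add: power2_eq_square)
qed

lemma ck_rels_ker: "ck_rels FC E \<subseteq> cnj_conj.op_ker E"
proof -
  note L = cnj_conj.op_ker_rels[OF path_graph_E, unfolded leavitt_rels_subset]
  have "op E (eiso FC e \<otimes>\<^bsub>FC\<^esub> star FC (eiso FC e) \<otimes>\<^bsub>FC\<^esub> eiso FC e) \<xi> = op E (eiso FC e) \<xi>"
    if e: "e \<in> arcs E" for e \<xi>
  proof -
    have "op E (eiso FC e \<otimes>\<^bsub>FC\<^esub> star FC (eiso FC e) \<otimes>\<^bsub>FC\<^esub> eiso FC e) \<xi> =
        gen_op E (GS e) (gen_op E (GSstar e) (gen_op E (GS e) \<xi>))"
      using e by (simp add: cnj_conj.op_mult) (simp add: free_simps(7) op_delta cnj_conj.star_delta)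
    also have "\<dots> = gen_op E (GS e) \<xi>"
      using e by (auto simp: fun_eq_iff infpaths_stl src_stl)
    finally show ?thesis by (simp add: free_simps(7) op_delta)
  qed
  then have "\<forall>e\<in>arcs E. eiso FC e \<otimes>\<^bsub>FC\<^esub> star FC (eiso FC e) \<otimes>\<^bsub>FC\<^esub> eiso FC e \<ominus>\<^bsub>FC\<^esub> eiso FC e \<in> cnj_conj.op_ker E"
    by (auto intro!: cnj_conj.op_ker_minus)
  then show ?thesis unfolding ck_rels_subset using L by blast
qed

lemma seminorm_iff: "\<rho> \<in> cstar_seminorms E \<longleftrightarrow> (\<forall>x\<in>carrier FC. \<rho> x \<ge> 0)
       \<and> (\<forall>x\<in>carrier FC. \<forall>y\<in>carrier FC. \<rho> (x \<oplus>\<^bsub>FC\<^esub> y) \<le> \<rho> x + \<rho> y)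
       \<and> (\<forall>c. \<forall>x\<in>carrier FC. \<rho> (\<lambda>w. c * x w) = cmod c * \<rho> x)
       \<and> (\<forall>x\<in>carrier FC. \<forall>y\<in>carrier FC. \<rho> (x \<otimes>\<^bsub>FC\<^esub> y) \<le> \<rho> x * \<rho> y)
       \<and> (\<forall>x\<in>carrier FC. \<rho> (star FC x \<otimes>\<^bsub>FC\<^esub> x) = (\<rho> x)\<^sup>2)
       \<and> (\<forall>x\<in>ck_rels FC E. \<rho> x = 0)"
  by (simp add: cstar_seminorms_def Let_def)

text \<open>The concrete norm competes in the supremum defining the universal one: it makes the
  index set nonempty and gives lower bounds.\<close>

lemma opnorm_seminorm: "opnorm \<in> cstar_seminorms E"
  unfolding seminorm_iff
proof (intro conjI ballI allI)
  fix f g assume fg: "f \<in> carrier FC" "g \<in> carrier FC"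
  show "opnorm (f \<oplus>\<^bsub>FC\<^esub> g) \<le> opnorm f + opnorm g"
  proof (rule opnorm_least)
    fix \<xi> assume x: "\<xi> \<in> finfun E" "nrm \<xi> \<le> 1"
    have "nrm (op E (f \<oplus>\<^bsub>FC\<^esub> g) \<xi>) \<le> nrm (op E f \<xi>) + nrm (op E g \<xi>)"
      unfolding free_simps(4) op_add[OF free_finite[OF fg(1)] free_finite[OF fg(2)]]
      by (rule nrm_triangle) (rule finfun_finite, rule op_finfun, rule fg, rule x)+
    then show "nrm (op E (f \<oplus>\<^bsub>FC\<^esub> g) \<xi>) \<le> opnorm f + opnorm g"
      using opnorm_upper[OF fg(1) x] opnorm_upper[OF fg(2) x] by simp
  qed
next
  fix c f assume f: "f \<in> carrier FC"
  have "cmod c * opnorm f \<le> opnorm (\<lambda>w. c * f w)"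
  proof (cases "c = 0")
    case True
    then show ?thesis using opnorm_nonneg[OF scale_carrier[OF f, of c]] by simp
  next
    case False
    have "(\<lambda>w. inverse c * (c * f w)) = f" by (rule ext) (simp add: mult.assoc[symmetric] False)
    then have "opnorm f \<le> cmod (inverse c) * opnorm (\<lambda>w. c * f w)"
      using opnorm_scale_le[OF scale_carrier[OF f, of c], of "inverse c"] by simp
    then show ?thesis using False by (simp add: norm_inverse norm_divide field_simps)
  qed
  then show "opnorm (\<lambda>w. c * f w) = cmod c * opnorm f" using opnorm_scale_le[OF f, of c] by simp
next
  fix f assume f: "f \<in> ck_rels FC E"
  then have k: "f \<in> cnj_conj.op_ker E" using ck_rels_ker by blast
  then have c: "f \<in> carrier FC" by (simp add: cnj_conj.op_ker_def)
  have "opnorm f \<le> 0"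
    by (rule opnorm_least) (use k in \<open>simp add: cnj_conj.op_ker_def finfun_pathfun\<close>)
  then show "opnorm f = 0" using opnorm_nonneg[OF c] by simp
next
  fix f assume "f \<in> carrier FC"
  then show "opnorm (star FC f \<otimes>\<^bsub>FC\<^esub> f) = (opnorm f)\<^sup>2"
    using cstar_of_le(2)[of opnorm f] opnorm_nonneg opnorm_mult_le opnorm_star_le by blast
next
  fix f g assume "f \<in> carrier FC" "g \<in> carrier FC"
  then show "opnorm (f \<otimes>\<^bsub>FC\<^esub> g) \<le> opnorm f * opnorm g" by (rule opnorm_mult_le)
next
  fix f assume "f \<in> carrier FC"
  then show "opnorm f \<ge> 0" by (rule opnorm_nonneg)
qed

text \<open>The point mass at \<open>x\<close> is a unit eigenvector with eigenvalue
  \<open>f x\<close>.\<close>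

lemma opnorm_point:
  assumes z: "z \<in> carrier FC" and x: "x \<in> infpaths E"
    and act: "\<forall>\<xi>\<in>pathfun E. op E z \<xi> = (\<lambda>x. f x * \<xi> x)"
  shows "cmod (f x) \<le> opnorm z"
proof -
  let ?d = "\<lambda>y. of_bool (y = x) :: complex"
  have fin: "finite {y. ?d y \<noteq> 0}" by simp
  have d: "?d \<in> finfun E" using x by (auto simp: finfun_def pathfun_def)
  have n: "nrm ?d = 1" by (subst nrm_superset[of "{x}"]) (auto simp: L2_set_def)
  have "op E z ?d = (\<lambda>y. f x * ?d y)" using act finfun_pathfun[OF d] by (auto simp: fun_eq_iff)
  then have "nrm (op E z ?d) = cmod (f x)" using nrm_scale[OF fin, of "f x"] n by simp
  then show ?thesis using opnorm_upper[OF z d] n by simp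
qed

subsection \<open>The universal seminorm\<close>

lemma seminorm_star:
  assumes "\<rho> \<in> cstar_seminorms E" "x \<in> carrier FC" shows "\<rho> (star FC x) = \<rho> x"
  by (rule cstar_of_le(1)) (use assms in \<open>auto simp: seminorm_iff\<close>)

lemma seminorm_minus:
  assumes r: "\<rho> \<in> cstar_seminorms E" and x: "x \<in> carrier FC" "y \<in> carrier FC"
  shows "\<rho> (x \<ominus>\<^bsub>FC\<^esub> y) = \<rho> (y \<ominus>\<^bsub>FC\<^esub> x)" "\<rho> x \<le> \<rho> (x \<ominus>\<^bsub>FC\<^esub> y) + \<rho> y"
proof -
  have "x \<ominus>\<^bsub>FC\<^esub> y = (\<lambda>w. (-1) * (y \<ominus>\<^bsub>FC\<^esub> x) w)"
    unfolding free_minus[OF x] free_minus[OF x(2,1)] by auto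
  moreover have "\<rho> (\<lambda>w. (-1) * (y \<ominus>\<^bsub>FC\<^esub> x) w) = cmod (-1) * \<rho> (y \<ominus>\<^bsub>FC\<^esub> x)"
    using r x FC.minus_closed unfolding seminorm_iff by blast
  ultimately show "\<rho> (x \<ominus>\<^bsub>FC\<^esub> y) = \<rho> (y \<ominus>\<^bsub>FC\<^esub> x)" by simp
  have "x = (x \<ominus>\<^bsub>FC\<^esub> y) \<oplus>\<^bsub>FC\<^esub> y"
    unfolding free_minus[OF x] free_simps(4) by simp
  then show "\<rho> x \<le> \<rho> (x \<ominus>\<^bsub>FC\<^esub> y) + \<rho> y"
    using r x FC.minus_closed unfolding seminorm_iff by metis
qed

lemma seminorm_eq:
  assumes r: "\<rho> \<in> cstar_seminorms E" and x: "x \<in> carrier FC" "y \<in> carrier FC" and 0: "\<rho> (x \<ominus>\<^bsub>FC\<^esub> y) = 0"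
  shows "\<rho> x = \<rho> y"
  using seminorm_minus[OF r x] seminorm_minus[OF r x(2,1)] 0 by simp

lemma seminorm_idem_le:
  assumes "(r::real) = r\<^sup>2" shows "r \<le> 1"
  using assms by (auto simp: power2_eq_square)

lemma seminorm_one:
  assumes r: "\<rho> \<in> cstar_seminorms E" shows "\<rho> \<one>\<^bsub>FC\<^esub> \<le> 1"
proof (rule seminorm_idem_le)
  have "\<rho> (star FC \<one>\<^bsub>FC\<^esub> \<otimes>\<^bsub>FC\<^esub> \<one>\<^bsub>FC\<^esub>) = (\<rho> \<one>\<^bsub>FC\<^esub>)\<^sup>2"
    using r FC.one_closed unfolding seminorm_iff by blast
  then show "\<rho> \<one>\<^bsub>FC\<^esub> = (\<rho> \<one>\<^bsub>FC\<^esub>)\<^sup>2" by simp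
qed

text \<open>By the C*-identity the seminorm of a self-adjoint idempotent equals its own square, so
  it is at most 1. For an edge the identity is applied to \<open>S_e\<close>, whose adjoint times
  itself is a vertex projection up to a null relation.\<close>

lemma seminorm_gen:
  assumes r: "\<rho> \<in> cstar_seminorms E" and g: "g \<in> gens E" shows "\<rho> (delta [g]) \<le> 1"
proof -
  have cs: "\<rho> (star FC x \<otimes>\<^bsub>FC\<^esub> x) = (\<rho> x)\<^sup>2" if "x \<in> carrier FC" for x
    using r that unfolding seminorm_iff by blast
  have rels: "ck_rels FC E \<subseteq> {x. \<rho> x = 0}" using r unfolding seminorm_iff by blast
  note R = rels[unfolded ck_rels_subset mem_Collect_eq]
  have P: "\<rho> (vproj FC v) \<le> 1" if v: "v \<in> verts E" for v
  proof (rule seminorm_idem_le)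
    have "\<rho> (vproj FC v \<otimes>\<^bsub>FC\<^esub> vproj FC v) = \<rho> (vproj FC v)"
      by (rule seminorm_eq[OF r]) (use v R in auto)
    then show "\<rho> (vproj FC v) = (\<rho> (vproj FC v))\<^sup>2" using cs[of "vproj FC v"] v by simp
  qed
  have S: "\<rho> (eiso FC e) \<le> 1" if e: "e \<in> arcs E" for e
  proof -
    have "\<rho> (star FC (eiso FC e) \<otimes>\<^bsub>FC\<^esub> eiso FC e) = \<rho> (vproj FC (head E e))"
      by (rule seminorm_eq[OF r]) (use e R in auto)
    then have "(\<rho> (eiso FC e))\<^sup>2 \<le> 1" using cs[of "eiso FC e"] P e by simp
    then show ?thesis by (simp add: abs_square_le_1 abs_le_iff)
  qed
  show ?thesis
  proof (cases g)
    case (GP v)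
    then show ?thesis using P[of v] g by (auto simp: gens_def free_simps(6))
  next
    case (GS e)
    then show ?thesis using S[of e] g by (auto simp: gens_def free_simps(7))
  next
    case (GSstar e)
    then have e: "e \<in> arcs E" using g by (auto simp: gens_def)
    have "\<rho> (star FC (eiso FC e)) = \<rho> (eiso FC e)" using seminorm_star[OF r] e by simp
    then show ?thesis using S[OF e] by (simp only: GSstar cnj_conj.star_eiso_delta)
  qed
qed

text \<open>The bound is independent of the seminorm, which makes the universal supremum
  finite.\<close>

lemma seminorm_bounded: "x \<in> carrier FC \<Longrightarrow> \<exists>C\<ge>0. \<forall>\<rho>\<in>cstar_seminorms E. \<rho> x \<le> C"
proof (induction rule: free_induct)
  case (const c)
  have "\<rho> (const c) \<le> cmod c" if r: "\<rho> \<in> cstar_seminorms E" for \<rho>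
  proof -
    have "const c = (\<lambda>w. c * \<one>\<^bsub>FC\<^esub> w)" by (auto simp: const_def free_simps(2))
    moreover have "\<rho> (\<lambda>w. c * \<one>\<^bsub>FC\<^esub> w) = cmod c * \<rho> \<one>\<^bsub>FC\<^esub>"
      using r FC.one_closed unfolding seminorm_iff by blast
    ultimately show ?thesis using seminorm_one[OF r] mult_left_mono[of "\<rho> \<one>\<^bsub>FC\<^esub>" 1 "cmod c"] by simp
  qed
  then show ?case by (intro exI[of _ "cmod c"]) auto
next
  case (delta g)
  then show ?case using seminorm_gen by (intro exI[of _ 1]) auto
next
  case (add f g)
  then obtain C D where C: "C \<ge> 0" "\<forall>\<rho>\<in>cstar_seminorms E. \<rho> f \<le> C"
    and D: "D \<ge> 0" "\<forall>\<rho>\<in>cstar_seminorms E. \<rho> g \<le> D" by blast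
  have "\<rho> (\<lambda>w. f w + g w) \<le> C + D" if r: "\<rho> \<in> cstar_seminorms E" for \<rho>
  proof -
    have "\<rho> (f \<oplus>\<^bsub>FC\<^esub> g) \<le> \<rho> f + \<rho> g" using r add(1,2) unfolding seminorm_iff by blast
    moreover have "\<rho> f \<le> C" "\<rho> g \<le> D" using C(2) D(2) r by auto
    ultimately show ?thesis unfolding free_simps(4) by linarith
  qed
  then show ?case using C D by (intro exI[of _ "C + D"]) auto
next
  case (mult f g)
  then obtain C D where C: "C \<ge> 0" "\<forall>\<rho>\<in>cstar_seminorms E. \<rho> f \<le> C"
    and D: "D \<ge> 0" "\<forall>\<rho>\<in>cstar_seminorms E. \<rho> g \<le> D" by blast
  have "\<rho> (conv f g) \<le> C * D" if r: "\<rho> \<in> cstar_seminorms E" for \<rho>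
  proof -
    have "\<rho> (f \<otimes>\<^bsub>FC\<^esub> g) \<le> \<rho> f * \<rho> g" "\<rho> f \<ge> 0" "\<rho> g \<ge> 0"
      using r mult(1,2) unfolding seminorm_iff by blast+
    moreover have "\<rho> f \<le> C" "\<rho> g \<le> D" using C(2) D(2) r by auto
    then have "\<rho> f * \<rho> g \<le> C * D" using \<open>\<rho> g \<ge> 0\<close> C(1) by (intro mult_mono) auto
    ultimately show ?thesis unfolding free_simps(1) by linarith
  qed
  then show ?case using C D by (intro exI[of _ "C * D"]) auto
qed

abbreviation "unorm \<equiv> univ_seminorm E"

lemma unorm_upper: "\<rho> \<in> cstar_seminorms E \<Longrightarrow> x \<in> carrier FC \<Longrightarrow> \<rho> x \<le> unorm x"
proof -
  assume r: "\<rho> \<in> cstar_seminorms E" and x: "x \<in> carrier FC"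
  obtain C where "\<forall>\<rho>\<in>cstar_seminorms E. \<rho> x \<le> C" using seminorm_bounded[OF x] by blast
  then have "bdd_above ((\<lambda>\<rho>. \<rho> x) ` cstar_seminorms E)" by (auto intro!: bdd_aboveI2)
  then show ?thesis unfolding univ_seminorm_def by (rule cSUP_upper[OF r])
qed

lemma unorm_least: "(\<And>\<rho>. \<rho> \<in> cstar_seminorms E \<Longrightarrow> \<rho> x \<le> C) \<Longrightarrow> unorm x \<le> C"
  unfolding univ_seminorm_def using opnorm_seminorm by (intro cSUP_least) auto

text \<open>The conditions pass to suprema; for the C*-identity it is enough to check the inequality
  required by \<open>cstar_of_le\<close>.\<close>

lemma unorm_seminorm: "unorm \<in> cstar_seminorms E"
proof -
  have nn: "unorm x \<ge> 0" if "x \<in> carrier FC" for x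
    using unorm_upper[OF opnorm_seminorm that] opnorm_nonneg[OF that] by simp
  have sc: "unorm (\<lambda>w. c * x w) \<le> cmod c * unorm x" if x: "x \<in> carrier FC" for c x
  proof (rule unorm_least)
    fix \<rho> assume r: "\<rho> \<in> cstar_seminorms E"
    have "\<rho> (\<lambda>w. c * x w) = cmod c * \<rho> x" using r x unfolding seminorm_iff by blast
    then show "\<rho> (\<lambda>w. c * x w) \<le> cmod c * unorm x" using unorm_upper[OF r x] by (simp add: mult_left_mono)
  qed
  have mu: "unorm (x \<otimes>\<^bsub>FC\<^esub> y) \<le> unorm x * unorm y" if xy: "x \<in> carrier FC" "y \<in> carrier FC" for x y
  proof (rule unorm_least)
    fix \<rho> assume r: "\<rho> \<in> cstar_seminorms E"
    have "\<rho> (x \<otimes>\<^bsub>FC\<^esub> y) \<le> \<rho> x * \<rho> y" "\<rho> y \<ge> 0" using r xy unfolding seminorm_iff by blast+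
    moreover have "\<rho> x * \<rho> y \<le> unorm x * unorm y"
      using unorm_upper[OF r xy(1)] unorm_upper[OF r xy(2)] \<open>\<rho> y \<ge> 0\<close> nn[OF xy(1)] by (intro mult_mono) auto
    ultimately show "\<rho> (x \<otimes>\<^bsub>FC\<^esub> y) \<le> unorm x * unorm y" by linarith
  qed
  have st: "(unorm x)\<^sup>2 \<le> unorm (star FC x \<otimes>\<^bsub>FC\<^esub> x)" if x: "x \<in> carrier FC" for x
  proof -
    have c: "star FC x \<otimes>\<^bsub>FC\<^esub> x \<in> carrier FC" using x by simp
    have "unorm x \<le> sqrt (unorm (star FC x \<otimes>\<^bsub>FC\<^esub> x))"
    proof (rule unorm_least, rule real_le_rsqrt)
      fix \<rho> assume r: "\<rho> \<in> cstar_seminorms E"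
      have "\<rho> (star FC x \<otimes>\<^bsub>FC\<^esub> x) = (\<rho> x)\<^sup>2" using r x unfolding seminorm_iff by blast
      then show "(\<rho> x)\<^sup>2 \<le> unorm (star FC x \<otimes>\<^bsub>FC\<^esub> x)" using unorm_upper[OF r c] by simp
    qed
    then show ?thesis using nn[OF x] nn[OF c] by (metis real_sqrt_le_iff real_sqrt_abs abs_of_nonneg)
  qed
  show ?thesis
    unfolding seminorm_iff
  proof (intro conjI ballI allI)
    fix x y assume xy: "x \<in> carrier FC" "y \<in> carrier FC"
    show "unorm (x \<oplus>\<^bsub>FC\<^esub> y) \<le> unorm x + unorm y"
    proof (rule unorm_least)
      fix \<rho> assume r: "\<rho> \<in> cstar_seminorms E"
      have "\<rho> (x \<oplus>\<^bsub>FC\<^esub> y) \<le> \<rho> x + \<rho> y" using r xy unfolding seminorm_iff by blast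
      then show "\<rho> (x \<oplus>\<^bsub>FC\<^esub> y) \<le> unorm x + unorm y"
        using unorm_upper[OF r xy(1)] unorm_upper[OF r xy(2)] by linarith
    qed
  next
    fix c x assume x: "x \<in> carrier FC"
    have "cmod c * unorm x \<le> unorm (\<lambda>w. c * x w)"
    proof (cases "c = 0")
      case True
      then show ?thesis using nn[OF scale_carrier[OF x, of c]] by simp
    next
      case False
      have "(\<lambda>w. inverse c * (c * x w)) = x" by (rule ext) (simp add: mult.assoc[symmetric] False)
      then have "unorm x \<le> cmod (inverse c) * unorm (\<lambda>w. c * x w)"
        using sc[OF scale_carrier[OF x, of c], of "inverse c"] by simp
      then show ?thesis using False by (simp add: norm_inverse norm_divide field_simps)
    qed
    then show "unorm (\<lambda>w. c * x w) = cmod c * unorm x" using sc[OF x, of c] by simp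
  next
    fix x assume x: "x \<in> ck_rels FC E"
    have "unorm x \<le> 0" by (rule unorm_least) (use x in \<open>simp add: seminorm_iff\<close>)
    moreover have "x \<in> carrier FC" using x ck_rels_ker by (auto simp: cnj_conj.op_ker_def)
    ultimately show "unorm x = 0" using nn[of x] by simp
  next
    fix x assume "x \<in> carrier FC"
    then show "unorm (star FC x \<otimes>\<^bsub>FC\<^esub> x) = (unorm x)\<^sup>2"
      using cstar_of_le(2)[of unorm x] nn mu st by blast
  next
    fix x y assume "x \<in> carrier FC" "y \<in> carrier FC"
    then show "unorm (x \<otimes>\<^bsub>FC\<^esub> y) \<le> unorm x * unorm y" by (rule mu)
  next
    fix x assume "x \<in> carrier FC"
    then show "unorm x \<ge> 0" by (rule nn)
  qed
qed

lemma unorm_nonneg: "x \<in> carrier FC \<Longrightarrow> unorm x \<ge> 0"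
  and unorm_add: "x \<in> carrier FC \<Longrightarrow> y \<in> carrier FC \<Longrightarrow> unorm (x \<oplus>\<^bsub>FC\<^esub> y) \<le> unorm x + unorm y"
  and unorm_scale: "x \<in> carrier FC \<Longrightarrow> unorm (\<lambda>w. c * x w) = cmod c * unorm x"
  and unorm_mult: "x \<in> carrier FC \<Longrightarrow> y \<in> carrier FC \<Longrightarrow> unorm (x \<otimes>\<^bsub>FC\<^esub> y) \<le> unorm x * unorm y"
  and unorm_cstar: "x \<in> carrier FC \<Longrightarrow> unorm (star FC x \<otimes>\<^bsub>FC\<^esub> x) = (unorm x)\<^sup>2"
  and unorm_rels: "x \<in> ck_rels FC E \<Longrightarrow> unorm x = 0"
  using unorm_seminorm unfolding seminorm_iff by blast+

lemmas unorm_star = seminorm_star[OF unorm_seminorm]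
lemmas unorm_minus = seminorm_minus[OF unorm_seminorm]
lemmas unorm_eq = seminorm_eq[OF unorm_seminorm]

end

section \<open>Sums of projections in a C*-algebra\<close>

text \<open>The intended instance is the quotient of the free algebra by null elements, before
  completion. \<open>sc\<close> supplies the real scalars as central self-adjoint elements.\<close>

locale cstar_norm = graph_star_ring E A
  for E :: "('v, 'e) pre_digraph" and A :: "('a, 'v, 'e) graph_alg" (structure) +
  fixes n :: "'a \<Rightarrow> real" and sc :: "real \<Rightarrow> 'a"
  assumes n_add: "x \<in> carrier A \<Longrightarrow> y \<in> carrier A \<Longrightarrow> n (x \<oplus> y) \<le> n x + n y"
    and n_mult: "x \<in> carrier A \<Longrightarrow> y \<in> carrier A \<Longrightarrow> n (x \<otimes> y) \<le> n x * n y"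
    and n_nonneg: "x \<in> carrier A \<Longrightarrow> n x \<ge> 0"
    and n_cstar: "x \<in> carrier A \<Longrightarrow> n (star A x \<otimes> x) = (n x)\<^sup>2"
    and n_eq_zero: "x \<in> carrier A \<Longrightarrow> n x = 0 \<Longrightarrow> x = \<zero>"
    and n_sc: "x \<in> carrier A \<Longrightarrow> n (sc r \<otimes> x) = \<bar>r\<bar> * n x"
    and sc_closed [simp]: "sc r \<in> carrier A"
    and sc_add: "sc (a + b) = sc a \<oplus> sc b"
    and sc_mult: "sc (a * b) = sc a \<otimes> sc b"
    and sc_one: "sc 1 = \<one>"
    and sc_star: "star A (sc r) = sc r"
    and sc_comm: "x \<in> carrier A \<Longrightarrow> x \<otimes> sc r = sc r \<otimes> x"
begin

lemma sc_zero: "sc 0 = \<zero>"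
  using sc_add[of 0 0] add.l_cancel_one[of "sc 0" "sc 0"] by simp

lemma sc_left_comm: "x \<in> carrier A \<Longrightarrow> y \<in> carrier A \<Longrightarrow> x \<otimes> (sc r \<otimes> y) = sc r \<otimes> (x \<otimes> y)"
  by (metis m_assoc sc_closed sc_comm)

lemma sc_sc: "x \<in> carrier A \<Longrightarrow> sc a \<otimes> (sc b \<otimes> x) = sc (a * b) \<otimes> x"
  by (simp add: sc_mult m_assoc)

lemma sc_neg: "x \<in> carrier A \<Longrightarrow> sc (-1) \<otimes> x = \<ominus> x"
proof -
  assume x: "x \<in> carrier A"
  have "sc (-1) \<otimes> x \<oplus> x = sc (-1 + 1) \<otimes> x" using x by (simp only: sc_add l_distr sc_closed sc_one one_closed l_one)
  then show ?thesis using x minus_equality[of "sc (-1) \<otimes> x" x] by (simp add: sc_zero)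
qed

lemma n_zero: "n \<zero> = 0"
  using n_sc[of \<zero> 0] by simp

lemma n_minus_le: "x \<in> carrier A \<Longrightarrow> y \<in> carrier A \<Longrightarrow> n (x \<ominus> y) \<le> n x + n y"
  using n_add[of x "sc (-1) \<otimes> y"] n_sc[of y "-1"] by (simp add: a_minus_def sc_neg)

lemma n_finsum: "finite I \<Longrightarrow> f \<in> I \<rightarrow> carrier A \<Longrightarrow> n (finsum A f I) \<le> (\<Sum>i\<in>I. n (f i))"
proof (induction I rule: finite_induct)
  case (insert i I)
  then have "finsum A f (insert i I) = f i \<oplus> finsum A f I" by (subst finsum_insert) auto
  moreover have "n (f i \<oplus> finsum A f I) \<le> n (f i) + n (finsum A f I)"
    using insert by (intro n_add finsum_closed) auto
  ultimately show ?case using insert by auto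
qed (simp add: n_zero)

lemma finsum_const_sc: "finite I \<Longrightarrow> c \<in> carrier A \<Longrightarrow> (\<Oplus>i\<in>I. c) = sc (real (card I)) \<otimes> c"
proof (induction I rule: finite_induct)
  case (insert i I)
  have "sc (real (card (insert i I))) \<otimes> c = sc (1 + real (card I)) \<otimes> c" using insert by simp
  also have "\<dots> = c \<oplus> sc (real (card I)) \<otimes> c" using insert by (simp only: sc_add l_distr sc_closed sc_one one_closed l_one)
  finally show ?case using insert by simp
qed (simp add: sc_zero)

lemma finsum_subtract:
  assumes "finite I" "f \<in> I \<rightarrow> carrier A" "g \<in> I \<rightarrow> carrier A"
  shows "(\<Oplus>i\<in>I. f i \<ominus> g i) = finsum A f I \<ominus> finsum A g I"
  using assms
proof (induction I rule: finite_induct)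
  case (insert i I)
  then have c: "f \<in> I \<rightarrow> carrier A" "g \<in> I \<rightarrow> carrier A" "f i \<in> carrier A" "g i \<in> carrier A"
    "finsum A f I \<in> carrier A" "finsum A g I \<in> carrier A" by (auto intro!: finsum_closed)
  then have "(\<lambda>i. f i \<ominus> g i) \<in> I \<rightarrow> carrier A" by auto
  then show ?case using insert c by (simp add: a_minus_def minus_add a_ac)
qed (simp add: a_minus_def)

context
  fixes c k
  assumes ck [simp]: "c \<in> carrier A" "k \<in> carrier A"
    and cc: "c \<otimes> c = c" and ckk: "c \<otimes> k = k" and kc: "k \<otimes> c = k"
begin

text \<open>Polynomials of degree at most 3 in \<open>k\<close>, with the corner unit
  \<open>c\<close> as constant term. The cubic coefficient arises only in products and cancels in
  the averages formed below.\<close>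

definition lin :: "real \<Rightarrow> real \<Rightarrow> real \<Rightarrow> real \<Rightarrow> 'a" where
  "lin \<alpha> \<beta> \<gamma> \<delta> = sc \<alpha> \<otimes> c \<oplus> (sc \<beta> \<otimes> k \<oplus> (sc \<gamma> \<otimes> (k \<otimes> k) \<oplus> sc \<delta> \<otimes> (k \<otimes> (k \<otimes> k))))"

lemma lin_closed [simp]: "lin \<alpha> \<beta> \<gamma> \<delta> \<in> carrier A"
  by (simp add: lin_def)

lemma lin_add: "lin \<alpha> \<beta> \<gamma> \<delta> \<oplus> lin \<alpha>' \<beta>' \<gamma>' \<delta>' = lin (\<alpha> + \<alpha>') (\<beta> + \<beta>') (\<gamma> + \<gamma>') (\<delta> + \<delta>')"
  by (simp add: lin_def sc_add l_distr a_ac)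

lemma lin_scale: "sc r \<otimes> lin \<alpha> \<beta> \<gamma> \<delta> = lin (r * \<alpha>) (r * \<beta>) (r * \<gamma>) (r * \<delta>)"
  by (simp add: lin_def sc_sc r_distr)

lemma c_lin: "c \<otimes> lin \<alpha> \<beta> \<gamma> \<delta> = lin \<alpha> \<beta> \<gamma> \<delta>"
proof -
  have ck': "c \<otimes> (k \<otimes> y) = k \<otimes> y" if "y \<in> carrier A" for y
    using that by (simp add: m_assoc[symmetric] ckk)
  show ?thesis by (simp add: lin_def r_distr sc_left_comm cc ckk ck')
qed

lemma k_lin: "k \<otimes> lin \<alpha> \<beta> \<gamma> 0 = lin 0 \<alpha> \<beta> \<gamma>"
  by (simp add: lin_def r_distr sc_left_comm kc sc_zero)

text \<open>The left-hand side is \<open>E ((z + S)\<^sup>2 \<Prod> (c + \<epsilon>\<^sub>i k))\<close> for a random walk \<open>S = \<epsilon>\<^sub>1 + \<dots> + \<epsilon>\<^sub>m\<close> with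
  independent uniform signs \<open>\<epsilon>\<^sub>i\<close>, and the right-hand side is \<open>E ((z + S)\<^sup>2)\<close>.\<close>

lemma random_walk:
  assumes "n c \<le> 1" "n (c \<oplus> k) \<le> 1" "n (c \<ominus> k) \<le> 1"
  shows "n (lin (real m + z\<^sup>2) (2 * real m * z) (real m * (real m - 1)) 0) \<le> real m + z\<^sup>2"
proof (induction m arbitrary: z)
  case 0
  have "lin (z\<^sup>2) 0 0 0 = sc (z\<^sup>2) \<otimes> c" by (simp add: lin_def sc_zero)
  then have "n (lin (z\<^sup>2) 0 0 0) = z\<^sup>2 * n c" by (simp add: n_sc)
  also have "\<dots> \<le> z\<^sup>2" using assms(1) mult_left_mono[of "n c" 1 "z\<^sup>2"] by simp
  finally show ?case by simp
next
  case (Suc m)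
  let ?L = "\<lambda>z. lin (real m + z\<^sup>2) (2 * real m * z) (real m * (real m - 1)) 0"
  let ?K = "\<lambda>z. lin 0 (real m + z\<^sup>2) (2 * real m * z) (real m * (real m - 1))"
  have p: "(c \<oplus> k) \<otimes> ?L (z + 1) = ?L (z + 1) \<oplus> ?K (z + 1)"
    by (simp only: l_distr ck lin_closed c_lin k_lin)
  have q: "(c \<ominus> k) \<otimes> ?L (z - 1) = ?L (z - 1) \<oplus> sc (-1) \<otimes> ?K (z - 1)"
    by (simp only: a_minus_def l_distr l_minus ck lin_closed a_inv_closed c_lin k_lin sc_neg)
  \<comment> \<open>Conditioning on one sign: it moves the start \<open>z\<close> to
    \<open>z + 1\<close> or \<open>z - 1\<close> and contributes the factor
    \<open>c \<oplus> k\<close> or \<open>c \<ominus> k\<close>, each with weight 1/2.\<close>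
  have "lin (real (Suc m) + z\<^sup>2) (2 * real (Suc m) * z) (real (Suc m) * (real (Suc m) - 1)) 0
      = sc (1/2) \<otimes> ((c \<oplus> k) \<otimes> ?L (z + 1) \<oplus> (c \<ominus> k) \<otimes> ?L (z - 1))"
    unfolding p q lin_scale lin_add
    by (intro arg_cong4[where f = lin]) (simp_all add: field_simps power2_eq_square)
  also have "n \<dots> = \<bar>1/2\<bar> * n ((c \<oplus> k) \<otimes> ?L (z + 1) \<oplus> (c \<ominus> k) \<otimes> ?L (z - 1))"
    by (rule n_sc) simp
  also have "\<dots> \<le> 1/2 * ((real m + (z + 1)\<^sup>2) + (real m + (z - 1)\<^sup>2))"
  proof -
    have "n ((c \<oplus> k) \<otimes> ?L (z + 1)) \<le> n (c \<oplus> k) * n (?L (z + 1))" by (rule n_mult) auto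
    also have "\<dots> \<le> 1 * (real m + (z + 1)\<^sup>2)" by (rule mult_mono[OF assms(2) Suc]) (auto simp: n_nonneg)
    finally have a: "n ((c \<oplus> k) \<otimes> ?L (z + 1)) \<le> real m + (z + 1)\<^sup>2" by simp
    have "n ((c \<ominus> k) \<otimes> ?L (z - 1)) \<le> n (c \<ominus> k) * n (?L (z - 1))" by (rule n_mult) auto
    also have "\<dots> \<le> 1 * (real m + (z - 1)\<^sup>2)" by (rule mult_mono[OF assms(3) Suc]) (auto simp: n_nonneg)
    finally have b: "n ((c \<ominus> k) \<otimes> ?L (z - 1)) \<le> real m + (z - 1)\<^sup>2" by simp
    have "n ((c \<oplus> k) \<otimes> ?L (z + 1) \<oplus> (c \<ominus> k) \<otimes> ?L (z - 1)) \<le>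
        n ((c \<oplus> k) \<otimes> ?L (z + 1)) + n ((c \<ominus> k) \<otimes> ?L (z - 1))" by (rule n_add) auto
    then show ?thesis using a b by simp
  qed
  also have "\<dots> = real (Suc m) + z\<^sup>2" by (simp add: field_simps power2_eq_square)
  finally show ?case .
qed

text \<open>The unit \<open>c\<close> of a corner is an extreme point of the unit ball of that corner.\<close>

lemma extreme_unit:
  assumes "n c \<le> 1" "n (c \<oplus> k) \<le> 1" "n (c \<ominus> k) \<le> 1" and k: "star A k = k"
  shows "k = \<zero>"
proof -
  \<comment> \<open>With start 0 the coefficient of \<open>k \<otimes> k\<close> grows quadratically
    in \<open>m\<close> but the norm bound only linearly; for large \<open>m\<close> this forces
    \<open>k \<otimes> k\<close> to have norm 0.\<close>
  have b: "real m * ((real m - 1) * n (k \<otimes> k)) \<le> real m * 2" if "m \<ge> 1" for m :: nat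
  proof -
    let ?x = "sc (real m * (real m - 1)) \<otimes> (k \<otimes> k)"
    have l: "lin (real m) 0 (real m * (real m - 1)) 0 = sc (real m) \<otimes> c \<oplus> ?x"
      by (simp add: lin_def sc_zero)
    then have "?x = lin (real m) 0 (real m * (real m - 1)) 0 \<ominus> sc (real m) \<otimes> c"
      by (simp add: a_minus_def a_ac r_neg2 r_neg1 r_neg)
    then have "n ?x \<le> n (lin (real m) 0 (real m * (real m - 1)) 0) + n (sc (real m) \<otimes> c)"
      using n_minus_le by simp
    also have "n (sc (real m) \<otimes> c) \<le> real m"
      using assms(1) mult_left_mono[of "n c" 1 "real m"] by (simp add: n_sc)
    also have "n (lin (real m) 0 (real m * (real m - 1)) 0) \<le> real m"
      using random_walk[OF assms(1-3), of m 0] by simp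
    finally show ?thesis using that by (simp add: n_sc abs_mult mult.assoc)
  qed
  have "n (k \<otimes> k) \<le> 0"
  proof (rule ccontr)
    assume "\<not> n (k \<otimes> k) \<le> 0"
    then obtain m :: nat where m: "2 < real m * n (k \<otimes> k)" using ex_less_of_nat_mult[of "n (k \<otimes> k)" 2] by auto
    have "real (Suc m) * ((real (Suc m) - 1) * n (k \<otimes> k)) \<le> real (Suc m) * 2" by (rule b) simp
    then have "(real (Suc m) - 1) * n (k \<otimes> k) \<le> 2" by (rule mult_left_le_imp_le) simp
    then show False using m by simp
  qed
  then have "(n k)\<^sup>2 \<le> 0" using n_cstar[of k] k by simp
  then show ?thesis using n_eq_zero[of k] by simp
qed

end

definition projection :: "'a \<Rightarrow> bool" where
  "projection p \<longleftrightarrow> p \<in> carrier A \<and> star A p = p \<and> p \<otimes> p = p"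

lemma projection_norm: "projection p \<Longrightarrow> n p \<le> 1"
  using n_cstar[of p] by (auto simp: projection_def power2_eq_square)

lemma projection_compl: "projection p \<Longrightarrow> projection (\<one> \<ominus> p)"
  by (auto simp: projection_def star_minus star_add star_uminus star_one a_minus_def l_distr r_distr l_minus r_minus minus_add r_neg a_ac)

text \<open>Positive elements \<open>c q\<^sub>i c\<close> with sum zero all vanish.  Extremality of \<open>c\<close> replaces the order
  structure of a C*-algebra here: were \<open>c q\<^sub>j c\<close> nonzero, then \<open>c \<plusminus> k\<close> would be contractive for a
  small positive multiple \<open>k\<close> of it.\<close>

lemma compressed_sum_zero:
  assumes I: "finite I" and q: "\<And>i. i \<in> I \<Longrightarrow> projection (q i)" and c: "projection c"
    and sum: "(\<Oplus>i\<in>I. c \<otimes> q i \<otimes> c) = \<zero>" and j: "j \<in> I"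
  shows "c \<otimes> q j = \<zero>"
proof -
  have cl: "c \<in> carrier A" "star A c = c" "c \<otimes> c = c" using c by (auto simp: projection_def)
  have ql: "q i \<in> carrier A" "star A (q i) = q i" "q i \<otimes> q i = q i" if "i \<in> I" for i
    using q[OF that] by (auto simp: projection_def)
  let ?h = "\<lambda>i. c \<otimes> q i \<otimes> c"
  have hc: "?h i \<in> carrier A" if "i \<in> I" for i using cl ql that by simp
  have nc: "n c \<le> 1" using projection_norm[OF c] .
  have comp: "n (c \<ominus> ?h i) \<le> 1" if i: "i \<in> I" for i
  proof -
    have p: "projection (\<one> \<ominus> q i)" using projection_compl[OF q[OF i]] .
    then have pc: "\<one> \<ominus> q i \<in> carrier A" by (simp add: projection_def)
    have "c \<ominus> ?h i = c \<otimes> (\<one> \<ominus> q i) \<otimes> c"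
      using cl ql[OF i] by (simp add: a_minus_def r_distr l_distr r_minus l_minus)
    also have "n \<dots> \<le> n (c \<otimes> (\<one> \<ominus> q i)) * n c" using pc cl by (intro n_mult) auto
    also have "\<dots> \<le> (n c * n (\<one> \<ominus> q i)) * n c"
      using pc cl n_mult[of c "\<one> \<ominus> q i"] n_nonneg by (intro mult_right_mono) auto
    also have "\<dots> \<le> (1 * 1) * 1"
      using nc projection_norm[OF p] n_nonneg[OF cl(1)] n_nonneg[OF pc] by (intro mult_mono) auto
    finally show ?thesis by simp
  qed
  let ?I = "I - {j}"
  let ?t = "real (card ?I)"
  have hs: "?h j \<oplus> finsum A ?h ?I = \<zero>"
  proof -
    have "finsum A ?h (insert j ?I) = ?h j \<oplus> finsum A ?h ?I"
      using I hc j by (intro finsum_insert) auto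
    then show ?thesis using sum j by (simp add: insert_absorb)
  qed
  have fc: "finsum A ?h ?I \<in> carrier A" using hc by (auto intro!: finsum_closed)
  have "?h j = \<zero>"
  proof (cases "?I = {}")
    case True
    then show ?thesis using hs hc[OF j] by (simp only: finsum_empty r_zero)
  next
    case False
    then have t: "?t \<ge> 1" using I by (simp add: Suc_le_eq card_gt_0_iff)
    \<comment> \<open>Divided by the number of the other indices, so that both
      \<open>c \<oplus> k\<close> and \<open>c \<ominus> k\<close> become averages of
      contractions.\<close>
    define k where "k = sc (1 / ?t) \<otimes> ?h j"
    have kc: "k \<in> carrier A" using hc[OF j] by (simp add: k_def)
    \<comment> \<open>As \<open>?h j\<close> is minus the sum of the others,
      \<open>c \<oplus> k\<close> is the mean of \<open>c \<ominus> ?h i\<close> over the indices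
      \<open>i\<close> other than \<open>j\<close>.\<close>
    have up: "n (c \<oplus> k) \<le> 1"
    proof -
      have "(\<Oplus>i\<in>?I. c \<ominus> ?h i) = (\<Oplus>i\<in>?I. c) \<ominus> finsum A ?h ?I"
        using I hc cl by (intro finsum_subtract) auto
      also have "\<dots> = sc ?t \<otimes> c \<oplus> ?h j"
      proof -
        have "?h j = \<ominus> finsum A ?h ?I" using hs hc[OF j] fc by (metis minus_equality)
        then show ?thesis using I cl by (simp add: finsum_const_sc a_minus_def)
      qed
      finally have e: "(\<Oplus>i\<in>?I. c \<ominus> ?h i) = sc ?t \<otimes> c \<oplus> ?h j" .
      have "sc (1 / ?t) \<otimes> (sc ?t \<otimes> c \<oplus> ?h j) = c \<oplus> k"
        using cl hc[OF j] t by (simp add: r_distr sc_sc k_def sc_one)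
      then have "n (c \<oplus> k) = \<bar>1 / ?t\<bar> * n (\<Oplus>i\<in>?I. c \<ominus> ?h i)"
        using n_sc[of "sc ?t \<otimes> c \<oplus> ?h j" "1 / ?t"] cl hc[OF j] e by simp
      also have "n (\<Oplus>i\<in>?I. c \<ominus> ?h i) \<le> (\<Sum>i\<in>?I. n (c \<ominus> ?h i))"
        using I hc cl by (intro n_finsum) auto
      also have "\<dots> \<le> (\<Sum>i\<in>?I. 1)" using comp by (intro sum_mono) auto
      finally show ?thesis using t by (simp add: divide_le_eq)
    qed
    \<comment> \<open>Here \<open>c \<ominus> k\<close> is a convex combination of \<open>c\<close>
      and \<open>c \<ominus> ?h j\<close>.\<close>
    have lo: "n (c \<ominus> k) \<le> 1"
    proof -
      have "c \<ominus> k = sc (1 - 1 / ?t) \<otimes> c \<oplus> sc (1 / ?t) \<otimes> (c \<ominus> ?h j)"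
      proof -
        have "sc (1 - 1 / ?t) \<otimes> c \<oplus> sc (1 / ?t) \<otimes> c = sc (1 - 1 / ?t + 1 / ?t) \<otimes> c"
          using cl by (simp only: sc_add l_distr sc_closed)
        then have "sc (1 - 1 / ?t) \<otimes> c \<oplus> sc (1 / ?t) \<otimes> c = c" using cl by (simp add: sc_one)
        then have "c \<ominus> k = sc (1 - 1 / ?t) \<otimes> c \<oplus> sc (1 / ?t) \<otimes> c \<ominus> k" by simp
        also have "\<dots> = sc (1 - 1 / ?t) \<otimes> c \<oplus> sc (1 / ?t) \<otimes> (c \<ominus> ?h j)"
          using cl hc[OF j] kc by (simp add: a_minus_def k_def r_distr r_minus a_assoc)
        finally show ?thesis .
      qed
      then have "n (c \<ominus> k) \<le> n (sc (1 - 1 / ?t) \<otimes> c) + n (sc (1 / ?t) \<otimes> (c \<ominus> ?h j))"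
        using cl hc[OF j] n_add[of "sc (1 - 1 / ?t) \<otimes> c" "sc (1 / ?t) \<otimes> (c \<ominus> ?h j)"] by simp
      also have "\<dots> = (1 - 1 / ?t) * n c + 1 / ?t * n (c \<ominus> ?h j)"
        using cl hc[OF j] t by (simp add: n_sc)
      also have "\<dots> \<le> (1 - 1 / ?t) * 1 + 1 / ?t * 1"
        using nc comp[OF j] t by (intro add_mono mult_left_mono) auto
      finally show ?thesis by simp
    qed
    have ck: "c \<otimes> k = k" "k \<otimes> c = k"
    proof -
      have "c \<otimes> ?h j = (c \<otimes> c) \<otimes> q j \<otimes> c" using cl(1) ql(1)[OF j] by (simp add: m_assoc)
      then show "c \<otimes> k = k" using cl hc[OF j] by (simp add: k_def sc_left_comm)
      have "?h j \<otimes> c = c \<otimes> q j \<otimes> (c \<otimes> c)" using cl(1) ql(1)[OF j] by (simp add: m_assoc)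
      then show "k \<otimes> c = k" using cl hc[OF j] by (simp add: k_def m_assoc)
    qed
    have sk: "star A k = k"
    proof -
      have "star A k = star A (?h j) \<otimes> star A (sc (1 / ?t))" using hc[OF j] by (simp add: k_def star_mult)
      moreover have "star A (?h j) = ?h j" using cl ql[OF j] by (simp add: star_mult m_assoc)
      ultimately show ?thesis using hc[OF j] by (simp add: k_def sc_comm sc_star)
    qed
    have "k = \<zero>" by (rule extreme_unit[OF cl(1) kc cl(3) ck nc up lo sk])
    then have "sc ?t \<otimes> k = \<zero>" by simp
    then show ?thesis using hc[OF j] t by (simp add: k_def sc_sc sc_one)
  qed
  \<comment> \<open>\<open>?h j\<close> is the adjoint of \<open>q j \<otimes> c\<close> times
    \<open>q j \<otimes> c\<close>, so the C*-identity leads from the vanishing compression to the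
    factor.\<close>
  moreover have "n (star A (q j \<otimes> c) \<otimes> (q j \<otimes> c)) = (n (q j \<otimes> c))\<^sup>2"
    using ql[OF j] cl by (intro n_cstar) auto
  moreover have "star A (q j \<otimes> c) \<otimes> (q j \<otimes> c) = ?h j"
  proof -
    have "star A (q j \<otimes> c) \<otimes> (q j \<otimes> c) = c \<otimes> (q j \<otimes> q j) \<otimes> c"
      using ql(1,2)[OF j] cl(1,2) by (simp add: star_mult m_assoc)
    then show ?thesis using ql[OF j] by simp
  qed
  ultimately have "q j \<otimes> c = \<zero>" using n_eq_zero[of "q j \<otimes> c"] n_zero ql[OF j] cl by simp
  then have "star A (q j \<otimes> c) = \<zero>" by simp
  then show ?thesis using ql[OF j] cl by (simp add: star_mult)
qed

text \<open>Orthogonality of the ranges of the \<open>S\<^sub>e\<close> is not among the C*-relations: it comes from positivity.\<close>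

lemma ck_imp_leavitt:
  assumes E: "fin_digraph E" and ck: "ck_rels A E \<subseteq> {\<zero>}"
  shows "leavitt_rels A E \<subseteq> {\<zero>}"
proof -
  interpret fin_digraph E by fact
  let ?P = "vproj A" and ?S = "eiso A" and ?T = "\<lambda>e. star A (eiso A e)"
  have cl: "(\<Oplus>v\<in>verts E. ?P v) \<in> carrier A" "(\<Oplus>e\<in>out_arcs E v. ?S e \<otimes> ?T e) \<in> carrier A" for v
    by (auto intro!: finsum_closed)
  note R = ck[unfolded ck_rels_subset singleton_iff]
  have unit: "\<one> = (\<Oplus>v\<in>verts E. ?P v)"
    and PP: "\<And>v. v \<in> verts E \<Longrightarrow> ?P v \<otimes> ?P v = ?P v"
    and PQ: "\<And>v w. v \<in> verts E \<Longrightarrow> w \<in> verts E \<Longrightarrow> v \<noteq> w \<Longrightarrow> ?P v \<otimes> ?P w = \<zero>"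
    and STS: "\<And>e. e \<in> arcs E \<Longrightarrow> ?S e \<otimes> ?T e \<otimes> ?S e = ?S e"
    and TS: "\<And>e. e \<in> arcs E \<Longrightarrow> ?T e \<otimes> ?S e = ?P (head E e)"
    and Psum: "\<And>v. v \<in> verts E \<Longrightarrow> ?P v = (\<Oplus>e\<in>out_arcs E v. ?S e \<otimes> ?T e)"
    using R cl by (auto simp: minus_eq_zero_iff)
  define q where "q e = ?S e \<otimes> ?T e" for e
  have qc [simp]: "q e \<in> carrier A" if "e \<in> arcs E" for e using that by (simp add: q_def)
  have qp: "projection (q e)" if "e \<in> arcs E" for e
  proof -
    have "q e \<otimes> q e = (?S e \<otimes> ?T e \<otimes> ?S e) \<otimes> ?T e" using that by (simp add: q_def m_assoc)
    then show ?thesis using that STS[OF that] by (simp add: projection_def star_mult q_def)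
  qed
  have Pp: "projection (?P v)" if "v \<in> verts E" for v
    using that PP by (simp add: projection_def)
  have qsum: "(\<Oplus>e\<in>out_arcs E v. c \<otimes> q e \<otimes> c) = c \<otimes> ?P v \<otimes> c" if "v \<in> verts E" "c \<in> carrier A" for v c
  proof -
    have "c \<otimes> ?P v \<otimes> c = (\<Oplus>e\<in>out_arcs E v. c \<otimes> q e) \<otimes> c"
      unfolding Psum[OF that(1)] q_def[symmetric] using that by (subst finsum_rdistr) auto
    also have "\<dots> = (\<Oplus>e\<in>out_arcs E v. c \<otimes> q e \<otimes> c)"
      using that by (intro finsum_ldistr) auto
    finally show ?thesis by simp
  qed
  \<comment> \<open>Compression by the complement of the vertex projection annihilates the sum of
    the range projections at \<open>v\<close>, hence each of them.\<close>
  have Pq: "?P v \<otimes> q e = q e" if v: "v \<in> verts E" and e: "e \<in> out_arcs E v" for v e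
  proof -
    let ?c = "\<one> \<ominus> ?P v"
    have c: "projection ?c" by (rule projection_compl[OF Pp[OF v]])
    have cP: "?c \<otimes> ?P v = \<zero>" using v PP[OF v] by (simp add: a_minus_def l_distr l_minus r_neg)
    have "?c \<otimes> q e = \<zero>"
    proof (rule compressed_sum_zero[OF finite_out_arcs _ c _ e])
      show "(\<Oplus>e\<in>out_arcs E v. ?c \<otimes> q e \<otimes> ?c) = \<zero>"
        using qsum[OF v, of ?c] cP v by simp
    qed (use qp in auto)
    then have "q e \<ominus> ?P v \<otimes> q e = \<zero>" using e v by (simp add: a_minus_def l_distr l_minus)
    then show ?thesis using e v by (simp add: minus_eq_zero_iff)
  qed
  have PS: "?P (tail E e) \<otimes> ?S e = ?S e" if e: "e \<in> arcs E" for e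
  proof -
    have "?P (tail E e) \<otimes> q e \<otimes> ?S e = q e \<otimes> ?S e" using Pq[of "tail E e" e] e by simp
    moreover have "q e \<otimes> ?S e = ?S e" using STS[OF e] by (simp add: q_def)
    ultimately show ?thesis using e by (simp add: m_assoc)
  qed
  have SP: "?S e \<otimes> ?P (head E e) = ?S e" if e: "e \<in> arcs E" for e
    using STS[OF e] TS[OF e] e by (simp add: m_assoc)
  \<comment> \<open>Compressing that sum by \<open>q e\<close> gives \<open>q e\<close>, which the
    term of \<open>e\<close> alone already accounts for; the remaining terms sum to zero.\<close>
  have qq: "q e \<otimes> q f = \<zero>" if e: "e \<in> out_arcs E v" "f \<in> out_arcs E v" "e \<noteq> f" and v: "v \<in> verts E" for e f v
  proof (rule compressed_sum_zero[where I = "out_arcs E v - {e}" and q = q])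
    have qe: "q e \<in> carrier A" "q e \<otimes> q e = q e" "star A (q e) = q e"
      using qp e by (auto simp: projection_def)
    have "(\<Oplus>f\<in>out_arcs E v. q e \<otimes> q f \<otimes> q e) = q e \<otimes> ?P v \<otimes> q e" by (rule qsum[OF v qe(1)])
    also have "\<dots> = q e" using Pq[OF v e(1)] qe v by (simp add: m_assoc)
    finally have 1: "(\<Oplus>f\<in>out_arcs E v. q e \<otimes> q f \<otimes> q e) = q e" .
    have "(\<Oplus>f\<in>insert e (out_arcs E v - {e}). q e \<otimes> q f \<otimes> q e) =
        q e \<otimes> q e \<otimes> q e \<oplus> (\<Oplus>f\<in>out_arcs E v - {e}. q e \<otimes> q f \<otimes> q e)"
      using qe by (intro finsum_insert) auto
    then have "q e \<oplus> (\<Oplus>f\<in>out_arcs E v - {e}. q e \<otimes> q f \<otimes> q e) = q e"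
      using 1 qe e(1) by (simp add: insert_absorb)
    moreover have "(\<Oplus>f\<in>out_arcs E v - {e}. q e \<otimes> q f \<otimes> q e) \<in> carrier A"
      using qe by (intro finsum_closed) auto
    ultimately show "(\<Oplus>f\<in>out_arcs E v - {e}. q e \<otimes> q f \<otimes> q e) = \<zero>"
      using qe(1) add.l_cancel_one by metis
  qed (use e qp in auto)
  have TSz: "?T e \<otimes> ?S f = \<zero>" if e: "e \<in> arcs E" "f \<in> arcs E" "e \<noteq> f" for e f
  proof -
    have qqz: "q e \<otimes> q f = \<zero>"
    proof (cases "tail E e = tail E f")
      case True
      then show ?thesis using qq[of e "tail E e" f] e by simp
    next
      case False
      have "q e \<otimes> ?P (tail E e) = star A (?P (tail E e) \<otimes> q e)" using e qp[OF e(1)] by (simp add: star_mult projection_def)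
      then have "q e \<otimes> ?P (tail E e) = q e" using Pq[of "tail E e" e] e qp[OF e(1)] by (simp add: projection_def)
      then have "q e \<otimes> q f = (q e \<otimes> ?P (tail E e)) \<otimes> (?P (tail E f) \<otimes> q f)"
        using Pq[of "tail E f" f] e by simp
      also have "\<dots> = q e \<otimes> (?P (tail E e) \<otimes> ?P (tail E f)) \<otimes> q f" using e by (simp add: m_assoc)
      also have "\<dots> = \<zero>" using PQ[OF _ _ False] e by simp
      finally show ?thesis .
    qed
    have "?T e \<otimes> q e = ?T e"
      using arg_cong[OF STS[OF e(1)], of "star A"] e by (simp add: q_def star_mult m_assoc)
    moreover have "q f \<otimes> ?S f = ?S f" using STS[OF e(2)] by (simp add: q_def)
    ultimately have "?T e \<otimes> ?S f = (?T e \<otimes> q e) \<otimes> (q f \<otimes> ?S f)" by simp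
    also have "\<dots> = ?T e \<otimes> (q e \<otimes> q f) \<otimes> ?S f" using e by (simp add: m_assoc)
    finally show ?thesis using qqz e by simp
  qed
  have TP: "?T e \<otimes> ?P (tail E e) = ?T e" "?P (head E e) \<otimes> ?T e = ?T e" if e: "e \<in> arcs E" for e
    using arg_cong[OF PS[OF e], of "star A"] arg_cong[OF SP[OF e], of "star A"] e by (simp_all add: star_mult)
  show ?thesis
    unfolding leavitt_rels_subset singleton_iff
    using PP PQ TSz TS PS SP TP unit cl by (auto simp: minus_eq_zero_iff Psum[symmetric])
qed

end

section \<open>The universal seminorm on the diagonal\<close>

text \<open>Extends statements about finitely supported functions to all functions on paths: a
  function may be cut off outside the finite set that matters at \<open>y\<close>.\<close>

lemma op_finite_dependence:
  assumes "f \<in> carrier (free_alg bar E)"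
  shows "\<exists>S. finite S \<and> (\<forall>\<xi> \<eta>. (\<forall>x\<in>S. \<xi> x = \<eta> x) \<longrightarrow> op E f \<xi> y = op E f \<eta> y)"
  using assms
proof (induction arbitrary: y rule: free_induct)
  case (const c)
  show ?case by (rule exI[of _ "{y}"]) (simp add: op_const)
next
  case (delta g)
  show ?case
  proof (rule exI[of _ "{y, stl y} \<union> (case g of GSstar e \<Rightarrow> {e ## y} | _ \<Rightarrow> {})"], intro conjI allI impI)
    fix \<xi> \<eta> :: "'b stream \<Rightarrow> 'c"
    assume "\<forall>x\<in>{y, stl y} \<union> (case g of GSstar e \<Rightarrow> {e ## y} | _ \<Rightarrow> {}). \<xi> x = \<eta> x"
    then show "op E (delta [g]) \<xi> y = op E (delta [g]) \<eta> y" by (cases g) (simp_all add: op_delta)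
  qed (simp split: gen.split)
next
  case (add f g)
  from add.IH(1)[of y] obtain S where S: "finite S" "\<forall>\<xi> \<eta>. (\<forall>x\<in>S. \<xi> x = \<eta> x) \<longrightarrow> op E f \<xi> y = op E f \<eta> y" by blast
  from add.IH(2)[of y] obtain T where T: "finite T" "\<forall>\<xi> \<eta>. (\<forall>x\<in>T. \<xi> x = \<eta> x) \<longrightarrow> op E g \<xi> y = op E g \<eta> y" by blast
  show ?case
  proof (rule exI[of _ "S \<union> T"], intro conjI allI impI)
    fix \<xi> \<eta> :: "'b stream \<Rightarrow> 'c" assume "\<forall>x\<in>S \<union> T. \<xi> x = \<eta> x"
    then have "op E f \<xi> y = op E f \<eta> y" "op E g \<xi> y = op E g \<eta> y" using S(2) T(2) by blast+
    then show "op E (\<lambda>w. f w + g w) \<xi> y = op E (\<lambda>w. f w + g w) \<eta> y"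
      using op_add[OF free_finite[OF add(1)] free_finite[OF add(2)]] by simp
  qed (use S(1) T(1) in simp)
next
  case (mult f g)
  from mult.IH(1)[of y] obtain S where S: "finite S" "\<forall>\<xi> \<eta>. (\<forall>x\<in>S. \<xi> x = \<eta> x) \<longrightarrow> op E f \<xi> y = op E f \<eta> y" by blast
  have "\<forall>x. \<exists>T. finite T \<and> (\<forall>\<xi> \<eta>. (\<forall>z\<in>T. \<xi> z = \<eta> z) \<longrightarrow> op E g \<xi> x = op E g \<eta> x)" using mult.IH(2) by blast
  then obtain T where T: "\<forall>x. finite (T x) \<and> (\<forall>\<xi> \<eta>. (\<forall>z\<in>T x. \<xi> z = \<eta> z) \<longrightarrow> op E g \<xi> x = op E g \<eta> x)"
    using choice[of "\<lambda>x T. finite T \<and> (\<forall>\<xi> \<eta>. (\<forall>z\<in>T. \<xi> z = \<eta> z) \<longrightarrow> op E g \<xi> x = op E g \<eta> x)"] by blast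
  show ?case
  proof (rule exI[of _ "\<Union>x\<in>S. T x"], intro conjI allI impI)
    fix \<xi> \<eta> :: "'b stream \<Rightarrow> 'c" assume e: "\<forall>x\<in>(\<Union>x\<in>S. T x). \<xi> x = \<eta> x"
    have "\<forall>x\<in>S. op E g \<xi> x = op E g \<eta> x"
    proof
      fix x assume "x \<in> S"
      then have "\<forall>z\<in>T x. \<xi> z = \<eta> z" using e by blast
      then show "op E g \<xi> x = op E g \<eta> x" using T by blast
    qed
    then have "op E f (op E g \<xi>) y = op E f (op E g \<eta>) y" using S(2) by blast
    then show "op E (conv f g) \<xi> y = op E (conv f g) \<eta> y"
      by (simp only: op_conv[OF free_finite[OF mult(1)] free_finite[OF mult(2)]])
  qed (use S(1) T in blast)
qed

lemma (in leavitt_alg) ck_rels: "ck_rels A E \<subseteq> {\<zero>}"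
  unfolding ck_rels_subset singleton_iff
  using sum_closed by (auto simp: minus_eq_zero_iff sum_vproj vproj_orth vproj_expand[symmetric] m_assoc)

lemma (in leavitt_coding) itinerary_onto:
  "(v, es) \<in> paths E \<Longrightarrow> \<exists>x\<in>infpaths E. itinerary x \<in> cyl E (v, es)"
proof (induction es arbitrary: v)
  case Nil
  then obtain x where "x \<in> infpaths E" "src E x = v" using ex_infpath[of v] by auto
  then show ?case by (intro bexI[of _ x]) (simp_all add: cyl_def itinerary_infpaths src_itinerary)
next
  case (Cons e es)
  have e: "(head E e, es) \<in> paths E" using Cons.prems by simp
  from Cons.IH[OF e] obtain x where x: "x \<in> infpaths E" "itinerary x \<in> cyl E (head E e, es)" by blast
  then have "src E x = head E e" using src_itinerary[OF x(1)] by (simp add: cyl_def)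
  then have "Umap (e ## x) \<in> {x \<in> infpaths E. itinerary x \<in> cyl E (v, e # es)}"
    unfolding itinerary_vimage_Cons[OF Cons.prems] using x by blast
  then show ?case by blast
qed

text \<open>With \<open>cmod w = cos s\<close> and \<open>t\<close> the argument of
  \<open>w\<close>, the unit numbers \<open>cis (t + s)\<close> and \<open>cis (t - s)\<close> lie
  symmetrically about the direction of \<open>w\<close>.\<close>

lemma average_of_unimodular:
  assumes "cmod w \<le> 1"
  obtains a b where "cmod a = 1" "cmod b = 1" "w = (a + b) / 2"
proof -
  define t where "t = Arg w"
  have w: "w = of_real (cmod w) * cis t"
    using rcis_cmod_Arg[of w] by (simp add: t_def rcis_def)
  define s where "s = arccos (cmod w)"
  have s: "cos s = cmod w" unfolding s_def using assms by (intro cos_arccos) (auto intro: order_trans[of _ 0])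
  have "(cis (t + s) + cis (t - s)) / 2 = of_real (cos s) * cis t"
    by (simp add: complex_eq_iff cos_add cos_diff sin_add sin_diff)
  then show thesis using that[of "cis (t + s)" "cis (t - s)"] w s by simp
qed

context cstar_graph
begin

definition nullI :: "(('v, 'e) gen list \<Rightarrow> complex) set" where
  "nullI = {x \<in> carrier FC. unorm x = 0}"

lemma scale_eq_mult: "(\<lambda>w. c * x w) = const c \<otimes>\<^bsub>FC\<^esub> x"
  by (simp add: free_simps(1) conv_const_left)

lemma unorm_const: "x \<in> carrier FC \<Longrightarrow> unorm (const c \<otimes>\<^bsub>FC\<^esub> x) = cmod c * unorm x"
  using unorm_scale[of x c] by (simp only: scale_eq_mult)

lemma unorm_zero: "unorm \<zero>\<^bsub>FC\<^esub> = 0"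
  using unorm_scale[OF FC.zero_closed, of 0] by (simp add: free_simps(3))

lemma nullI_ideal: "ideal nullI FC"
proof (rule FC.ideal_intro)
  show "nullI \<subseteq> carrier FC" by (auto simp: nullI_def)
  show "\<zero>\<^bsub>FC\<^esub> \<in> nullI" by (simp add: nullI_def unorm_zero)
next
  fix a b assume "a \<in> nullI" "b \<in> nullI"
  then show "a \<oplus>\<^bsub>FC\<^esub> b \<in> nullI" using unorm_add[of a b] unorm_nonneg[of "a \<oplus>\<^bsub>FC\<^esub> b"] by (simp add: nullI_def)
next
  fix a x assume "a \<in> nullI" "x \<in> carrier FC"
  then show "x \<otimes>\<^bsub>FC\<^esub> a \<in> nullI" "a \<otimes>\<^bsub>FC\<^esub> x \<in> nullI"
    using unorm_mult[of x a] unorm_nonneg[of "x \<otimes>\<^bsub>FC\<^esub> a"] unorm_mult[of a x] unorm_nonneg[of "a \<otimes>\<^bsub>FC\<^esub> x"]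
    by (simp_all add: nullI_def)
qed

lemma star_nullI: "x \<in> nullI \<Longrightarrow> star FC x \<in> nullI"
  by (simp add: nullI_def unorm_star)

sublocale nq: star_quotient E FC nullI
proof -
  interpret ideal nullI FC by (rule nullI_ideal)
  show "star_quotient E FC nullI" by unfold_locales (rule star_nullI)
qed

lemma nq_unorm: "x \<in> carrier FC \<Longrightarrow> y \<in> carrier FC \<Longrightarrow> nq.q x = nq.q y \<Longrightarrow> unorm x = unorm y"
  using unorm_eq[of x y] nq.q_eq_iff[of x y] unfolding nullI_def by blast

definition qnorm :: "(('v, 'e) gen list \<Rightarrow> complex) set \<Rightarrow> real" where
  "qnorm X = unorm (SOME x. x \<in> carrier FC \<and> X = nq.q x)"

lemma qnorm_q: "x \<in> carrier FC \<Longrightarrow> qnorm (nq.q x) = unorm x"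
proof -
  assume x: "x \<in> carrier FC"
  have "\<exists>y. y \<in> carrier FC \<and> nq.q x = nq.q y" using x by blast
  from someI_ex[OF this] have *: "(SOME y. y \<in> carrier FC \<and> nq.q x = nq.q y) \<in> carrier FC"
    "nq.q x = nq.q (SOME y. y \<in> carrier FC \<and> nq.q x = nq.q y)" by blast+
  show ?thesis unfolding qnorm_def by (rule nq_unorm[OF *(1) x *(2)[symmetric]])
qed

lemma const_mult: "const (a * b) = const a \<otimes>\<^bsub>FC\<^esub> const b" for a b :: complex
  by (auto simp: free_simps(1) conv_const_left) (auto simp: const_def)

lemma const_comm: "x \<otimes>\<^bsub>FC\<^esub> const c = const c \<otimes>\<^bsub>FC\<^esub> x" for c :: complex
  by (simp add: free_simps(1) conv_const_left conv_const_right)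

lemma const_add: "const (a + b) = const a \<oplus>\<^bsub>FC\<^esub> const b" for a b :: complex
  by (auto simp: free_simps(4) const_def)

lemma const_one: "const 1 = \<one>\<^bsub>FC\<^esub>"
  by (simp add: free_simps(2))

lemma quotient_cstar_norm: "cstar_norm E nq.Qt qnorm (\<lambda>r. nq.q (const (of_real r)))"
proof unfold_locales
  fix X Y assume "X \<in> carrier nq.Qt" "Y \<in> carrier nq.Qt"
  then obtain x y where xy: "x \<in> carrier FC" "y \<in> carrier FC" "X = nq.q x" "Y = nq.q y"
    by (metis nq.quot_carrier)
  show "qnorm (X \<oplus>\<^bsub>nq.Qt\<^esub> Y) \<le> qnorm X + qnorm Y"
    using xy unorm_add by (simp add: nq.qh.hom_add[symmetric] qnorm_q del: nq.qh.hom_add)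
  show "qnorm (X \<otimes>\<^bsub>nq.Qt\<^esub> Y) \<le> qnorm X * qnorm Y"
    using xy unorm_mult by (simp add: nq.qh.hom_mult[symmetric] qnorm_q del: nq.qh.hom_mult)
next
  fix X assume "X \<in> carrier nq.Qt"
  then obtain x where x: "x \<in> carrier FC" "X = nq.q x" by (metis nq.quot_carrier)
  show "qnorm X \<ge> 0" using x unorm_nonneg by (simp add: qnorm_q)
  have "qnorm (nq.q (star FC x \<otimes>\<^bsub>FC\<^esub> x)) = (unorm x)\<^sup>2"
    using x unorm_cstar by (simp add: qnorm_q del: nq.qh.hom_mult)
  then show "qnorm (star nq.Qt X \<otimes>\<^bsub>nq.Qt\<^esub> X) = (qnorm X)\<^sup>2"
    using x by (simp add: qnorm_q nq.qh.hom_star)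
  have qz: "nq.q x = \<zero>\<^bsub>nq.Qt\<^esub> \<longleftrightarrow> x \<in> nullI" by (rule nq.q_eq_zero[OF x(1)])
  have "unorm x = 0 \<Longrightarrow> x \<in> nullI" using x(1) unfolding nullI_def by blast
  then show "qnorm X = 0 \<Longrightarrow> X = \<zero>\<^bsub>nq.Qt\<^esub>"
    unfolding x(2) qnorm_q[OF x(1)] qz .
  fix r :: real
  have "qnorm (nq.q (const (of_real r) \<otimes>\<^bsub>FC\<^esub> x)) = \<bar>r\<bar> * unorm x"
    using x unorm_const by (simp add: qnorm_q del: nq.qh.hom_mult)
  then show "qnorm (nq.q (const (of_real r)) \<otimes>\<^bsub>nq.Qt\<^esub> X) = \<bar>r\<bar> * qnorm X"
    using x by (simp add: qnorm_q)
  have "nq.q (x \<otimes>\<^bsub>FC\<^esub> const (of_real r)) = nq.q (const (of_real r) \<otimes>\<^bsub>FC\<^esub> x)" by (simp only: const_comm)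
  then show "X \<otimes>\<^bsub>nq.Qt\<^esub> nq.q (const (of_real r)) = nq.q (const (of_real r)) \<otimes>\<^bsub>nq.Qt\<^esub> X"
    using x by simp
next
  fix a b r :: real
  show "nq.q (const (of_real r)) \<in> carrier nq.Qt" by (rule nq.q_closed) simp
  show "nq.q (const (of_real (a + b))) = nq.q (const (of_real a)) \<oplus>\<^bsub>nq.Qt\<^esub> nq.q (const (of_real b))"
    by (simp add: const_add)
  show "nq.q (const (of_real (a * b))) = nq.q (const (of_real a)) \<otimes>\<^bsub>nq.Qt\<^esub> nq.q (const (of_real b))"
    by (simp add: const_mult)
  show "nq.q (const (of_real 1)) = \<one>\<^bsub>nq.Qt\<^esub>" by (simp add: const_one)
  have "star FC (const (of_real r)) = const (of_real r)" by (simp only: cnj_conj.star_const complex_cnj_complex_of_real)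
  then show "star nq.Qt (nq.q (const (of_real r))) = nq.q (const (of_real r))"
    using nq.qh.hom_star[of "const (of_real r)"] by simp
qed

text \<open>By definition only the C*-relations have seminorm 0. In the quotient by null elements
  the norm is faithful, so \<open>ck_imp_leavitt\<close> applies there and its conclusion is pulled
  back.\<close>

lemma leavitt_rels_nullI: "leavitt_rels FC E \<subseteq> nullI"
proof -
  interpret Q: cstar_norm E nq.Qt qnorm "\<lambda>r. nq.q (const (of_real r))" by (rule quotient_cstar_norm)
  have "nq.q x = \<zero>\<^bsub>nq.Qt\<^esub>" if "x \<in> ck_rels FC E" for x
  proof -
    have x: "x \<in> carrier FC" using ck_rels_ker that by (auto simp: cnj_conj.op_ker_def)
    have "x \<in> nullI" using x unorm_rels[OF that] unfolding nullI_def by blast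
    then show ?thesis unfolding nq.q_eq_zero[OF x] .
  qed
  then have "ck_rels FC E \<subseteq> {x. nq.q x \<in> {\<zero>\<^bsub>nq.Qt\<^esub>}}" by blast
  then have "ck_rels nq.Qt E \<subseteq> {\<zero>\<^bsub>nq.Qt\<^esub>}" by (simp only: nq.qh.ck_rels_vimage)
  then have "leavitt_rels nq.Qt E \<subseteq> {\<zero>\<^bsub>nq.Qt\<^esub>}" by (rule Q.ck_imp_leavitt[OF fin_digraph_axioms])
  then have L: "leavitt_rels FC E \<subseteq> {x. nq.q x \<in> {\<zero>\<^bsub>nq.Qt\<^esub>}}" by (simp only: nq.qh.leavitt_rels_vimage)
  show ?thesis
  proof
    fix x assume x: "x \<in> leavitt_rels FC E"
    have "x \<in> carrier FC" using cnj_conj.op_ker_rels[OF path_graph_E] x by (auto simp: cnj_conj.op_ker_def)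
    then have "nq.q x = \<zero>\<^bsub>nq.Qt\<^esub> \<longleftrightarrow> x \<in> nullI" by (rule nq.q_eq_zero)
    then show "x \<in> nullI" using subsetD[OF L x] by blast
  qed
qed

lemma nrm_eq_zero: "finite {x. \<xi> x \<noteq> 0} \<Longrightarrow> nrm \<xi> \<le> 0 \<Longrightarrow> \<xi> x = 0"
proof (rule ccontr)
  assume f: "finite {x. \<xi> x \<noteq> 0}" "nrm \<xi> \<le> 0" "\<xi> x \<noteq> 0"
  then have "cmod (\<xi> x) \<le> nrm \<xi>" unfolding nrm_def by (intro member_le_L2_set) auto
  moreover have "cmod (\<xi> x) > 0" using f(3) by simp
  ultimately show False using f(2) by linarith
qed

text \<open>The universal seminorm dominates the operator norm, so null elements act as zero on
  finitely supported functions, and by finite dependence on all functions.\<close>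

lemma nullI_op_ker: "nullI \<subseteq> cnj_conj.op_ker E"
proof
  fix f assume f: "f \<in> nullI"
  then have fc: "f \<in> carrier FC" and 0: "unorm f = 0" unfolding nullI_def by blast+
  have "opnorm f \<le> 0" using unorm_upper[OF opnorm_seminorm fc] 0 by simp
  then have fin: "op E f \<xi> x = 0" if "\<xi> \<in> finfun E" for \<xi> x
  proof -
    have "nrm (op E f \<xi>) \<le> opnorm f * nrm \<xi>" by (rule opnorm_bound[OF fc that])
    also have "\<dots> \<le> 0" using \<open>opnorm f \<le> 0\<close> by (intro mult_nonpos_nonneg) auto
    finally show ?thesis by (rule nrm_eq_zero[OF finfun_finite[OF op_finfun[OF fc that]]])
  qed
  have "op E f \<xi> y = 0" if xi: "\<xi> \<in> pathfun E" for \<xi> y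
  proof -
    obtain S where S: "finite S" "\<forall>\<xi> \<eta>. (\<forall>x\<in>S. \<xi> x = \<eta> x) \<longrightarrow> op E f \<xi> y = op E f \<eta> y"
      using op_finite_dependence[OF fc, of y] by blast
    define \<eta> where "\<eta> = (\<lambda>x. if x \<in> S then \<xi> x else 0)"
    have "{x. \<eta> x \<noteq> 0} \<subseteq> S" by (auto simp: \<eta>_def)
    then have "\<eta> \<in> finfun E" using xi S(1) by (auto simp: finfun_def pathfun_def \<eta>_def intro: finite_subset)
    moreover have "op E f \<xi> y = op E f \<eta> y" using S(2) by (simp add: \<eta>_def)
    ultimately show ?thesis using fin by simp
  qed
  then show "f \<in> cnj_conj.op_ker E" using fc by (simp add: cnj_conj.op_ker_def fun_eq_iff)
qed

end

locale cstar_coding = cstar_graph E + coding E J for E :: "('v, 'e) pre_digraph" and J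
begin

sublocale fc: free_coding E J cnj nullI
  by unfold_locales (use nullI_ideal star_nullI leavitt_rels_nullI nullI_op_ker in auto)

lemma phi_const_mult: "x \<in> carrier FC \<Longrightarrow> fc.phi (const c \<otimes>\<^bsub>FC\<^esub> x) = const c \<otimes>\<^bsub>FC\<^esub> fc.phi x"
  by (simp add: fc.phi_mult fc.phi_const)

text \<open>Maximality: the universal seminorm composed with \<open>phi\<close> is again a
  C*-seminorm killing the relations, because the twisted family satisfies them in the
  quotient.\<close>

lemma unorm_phi: "x \<in> carrier FC \<Longrightarrow> unorm (fc.phi x) \<le> unorm x"
proof (rule unorm_upper[of "\<lambda>x. unorm (fc.phi x)"])
  show "(\<lambda>x. unorm (fc.phi x)) \<in> cstar_seminorms E"
    unfolding seminorm_iff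
  proof (intro conjI ballI allI)
    fix x assume x: "x \<in> ck_rels FC E"
    have c: "x \<in> carrier FC" using ck_rels_ker x by (auto simp: cnj_conj.op_ker_def)
    have "nq.q (fc.phi x) \<in> ck_rels fc.twisted E" by (rule fc.ph.hom_ck_rels[OF x])
    then have "nq.q (fc.phi x) = \<zero>\<^bsub>nq.Qt\<^esub>" using fc.tw.ck_rels by auto
    then have "fc.phi x \<in> nullI" using nq.q_eq_zero[OF fc.phi_closed[OF c]] by blast
    then show "unorm (fc.phi x) = 0" unfolding nullI_def by blast
  next
    fix c :: complex and x assume x: "x \<in> carrier FC"
    then show "unorm (fc.phi (\<lambda>w. c * x w)) = cmod c * unorm (fc.phi x)"
      unfolding scale_eq_mult phi_const_mult[OF x] by (intro unorm_const) simp
  next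
    fix x assume x: "x \<in> carrier FC"
    then show "unorm (fc.phi (star FC x \<otimes>\<^bsub>FC\<^esub> x)) = (unorm (fc.phi x))\<^sup>2"
      by (simp add: fc.phi_mult fc.phi_star unorm_cstar)
  qed (simp_all add: fc.phi_mult fc.phi_add unorm_mult unorm_add unorm_nonneg)
qed

section \<open>Step functions and their norm\<close>

abbreviation "K c \<equiv> nq.q (const c)"

definition step_elt :: "(('v, 'e) gpath \<Rightarrow> complex) \<Rightarrow> nat \<Rightarrow> ('v, 'e) gen list \<Rightarrow> complex" where
  "step_elt a n = finsum FC (\<lambda>\<gamma>. const (a \<gamma>) \<otimes>\<^bsub>FC\<^esub> path_proj FC \<gamma>) (fc.lev n)"

lemma step_summand: "(\<lambda>\<gamma>. const (a \<gamma>) \<otimes>\<^bsub>FC\<^esub> path_proj FC \<gamma>) \<in> fc.lev n \<rightarrow> carrier FC"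
  using fc.lev_paths by auto

lemma step_closed [simp]: "step_elt a n \<in> carrier FC"
  unfolding step_elt_def by (rule FC.finsum_closed[OF step_summand])

lemma K_closed [simp]: "K c \<in> carrier nq.Qt"
  by (rule nq.q_closed) simp

lemma K_zero: "K 0 = \<zero>\<^bsub>nq.Qt\<^esub>"
proof -
  have "const 0 = \<zero>\<^bsub>FC\<^esub>" by (auto simp: const_def free_simps(3))
  then show ?thesis by (simp only: nq.qh.hom_zero)
qed

lemma K_mult: "K (a * b) = K a \<otimes>\<^bsub>nq.Qt\<^esub> K b"
  by (simp add: const_mult)

lemma K_comm: "X \<in> carrier nq.Qt \<Longrightarrow> X \<otimes>\<^bsub>nq.Qt\<^esub> K c = K c \<otimes>\<^bsub>nq.Qt\<^esub> X"
proof -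
  assume "X \<in> carrier nq.Qt"
  then obtain x where x: "x \<in> carrier FC" "X = nq.q x" by (metis nq.quot_carrier)
  have "nq.q (x \<otimes>\<^bsub>FC\<^esub> const c) = nq.q (const c \<otimes>\<^bsub>FC\<^esub> x)" by (simp only: const_comm)
  then show ?thesis using x by simp
qed

lemma step_q: "nq.q (step_elt a n) = (\<Oplus>\<^bsub>nq.Qt\<^esub>\<gamma>\<in>fc.lev n. K (a \<gamma>) \<otimes>\<^bsub>nq.Qt\<^esub> fc.pp \<gamma>)"
  unfolding step_elt_def nq.qh.hom_finsum[OF step_summand]
  by (intro nq.Qt.finsum_cong') (use fc.lev_paths in \<open>auto simp: nq.qh.hom_path_proj\<close>)

lemma step_pp:
  assumes "\<gamma> \<in> fc.lev n"
  shows "fc.pp \<gamma> \<otimes>\<^bsub>nq.Qt\<^esub> nq.q (step_elt a n) = K (a \<gamma>) \<otimes>\<^bsub>nq.Qt\<^esub> fc.pp \<gamma>"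
proof -
  let ?t = "\<lambda>\<delta>. K (a \<delta>) \<otimes>\<^bsub>nq.Qt\<^esub> fc.pp \<delta>"
  have t: "?t \<in> fc.lev n \<rightarrow> carrier nq.Qt" using fc.lev_paths by auto
  have "fc.pp \<gamma> \<otimes>\<^bsub>nq.Qt\<^esub> nq.q (step_elt a n) = (\<Oplus>\<^bsub>nq.Qt\<^esub>\<delta>\<in>fc.lev n. fc.pp \<gamma> \<otimes>\<^bsub>nq.Qt\<^esub> ?t \<delta>)"
    unfolding step_q using t assms fc.lev_paths by (intro nq.Qt.finsum_rdistr) auto
  also have "\<dots> = (\<Oplus>\<^bsub>nq.Qt\<^esub>\<delta>\<in>fc.lev n. if \<gamma> = \<delta> then ?t \<delta> else \<zero>\<^bsub>nq.Qt\<^esub>)"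
  proof (rule nq.Qt.finsum_cong')
    fix \<delta> assume d: "\<delta> \<in> fc.lev n"
    have c: "fc.pp \<gamma> \<in> carrier nq.Qt" "fc.pp \<delta> \<in> carrier nq.Qt" using d assms fc.lev_paths by auto
    have "fc.pp \<gamma> \<otimes>\<^bsub>nq.Qt\<^esub> ?t \<delta> = (fc.pp \<gamma> \<otimes>\<^bsub>nq.Qt\<^esub> K (a \<delta>)) \<otimes>\<^bsub>nq.Qt\<^esub> fc.pp \<delta>"
      using c by (simp add: nq.Qt.m_assoc)
    also have "\<dots> = K (a \<delta>) \<otimes>\<^bsub>nq.Qt\<^esub> (fc.pp \<gamma> \<otimes>\<^bsub>nq.Qt\<^esub> fc.pp \<delta>)"
      unfolding K_comm[OF c(1)] using c by (simp add: nq.Qt.m_assoc)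
    also have "\<dots> = (if \<gamma> = \<delta> then ?t \<delta> else \<zero>\<^bsub>nq.Qt\<^esub>)"
    proof (cases "\<gamma> = \<delta>")
      case True
      then show ?thesis using fc.pp_idem d fc.lev_paths by simp
    next
      case False
      then have "\<not> comparable \<gamma> \<delta>" using comparable_same_length[of \<gamma> \<delta>] assms d by (auto simp: fc.lev_def)
      then have "fc.pp \<gamma> \<otimes>\<^bsub>nq.Qt\<^esub> fc.pp \<delta> = \<zero>\<^bsub>nq.Qt\<^esub>" using assms d fc.lev_paths by (intro fc.pp_orth) auto
      then show ?thesis using False by simp
    qed
    finally show "fc.pp \<gamma> \<otimes>\<^bsub>nq.Qt\<^esub> ?t \<delta> = (if \<gamma> = \<delta> then ?t \<delta> else \<zero>\<^bsub>nq.Qt\<^esub>)" .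
  qed (use t in auto)
  also have "\<dots> = ?t \<gamma>" by (rule nq.Qt.add.finprod_singleton[OF assms _ t]) simp
  finally show ?thesis .
qed

lemma sum_lev: "\<exists>N. \<forall>n\<ge>N. (\<Oplus>\<^bsub>nq.Qt\<^esub>\<gamma>\<in>fc.lev n. fc.pp \<gamma>) = \<one>\<^bsub>nq.Qt\<^esub>"
proof -
  have "{\<beta> \<in> fc.lev n. cyl E \<beta> \<subseteq> infpaths E} = fc.lev n" for n using cyl_infpaths by blast
  then show ?thesis using fc.clopen_proj_eventually[OF fc.clopen_proj_one] by (simp add: fc.Q_def) blast
qed

text \<open>The phases cancel on each cylinder, so the adjoint times the element is the sum of all
  projections of level \<open>n\<close>, that is, 1.\<close>

lemma unorm_step:
  assumes one: "(\<Oplus>\<^bsub>nq.Qt\<^esub>\<gamma>\<in>fc.lev n. fc.pp \<gamma>) = \<one>\<^bsub>nq.Qt\<^esub>"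
    and a: "\<And>\<gamma>. \<gamma> \<in> fc.lev n \<Longrightarrow> cmod (a \<gamma>) = 1"
  shows "unorm (step_elt a n) \<le> 1"
proof -
  let ?U = "step_elt a n"
  have t: "(\<lambda>\<delta>. K (a \<delta>) \<otimes>\<^bsub>nq.Qt\<^esub> fc.pp \<delta>) \<in> fc.lev n \<rightarrow> carrier nq.Qt" using fc.lev_paths by auto
  have st: "star nq.Qt (nq.q ?U) = (\<Oplus>\<^bsub>nq.Qt\<^esub>\<gamma>\<in>fc.lev n. K (cnj (a \<gamma>)) \<otimes>\<^bsub>nq.Qt\<^esub> fc.pp \<gamma>)"
    unfolding step_q nq.Qt.star_finsum[OF t]
  proof (rule nq.Qt.finsum_cong')
    fix \<gamma> assume g: "\<gamma> \<in> fc.lev n"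
    have p: "fc.pp \<gamma> \<in> carrier nq.Qt" "star nq.Qt (fc.pp \<gamma>) = fc.pp \<gamma>" using g fc.lev_paths fc.star_pp by auto
    have "star nq.Qt (K (a \<gamma>)) = K (cnj (a \<gamma>))"
      using nq.qh.hom_star[of "const (a \<gamma>)"] by (simp add: cnj_conj.star_const)
    then show "star nq.Qt (K (a \<gamma>) \<otimes>\<^bsub>nq.Qt\<^esub> fc.pp \<gamma>) = K (cnj (a \<gamma>)) \<otimes>\<^bsub>nq.Qt\<^esub> fc.pp \<gamma>"
      using p by (simp add: nq.Qt.star_mult K_comm)
  qed (use fc.lev_paths in auto)
  have "star nq.Qt (nq.q ?U) \<otimes>\<^bsub>nq.Qt\<^esub> nq.q ?U =
      (\<Oplus>\<^bsub>nq.Qt\<^esub>\<gamma>\<in>fc.lev n. K (cnj (a \<gamma>)) \<otimes>\<^bsub>nq.Qt\<^esub> fc.pp \<gamma> \<otimes>\<^bsub>nq.Qt\<^esub> nq.q ?U)"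
    unfolding st by (intro nq.Qt.finsum_ldistr) (use fc.lev_paths in auto)
  also have "\<dots> = (\<Oplus>\<^bsub>nq.Qt\<^esub>\<gamma>\<in>fc.lev n. fc.pp \<gamma>)"
  proof (rule nq.Qt.finsum_cong')
    fix \<gamma> assume g: "\<gamma> \<in> fc.lev n"
    have p: "fc.pp \<gamma> \<in> carrier nq.Qt" using g fc.lev_paths by auto
    have "K (cnj (a \<gamma>)) \<otimes>\<^bsub>nq.Qt\<^esub> fc.pp \<gamma> \<otimes>\<^bsub>nq.Qt\<^esub> nq.q ?U = K (cnj (a \<gamma>)) \<otimes>\<^bsub>nq.Qt\<^esub> (K (a \<gamma>) \<otimes>\<^bsub>nq.Qt\<^esub> fc.pp \<gamma>)"
      using p by (simp add: nq.Qt.m_assoc step_pp[OF g])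
    also have "\<dots> = K (cnj (a \<gamma>) * a \<gamma>) \<otimes>\<^bsub>nq.Qt\<^esub> fc.pp \<gamma>"
      using p by (simp add: K_mult nq.Qt.m_assoc del: nq.qh.hom_mult)
    also have "cnj (a \<gamma>) * a \<gamma> = 1"
      using complex_norm_square[of "a \<gamma>"] a[OF g] by (simp add: mult.commute)
    finally show "K (cnj (a \<gamma>)) \<otimes>\<^bsub>nq.Qt\<^esub> fc.pp \<gamma> \<otimes>\<^bsub>nq.Qt\<^esub> nq.q ?U = fc.pp \<gamma>"
      using p by (simp add: const_one)
  qed (use fc.lev_paths in auto)
  finally have "nq.q (star FC ?U \<otimes>\<^bsub>FC\<^esub> ?U) = nq.q \<one>\<^bsub>FC\<^esub>" using one by (simp add: nq.qh.hom_star)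
  then have "unorm (star FC ?U \<otimes>\<^bsub>FC\<^esub> ?U) = unorm \<one>\<^bsub>FC\<^esub>" by (intro nq_unorm) auto
  then have "(unorm ?U)\<^sup>2 \<le> 1" using seminorm_one[OF unorm_seminorm] unorm_cstar[of ?U] by simp
  then show ?thesis using abs_square_le_1[of "unorm ?U"] by simp
qed

lemma step_add:
  "nq.q (step_elt (\<lambda>\<gamma>. a \<gamma> + b \<gamma>) n) = nq.q (step_elt a n) \<oplus>\<^bsub>nq.Qt\<^esub> nq.q (step_elt b n)"
proof -
  have t: "(\<lambda>\<delta>. K (a \<delta>) \<otimes>\<^bsub>nq.Qt\<^esub> fc.pp \<delta>) \<in> fc.lev n \<rightarrow> carrier nq.Qt" for a using fc.lev_paths by auto
  show ?thesis unfolding step_q nq.Qt.finsum_addf[OF t t, symmetric]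
    by (intro nq.Qt.finsum_cong') (use fc.lev_paths in \<open>auto simp: const_add nq.Qt.l_distr\<close>)
qed

lemma step_scale: "nq.q (step_elt (\<lambda>\<gamma>. c * a \<gamma>) n) = K c \<otimes>\<^bsub>nq.Qt\<^esub> nq.q (step_elt a n)"
proof -
  have t: "(\<lambda>\<delta>. K (a \<delta>) \<otimes>\<^bsub>nq.Qt\<^esub> fc.pp \<delta>) \<in> fc.lev n \<rightarrow> carrier nq.Qt" for a using fc.lev_paths by auto
  have "K c \<otimes>\<^bsub>nq.Qt\<^esub> nq.q (step_elt a n) = (\<Oplus>\<^bsub>nq.Qt\<^esub>\<gamma>\<in>fc.lev n. K c \<otimes>\<^bsub>nq.Qt\<^esub> (K (a \<gamma>) \<otimes>\<^bsub>nq.Qt\<^esub> fc.pp \<gamma>))"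
    unfolding step_q using t by (intro nq.Qt.finsum_rdistr) auto
  also have "\<dots> = nq.q (step_elt (\<lambda>\<gamma>. c * a \<gamma>) n)"
    unfolding step_q
    by (intro nq.Qt.finsum_cong') (use fc.lev_paths in \<open>auto simp: const_mult nq.Qt.m_assoc\<close>)
  finally show ?thesis by simp
qed

text \<open>From some level on the element is the step function of its multiplier. The quantifier
  over all large \<open>n\<close> lets sums be formed at a common level.\<close>

lemma cdiag_step:
  "z \<in> fc.cdiag \<Longrightarrow> \<exists>f N. fc.acts z f \<and>
    (\<forall>n\<ge>N. \<exists>a. (\<forall>\<gamma>\<in>fc.lev n. \<forall>x\<in>cyl E \<gamma>. f x = a \<gamma>) \<and> nq.q z = nq.q (step_elt a n))"
proof (induction rule: fc.cdiag_induct)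
  case zero
  have "nq.q \<zero>\<^bsub>FC\<^esub> = nq.q (step_elt (\<lambda>_. 0) n)" for n
  proof -
    have "nq.q (step_elt (\<lambda>_. 0) n) = (\<Oplus>\<^bsub>nq.Qt\<^esub>\<gamma>\<in>fc.lev n. \<zero>\<^bsub>nq.Qt\<^esub>)"
      unfolding step_q by (intro nq.Qt.finsum_cong') (use fc.lev_paths in \<open>auto simp: K_zero\<close>)
    then show ?thesis by simp
  qed
  then show ?case using fc.acts_zero by (intro exI[of _ "\<lambda>x. 0"] exI[of _ 0]) auto
next
  case (gen c \<beta>)
  let ?f = "\<lambda>x. c * of_bool (x \<in> cyl E \<beta>)"
  show ?case
  proof (intro exI conjI allI impI)
    show "fc.acts (const c \<otimes>\<^bsub>FC\<^esub> path_proj FC \<beta>) ?f"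
      using gen fc.acts_proj by (intro fc.acts_scale) auto
    fix n assume n: "length (snd \<beta>) \<le> n"
    let ?a = "\<lambda>\<gamma>. if cyl E \<gamma> \<subseteq> cyl E \<beta> then c else 0"
    show "\<forall>\<gamma>\<in>fc.lev n. \<forall>x\<in>cyl E \<gamma>. ?f x = ?a \<gamma>"
    proof (intro ballI)
      fix \<gamma> x assume g: "\<gamma> \<in> fc.lev n" and x: "x \<in> cyl E \<gamma>"
      have "cyl E \<gamma> \<subseteq> cyl E \<beta> \<or> cyl E \<gamma> \<inter> cyl E \<beta> = {}"
        using fc.saturated_cyl[OF n gen] g unfolding fc.saturated_def by blast
      then show "?f x = ?a \<gamma>" using x by auto
    qed
    have "nq.q (const c \<otimes>\<^bsub>FC\<^esub> path_proj FC \<beta>) = K c \<otimes>\<^bsub>nq.Qt\<^esub> fc.pp \<beta>"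
      using gen by (simp add: nq.qh.hom_path_proj)
    also have "\<dots> = K c \<otimes>\<^bsub>nq.Qt\<^esub> (\<Oplus>\<^bsub>nq.Qt\<^esub>\<gamma>\<in>{\<gamma> \<in> fc.lev n. cyl E \<gamma> \<subseteq> cyl E \<beta>}. fc.pp \<gamma>)"
      using fc.Q_cyl[OF gen n] by (simp add: fc.Q_def)
    also have "\<dots> = (\<Oplus>\<^bsub>nq.Qt\<^esub>\<gamma>\<in>{\<gamma> \<in> fc.lev n. cyl E \<gamma> \<subseteq> cyl E \<beta>}. K c \<otimes>\<^bsub>nq.Qt\<^esub> fc.pp \<gamma>)"
      by (intro nq.Qt.finsum_rdistr) (use fc.lev_paths in auto)
    also have "\<dots> = nq.q (step_elt ?a n)"
      unfolding step_q
      by (rule nq.Qt.add.finprod_mono_neutral_cong_left) (use fc.lev_paths in \<open>auto simp: K_zero\<close>)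
    finally show "nq.q (const c \<otimes>\<^bsub>FC\<^esub> path_proj FC \<beta>) = nq.q (step_elt ?a n)" .
  qed
next
  case (add x y)
  have c: "x \<in> carrier FC" "y \<in> carrier FC" using add(1,2) fc.cdiag_carrier by auto
  from add.IH(1) obtain f N where f: "fc.acts x f"
    "\<forall>n\<ge>N. \<exists>a. (\<forall>\<gamma>\<in>fc.lev n. \<forall>x\<in>cyl E \<gamma>. f x = a \<gamma>) \<and> nq.q x = nq.q (step_elt a n)" by blast
  from add.IH(2) obtain g M where g: "fc.acts y g"
    "\<forall>n\<ge>M. \<exists>a. (\<forall>\<gamma>\<in>fc.lev n. \<forall>x\<in>cyl E \<gamma>. g x = a \<gamma>) \<and> nq.q y = nq.q (step_elt a n)" by blast
  show ?case
  proof (rule exI[of _ "\<lambda>x. f x + g x"], rule exI[of _ "max N M"], intro conjI allI impI)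
    show "fc.acts (x \<oplus>\<^bsub>FC\<^esub> y) (\<lambda>x. f x + g x)" by (rule fc.acts_add[OF c f(1) g(1)])
    fix n assume n: "max N M \<le> n"
    then obtain a where a: "\<forall>\<gamma>\<in>fc.lev n. \<forall>x\<in>cyl E \<gamma>. f x = a \<gamma>" "nq.q x = nq.q (step_elt a n)"
      using f(2) by (metis max.bounded_iff)
    from n obtain b where b: "\<forall>\<gamma>\<in>fc.lev n. \<forall>x\<in>cyl E \<gamma>. g x = b \<gamma>" "nq.q y = nq.q (step_elt b n)"
      using g(2) by (metis max.bounded_iff)
    have "nq.q (x \<oplus>\<^bsub>FC\<^esub> y) = nq.q (step_elt (\<lambda>\<gamma>. a \<gamma> + b \<gamma>) n)"
      unfolding step_add using c a(2) b(2) by simp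
    then show "\<exists>a. (\<forall>\<gamma>\<in>fc.lev n. \<forall>x\<in>cyl E \<gamma>. f x + g x = a \<gamma>) \<and> nq.q (x \<oplus>\<^bsub>FC\<^esub> y) = nq.q (step_elt a n)"
      using a(1) b(1) by (intro exI[of _ "\<lambda>\<gamma>. a \<gamma> + b \<gamma>"]) simp
  qed
qed

text \<open>A step function with unimodular values is unitary, and one with values in the unit disc is the
  average of two such functions.\<close>

lemma unorm_cdiag_le:
  assumes z: "z \<in> fc.cdiag" and act: "fc.acts z f" and M: "M > 0"
    and f: "\<And>x. x \<in> infpaths E \<Longrightarrow> cmod (f x) \<le> M"
  shows "unorm z \<le> M"
proof -
  have zc: "z \<in> carrier FC" using z by (rule fc.cdiag_carrier)
  obtain g N where g: "fc.acts z g"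
    "\<forall>n\<ge>N. \<exists>a. (\<forall>\<gamma>\<in>fc.lev n. \<forall>x\<in>cyl E \<gamma>. g x = a \<gamma>) \<and> nq.q z = nq.q (step_elt a n)"
    using cdiag_step[OF z] by blast
  obtain N' where N': "\<forall>n\<ge>N'. (\<Oplus>\<^bsub>nq.Qt\<^esub>\<gamma>\<in>fc.lev n. fc.pp \<gamma>) = \<one>\<^bsub>nq.Qt\<^esub>" using sum_lev by blast
  define n where "n = max N N'"
  have one: "(\<Oplus>\<^bsub>nq.Qt\<^esub>\<gamma>\<in>fc.lev n. fc.pp \<gamma>) = \<one>\<^bsub>nq.Qt\<^esub>" using N' by (simp add: n_def)
  have "\<exists>a. (\<forall>\<gamma>\<in>fc.lev n. \<forall>x\<in>cyl E \<gamma>. g x = a \<gamma>) \<and> nq.q z = nq.q (step_elt a n)"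
    using g(2) by (simp add: n_def)
  then obtain a where a: "\<forall>\<gamma>\<in>fc.lev n. \<forall>x\<in>cyl E \<gamma>. g x = a \<gamma>" "nq.q z = nq.q (step_elt a n)" by blast
  \<comment> \<open>Each value of the step function is a value of \<open>f\<close> on the path
    space, so after division by \<open>M\<close> it lies in the unit disc.\<close>
  have "\<exists>b c. cmod b = 1 \<and> cmod c = 1 \<and> a \<gamma> = of_real (M / 2) * (b + c)" if g': "\<gamma> \<in> fc.lev n" for \<gamma>
  proof -
    obtain x where x: "x \<in> cyl E \<gamma>" using fc.cyl_not_empty[OF fc.lev_paths[OF g']] by blast
    then have "a \<gamma> = g x" using a(1) g' by simp
    also have "\<dots> = f x" by (rule fc.acts_unique[OF g(1) act cyl_infpaths[OF x]])
    finally have "cmod (a \<gamma>) \<le> M" using f[OF cyl_infpaths[OF x]] by simp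
    then have "cmod (a \<gamma> / M) \<le> 1" using M by (simp add: norm_divide)
    then obtain b c where "cmod b = 1" "cmod c = 1" "a \<gamma> / M = (b + c) / 2" by (rule average_of_unimodular)
    then show ?thesis using M by (intro exI[of _ b] exI[of _ c]) (simp add: field_simps)
  qed
  then obtain b c where bc: "\<And>\<gamma>. \<gamma> \<in> fc.lev n \<Longrightarrow> cmod (b \<gamma>) = 1 \<and> cmod (c \<gamma>) = 1 \<and> a \<gamma> = of_real (M / 2) * (b \<gamma> + c \<gamma>)"
    by metis
  have "step_elt a n = step_elt (\<lambda>\<gamma>. of_real (M / 2) * (b \<gamma> + c \<gamma>)) n"
    unfolding step_elt_def
  proof (rule FC.finsum_cong')
    fix \<gamma> assume "\<gamma> \<in> fc.lev n"
    then have "a \<gamma> = of_real (M / 2) * (b \<gamma> + c \<gamma>)" using bc by blast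
    then show "const (a \<gamma>) \<otimes>\<^bsub>FC\<^esub> path_proj FC \<gamma> = const (of_real (M / 2) * (b \<gamma> + c \<gamma>)) \<otimes>\<^bsub>FC\<^esub> path_proj FC \<gamma>"
      by (rule arg_cong)
  qed (use step_summand in auto)
  then have "nq.q z = nq.q (const (of_real (M / 2)) \<otimes>\<^bsub>FC\<^esub> (step_elt b n \<oplus>\<^bsub>FC\<^esub> step_elt c n))"
    using a(2) by (simp only: step_scale step_add) simp
  then have "unorm z = unorm (const (of_real (M / 2)) \<otimes>\<^bsub>FC\<^esub> (step_elt b n \<oplus>\<^bsub>FC\<^esub> step_elt c n))"
    using zc by (intro nq_unorm) auto
  also have "\<dots> = cmod (of_real (M / 2)) * unorm (step_elt b n \<oplus>\<^bsub>FC\<^esub> step_elt c n)" by (rule unorm_const) simp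
  also have "\<dots> \<le> cmod (of_real (M / 2)) * (1 + 1)"
    using unorm_step[OF one, of b] unorm_step[OF one, of c] bc unorm_add[of "step_elt b n" "step_elt c n"]
    by (intro mult_left_mono) auto
  also have "\<dots> = M" using M by (simp add: norm_divide)
  finally show ?thesis .
qed

text \<open>Itineraries enter every cylinder and \<open>f\<close> is locally constant, so every
  value of \<open>f\<close> is a value of the multiplier of \<open>phi z\<close> and is bounded by
  its norm. The values of \<open>f\<close> in turn bound the norm of \<open>z\<close>.\<close>

lemma unorm_cdiag_phi:
  assumes z: "z \<in> fc.cdiag" shows "unorm z = unorm (fc.phi z)"
proof (rule antisym)
  have zc: "z \<in> carrier FC" using z by (rule fc.cdiag_carrier)
  then show "unorm (fc.phi z) \<le> unorm z" by (rule unorm_phi)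
  obtain f N where f: "fc.local_fun N f" "fc.acts z f" "fc.acts (fc.phi z) (\<lambda>x. f (itinerary x))"
    using fc.cdiag_function[OF z] by blast
  have bd: "cmod (f x) \<le> unorm (fc.phi z)" if x: "x \<in> infpaths E" for x
  proof -
    obtain y where y: "y \<in> infpaths E" "itinerary y \<in> cyl E (src E x, stake N x)"
      using fc.itinerary_onto[OF stake_path[OF x]] by blast
    have "f x = f (itinerary y)"
    proof -
      have i: "itinerary y \<in> infpaths E" by (rule itinerary_infpaths[OF y(1)])
      have "src E x = src E (itinerary y)" "stake N x = stake N (itinerary y)"
        using y(2) by (simp_all add: cyl_def)
      then show ?thesis using f(1)[unfolded fc.local_fun_def, THEN bspec, OF x, THEN bspec, OF i] by blast
    qed
    also have "cmod \<dots> \<le> opnorm (fc.phi z)"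
      using opnorm_point[of "fc.phi z" y "\<lambda>x. f (itinerary x)"] zc y(1) f(3) by (simp add: fc.acts_def)
    also have "\<dots> \<le> unorm (fc.phi z)" using zc by (intro unorm_upper[OF opnorm_seminorm]) simp
    finally show ?thesis .
  qed
  show "unorm z \<le> unorm (fc.phi z)"
  \<comment> \<open>The bound in \<open>unorm_cdiag_le\<close> has to be strictly positive, hence
    the extra \<open>e\<close>.\<close>
  proof (rule field_le_epsilon)
    fix e :: real assume e: "e > 0"
    show "unorm z \<le> unorm (fc.phi z) + e"
    proof (rule unorm_cdiag_le[OF z f(2)])
      show "unorm (fc.phi z) + e > 0" using unorm_nonneg[of "fc.phi z"] zc e by simp
      show "cmod (f x) \<le> unorm (fc.phi z) + e" if "x \<in> infpaths E" for x using bd[OF that] e by simp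
    qed
  qed
qed

end

section \<open>The graph C*-algebra\<close>

context cstar_graph
begin

section \<open>Cauchy sequences over the free algebra\<close>

abbreviation "BC \<equiv> cauchy_alg E"

lemma bc_simps:
  "mult BC x y = (\<lambda>n. x n \<otimes>\<^bsub>FC\<^esub> y n)" "one BC = (\<lambda>n. \<one>\<^bsub>FC\<^esub>)" "zero BC = (\<lambda>n. \<zero>\<^bsub>FC\<^esub>)"
  "add BC x y = (\<lambda>n. x n \<oplus>\<^bsub>FC\<^esub> y n)" "star BC x = (\<lambda>n. star FC (x n))"
  "vproj BC v = (\<lambda>n. vproj FC v)" "eiso BC e = (\<lambda>n. eiso FC e)"
  by (simp_all add: cauchy_alg_def Let_def)

lemma bc_carrier: "x \<in> carrier BC \<longleftrightarrow> (\<forall>n. x n \<in> carrier FC) \<and>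
    (\<forall>\<epsilon>>0. \<exists>N. \<forall>m\<ge>N. \<forall>n\<ge>N. unorm (x m \<ominus>\<^bsub>FC\<^esub> x n) < \<epsilon>)"
  by (simp add: cauchy_alg_def Let_def)

lemma bc_closed: "x \<in> carrier BC \<Longrightarrow> x n \<in> carrier FC"
  by (simp add: bc_carrier)

lemma bc_eventually:
  "x \<in> carrier BC \<Longrightarrow> \<epsilon> > 0 \<Longrightarrow> \<exists>N. \<forall>m\<ge>N. \<forall>n\<ge>N. unorm (x m \<ominus>\<^bsub>FC\<^esub> x n) < \<epsilon>"
  unfolding bc_carrier by blast

lemma unorm_self: "x \<in> carrier FC \<Longrightarrow> unorm (x \<ominus>\<^bsub>FC\<^esub> x) = 0"
  by (simp add: FC.r_neg a_minus_def unorm_zero)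

text \<open>Sums, products, adjoints and images under \<open>phi\<close> vary at most proportionally
  to the given sequences; this test handles them together.\<close>

lemma bcI:
  assumes y: "\<And>n. y n \<in> carrier FC" and AB: "A \<ge> 0" "B \<ge> 0"
    and x: "x \<in> carrier BC" "x' \<in> carrier BC"
    and le: "\<And>m n. unorm (y m \<ominus>\<^bsub>FC\<^esub> y n) \<le> A * unorm (x m \<ominus>\<^bsub>FC\<^esub> x n) + B * unorm (x' m \<ominus>\<^bsub>FC\<^esub> x' n)"
  shows "y \<in> carrier BC"
  unfolding bc_carrier
proof (intro conjI allI impI y)
  fix \<epsilon> :: real assume e: "\<epsilon> > 0"
  \<comment> \<open>The 1 in the denominator keeps it positive when \<open>A\<close> and
    \<open>B\<close> vanish and makes the final inequality strict.\<close>
  define \<delta> where "\<delta> = \<epsilon> / (A + B + 1)"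
  have d: "\<delta> > 0" using e AB by (simp add: \<delta>_def)
  obtain N where N: "\<forall>m\<ge>N. \<forall>n\<ge>N. unorm (x m \<ominus>\<^bsub>FC\<^esub> x n) < \<delta>" using bc_eventually[OF x(1) d] by blast
  obtain M where M: "\<forall>m\<ge>M. \<forall>n\<ge>M. unorm (x' m \<ominus>\<^bsub>FC\<^esub> x' n) < \<delta>" using bc_eventually[OF x(2) d] by blast
  have "unorm (y m \<ominus>\<^bsub>FC\<^esub> y n) < \<epsilon>" if "m \<ge> max N M" "n \<ge> max N M" for m n
  proof -
    have "unorm (x m \<ominus>\<^bsub>FC\<^esub> x n) \<le> \<delta>" "unorm (x' m \<ominus>\<^bsub>FC\<^esub> x' n) \<le> \<delta>" using N M that by (simp_all add: less_imp_le)
    then have "A * unorm (x m \<ominus>\<^bsub>FC\<^esub> x n) + B * unorm (x' m \<ominus>\<^bsub>FC\<^esub> x' n) \<le> A * \<delta> + B * \<delta>"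
      using AB by (intro add_mono mult_left_mono) auto
    also have "\<dots> < (A + B + 1) * \<delta>" using d by (simp add: algebra_simps)
    also have "\<dots> = \<epsilon>" using AB by (simp add: \<delta>_def)
    finally show ?thesis using le[of m n] by linarith
  qed
  then show "\<exists>N. \<forall>m\<ge>N. \<forall>n\<ge>N. unorm (y m \<ominus>\<^bsub>FC\<^esub> y n) < \<epsilon>" by blast
qed

lemma bcI1:
  assumes "\<And>n. y n \<in> carrier FC" "x \<in> carrier BC"
    and "\<And>m n. unorm (y m \<ominus>\<^bsub>FC\<^esub> y n) \<le> unorm (x m \<ominus>\<^bsub>FC\<^esub> x n)"
  shows "y \<in> carrier BC"
  by (rule bcI[where A = 1 and B = 0 and x = x and x' = x]) (use assms in auto)

lemma bc_const: "x \<in> carrier FC \<Longrightarrow> (\<lambda>_. x) \<in> carrier BC"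
  by (simp add: bc_carrier unorm_self)

lemma unorm_convergent:
  assumes x: "x \<in> carrier BC" shows "convergent (\<lambda>n. unorm (x n))"
proof (rule real_Cauchy_convergent, rule CauchyI)
  fix \<epsilon> :: real assume "\<epsilon> > 0"
  then obtain N where N: "\<forall>m\<ge>N. \<forall>n\<ge>N. unorm (x m \<ominus>\<^bsub>FC\<^esub> x n) < \<epsilon>" using bc_eventually[OF x] by blast
  have "norm (unorm (x m) - unorm (x n)) < \<epsilon>" if "m \<ge> N" "n \<ge> N" for m n
  proof -
    have c: "x m \<in> carrier FC" "x n \<in> carrier FC" using bc_closed[OF x] by blast+
    have "unorm (x m) \<le> unorm (x m \<ominus>\<^bsub>FC\<^esub> x n) + unorm (x n)" by (rule unorm_minus(2)[OF c])
    moreover have "unorm (x n) \<le> unorm (x n \<ominus>\<^bsub>FC\<^esub> x m) + unorm (x m)" by (rule unorm_minus(2)[OF c(2,1)])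
    moreover have "unorm (x m \<ominus>\<^bsub>FC\<^esub> x n) < \<epsilon>" "unorm (x n \<ominus>\<^bsub>FC\<^esub> x m) < \<epsilon>" using N that by blast+
    ultimately show ?thesis by (simp add: abs_less_iff)
  qed
  then show "\<exists>M. \<forall>m\<ge>M. \<forall>n\<ge>M. norm (unorm (x m) - unorm (x n)) < \<epsilon>" by blast
qed

lemma bc_bounded:
  assumes x: "x \<in> carrier BC" obtains M where "M \<ge> 0" "\<And>n. unorm (x n) \<le> M"
proof -
  have "Bseq (\<lambda>n. unorm (x n))" by (rule convergent_imp_Bseq[OF unorm_convergent[OF x]])
  then obtain M where M: "M > 0" "\<forall>n. norm (unorm (x n)) \<le> M" by (rule BseqE)
  have "unorm (x n) \<le> M" for n using M(2)[rule_format, of n] by simp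
  then show thesis using that[of M] M(1) by simp
qed

lemma unorm_diff_add:
  assumes "a \<in> carrier FC" "b \<in> carrier FC" "c \<in> carrier FC" "d \<in> carrier FC"
  shows "unorm ((a \<oplus>\<^bsub>FC\<^esub> b) \<ominus>\<^bsub>FC\<^esub> (c \<oplus>\<^bsub>FC\<^esub> d)) \<le> unorm (a \<ominus>\<^bsub>FC\<^esub> c) + unorm (b \<ominus>\<^bsub>FC\<^esub> d)"
proof -
  have "(a \<oplus>\<^bsub>FC\<^esub> b) \<ominus>\<^bsub>FC\<^esub> (c \<oplus>\<^bsub>FC\<^esub> d) = (a \<ominus>\<^bsub>FC\<^esub> c) \<oplus>\<^bsub>FC\<^esub> (b \<ominus>\<^bsub>FC\<^esub> d)"
    using assms by (simp add: a_minus_def FC.minus_add FC.a_ac)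
  then show ?thesis using assms unorm_add[of "a \<ominus>\<^bsub>FC\<^esub> c" "b \<ominus>\<^bsub>FC\<^esub> d"] by simp
qed

text \<open>Telescoping: the difference of the products is
  \<open>(a - c) d + a (b - d)\<close>.\<close>

lemma unorm_diff_mult:
  assumes c: "a \<in> carrier FC" "b \<in> carrier FC" "c \<in> carrier FC" "d \<in> carrier FC"
    and M: "unorm a \<le> M" "unorm d \<le> K"
  shows "unorm ((a \<otimes>\<^bsub>FC\<^esub> b) \<ominus>\<^bsub>FC\<^esub> (c \<otimes>\<^bsub>FC\<^esub> d)) \<le> K * unorm (a \<ominus>\<^bsub>FC\<^esub> c) + M * unorm (b \<ominus>\<^bsub>FC\<^esub> d)"
proof -
  have "(a \<otimes>\<^bsub>FC\<^esub> b) \<ominus>\<^bsub>FC\<^esub> (c \<otimes>\<^bsub>FC\<^esub> d) = (a \<ominus>\<^bsub>FC\<^esub> c) \<otimes>\<^bsub>FC\<^esub> d \<oplus>\<^bsub>FC\<^esub> a \<otimes>\<^bsub>FC\<^esub> (b \<ominus>\<^bsub>FC\<^esub> d)"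
  proof -
    have "(a \<ominus>\<^bsub>FC\<^esub> c) \<otimes>\<^bsub>FC\<^esub> d \<oplus>\<^bsub>FC\<^esub> a \<otimes>\<^bsub>FC\<^esub> (b \<ominus>\<^bsub>FC\<^esub> d) =
      (a \<otimes>\<^bsub>FC\<^esub> d \<oplus>\<^bsub>FC\<^esub> \<ominus>\<^bsub>FC\<^esub> (a \<otimes>\<^bsub>FC\<^esub> d)) \<oplus>\<^bsub>FC\<^esub> (a \<otimes>\<^bsub>FC\<^esub> b \<oplus>\<^bsub>FC\<^esub> \<ominus>\<^bsub>FC\<^esub> (c \<otimes>\<^bsub>FC\<^esub> d))"
      using c by (simp add: a_minus_def FC.l_distr FC.r_distr FC.l_minus FC.r_minus FC.a_ac)
    then show ?thesis using c by (simp add: FC.r_neg a_minus_def)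
  qed
  then have "unorm ((a \<otimes>\<^bsub>FC\<^esub> b) \<ominus>\<^bsub>FC\<^esub> (c \<otimes>\<^bsub>FC\<^esub> d)) \<le>
      unorm ((a \<ominus>\<^bsub>FC\<^esub> c) \<otimes>\<^bsub>FC\<^esub> d) + unorm (a \<otimes>\<^bsub>FC\<^esub> (b \<ominus>\<^bsub>FC\<^esub> d))"
    using c unorm_add[of "(a \<ominus>\<^bsub>FC\<^esub> c) \<otimes>\<^bsub>FC\<^esub> d" "a \<otimes>\<^bsub>FC\<^esub> (b \<ominus>\<^bsub>FC\<^esub> d)"] by simp
  also have "\<dots> \<le> unorm (a \<ominus>\<^bsub>FC\<^esub> c) * unorm d + unorm a * unorm (b \<ominus>\<^bsub>FC\<^esub> d)"
    using c by (intro add_mono unorm_mult) auto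
  also have "\<dots> \<le> unorm (a \<ominus>\<^bsub>FC\<^esub> c) * K + M * unorm (b \<ominus>\<^bsub>FC\<^esub> d)"
    using c M by (intro add_mono mult_left_mono mult_right_mono) (auto intro: unorm_nonneg)
  finally show ?thesis by (simp add: mult.commute)
qed

lemma bc_mult: assumes x: "x \<in> carrier BC" and y: "y \<in> carrier BC"
  shows "(\<lambda>n. x n \<otimes>\<^bsub>FC\<^esub> y n) \<in> carrier BC"
proof -
  obtain M where M: "M \<ge> 0" "\<And>n. unorm (x n) \<le> M" using bc_bounded[OF x] by blast
  obtain K where K: "K \<ge> 0" "\<And>n. unorm (y n) \<le> K" using bc_bounded[OF y] by blast
  show ?thesis
  proof (rule bcI[OF _ K(1) M(1) x y])
    show "x n \<otimes>\<^bsub>FC\<^esub> y n \<in> carrier FC" for n using bc_closed[OF x] bc_closed[OF y] by simp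
    show "unorm (x m \<otimes>\<^bsub>FC\<^esub> y m \<ominus>\<^bsub>FC\<^esub> x n \<otimes>\<^bsub>FC\<^esub> y n) \<le> K * unorm (x m \<ominus>\<^bsub>FC\<^esub> x n) + M * unorm (y m \<ominus>\<^bsub>FC\<^esub> y n)" for m n
      by (rule unorm_diff_mult) (use bc_closed[OF x] bc_closed[OF y] M K in auto)
  qed
qed

lemma bc_add: assumes x: "x \<in> carrier BC" and y: "y \<in> carrier BC"
  shows "(\<lambda>n. x n \<oplus>\<^bsub>FC\<^esub> y n) \<in> carrier BC"
proof (rule bcI[where A = 1 and B = 1, OF _ _ _ x y])
  show "unorm ((x m \<oplus>\<^bsub>FC\<^esub> y m) \<ominus>\<^bsub>FC\<^esub> (x n \<oplus>\<^bsub>FC\<^esub> y n)) \<le> 1 * unorm (x m \<ominus>\<^bsub>FC\<^esub> x n) + 1 * unorm (y m \<ominus>\<^bsub>FC\<^esub> y n)" for m n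
    using unorm_diff_add[of "x m" "y m" "x n" "y n"] bc_closed[OF x] bc_closed[OF y] by simp
qed (use bc_closed[OF x] bc_closed[OF y] in auto)

lemma bc_star: assumes x: "x \<in> carrier BC" shows "(\<lambda>n. star FC (x n)) \<in> carrier BC"
proof (rule bcI1[OF _ x])
  show "unorm (star FC (x m) \<ominus>\<^bsub>FC\<^esub> star FC (x n)) \<le> unorm (x m \<ominus>\<^bsub>FC\<^esub> x n)" for m n
    using bc_closed[OF x] unorm_star[of "x m \<ominus>\<^bsub>FC\<^esub> x n"] by (simp add: FC.star_minus)
qed (use bc_closed[OF x] in simp)

lemma bc_uminus: assumes x: "x \<in> carrier BC" shows "(\<lambda>n. \<ominus>\<^bsub>FC\<^esub> x n) \<in> carrier BC"
proof (rule bcI1[OF _ x])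
  show "unorm (\<ominus>\<^bsub>FC\<^esub> x m \<ominus>\<^bsub>FC\<^esub> \<ominus>\<^bsub>FC\<^esub> x n) \<le> unorm (x m \<ominus>\<^bsub>FC\<^esub> x n)" for m n
  proof -
    have c: "x m \<in> carrier FC" "x n \<in> carrier FC" using bc_closed[OF x] by blast+
    have "\<ominus>\<^bsub>FC\<^esub> x m \<ominus>\<^bsub>FC\<^esub> \<ominus>\<^bsub>FC\<^esub> x n = x n \<ominus>\<^bsub>FC\<^esub> x m" using c by (simp add: a_minus_def FC.a_comm)
    then show ?thesis using unorm_minus(1)[OF c] by simp
  qed
qed (use bc_closed[OF x] in simp)

lemma bc_ring: "ring BC"
proof (rule ringI)
  show "abelian_group BC"
  proof (rule abelian_groupI)
    fix x assume "x \<in> carrier BC"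
    then show "\<exists>y\<in>carrier BC. y \<oplus>\<^bsub>BC\<^esub> x = \<zero>\<^bsub>BC\<^esub>"
      using bc_uminus bc_closed by (intro bexI[of _ "\<lambda>n. \<ominus>\<^bsub>FC\<^esub> x n"]) (auto simp: bc_simps fun_eq_iff FC.l_neg)
  qed (auto simp: bc_simps bc_add bc_const bc_closed fun_eq_iff FC.a_ac)
  show "monoid BC"
    by (rule monoidI) (auto simp: bc_simps bc_mult bc_const bc_closed fun_eq_iff FC.m_assoc)
qed (auto simp: bc_simps bc_closed fun_eq_iff FC.l_distr FC.r_distr)

lemma bc_graph_star_ring: "graph_star_ring E BC"
proof -
  interpret ring BC by (rule bc_ring)
  show ?thesis
    by unfold_locales (auto simp: bc_simps bc_const bc_star bc_closed fun_eq_iff FC.star_add FC.star_mult)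
qed

sublocale BC: graph_star_ring E BC by (rule bc_graph_star_ring)

lemma bc_minus: "x \<in> carrier BC \<Longrightarrow> y \<in> carrier BC \<Longrightarrow> x \<ominus>\<^bsub>BC\<^esub> y = (\<lambda>n. x n \<ominus>\<^bsub>FC\<^esub> y n)"
proof -
  assume x: "x \<in> carrier BC" and y: "y \<in> carrier BC"
  have "\<ominus>\<^bsub>BC\<^esub> y = (\<lambda>n. \<ominus>\<^bsub>FC\<^esub> y n)"
    by (rule BC.minus_equality[OF _ y bc_uminus[OF y]])
      (use bc_closed[OF y] in \<open>simp add: bc_simps FC.l_neg\<close>)
  then show ?thesis by (simp add: a_minus_def bc_simps)
qed

abbreviation "NC \<equiv> null_seqs E"

section \<open>The quotient by null sequences and its norm\<close>

lemma null_iff: "x \<in> NC \<longleftrightarrow> x \<in> carrier BC \<and> (\<lambda>n. unorm (x n)) \<longlonglongrightarrow> 0"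
  unfolding null_seqs_def by blast

lemma nullI_le:
  assumes y: "y \<in> carrier BC" and f: "f \<longlonglongrightarrow> 0" and le: "\<And>n. unorm (y n) \<le> f n"
  shows "y \<in> NC"
  unfolding null_iff
  by (intro conjI y tendsto_sandwich[OF _ _ tendsto_const f]) (auto intro!: always_eventually le unorm_nonneg bc_closed[OF y])

lemma null_ideal: "ideal NC BC"
proof (rule BC.ideal_intro)
  show "NC \<subseteq> carrier BC" unfolding null_iff subset_iff by blast
  show "\<zero>\<^bsub>BC\<^esub> \<in> NC" unfolding null_iff by (simp add: bc_simps bc_const unorm_zero)
next
  fix a b assume a: "a \<in> NC" and b: "b \<in> NC"
  then have c: "a \<in> carrier BC" "b \<in> carrier BC" unfolding null_iff by blast+
  show "a \<oplus>\<^bsub>BC\<^esub> b \<in> NC"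
  proof (rule nullI_le)
    show "(\<lambda>n. unorm (a n) + unorm (b n)) \<longlonglongrightarrow> 0"
      using a b unfolding null_iff by (metis (no_types) add_0 tendsto_add)
  qed (use c unorm_add bc_closed in \<open>simp_all add: bc_simps bc_add\<close>)
next
  fix a x assume a: "a \<in> NC" and x: "x \<in> carrier BC"
  have c: "a \<in> carrier BC" and lim: "(\<lambda>n. unorm (a n)) \<longlonglongrightarrow> 0" using a unfolding null_iff by blast+
  obtain M where M: "M \<ge> 0" "\<And>n. unorm (x n) \<le> M" using bc_bounded[OF x] by blast
  have l: "(\<lambda>n. M * unorm (a n)) \<longlonglongrightarrow> 0" using tendsto_mult_left[OF lim, of M] by simp
  show "x \<otimes>\<^bsub>BC\<^esub> a \<in> NC"
  proof (rule nullI_le[OF _ l])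
    fix n
    have "unorm (x n \<otimes>\<^bsub>FC\<^esub> a n) \<le> unorm (x n) * unorm (a n)"
      by (rule unorm_mult[OF bc_closed[OF x] bc_closed[OF c]])
    also have "\<dots> \<le> M * unorm (a n)" by (rule mult_right_mono[OF M(2) unorm_nonneg[OF bc_closed[OF c]]])
    finally show "unorm ((x \<otimes>\<^bsub>BC\<^esub> a) n) \<le> M * unorm (a n)" by (simp only: bc_simps)
  qed (use x c in simp)
  show "a \<otimes>\<^bsub>BC\<^esub> x \<in> NC"
  proof (rule nullI_le[OF _ l])
    fix n
    have "unorm (a n \<otimes>\<^bsub>FC\<^esub> x n) \<le> unorm (a n) * unorm (x n)"
      by (rule unorm_mult[OF bc_closed[OF c] bc_closed[OF x]])
    also have "\<dots> \<le> unorm (a n) * M" by (rule mult_left_mono[OF M(2) unorm_nonneg[OF bc_closed[OF c]]])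
    finally show "unorm ((a \<otimes>\<^bsub>BC\<^esub> x) n) \<le> M * unorm (a n)" by (simp only: bc_simps mult.commute)
  qed (use x c in simp)
qed

lemma star_null: "x \<in> NC \<Longrightarrow> star BC x \<in> NC"
  unfolding null_iff using bc_star bc_closed by (simp add: bc_simps unorm_star)

sublocale cq: star_quotient E BC NC
proof -
  interpret ideal NC BC by (rule null_ideal)
  show "star_quotient E BC NC" by unfold_locales (rule star_null)
qed

lemma graph_cstar_eq: "graph_cstar E = cq.Qt"
  by (simp only: graph_cstar_def)

lemma cq_eq_iff:
  "x \<in> carrier BC \<Longrightarrow> y \<in> carrier BC \<Longrightarrow> cq.q x = cq.q y \<longleftrightarrow> (\<lambda>n. unorm (x n \<ominus>\<^bsub>FC\<^esub> y n)) \<longlonglongrightarrow> 0"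
proof -
  assume x: "x \<in> carrier BC" and y: "y \<in> carrier BC"
  have "cq.q x = cq.q y \<longleftrightarrow> x \<ominus>\<^bsub>BC\<^esub> y \<in> NC" by (rule cq.q_eq_iff[OF x y])
  also have "\<dots> \<longleftrightarrow> (\<lambda>n. unorm ((x \<ominus>\<^bsub>BC\<^esub> y) n)) \<longlonglongrightarrow> 0"
    unfolding null_iff using BC.minus_closed[OF x y] by blast
  finally show ?thesis unfolding bc_minus[OF x y] .
qed

lemma cq_zero_iff: "x \<in> carrier BC \<Longrightarrow> cq.q x = \<zero>\<^bsub>cq.Qt\<^esub> \<longleftrightarrow> (\<lambda>n. unorm (x n)) \<longlonglongrightarrow> 0"
  using cq.q_eq_zero[of x] null_iff[of x] by blast

text \<open>Representatives of one class differ by a null sequence, so their norms have a common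
  limit, and the definite description denotes it.\<close>

lemma cnorm_eqI:
  assumes x: "x \<in> carrier BC" and lim: "(\<lambda>n. unorm (x n)) \<longlonglongrightarrow> c"
  shows "cnorm E (cq.q x) = c"
  unfolding cnorm_def
proof (rule the_equality)
  have mem: "(\<lambda>n. unorm (y n)) \<longlonglongrightarrow> c" if yq: "y \<in> cq.q x" for y
  proof -
    obtain h where h: "h \<in> NC" "y = h \<oplus>\<^bsub>BC\<^esub> x" using yq unfolding cq.q_memb by blast
    have hc: "h \<in> carrier BC" and hl: "(\<lambda>n. unorm (h n)) \<longlonglongrightarrow> 0" using h(1) unfolding null_iff by blast+
    have le: "norm (unorm (y n) - unorm (x n)) \<le> unorm (h n)" for n
    proof -
      have c: "h n \<in> carrier FC" "x n \<in> carrier FC" using bc_closed[OF hc] bc_closed[OF x] by blast+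
      have yn: "y n = h n \<oplus>\<^bsub>FC\<^esub> x n" by (simp only: h(2) bc_simps)
      have "(h n \<oplus>\<^bsub>FC\<^esub> x n) \<ominus>\<^bsub>FC\<^esub> x n = h n" using c by (simp add: a_minus_def FC.a_assoc FC.r_neg)
      then have "unorm (y n \<ominus>\<^bsub>FC\<^esub> x n) = unorm (h n)" "unorm (x n \<ominus>\<^bsub>FC\<^esub> y n) = unorm (h n)"
        using unorm_minus(1)[of "x n" "y n"] c yn by simp_all
      then show ?thesis using unorm_minus(2)[of "y n" "x n"] unorm_minus(2)[of "x n" "y n"] c yn
        by (simp add: abs_le_iff)
    qed
    have "(\<lambda>n. unorm (y n) - unorm (x n)) \<longlonglongrightarrow> 0"
    proof (rule tendsto_0_le[OF hl, where K = 1], intro always_eventually allI)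
      show "norm (unorm (y n) - unorm (x n)) \<le> norm (unorm (h n)) * 1" for n
        using le[of n] by simp
    qed
    from tendsto_add[OF this lim] show ?thesis by simp
  qed
  then show "\<forall>y\<in>cq.q x. (\<lambda>n. unorm (y n)) \<longlonglongrightarrow> c" by blast
  have "x \<in> cq.q x" unfolding cq.q_memb
    by (rule bexI[of _ "\<zero>\<^bsub>BC\<^esub>"]) (use x in simp, rule additive_subgroup.zero_closed[OF cq.additive_subgroup_axioms])
  moreover fix d assume "\<forall>y\<in>cq.q x. (\<lambda>n. unorm (y n)) \<longlonglongrightarrow> d"
  ultimately have "(\<lambda>n. unorm (x n)) \<longlonglongrightarrow> d" by blast
  then show "d = c" using lim by (rule LIMSEQ_unique)
qed

lemma cnorm_lim: "x \<in> carrier BC \<Longrightarrow> (\<lambda>n. unorm (x n)) \<longlonglongrightarrow> cnorm E (cq.q x)"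
proof -
  assume x: "x \<in> carrier BC"
  have l: "(\<lambda>n. unorm (x n)) \<longlonglongrightarrow> lim (\<lambda>n. unorm (x n))"
    using unorm_convergent[OF x] unfolding convergent_LIMSEQ_iff .
  show ?thesis unfolding cnorm_eqI[OF x l] by (rule l)
qed

text \<open>Constant sequences: the image of the free algebra in the completion, dense by
  \<open>kap_approx\<close>.\<close>

abbreviation "kap x \<equiv> cq.q (\<lambda>_. x)"

lemma kap_closed [simp]: "x \<in> carrier FC \<Longrightarrow> kap x \<in> carrier cq.Qt"
  by (intro cq.q_closed bc_const)

lemma cnorm_kap: "x \<in> carrier FC \<Longrightarrow> cnorm E (kap x) = unorm x"
  by (intro cnorm_eqI bc_const tendsto_const)

lemma const_hom: "(\<lambda>x _. x) \<in> graph_hom E FC BC"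
  unfolding graph_hom_def
proof (intro CollectI conjI ballI)
  show "(\<lambda>x _. x) \<in> ring_hom FC BC" by (rule ring_hom_memI) (auto simp: bc_simps bc_const)
qed (simp_all add: bc_simps)

lemma kap_hom: "(\<lambda>x. kap x) \<in> graph_hom E FC cq.Qt"
proof -
  interpret c: graph_hom_ctx E FC BC "\<lambda>x _. x" by unfold_locales (rule const_hom)
  show ?thesis unfolding graph_hom_def
  proof (intro CollectI conjI ballI)
    show "(\<lambda>x. kap x) \<in> ring_hom FC cq.Qt"
      using ring_hom_trans[OF c.homh cq.q_hom] by (simp add: comp_def)
  next
    fix x assume x: "x \<in> carrier FC"
    have "kap (star FC x) = cq.q (star BC (\<lambda>_. x))" by (simp only: bc_simps)
    then show "kap (star FC x) = star cq.Qt (kap x)" using cq.qh.hom_star[OF bc_const[OF x]] by (simp only:)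
  next
    fix v assume v: "v \<in> verts E"
    have "kap (vproj FC v) = cq.q (vproj BC v)" by (simp only: bc_simps)
    then show "kap (vproj FC v) = vproj cq.Qt v" using cq.qh.hom_vproj[OF v] by (simp only:)
  next
    fix e assume e: "e \<in> arcs E"
    have "kap (eiso FC e) = cq.q (eiso BC e)" by (simp only: bc_simps)
    then show "kap (eiso FC e) = eiso cq.Qt e" using cq.qh.hom_eiso[OF e] by (simp only:)
  qed
qed

sublocale kp: graph_hom_ctx E FC cq.Qt "\<lambda>x. kap x"
  by unfold_locales (rule kap_hom)

lemma cscalar_eq: "cscalar E c = kap (const c)"
  unfolding cscalar_def const_def ..

lemma cstar_leavitt_rels: "leavitt_rels cq.Qt E \<subseteq> {\<zero>\<^bsub>cq.Qt\<^esub>}"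
proof -
  have "leavitt_rels FC E \<subseteq> {x. kap x \<in> {\<zero>\<^bsub>cq.Qt\<^esub>}}"
  proof
    fix x assume "x \<in> leavitt_rels FC E"
    then have "x \<in> nullI" using leavitt_rels_nullI by blast
    then have x: "x \<in> carrier FC" "unorm x = 0" unfolding nullI_def by blast+
    have "kap x = \<zero>\<^bsub>cq.Qt\<^esub>" unfolding cq_zero_iff[OF bc_const[OF x(1)]] x(2) by (rule tendsto_const)
    then show "x \<in> {x. kap x \<in> {\<zero>\<^bsub>cq.Qt\<^esub>}}" by blast
  qed
  then show ?thesis unfolding kp.leavitt_rels_vimage .
qed

lemma cnorm_nonneg: "X \<in> carrier cq.Qt \<Longrightarrow> cnorm E X \<ge> 0"
proof -
  assume "X \<in> carrier cq.Qt"
  then obtain x where x: "x \<in> carrier BC" "X = cq.q x" by (rule cq.quot_carrierE)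
  show ?thesis unfolding x(2)
    by (rule LIMSEQ_le_const[OF cnorm_lim[OF x(1)]]) (use unorm_nonneg bc_closed[OF x(1)] in blast)
qed

lemma cnorm_add_le:
  assumes "X \<in> carrier cq.Qt" "Y \<in> carrier cq.Qt"
  shows "cnorm E (X \<oplus>\<^bsub>cq.Qt\<^esub> Y) \<le> cnorm E X + cnorm E Y"
proof -
  obtain x where x: "x \<in> carrier BC" "X = cq.q x" using assms(1) by (rule cq.quot_carrierE)
  obtain y where y: "y \<in> carrier BC" "Y = cq.q y" using assms(2) by (rule cq.quot_carrierE)
  have e: "X \<oplus>\<^bsub>cq.Qt\<^esub> Y = cq.q (\<lambda>n. x n \<oplus>\<^bsub>FC\<^esub> y n)"
    unfolding x(2) y(2) cq.qh.hom_add[OF x(1) y(1), symmetric] by (simp only: bc_simps)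
  have "unorm (x n \<oplus>\<^bsub>FC\<^esub> y n) \<le> unorm (x n) + unorm (y n)" for n
    by (rule unorm_add[OF bc_closed[OF x(1)] bc_closed[OF y(1)]])
  then show ?thesis unfolding e unfolding x(2) y(2)
    by (intro LIMSEQ_le[OF cnorm_lim[OF bc_add[OF x(1) y(1)]] tendsto_add[OF cnorm_lim[OF x(1)] cnorm_lim[OF y(1)]]]) blast
qed

lemma cnorm_zero: assumes "X \<in> carrier cq.Qt" "cnorm E X \<le> 0" shows "X = \<zero>\<^bsub>cq.Qt\<^esub>"
proof -
  obtain x where x: "x \<in> carrier BC" "X = cq.q x" using assms(1) by (rule cq.quot_carrierE)
  have "cnorm E X = 0" using cnorm_nonneg[OF assms(1)] assms(2) by simp
  then have "(\<lambda>n. unorm (x n)) \<longlonglongrightarrow> 0" using cnorm_lim[OF x(1)] x(2) by (simp only:)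
  then show ?thesis unfolding x(2) cq_zero_iff[OF x(1)] .
qed

lemma q_diff: "x \<in> carrier BC \<Longrightarrow> y \<in> carrier BC \<Longrightarrow> cq.q x \<ominus>\<^bsub>cq.Qt\<^esub> cq.q y = cq.q (\<lambda>n. x n \<ominus>\<^bsub>FC\<^esub> y n)"
  using cq.qh.hom_minus[of x y] bc_minus[of x y] by (simp only:)

lemma bc_diff: "x \<in> carrier BC \<Longrightarrow> y \<in> carrier BC \<Longrightarrow> (\<lambda>n. x n \<ominus>\<^bsub>FC\<^esub> y n) \<in> carrier BC"
  using BC.minus_closed[of x y] bc_minus[of x y] by (simp only:)

lemma cnorm_diff_commute:
  assumes "X \<in> carrier cq.Qt" "Y \<in> carrier cq.Qt"
  shows "cnorm E (X \<ominus>\<^bsub>cq.Qt\<^esub> Y) = cnorm E (Y \<ominus>\<^bsub>cq.Qt\<^esub> X)"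
proof -
  obtain x where x: "x \<in> carrier BC" "X = cq.q x" using assms(1) by (rule cq.quot_carrierE)
  obtain y where y: "y \<in> carrier BC" "Y = cq.q y" using assms(2) by (rule cq.quot_carrierE)
  have "unorm (x n \<ominus>\<^bsub>FC\<^esub> y n) = unorm (y n \<ominus>\<^bsub>FC\<^esub> x n)" for n
    by (rule unorm_minus(1)[OF bc_closed[OF x(1)] bc_closed[OF y(1)]])
  then have "(\<lambda>n. unorm (x n \<ominus>\<^bsub>FC\<^esub> y n)) \<longlonglongrightarrow> cnorm E (Y \<ominus>\<^bsub>cq.Qt\<^esub> X)"
    using cnorm_lim[OF bc_diff[OF y(1) x(1)]] unfolding x(2) y(2) q_diff[OF y(1) x(1)] by (simp only:)
  then show ?thesis unfolding x(2) y(2) q_diff[OF x(1) y(1)] by (intro cnorm_eqI bc_diff[OF x(1) y(1)])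
qed

lemma cnorm_triangle:
  assumes c: "X \<in> carrier cq.Qt" "Y \<in> carrier cq.Qt" "Z \<in> carrier cq.Qt"
  shows "cnorm E (X \<ominus>\<^bsub>cq.Qt\<^esub> Z) \<le> cnorm E (X \<ominus>\<^bsub>cq.Qt\<^esub> Y) + cnorm E (Y \<ominus>\<^bsub>cq.Qt\<^esub> Z)"
proof -
  have "X \<ominus>\<^bsub>cq.Qt\<^esub> Z = (X \<ominus>\<^bsub>cq.Qt\<^esub> Y) \<oplus>\<^bsub>cq.Qt\<^esub> (Y \<ominus>\<^bsub>cq.Qt\<^esub> Z)"
    unfolding a_minus_def using c
    by (simp only: cq.Qt.a_assoc cq.Qt.r_neg1 cq.Qt.a_inv_closed cq.Qt.a_closed)
  then show ?thesis using cnorm_add_le[of "X \<ominus>\<^bsub>cq.Qt\<^esub> Y" "Y \<ominus>\<^bsub>cq.Qt\<^esub> Z"] c cq.Qt.minus_closed by (simp only:)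
qed

lemma kap_approx:
  assumes x: "x \<in> carrier BC" and e: "\<epsilon> > 0"
  shows "\<exists>N. \<forall>n\<ge>N. cnorm E (cq.q x \<ominus>\<^bsub>cq.Qt\<^esub> kap (x n)) < \<epsilon>"
proof -
  obtain N where N: "\<forall>m\<ge>N. \<forall>n\<ge>N. unorm (x m \<ominus>\<^bsub>FC\<^esub> x n) < \<epsilon> / 2"
    using bc_eventually[OF x, of "\<epsilon> / 2"] e by (meson half_gt_zero)
  have "cnorm E (cq.q x \<ominus>\<^bsub>cq.Qt\<^esub> kap (x n)) < \<epsilon>" if n: "n \<ge> N" for n
  proof -
    have c: "(\<lambda>_. x n) \<in> carrier BC" by (rule bc_const[OF bc_closed[OF x]])
    have "cnorm E (cq.q x \<ominus>\<^bsub>cq.Qt\<^esub> kap (x n)) \<le> \<epsilon> / 2"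
      unfolding q_diff[OF x c]
      by (rule LIMSEQ_le_const2[OF cnorm_lim[OF bc_diff[OF x c]]]) (use N n in \<open>auto intro!: exI[of _ N] less_imp_le\<close>)
    then show ?thesis using e by simp
  qed
  then show ?thesis by blast
qed

end

subsection \<open>The endomorphism of the graph C*-algebra\<close>

context cstar_coding
begin

sublocale lc: leavitt_coding E J cq.Qt
  by unfold_locales (rule cstar_leavitt_rels)

text \<open>The extension of \<open>phi\<close> by continuity, applied termwise;
  \<open>unorm_phi\<close> keeps Cauchy sequences Cauchy and null sequences null.\<close>

definition lam :: "(nat \<Rightarrow> ('v, 'e) gen list \<Rightarrow> complex) \<Rightarrow> ('v, 'e) cstar_elt" where
  "lam x = cq.q (\<lambda>n. fc.phi (x n))"

lemma bc_phi: assumes x: "x \<in> carrier BC" shows "(\<lambda>n. fc.phi (x n)) \<in> carrier BC"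
proof (rule bcI1[OF _ x])
  show "unorm (fc.phi (x m) \<ominus>\<^bsub>FC\<^esub> fc.phi (x n)) \<le> unorm (x m \<ominus>\<^bsub>FC\<^esub> x n)" for m n
  proof -
    have c: "x m \<in> carrier FC" "x n \<in> carrier FC" using bc_closed[OF x] by blast+
    show ?thesis unfolding fc.phi_minus[OF c, symmetric] by (rule unorm_phi[OF FC.minus_closed[OF c]])
  qed
  show "fc.phi (x n) \<in> carrier FC" for n by (rule fc.phi_closed[OF bc_closed[OF x]])
qed

lemma lam_closed: "x \<in> carrier BC \<Longrightarrow> lam x \<in> carrier cq.Qt"
  unfolding lam_def by (intro cq.q_closed bc_phi)

lemma lam_hom: "lam \<in> graph_hom E BC lc.twisted"
  unfolding graph_hom_def
proof (intro CollectI conjI ballI)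
  show "lam \<in> ring_hom BC lc.twisted"
  proof (rule ring_hom_memI)
    fix x assume x: "x \<in> carrier BC"
    show "lam x \<in> carrier lc.twisted" using lam_closed[OF x] by (simp only: lc.twisted_simps)
    fix y assume y: "y \<in> carrier BC"
    have "lam (x \<otimes>\<^bsub>BC\<^esub> y) = cq.q ((\<lambda>n. fc.phi (x n)) \<otimes>\<^bsub>BC\<^esub> (\<lambda>n. fc.phi (y n)))"
      unfolding lam_def by (simp only: bc_simps fc.phi_mult[OF bc_closed[OF x] bc_closed[OF y]])
    then show "lam (x \<otimes>\<^bsub>BC\<^esub> y) = lam x \<otimes>\<^bsub>lc.twisted\<^esub> lam y"
      unfolding cq.qh.hom_mult[OF bc_phi[OF x] bc_phi[OF y]] lam_def by (simp only: lc.twisted_simps)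
    have "lam (x \<oplus>\<^bsub>BC\<^esub> y) = cq.q ((\<lambda>n. fc.phi (x n)) \<oplus>\<^bsub>BC\<^esub> (\<lambda>n. fc.phi (y n)))"
      unfolding lam_def by (simp only: bc_simps fc.phi_add[OF bc_closed[OF x] bc_closed[OF y]])
    then show "lam (x \<oplus>\<^bsub>BC\<^esub> y) = lam x \<oplus>\<^bsub>lc.twisted\<^esub> lam y"
      unfolding cq.qh.hom_add[OF bc_phi[OF x] bc_phi[OF y]] lam_def by (simp only: lc.twisted_simps)
  next
    have "lam \<one>\<^bsub>BC\<^esub> = cq.q \<one>\<^bsub>BC\<^esub>"
      unfolding lam_def using ring_hom_one[OF fc.phi_hom] by (simp only: bc_simps)
    then show "lam \<one>\<^bsub>BC\<^esub> = \<one>\<^bsub>lc.twisted\<^esub>" using ring_hom_one[OF cq.q_hom] by (simp only: lc.twisted_simps)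
  qed
next
  fix x assume x: "x \<in> carrier BC"
  have "lam (star BC x) = cq.q (star BC (\<lambda>n. fc.phi (x n)))"
    unfolding lam_def by (simp only: bc_simps fc.phi_star[OF bc_closed[OF x]])
  then show "lam (star BC x) = star lc.twisted (lam x)"
    unfolding cq.qh.hom_star[OF bc_phi[OF x]] lam_def by (simp only: lc.twisted_simps)
next
  fix v assume v: "v \<in> verts E"
  show "lam (vproj BC v) = vproj lc.twisted v"
    unfolding lam_def using kp.hom_vproj[OF v] by (simp only: bc_simps fc.phi_vproj lc.twisted_simps)
next
  fix e assume e: "e \<in> arcs E"
  have "lam (eiso BC e) = kap (pair_sum FC J \<otimes>\<^bsub>FC\<^esub> eiso FC e)"
    unfolding lam_def by (simp only: bc_simps fc.phi_eiso)
  also have "\<dots> = kap (pair_sum FC J) \<otimes>\<^bsub>cq.Qt\<^esub> kap (eiso FC e)"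
    by (rule kp.hom_mult[OF fc.uF_closed FC.eiso_closed[OF e]])
  finally show "lam (eiso BC e) = eiso lc.twisted e"
    by (simp only: kp.hom_pair_sum[OF fc.J_sub] kp.hom_eiso[OF e] lc.twisted_simps lc.u_def)
qed

sublocale lm: graph_hom_ctx E BC lc.twisted lam
  by unfold_locales (rule lam_hom)

definition lamq :: "('v, 'e) cstar_elt \<Rightarrow> ('v, 'e) cstar_elt" where
  "lamq = cq.induced lam"

lemma lam_null: "x \<in> NC \<Longrightarrow> lam x = \<zero>\<^bsub>lc.twisted\<^esub>"
proof -
  assume "x \<in> NC"
  then have x: "x \<in> carrier BC" "(\<lambda>n. unorm (x n)) \<longlonglongrightarrow> 0" unfolding null_iff by blast+
  have "(\<lambda>n. fc.phi (x n)) \<in> NC"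
    by (rule nullI_le[OF bc_phi[OF x(1)] x(2)]) (rule unorm_phi[OF bc_closed[OF x(1)]])
  then show ?thesis unfolding lam_def using cq.q_eq_zero[OF bc_phi[OF x(1)]] by (simp only: lc.twisted_simps)
qed

lemma lamq_q: "x \<in> carrier BC \<Longrightarrow> lamq (cq.q x) = lam x"
  unfolding lamq_def by (rule cq.induced_q[OF lm.graph_hom_ctx_axioms lam_null])

lemma lamq_hom: "lamq \<in> graph_hom E cq.Qt lc.twisted"
  unfolding lamq_def by (rule cq.induced_hom[OF lm.graph_hom_ctx_axioms lam_null])

lemma lamq_kap: "x \<in> carrier FC \<Longrightarrow> lamq (kap x) = kap (fc.phi x)"
  unfolding lamq_q[OF bc_const] lam_def ..

lemma lamq_contractive: assumes "X \<in> carrier cq.Qt" shows "cnorm E (lamq X) \<le> cnorm E X"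
proof -
  obtain x where x: "x \<in> carrier BC" "X = cq.q x" using assms by (rule cq.quot_carrierE)
  show ?thesis unfolding x(2) lamq_q[OF x(1)] lam_def
    by (rule LIMSEQ_le[OF cnorm_lim[OF bc_phi[OF x(1)]] cnorm_lim[OF x(1)]])
      (use unorm_phi bc_closed[OF x(1)] in blast)
qed

lemma graph_hom_twisted:
  "\<phi> \<in> graph_hom E cq.Qt lc.twisted \<longleftrightarrow> \<phi> \<in> star_endo (graph_cstar E)
     \<and> (\<forall>e\<in>arcs E. \<phi> (eiso (graph_cstar E) e) = pair_sum (graph_cstar E) J \<otimes>\<^bsub>graph_cstar E\<^esub> eiso (graph_cstar E) e)
     \<and> (\<forall>v\<in>verts E. \<phi> (vproj (graph_cstar E) v) = vproj (graph_cstar E) v)"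
  unfolding graph_hom_def star_endo_def ring_hom_def graph_cstar_eq by (auto simp: lc.u_def)

text \<open>The condition in the definition of \<open>lambda_endo\<close>, with its algebraic
  clauses bundled into a homomorphism to the twisted family.\<close>

definition describes :: "(('v, 'e) cstar_elt \<Rightarrow> ('v, 'e) cstar_elt) \<Rightarrow> bool" where
  "describes \<phi> \<longleftrightarrow> \<phi> \<in> extensional (carrier cq.Qt) \<and> \<phi> \<in> graph_hom E cq.Qt lc.twisted
     \<and> (\<forall>c. \<phi> (kap (const c)) = kap (const c)) \<and> (\<forall>X\<in>carrier cq.Qt. cnorm E (\<phi> X) \<le> cnorm E X)"

lemma describes_kap:
  assumes a: "describes \<phi>" "describes \<psi>" and f: "f \<in> carrier FC"
  shows "\<phi> (kap f) = \<psi> (kap f)"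
proof -
  interpret p: graph_hom_ctx E cq.Qt lc.twisted \<phi> by unfold_locales (use a(1) in \<open>simp add: describes_def\<close>)
  interpret r: graph_hom_ctx E cq.Qt lc.twisted \<psi> by unfold_locales (use a(2) in \<open>simp add: describes_def\<close>)
  define agree where "agree f \<longleftrightarrow> \<phi> (kap f) = \<psi> (kap f)" for f
  have "agree f" using f
  proof (induction rule: free_induct)
    case (const c)
    show ?case unfolding agree_def using a unfolding describes_def by simp
  next
    case (delta g)
    show ?case
    proof (cases g)
      case (GP v)
      then have v: "v \<in> verts E" using delta by (auto simp: gens_def)
      have "delta [g] = vproj FC v" by (simp add: GP free_simps(6))
      then show ?thesis unfolding agree_def by (simp only: kp.hom_vproj[OF v] p.hom_vproj[OF v] r.hom_vproj[OF v])
    next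
      case (GS e)
      then have e: "e \<in> arcs E" using delta by (auto simp: gens_def)
      have "delta [g] = eiso FC e" by (simp add: GS free_simps(7))
      then show ?thesis unfolding agree_def by (simp only: kp.hom_eiso[OF e] p.hom_eiso[OF e] r.hom_eiso[OF e])
    next
      case (GSstar e)
      then have e: "e \<in> arcs E" using delta by (auto simp: gens_def)
      have d: "delta [g] = star FC (eiso FC e)" by (simp only: GSstar cnj_conj.star_eiso_delta)
      have c: "eiso cq.Qt e \<in> carrier cq.Qt" by (rule cq.Qt.eiso_closed[OF e])
      show ?thesis unfolding agree_def d
        by (simp only: kp.hom_star[OF FC.eiso_closed[OF e]] kp.hom_eiso[OF e] p.hom_star[OF c] r.hom_star[OF c]
            p.hom_eiso[OF e] r.hom_eiso[OF e])
    qed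
  next
    case (add f g)
    have k: "kap f \<in> carrier cq.Qt" "kap g \<in> carrier cq.Qt" using add(1,2) by simp_all
    have "agree (f \<oplus>\<^bsub>FC\<^esub> g)"
      unfolding agree_def kp.hom_add[OF add(1,2)] p.hom_add[OF k] r.hom_add[OF k]
      using add.IH unfolding agree_def by (simp only:)
    then show ?case by (simp only: free_simps(4))
  next
    case (mult f g)
    have k: "kap f \<in> carrier cq.Qt" "kap g \<in> carrier cq.Qt" using mult(1,2) by simp_all
    have "agree (f \<otimes>\<^bsub>FC\<^esub> g)"
      unfolding agree_def kp.hom_mult[OF mult(1,2)] p.hom_mult[OF k] r.hom_mult[OF k]
      using mult.IH unfolding agree_def by (simp only:)
    then show ?case by (simp only: free_simps(1))
  qed
  then show ?thesis unfolding agree_def .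
qed

text \<open>Such maps agree on the dense image of the free algebra, and contractivity extends the
  agreement to the completion.\<close>

lemma describes_unique:
  assumes a: "describes \<phi>" "describes \<psi>" shows "\<phi> = \<psi>"
proof (rule extensionalityI)
  show "\<phi> \<in> extensional (carrier cq.Qt)" "\<psi> \<in> extensional (carrier cq.Qt)" using a unfolding describes_def by blast+
  fix X assume X: "X \<in> carrier cq.Qt"
  obtain x where x: "x \<in> carrier BC" "X = cq.q x" using X by (rule cq.quot_carrierE)
  have hom: "\<phi> Y \<in> carrier cq.Qt" "\<phi> Y \<ominus>\<^bsub>cq.Qt\<^esub> \<phi> Z = \<phi> (Y \<ominus>\<^bsub>cq.Qt\<^esub> Z)" "cnorm E (\<phi> Y) \<le> cnorm E Y"
    if d: "describes \<phi>" and c: "Y \<in> carrier cq.Qt" "Z \<in> carrier cq.Qt" for \<phi> Y Z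
  proof -
    interpret p: graph_hom_ctx E cq.Qt lc.twisted \<phi> by unfold_locales (use d in \<open>simp add: describes_def\<close>)
    show "\<phi> Y \<in> carrier cq.Qt" using p.hom_closed[OF c(1)] by (simp only: lc.twisted_simps)
    show "\<phi> Y \<ominus>\<^bsub>cq.Qt\<^esub> \<phi> Z = \<phi> (Y \<ominus>\<^bsub>cq.Qt\<^esub> Z)" using p.hom_minus[OF c] by (simp only: lc.twisted_minus)
    show "cnorm E (\<phi> Y) \<le> cnorm E Y" using d c(1) unfolding describes_def by blast
  qed
  have cl: "\<phi> X \<in> carrier cq.Qt" "\<psi> X \<in> carrier cq.Qt" using hom(1) a X by blast+
  have "cnorm E (\<phi> X \<ominus>\<^bsub>cq.Qt\<^esub> \<psi> X) \<le> 0"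
  proof (rule field_le_epsilon)
    fix e :: real assume "e > 0"
    then obtain n where n: "cnorm E (X \<ominus>\<^bsub>cq.Qt\<^esub> kap (x n)) < e / 2"
      using kap_approx[OF x(1), of "e / 2"] unfolding x(2) by (meson half_gt_zero order_refl)
    let ?Y = "kap (x n)"
    have Y: "?Y \<in> carrier cq.Qt" using bc_closed[OF x(1)] by simp
    have eq: "\<phi> ?Y = \<psi> ?Y" by (rule describes_kap[OF a bc_closed[OF x(1)]])
    have "cnorm E (\<phi> X \<ominus>\<^bsub>cq.Qt\<^esub> \<psi> X) \<le> cnorm E (\<phi> X \<ominus>\<^bsub>cq.Qt\<^esub> \<phi> ?Y) + cnorm E (\<phi> ?Y \<ominus>\<^bsub>cq.Qt\<^esub> \<psi> X)"
      by (rule cnorm_triangle[OF cl(1) hom(1)[OF a(1) Y Y] cl(2)])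
    also have "\<dots> = cnorm E (\<phi> (X \<ominus>\<^bsub>cq.Qt\<^esub> ?Y)) + cnorm E (\<psi> (?Y \<ominus>\<^bsub>cq.Qt\<^esub> X))"
      unfolding hom(2)[OF a(1) X Y] hom(2)[OF a(2) Y X, folded eq] ..
    also have "\<dots> \<le> cnorm E (X \<ominus>\<^bsub>cq.Qt\<^esub> ?Y) + cnorm E (?Y \<ominus>\<^bsub>cq.Qt\<^esub> X)"
      by (intro add_mono hom(3)[OF a(1) _ Y] hom(3)[OF a(2) _ Y] cq.Qt.minus_closed X Y)
    also have "\<dots> \<le> 0 + e" using n cnorm_diff_commute[OF X Y] by linarith
    finally show "cnorm E (\<phi> X \<ominus>\<^bsub>cq.Qt\<^esub> \<psi> X) \<le> 0 + e" .
  qed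
  then have "\<phi> X \<ominus>\<^bsub>cq.Qt\<^esub> \<psi> X = \<zero>\<^bsub>cq.Qt\<^esub>" by (rule cnorm_zero[OF cq.Qt.minus_closed[OF cl]])
  then show "\<phi> X = \<psi> X" unfolding cq.Qt.minus_eq_zero_iff[OF cl] .
qed

lemma lambda_endo_eq: "lambda_endo E J = lamq"
proof -
  have d: "describes lamq"
    unfolding describes_def
  proof (intro conjI allI ballI)
    show "lamq \<in> extensional (carrier cq.Qt)" unfolding lamq_def cq.induced_def by simp
    show "lamq (kap (const c)) = kap (const c)" for c unfolding lamq_kap[OF const_carrier] fc.phi_const ..
  qed (auto simp only: lamq_hom lamq_contractive)
  have iff: "(\<phi> \<in> extensional (carrier (graph_cstar E)) \<and> \<phi> \<in> star_endo (graph_cstar E)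
       \<and> (\<forall>c. \<phi> (cscalar E c) = cscalar E c)
       \<and> (\<forall>x\<in>carrier (graph_cstar E). cnorm E (\<phi> x) \<le> cnorm E x)
       \<and> (\<forall>e\<in>arcs E. \<phi> (eiso (graph_cstar E) e) = pair_sum (graph_cstar E) J \<otimes>\<^bsub>graph_cstar E\<^esub> eiso (graph_cstar E) e)
       \<and> (\<forall>v\<in>verts E. \<phi> (vproj (graph_cstar E) v) = vproj (graph_cstar E) v)) \<longleftrightarrow> describes \<phi>" for \<phi>
    unfolding describes_def graph_hom_twisted cscalar_eq graph_cstar_eq by blast
  show ?thesis unfolding lambda_endo_def Let_def iff
    by (rule the_equality[where P = describes, OF d]) (rule describes_unique[OF _ d])
qed

subsection \<open>The diagonal\<close>

lemma cspan_eq: "cspan E (path_proj (graph_cstar E) ` paths E) = (\<lambda>x. kap x) ` fc.cdiag"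
proof -
  let ?G = "{const c \<otimes>\<^bsub>FC\<^esub> path_proj FC \<beta> |c \<beta>. \<beta> \<in> paths E}"
  have k: "kap (const c \<otimes>\<^bsub>FC\<^esub> path_proj FC \<beta>) = cscalar E c \<otimes>\<^bsub>cq.Qt\<^esub> path_proj cq.Qt \<beta>" if "\<beta> \<in> paths E" for c \<beta>
    unfolding kp.hom_mult[OF const_carrier fc.projF_closed[OF that]] cscalar_eq kp.hom_path_proj[OF that] ..
  have "(\<lambda>x. kap x) ` ?G = {cscalar E c \<otimes>\<^bsub>cq.Qt\<^esub> b |c b. b \<in> path_proj cq.Qt ` paths E}"
  proof (intro equalityI subsetI)
    fix X assume "X \<in> (\<lambda>x. kap x) ` ?G"
    then obtain c \<beta> where "\<beta> \<in> paths E" "X = kap (const c \<otimes>\<^bsub>FC\<^esub> path_proj FC \<beta>)" by blast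
    then show "X \<in> {cscalar E c \<otimes>\<^bsub>cq.Qt\<^esub> b |c b. b \<in> path_proj cq.Qt ` paths E}" using k by blast
  next
    fix X assume "X \<in> {cscalar E c \<otimes>\<^bsub>cq.Qt\<^esub> b |c b. b \<in> path_proj cq.Qt ` paths E}"
    then obtain c \<beta> where b: "\<beta> \<in> paths E" "X = cscalar E c \<otimes>\<^bsub>cq.Qt\<^esub> path_proj cq.Qt \<beta>" by blast
    then have "X = kap (const c \<otimes>\<^bsub>FC\<^esub> path_proj FC \<beta>)" using k[OF b(1)] by (simp only:)
    then show "X \<in> (\<lambda>x. kap x) ` ?G" using b(1) by blast
  qed
  then show ?thesis
    unfolding cspan_def graph_cstar_eq fc.cdiag_def
    by (simp only: generate_hom_image[OF FC.ring_axioms cq.Qt.ring_axioms kp.homh fc.cdiag_gens])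
qed

lemma cdiag_minus: "x \<in> fc.cdiag \<Longrightarrow> y \<in> fc.cdiag \<Longrightarrow> x \<ominus>\<^bsub>FC\<^esub> y \<in> fc.cdiag"
proof -
  assume x: "x \<in> fc.cdiag" and y: "y \<in> fc.cdiag"
  have "\<ominus>\<^bsub>FC\<^esub> y \<in> fc.cdiag"
    using subgroup.m_inv_closed[OF fc.cdiag_subgroup y] by (simp only: a_inv_def)
  then show ?thesis unfolding a_minus_def by (rule fc.cdiag_add[OF x])
qed

lemma cstar_diag_iff: "X \<in> cstar_diag E \<longleftrightarrow> X \<in> carrier cq.Qt \<and>
    (\<forall>e>0. \<exists>z\<in>fc.cdiag. cnorm E (X \<ominus>\<^bsub>cq.Qt\<^esub> kap z) < e)"
  unfolding cstar_diag_def cclosure_def cspan_eq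
  unfolding graph_cstar_eq mem_Collect_eq bex_simps ..

lemma bc_diag: "x \<in> carrier BC \<Longrightarrow> (\<And>n. x n \<in> fc.cdiag) \<Longrightarrow> cq.q x \<in> cstar_diag E"
proof -
  assume x: "x \<in> carrier BC" and d: "\<And>n. x n \<in> fc.cdiag"
  have "\<exists>z\<in>fc.cdiag. cnorm E (cq.q x \<ominus>\<^bsub>cq.Qt\<^esub> kap z) < e" if e: "e > 0" for e
  proof -
    obtain N where "\<forall>n\<ge>N. cnorm E (cq.q x \<ominus>\<^bsub>cq.Qt\<^esub> kap (x n)) < e" using kap_approx[OF x e] by blast
    then have "cnorm E (cq.q x \<ominus>\<^bsub>cq.Qt\<^esub> kap (x N)) < e" by blast
    then show ?thesis using d[of N] by (rule bexI)
  qed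
  then show ?thesis unfolding cstar_diag_iff by (intro conjI allI impI cq.q_closed[OF x])
qed

text \<open>Approximants within \<open>1 / Suc n\<close> form a Cauchy sequence whose class is
  \<open>X\<close>. Such sequences reduce arguments about the closure to
  \<open>cdiag\<close>.\<close>

lemma diag_bc:
  assumes X: "X \<in> cstar_diag E"
  obtains x where "x \<in> carrier BC" "\<And>n. x n \<in> fc.cdiag" "X = cq.q x"
proof -
  have Xc: "X \<in> carrier cq.Qt"
    and ap: "\<And>e. e > 0 \<Longrightarrow> \<exists>z\<in>fc.cdiag. cnorm E (X \<ominus>\<^bsub>cq.Qt\<^esub> kap z) < e"
    using X[unfolded cstar_diag_iff, THEN conjunct1] X[unfolded cstar_diag_iff, THEN conjunct2, rule_format] .
  have "\<exists>z. z \<in> fc.cdiag \<and> cnorm E (X \<ominus>\<^bsub>cq.Qt\<^esub> kap z) < 1 / Suc n" for n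
    using ap[of "1 / Suc n"] unfolding Bex_def by simp
  then have "\<forall>n. \<exists>z. z \<in> fc.cdiag \<and> cnorm E (X \<ominus>\<^bsub>cq.Qt\<^esub> kap z) < 1 / Suc n" by (rule allI)
  then obtain x where x: "\<forall>n. x n \<in> fc.cdiag \<and> cnorm E (X \<ominus>\<^bsub>cq.Qt\<^esub> kap (x n)) < 1 / Suc n"
    using choice[of "\<lambda>n z. z \<in> fc.cdiag \<and> cnorm E (X \<ominus>\<^bsub>cq.Qt\<^esub> kap z) < 1 / Suc n"] by blast
  then have xd: "\<And>n. x n \<in> fc.cdiag" and xl: "\<And>n. cnorm E (X \<ominus>\<^bsub>cq.Qt\<^esub> kap (x n)) < 1 / Suc n" by blast+
  have xc: "x n \<in> carrier FC" for n by (rule fc.cdiag_carrier[OF xd])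
  have K: "kap (x n) \<in> carrier cq.Qt" for n by (rule kap_closed[OF xc])
  have le: "unorm (x m \<ominus>\<^bsub>FC\<^esub> x n) < 1 / Suc m + 1 / Suc n" for m n
  proof -
    have "unorm (x m \<ominus>\<^bsub>FC\<^esub> x n) = cnorm E (kap (x m) \<ominus>\<^bsub>cq.Qt\<^esub> kap (x n))"
      unfolding kp.hom_minus[OF xc xc, symmetric] by (rule cnorm_kap[OF FC.minus_closed[OF xc xc], symmetric])
    also have "\<dots> \<le> cnorm E (kap (x m) \<ominus>\<^bsub>cq.Qt\<^esub> X) + cnorm E (X \<ominus>\<^bsub>cq.Qt\<^esub> kap (x n))"
      by (rule cnorm_triangle[OF K Xc K])
    also have "\<dots> < 1 / Suc m + 1 / Suc n"
      unfolding cnorm_diff_commute[OF K Xc] by (intro add_strict_mono xl)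
    finally show ?thesis .
  qed
  have arch: "\<exists>N. \<forall>n\<ge>N. 1 / Suc n < e" if e: "e > 0" for e :: real
  proof -
    obtain N where N: "inverse (real (Suc N)) < e" using reals_Archimedean[OF e] by blast
    have "1 / Suc n < e" if "n \<ge> N" for n
    proof -
      have "1 / Suc n \<le> 1 / Suc N" using that by (intro divide_left_mono) auto
      then show ?thesis using N by (simp add: inverse_eq_divide)
    qed
    then show ?thesis by blast
  qed
  have xB: "x \<in> carrier BC"
    unfolding bc_carrier
  proof (intro conjI allI impI xc)
    fix e :: real assume "e > 0"
    then obtain N where N: "\<forall>n\<ge>N. 1 / Suc n < e / 2" using arch[of "e / 2"] by (meson half_gt_zero)
    have "unorm (x m \<ominus>\<^bsub>FC\<^esub> x n) < e" if "m \<ge> N" "n \<ge> N" for m n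
    proof -
      have "1 / Suc m < e / 2" "1 / Suc n < e / 2" using N that by blast+
      then show ?thesis using le[of m n] by linarith
    qed
    then show "\<exists>N. \<forall>m\<ge>N. \<forall>n\<ge>N. unorm (x m \<ominus>\<^bsub>FC\<^esub> x n) < e" by blast
  qed
  have qc: "cq.q x \<in> carrier cq.Qt" by (rule cq.q_closed[OF xB])
  have "cnorm E (X \<ominus>\<^bsub>cq.Qt\<^esub> cq.q x) \<le> 0"
  proof (rule field_le_epsilon)
    fix e :: real assume e: "e > 0"
    then have e2: "e / 2 > 0" by simp
    obtain N where N: "\<forall>n\<ge>N. 1 / Suc n < e / 2" using arch[OF e2] by blast
    obtain M where M: "\<forall>n\<ge>M. cnorm E (cq.q x \<ominus>\<^bsub>cq.Qt\<^esub> kap (x n)) < e / 2" using kap_approx[OF xB e2] by blast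
    define n where "n = max N M"
    have "cnorm E (X \<ominus>\<^bsub>cq.Qt\<^esub> cq.q x) \<le> cnorm E (X \<ominus>\<^bsub>cq.Qt\<^esub> kap (x n)) + cnorm E (kap (x n) \<ominus>\<^bsub>cq.Qt\<^esub> cq.q x)"
      by (rule cnorm_triangle[OF Xc K qc])
    moreover have "cnorm E (kap (x n) \<ominus>\<^bsub>cq.Qt\<^esub> cq.q x) < e / 2"
      unfolding cnorm_diff_commute[OF K qc] using M by (simp add: n_def)
    moreover have "1 / Suc n < e / 2" using N by (simp add: n_def)
    ultimately show "cnorm E (X \<ominus>\<^bsub>cq.Qt\<^esub> cq.q x) \<le> 0 + e" using xl[of n] by linarith
  qed
  then have "X \<ominus>\<^bsub>cq.Qt\<^esub> cq.q x = \<zero>\<^bsub>cq.Qt\<^esub>" by (rule cnorm_zero[OF cq.Qt.minus_closed[OF Xc qc]])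
  then have "X = cq.q x" unfolding cq.Qt.minus_eq_zero_iff[OF Xc qc] .
  then show thesis using that xB xd by blast
qed

lemma unorm_cong:
  assumes "x \<in> carrier FC" "y \<in> carrier FC" "x' \<in> carrier FC" "y' \<in> carrier FC"
    "nq.q x = nq.q x'" "nq.q y = nq.q y'"
  shows "unorm (x \<ominus>\<^bsub>FC\<^esub> y) = unorm (x' \<ominus>\<^bsub>FC\<^esub> y')"
  by (rule nq_unorm) (use assms in \<open>simp_all only: nq.qh.hom_minus FC.minus_closed\<close>)

text \<open>The witnesses of \<open>phi_cdiag\<close> and \<open>cdiag_phi\<close> are equal to the
  wanted elements only modulo null elements; this permits the termwise exchange.\<close>

lemma bc_cong:
  assumes x: "x \<in> carrier BC" and y: "\<And>n. y n \<in> carrier FC" and eq: "\<And>n. nq.q (x n) = nq.q (y n)"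
  shows "y \<in> carrier BC" "cq.q x = cq.q y"
proof -
  show yB: "y \<in> carrier BC"
    by (rule bcI1[OF y x]) (use unorm_cong[OF bc_closed[OF x] bc_closed[OF x] y y eq eq] in simp)
  have "unorm (x n \<ominus>\<^bsub>FC\<^esub> y n) = 0" for n
    unfolding unorm_cong[OF bc_closed[OF x] y y y eq refl] by (rule unorm_self[OF y])
  then show "cq.q x = cq.q y" unfolding cq_eq_iff[OF x yB] by simp
qed

theorem cstar_automorphism:
  "restricts_to_automorphism (lambda_endo E J) (cstar_diag E) \<longleftrightarrow> (\<forall>\<beta>\<in>paths E. determined \<beta>)"
proof
  assume "restricts_to_automorphism (lambda_endo E J) (cstar_diag E)"
  then have eq: "lamq ` cstar_diag E = cstar_diag E" unfolding restricts_to_automorphism_def lambda_endo_eq .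
  show "\<forall>\<beta>\<in>paths E. determined \<beta>"
  proof
    fix \<beta> assume b: "\<beta> \<in> paths E"
    let ?p = "path_proj FC \<beta>"
    have pc: "?p \<in> carrier FC" by (rule fc.projF_closed[OF b])
    have "kap ?p \<in> cstar_diag E" by (rule bc_diag[OF bc_const[OF pc]]) (rule fc.cdiag_proj[OF b])
    then have "kap ?p \<in> lamq ` cstar_diag E" by (simp only: eq)
    then obtain X where X: "X \<in> cstar_diag E" "kap ?p = lamq X" by blast
    obtain x where x: "x \<in> carrier BC" "\<And>n. x n \<in> fc.cdiag" "X = cq.q x" using diag_bc[OF X(1)] by blast
    have "cq.q (\<lambda>n. fc.phi (x n)) = kap ?p" using X(2) unfolding x(3) lamq_q[OF x(1)] lam_def by (rule sym)
    then have "(\<lambda>n. unorm (fc.phi (x n) \<ominus>\<^bsub>FC\<^esub> ?p)) \<longlonglongrightarrow> 0"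
      unfolding cq_eq_iff[OF bc_phi[OF x(1)] bc_const[OF pc]] .
    then have "eventually (\<lambda>n. unorm (fc.phi (x n) \<ominus>\<^bsub>FC\<^esub> ?p) < 1 / 2) sequentially"
      by (rule order_tendstoD(2)) simp
    \<comment> \<open>The distance 1/2 suffices because an indicator takes only the values 0 and
      1.\<close>
    then obtain n where n: "unorm (fc.phi (x n) \<ominus>\<^bsub>FC\<^esub> ?p) < 1 / 2" unfolding eventually_sequentially by blast
    let ?z = "x n"
    have zc: "?z \<in> carrier FC" "fc.phi ?z \<in> carrier FC"
      using fc.cdiag_carrier[OF x(2)] fc.phi_closed[OF fc.cdiag_carrier[OF x(2)]] by blast+
    obtain f N where f: "fc.local_fun N f" "fc.acts (fc.phi ?z) (\<lambda>x. f (itinerary x))"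
      using fc.cdiag_function[OF x(2)] by blast
    have act: "\<forall>\<xi>\<in>pathfun E. op E (fc.phi ?z \<ominus>\<^bsub>FC\<^esub> ?p) \<xi> = (\<lambda>x. (f (itinerary x) - of_bool (x \<in> cyl E \<beta>)) * \<xi> x)"
      using f(2) fc.acts_proj[OF b] unfolding fc.acts_def cnj_conj.op_minus[OF zc(2) pc] by (simp add: left_diff_distrib)
    have near: "cmod (f (itinerary y) - of_bool (y \<in> cyl E \<beta>)) < 1 / 2" if y: "y \<in> infpaths E" for y
    proof -
      have "cmod (f (itinerary y) - of_bool (y \<in> cyl E \<beta>)) \<le> opnorm (fc.phi ?z \<ominus>\<^bsub>FC\<^esub> ?p)"
        by (rule opnorm_point[OF FC.minus_closed[OF zc(2) pc] y act])
      also have "\<dots> \<le> unorm (fc.phi ?z \<ominus>\<^bsub>FC\<^esub> ?p)"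
        by (rule unorm_upper[OF opnorm_seminorm FC.minus_closed[OF zc(2) pc]])
      finally show ?thesis using n by linarith
    qed
    show "determined \<beta>"
    proof (rule fc.determinedI[OF f(1), where p = "\<lambda>c. cmod (c - 1) < 1 / 2"])
      fix y assume y: "y \<in> infpaths E"
      show "y \<in> cyl E \<beta> \<longleftrightarrow> cmod (f (itinerary y) - 1) < 1 / 2"
      proof (cases "y \<in> cyl E \<beta>")
        case True
        then show ?thesis using near[OF y] by simp
      next
        case False
        then have "cmod (f (itinerary y)) < 1 / 2" using near[OF y] by simp
        moreover have "1 \<le> cmod (f (itinerary y)) + cmod (f (itinerary y) - 1)"
          using norm_triangle_sub[of 1 "f (itinerary y)"] by (simp add: norm_minus_commute)
        ultimately show ?thesis using False by linarith
      qed
    qed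
  qed
next
  assume det: "\<forall>\<beta>\<in>paths E. determined \<beta>"
  have "lamq ` cstar_diag E = cstar_diag E"
  proof (intro equalityI subsetI)
    fix Y assume "Y \<in> lamq ` cstar_diag E"
    then obtain X where X: "X \<in> cstar_diag E" "Y = lamq X" by blast
    obtain x where x: "x \<in> carrier BC" "\<And>n. x n \<in> fc.cdiag" "X = cq.q x" using diag_bc[OF X(1)] by blast
    have "\<forall>n. \<exists>z. z \<in> fc.cdiag \<and> nq.q (fc.phi (x n)) = nq.q z" using fc.phi_cdiag[OF x(2)] by blast
    then obtain z where z: "\<forall>n. z n \<in> fc.cdiag \<and> nq.q (fc.phi (x n)) = nq.q (z n)"
      using choice[of "\<lambda>n z. z \<in> fc.cdiag \<and> nq.q (fc.phi (x n)) = nq.q z"] by blast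
    then have zd: "\<And>n. z n \<in> fc.cdiag" and zq: "\<And>n. nq.q (fc.phi (x n)) = nq.q (z n)" by blast+
    note c = bc_cong[OF bc_phi[OF x(1)] fc.cdiag_carrier[OF zd] zq]
    have "Y = cq.q z" unfolding X(2) x(3) lamq_q[OF x(1)] lam_def by (rule c(2))
    then show "Y \<in> cstar_diag E" using bc_diag[OF c(1) zd] by (simp only:)
  next
    fix Y assume Y: "Y \<in> cstar_diag E"
    obtain y where y: "y \<in> carrier BC" "\<And>n. y n \<in> fc.cdiag" "Y = cq.q y" using diag_bc[OF Y] by blast
    have "\<forall>n. \<exists>z. z \<in> fc.cdiag \<and> nq.q (y n) = nq.q (fc.phi z)" using fc.cdiag_phi[OF det y(2)] by blast
    then obtain z where z: "\<forall>n. z n \<in> fc.cdiag \<and> nq.q (y n) = nq.q (fc.phi (z n))"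
      using choice[of "\<lambda>n z. z \<in> fc.cdiag \<and> nq.q (y n) = nq.q (fc.phi z)"] by blast
    then have zd: "\<And>n. z n \<in> fc.cdiag" and zq: "\<And>n. nq.q (y n) = nq.q (fc.phi (z n))" by blast+
    have zc: "z n \<in> carrier FC" for n by (rule fc.cdiag_carrier[OF zd])
    have pc: "fc.phi (z n) \<in> carrier FC" for n by (rule fc.phi_closed[OF zc])
    \<comment> \<open>The termwise preimages form a Cauchy sequence because \<open>phi\<close> is
      isometric on \<open>cdiag\<close>; their class is the preimage sought.\<close>
    have zB: "z \<in> carrier BC"
    proof (rule bcI1[OF zc y(1)])
      fix m n
      have "unorm (z m \<ominus>\<^bsub>FC\<^esub> z n) = unorm (fc.phi (z m \<ominus>\<^bsub>FC\<^esub> z n))"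
        by (rule unorm_cdiag_phi[OF cdiag_minus[OF zd zd]])
      also have "\<dots> = unorm (y m \<ominus>\<^bsub>FC\<^esub> y n)"
        unfolding fc.phi_minus[OF zc zc]
        by (rule unorm_cong[OF pc pc bc_closed[OF y(1)] bc_closed[OF y(1)] zq[symmetric] zq[symmetric]])
      finally show "unorm (z m \<ominus>\<^bsub>FC\<^esub> z n) \<le> unorm (y m \<ominus>\<^bsub>FC\<^esub> y n)" by simp
    qed
    have "Y = lamq (cq.q z)" unfolding y(3) lamq_q[OF zB] lam_def by (rule bc_cong(2)[OF y(1) pc zq])
    then show "Y \<in> lamq ` cstar_diag E" using bc_diag[OF zB zd] by blast
  qed
  then show "restricts_to_automorphism (lambda_endo E J) (cstar_diag E)"
    unfolding restricts_to_automorphism_def lambda_endo_eq .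
qed

end

theorem corollary5p9:
  fixes E :: "('v, 'e) pre_digraph" and J :: "('v, 'e) path_pair set"
  assumes "fin_digraph E" and "no_sinks E" and "no_sources E"
    and "\<forall>\<mu>\<in>cycles E. has_exit E \<mu>"
    and "admissible E J"
  shows "(has_nonpos_cycle E J \<longrightarrow>
            \<not> restricts_to_automorphism (Lambda_endo E J) (leavitt_diag E))
       \<and> (only_nonneg_edges E J \<and> \<not> has_nonpos_cycle E J \<longrightarrow>
            (left_synchronizing E J \<longleftrightarrow>
             restricts_to_automorphism (Lambda_endo E J) (leavitt_diag E)))
       \<and> (has_nonpos_cycle E J \<longrightarrow>
            \<not> restricts_to_automorphism (lambda_endo E J) (cstar_diag E))
       \<and> (only_nonneg_edges E J \<and> \<not> has_nonpos_cycle E J \<longrightarrow>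
            (left_synchronizing E J \<longleftrightarrow>
             restricts_to_automorphism (lambda_endo E J) (cstar_diag E)))"
proof -
  interpret fin_digraph E by fact
  interpret leavitt_int E by unfold_locales fact
  interpret coding E J by (rule admissible_coding) fact
  interpret coding_labels E J by (rule labels) (fact | rule coding_axioms)+
  interpret leavitt_endo E J by unfold_locales
  interpret cs: cstar_coding E J by unfold_locales
  have "has_nonpos_cycle E J \<Longrightarrow> \<not> (\<forall>\<beta>\<in>paths E. determined \<beta>)"
    using nonpos_cycle_not_determined[OF assms(4)] by blast
  moreover have "only_nonneg_edges E J \<Longrightarrow> \<not> has_nonpos_cycle E J \<Longrightarrow>
      left_synchronizing E J \<longleftrightarrow> (\<forall>\<beta>\<in>paths E. determined \<beta>)"
    using synchronizing_imp_determined determined_imp_synchronizing by blast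
  ultimately show ?thesis unfolding leavitt_automorphism cs.cstar_automorphism by blast
qed

end
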